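(* Let $l\ge2$. (1) Up to conjugation by automorphisms, $\mathfrak{so}_{1,2l}$ has exactly one non-zero abelian inner ideal, namely $\mathcal B_{\{1\}}$, of dimension $2l-1$. In particular $\mathfrak{so}_{1,2l}$ has no extremal elements. (2) If $2\le p\le l$, then up to conjugation by automorphisms $\mathfrak{so}_{p,2l+1-p}$ has exactly $2p-2$ non-zero abelian inner ideals, namely $\mathcal B_{\{2\}}\subset\mathcal B_{\{1\}}$ if $p=2$, and $$\{\mathcal B_{\{k\}}:1\le k\le p\}\cup\{\mathcal B_{\{1,k\}}:3\le k\le p\}$$ if $p\ge3$. Thus a chain of non-zero abelian inner ideals of maximal length has length $p$: $$\mathcal B_{\{2\}}\subset\mathcal B_{\{1,3\}}\subset\mathcal B_{\{1,4\}}\subset\dots\subset\mathcal B_{\{1,p\}}\subset\mathcal B_{\{1\}}.$$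
   Context: $\mathfrak{so}_{p,q}=\{x\in\mathfrak{gl}_{p+q}(\mathbb R):I_{p,q}x+x^tI_{p,q}=0\}$ with $I_{p,q}=\mathrm{diag}(I_p,-I_q)$. A subspace $B$ of a Lie algebra $L$ is an inner ideal if $[B,[B,L]]\subseteq B$; abelian if $[B,B]=0$. A non-zero $e\in L$ is extremal if $[e,[e,L]]\subseteq\langle e\rangle$. Subspaces $B,B'$ of $\mathfrak g$ are conjugate if $\varphi(B)=B'$ for some $\varphi\in\mathrm{Aut}(\mathfrak g)$. The length of a chain is its number of members. Setting, for a real form $\mathfrak g$ of a simple complex Lie algebra. Fix a maximal abelian subspace $\mathfrak a\subseteq\mathfrak g$ on which the Killing form is positive definite and such that some Cartan involution $\theta$ satisfies $\theta|_{\mathfrak a}=-\mathrm{id}$; put $\mathfrak g_\lambda=\{x\in\mathfrak g:[h,x]=\lambda(h)x\ \forall h\in\mathfrak a\}$ for $\lambda\in\mathfrak a^*$. Let $\mathfrak h\supseteq\mathfrak a$ be a maximal abelian subalgebra of $\mathfrak g$, $\Phi$ the root system of $\mathfrak g^{\mathbb C}$ relative to $\mathfrak h^{\mathbb C}$, $\bar\alpha=\alpha|_{\mathfrak a}$, $\Phi_0=\{\alpha\in\Phi:\bar\alpha=0\}$, $\Sigma=\{\bar\alpha:\alpha\in\Phi\setminus\Phi_0\}$. Let $\Delta=\{\alpha_1,\dots,\alpha_l\}$ be a basis of $\Phi$ as for Satake diagrams: $\Delta\cap\Phi_0$ is a basis of $\Phi_0$ and the positive roots in $\Phi\setminus\Phi_0$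 restrict to a positive system of $\Sigma$. In the Satake diagram, nodes in $\Phi_0$ are black, others are white, and distinct white nodes with equal restriction to $\mathfrak a$ are joined by an arrow. If $\tilde\alpha=\sum m_i\alpha_i$ is the maximal root and $I\subseteq\{1,\dots,l\}$ is non-empty, consists of white nodes and is closed under arrows, put $\Phi_I=\{\sum p_i\alpha_i\in\Phi:p_j=m_j\ \forall j\in I\}$ and $\mathcal B_I=\bigoplus\{\mathfrak g_{\bar\alpha}:\alpha\in\Phi_I\}$ (sum over distinct restrictions). Labelling: $B_l$ is the chain $1-2-\dots-l$ with $\alpha_l$ the short simple root; maximal root $\alpha_1+2\alpha_2+\dots+2\alpha_l$. The Satake diagram of $\mathfrak{so}_{p,2l+1-p}$ ($p\le l$) has white nodes exactly $\{1,\dots,p\}$ and no arrows. *)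

theory Defs
  imports "HOL-Analysis.Analysis"
begin

text \<open>Real Lie algebras are given as Lie subalgebras of the algebra of all real matrices indexed
  by a finite type, under the commutator bracket. Their complexifications are complex Lie algebras
  of complex matrices.\<close>

definition lie_br :: "'a::comm_ring_1^'n^'n \<Rightarrow> 'a^'n^'n \<Rightarrow> 'a^'n^'n" where
  "lie_br x y = x ** y - y ** x"

definition I_pq :: "real^('p::finite + 'q::finite)^('p + 'q)" where
  "I_pq = (\<chi> i j. if i = j then (case i of Inl _ \<Rightarrow> 1 | Inr _ \<Rightarrow> -1) else 0)"

definition so_pq :: "(real^('p::finite + 'q::finite)^('p + 'q)) set" where
  "so_pq = {x. I_pq ** x + transpose x ** I_pq = 0}"

definition abelian :: "(real^'n^'n) set \<Rightarrow> bool" where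
  "abelian B \<longleftrightarrow> (\<forall>x\<in>B. \<forall>y\<in>B. lie_br x y = 0)"

definition inner_ideal :: "(real^'n^'n) set \<Rightarrow> (real^'n^'n) set \<Rightarrow> bool" where
  "inner_ideal g B \<longleftrightarrow> subspace B \<and> B \<subseteq> g \<and>
     (\<forall>b\<in>B. \<forall>b'\<in>B. \<forall>x\<in>g. lie_br b (lie_br b' x) \<in> B)"

definition nonzero_abelian_inner_ideals :: "(real^'n^'n) set \<Rightarrow> (real^'n^'n) set set" where
  "nonzero_abelian_inner_ideals g = {B. inner_ideal g B \<and> abelian B \<and> B \<noteq> {0}}"

definition extremal :: "(real^'n^'n) set \<Rightarrow> real^'n^'n \<Rightarrow> bool" where
  "extremal g e \<longleftrightarrow> e \<in> g \<and> e \<noteq> 0 \<and> (\<forall>x\<in>g. lie_br e (lie_br e x) \<in> span {e})"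

definition lie_automorphism ::
    "(real^'n^'n) set \<Rightarrow> (real^'n^'n \<Rightarrow> real^'n^'n) \<Rightarrow> bool" where
  "lie_automorphism g f \<longleftrightarrow> bij_betw f g g \<and>
     (\<forall>x\<in>g. \<forall>y\<in>g. f (x + y) = f x + f y) \<and>
     (\<forall>c. \<forall>x\<in>g. f (c *\<^sub>R x) = c *\<^sub>R f x) \<and>
     (\<forall>x\<in>g. \<forall>y\<in>g. f (lie_br x y) = lie_br (f x) (f y))"

definition conjugate :: "(real^'n^'n) set \<Rightarrow> (real^'n^'n) set \<Rightarrow> (real^'n^'n) set \<Rightarrow> bool" where
  "conjugate g B B' \<longleftrightarrow> (\<exists>f. lie_automorphism g f \<and> f ` B = B')"

text \<open>\<open>R\<close> is a set of representatives, one from each conjugacy class, of the non-zero abelian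
  inner ideals; the number of these up to conjugation is then \<open>card R\<close>.\<close>

definition representatives_up_to_conjugation ::
    "(real^'n^'n) set \<Rightarrow> (real^'n^'n) set set \<Rightarrow> bool" where
  "representatives_up_to_conjugation g R \<longleftrightarrow>
     R \<subseteq> nonzero_abelian_inner_ideals g \<and>
     (\<forall>B\<in>nonzero_abelian_inner_ideals g. \<exists>!B'. B' \<in> R \<and> conjugate g B B')"

text \<open>Trace of a linear endomorphism \<open>f\<close> of the subspace \<open>V\<close>: the sum of the diagonal entries of
  its matrix in some basis of \<open>V\<close>.\<close>

definition trace_on :: "'a::real_vector set \<Rightarrow> ('a \<Rightarrow> 'a) \<Rightarrow> real" where
  "trace_on V f = (let B = (SOME B. B \<subseteq> V \<and> independent B \<and> span B = V)
                   in \<Sum>b\<in>B. representation B (f b) b)"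

definition killing_form :: "(real^'n^'n) set \<Rightarrow> real^'n^'n \<Rightarrow> real^'n^'n \<Rightarrow> real" where
  "killing_form g x y = trace_on g (\<lambda>z. lie_br x (lie_br y z))"

definition cartan_involution ::
    "(real^'n^'n) set \<Rightarrow> (real^'n^'n \<Rightarrow> real^'n^'n) \<Rightarrow> bool" where
  "cartan_involution g \<theta> \<longleftrightarrow> lie_automorphism g \<theta> \<and> (\<forall>x\<in>g. \<theta> (\<theta> x) = x) \<and>
     (\<forall>x\<in>g. x \<noteq> 0 \<longrightarrow> killing_form g x (\<theta> x) < 0)"

definition split_abelian :: "(real^'n^'n) set \<Rightarrow> (real^'n^'n) set \<Rightarrow> bool" where
  "split_abelian g a \<longleftrightarrow> subspace a \<and> a \<subseteq> g \<and> abelian a \<and>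
     (\<forall>x\<in>a. x \<noteq> 0 \<longrightarrow> killing_form g x x > 0) \<and>
     (\<exists>\<theta>. cartan_involution g \<theta> \<and> (\<forall>x\<in>a. \<theta> x = - x))"

definition maximal_split_abelian :: "(real^'n^'n) set \<Rightarrow> (real^'n^'n) set \<Rightarrow> bool" where
  "maximal_split_abelian g a \<longleftrightarrow> split_abelian g a \<and>
     (\<forall>a'. split_abelian g a' \<and> a \<subseteq> a' \<longrightarrow> a' = a)"

definition maximal_abelian_subalgebra :: "(real^'n^'n) set \<Rightarrow> (real^'n^'n) set \<Rightarrow> bool" where
  "maximal_abelian_subalgebra g h \<longleftrightarrow> subspace h \<and> h \<subseteq> g \<and> abelian h \<and>
     (\<forall>h'. subspace h' \<and> h' \<subseteq> g \<and> abelian h' \<and> h \<subseteq> h' \<longrightarrow> h' = h)"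

text \<open>\<open>complexification V\<close> is \<open>V + \<i>V\<close> inside the complex matrices.\<close>

definition complexification :: "(real^'n^'n) set \<Rightarrow> (complex^'n^'n) set" where
  "complexification V = {z. map_matrix Re z \<in> V \<and> map_matrix Im z \<in> V}"

definition scale_mat :: "complex \<Rightarrow> complex^'n^'n \<Rightarrow> complex^'n^'n" where
  "scale_mat c z = map_matrix ((*) c) z"

text \<open>Functionals on a subspace are represented by functions that vanish off the subspace, so that
  equality of functions is equality of functionals.\<close>

definition complex_functional :: "(complex^'n^'n) set \<Rightarrow> (complex^'n^'n \<Rightarrow> complex) \<Rightarrow> bool" where
  "complex_functional H \<alpha> \<longleftrightarrow>
     (\<forall>x\<in>H. \<forall>y\<in>H. \<alpha> (x + y) = \<alpha> x + \<alpha> y) \<and>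
     (\<forall>c. \<forall>x\<in>H. \<alpha> (scale_mat c x) = c * \<alpha> x) \<and>
     (\<forall>x. x \<notin> H \<longrightarrow> \<alpha> x = 0)"

definition root_space ::
    "(real^'n^'n) set \<Rightarrow> (real^'n^'n) set \<Rightarrow> (complex^'n^'n \<Rightarrow> complex) \<Rightarrow> (complex^'n^'n) set" where
  "root_space g h \<alpha> =
     {x \<in> complexification g. \<forall>t\<in>complexification h. lie_br t x = scale_mat (\<alpha> t) x}"

definition roots ::
    "(real^'n^'n) set \<Rightarrow> (real^'n^'n) set \<Rightarrow> (complex^'n^'n \<Rightarrow> complex) set" where
  "roots g h = {\<alpha>. complex_functional (complexification h) \<alpha> \<and> \<alpha> \<noteq> (\<lambda>_. 0) \<and>
                   root_space g h \<alpha> \<noteq> {0}}"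

text \<open>Restriction of a root to \<open>a\<close>. As \<open>ad x\<close> is diagonalizable over the reals for \<open>x\<close> in a split
  abelian subspace \<open>a\<close>, roots take real values there and \<open>Re\<close> is only a change of type.\<close>

definition restr ::
    "(real^'n^'n) set \<Rightarrow> (complex^'n^'n \<Rightarrow> complex) \<Rightarrow> (real^'n^'n \<Rightarrow> real)" where
  "restr a \<alpha> = (\<lambda>x. if x \<in> a then Re (\<alpha> (map_matrix complex_of_real x)) else 0)"

definition restricted_root_space ::
    "(real^'n^'n) set \<Rightarrow> (real^'n^'n) set \<Rightarrow> (real^'n^'n \<Rightarrow> real) \<Rightarrow> (real^'n^'n) set" where
  "restricted_root_space g a \<mu> = {x \<in> g. \<forall>t\<in>a. lie_br t x = \<mu> t *\<^sub>R x}"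

definition roots0 ::
    "(real^'n^'n) set \<Rightarrow> (real^'n^'n) set \<Rightarrow> (real^'n^'n) set \<Rightarrow> (complex^'n^'n \<Rightarrow> complex) set" where
  "roots0 g a h = {\<alpha> \<in> roots g h. restr a \<alpha> = (\<lambda>_. 0)}"

definition restricted_roots ::
    "(real^'n^'n) set \<Rightarrow> (real^'n^'n) set \<Rightarrow> (real^'n^'n) set \<Rightarrow> (real^'n^'n \<Rightarrow> real) set" where
  "restricted_roots g a h = restr a ` (roots g h - roots0 g a h)"

definition int_comb ::
    "nat set \<Rightarrow> (nat \<Rightarrow> 'a \<Rightarrow> complex) \<Rightarrow> (nat \<Rightarrow> int) \<Rightarrow> 'a \<Rightarrow> complex" where
  "int_comb I \<alpha> c = (\<lambda>t. \<Sum>i\<in>I. of_int (c i) * \<alpha> i t)"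

definition root_basis :: "('a \<Rightarrow> complex) set \<Rightarrow> nat set \<Rightarrow> (nat \<Rightarrow> 'a \<Rightarrow> complex) \<Rightarrow> bool" where
  "root_basis \<Phi> I \<alpha> \<longleftrightarrow> finite I \<and> \<alpha> ` I \<subseteq> \<Phi> \<and>
     (\<forall>c :: nat \<Rightarrow> real. (\<forall>t. (\<Sum>i\<in>I. complex_of_real (c i) * \<alpha> i t) = 0) \<longrightarrow> (\<forall>i\<in>I. c i = 0)) \<and>
     (\<forall>\<beta>\<in>\<Phi>. \<exists>c. \<beta> = int_comb I \<alpha> c \<and> ((\<forall>i\<in>I. c i \<ge> 0) \<or> (\<forall>i\<in>I. c i \<le> 0)))"

definition positive_roots ::
    "('a \<Rightarrow> complex) set \<Rightarrow> nat set \<Rightarrow> (nat \<Rightarrow> 'a \<Rightarrow> complex) \<Rightarrow> ('a \<Rightarrow> complex) set" where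
  "positive_roots \<Phi> I \<alpha> = {\<beta> \<in> \<Phi>. \<exists>c. \<beta> = int_comb I \<alpha> c \<and> (\<forall>i\<in>I. c i \<ge> 0)}"

definition positive_system :: "('a \<Rightarrow> real) set \<Rightarrow> ('a \<Rightarrow> real) set \<Rightarrow> bool" where
  "positive_system \<Sigma> P \<longleftrightarrow> P \<subseteq> \<Sigma> \<and>
     (\<forall>\<mu>\<in>\<Sigma>. (\<mu> \<in> P) \<noteq> ((\<lambda>t. - \<mu> t) \<in> P)) \<and>
     (\<forall>\<mu>\<in>P. \<forall>\<nu>\<in>P. (\<lambda>t. \<mu> t + \<nu> t) \<in> \<Sigma> \<longrightarrow> (\<lambda>t. \<mu> t + \<nu> t) \<in> P)"

text \<open>\<open>m\<close> is the coefficient vector of the maximal root.\<close>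

definition maximal_root :: "('a \<Rightarrow> complex) set \<Rightarrow> nat set \<Rightarrow> (nat \<Rightarrow> 'a \<Rightarrow> complex) \<Rightarrow>
    (nat \<Rightarrow> int) \<Rightarrow> bool" where
  "maximal_root \<Phi> I \<alpha> m \<longleftrightarrow> int_comb I \<alpha> m \<in> \<Phi> \<and>
     (\<forall>c. int_comb I \<alpha> c \<in> \<Phi> \<longrightarrow> (\<forall>i\<in>I. c i \<le> m i))"

text \<open>The coroot of \<open>\<alpha>\<close> is the element of the line \<open>[g\<^sub>\<alpha>, g\<^sub>-\<^sub>\<alpha>]\<close> on which \<open>\<alpha>\<close> has the value 2, and
  the Cartan integer \<open>2(\<beta>,\<alpha>)/(\<alpha>,\<alpha>)\<close> is the value of \<open>\<beta>\<close> on it. Root spaces being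
  one-dimensional, the line consists of brackets.\<close>

definition coroot :: "(real^'n^'n) set \<Rightarrow> (real^'n^'n) set \<Rightarrow> (complex^'n^'n \<Rightarrow> complex) \<Rightarrow>
    complex^'n^'n" where
  "coroot g h \<alpha> = (THE t. (\<exists>x\<in>root_space g h \<alpha>. \<exists>y\<in>root_space g h (\<lambda>s. - \<alpha> s). t = lie_br x y)
                        \<and> \<alpha> t = 2)"

definition cartan_integer :: "(real^'n^'n) set \<Rightarrow> (real^'n^'n) set \<Rightarrow>
    (complex^'n^'n \<Rightarrow> complex) \<Rightarrow> (complex^'n^'n \<Rightarrow> complex) \<Rightarrow> complex" where
  "cartan_integer g h \<beta> \<alpha> = \<beta> (coroot g h \<alpha>)"

text \<open>Off-diagonal Cartan integers of the Dynkin diagram \<open>1 - 2 - \<dots> - l\<close> of type \<open>B\<^sub>l\<close>. The entry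
  \<open>-2\<close> at \<open>(l - 1, l)\<close> says that the root numbered \<open>l\<close> is the short one.\<close>

definition labelled_B :: "(real^'n^'n) set \<Rightarrow> (real^'n^'n) set \<Rightarrow> nat \<Rightarrow>
    (nat \<Rightarrow> complex^'n^'n \<Rightarrow> complex) \<Rightarrow> bool" where
  "labelled_B g h l \<alpha> \<longleftrightarrow> (\<forall>i\<in>{1..l}. \<forall>j\<in>{1..l}. i \<noteq> j \<longrightarrow>
     cartan_integer g h (\<alpha> i) (\<alpha> j) =
       (if j = l \<and> i + 1 = l then -2 else if i + 1 = j \<or> j + 1 = i then -1 else 0))"

definition satake_basis :: "(real^'n^'n) set \<Rightarrow> (real^'n^'n) set \<Rightarrow> (real^'n^'n) set \<Rightarrow> nat \<Rightarrow>
    (nat \<Rightarrow> complex^'n^'n \<Rightarrow> complex) \<Rightarrow> bool" where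
  "satake_basis g a h l \<alpha> \<longleftrightarrow> root_basis (roots g h) {1..l} \<alpha> \<and>
     root_basis (roots0 g a h) {i \<in> {1..l}. \<alpha> i \<in> roots0 g a h} \<alpha> \<and>
     positive_system (restricted_roots g a h)
       (restr a ` (positive_roots (roots g h) {1..l} \<alpha> - roots0 g a h))"

text \<open>Non-empty sets of white nodes of the Satake diagram that are closed under arrows.\<close>

definition satake_closed :: "(real^'n^'n) set \<Rightarrow> (real^'n^'n) set \<Rightarrow> (real^'n^'n) set \<Rightarrow> nat \<Rightarrow>
    (nat \<Rightarrow> complex^'n^'n \<Rightarrow> complex) \<Rightarrow> nat set \<Rightarrow> bool" where
  "satake_closed g a h l \<alpha> I \<longleftrightarrow> I \<noteq> {} \<and> I \<subseteq> {i \<in> {1..l}. \<alpha> i \<notin> roots0 g a h} \<and>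
     (\<forall>i\<in>I. \<forall>j\<in>{1..l}. \<alpha> j \<notin> roots0 g a h \<and> restr a (\<alpha> j) = restr a (\<alpha> i) \<longrightarrow> j \<in> I)"

definition Phi_I :: "(real^'n^'n) set \<Rightarrow> (real^'n^'n) set \<Rightarrow> nat \<Rightarrow>
    (nat \<Rightarrow> complex^'n^'n \<Rightarrow> complex) \<Rightarrow> nat set \<Rightarrow> (complex^'n^'n \<Rightarrow> complex) set" where
  "Phi_I g h l \<alpha> I = {\<beta> \<in> roots g h. \<exists>m c. maximal_root (roots g h) {1..l} \<alpha> m \<and>
     \<beta> = int_comb {1..l} \<alpha> c \<and> (\<forall>j\<in>I. c j = m j)}"

text \<open>The subspace \<open>\<B>\<^sub>I\<close>, meaningful when \<^const>\<open>satake_closed\<close> holds. The sum of the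
  restricted root spaces is direct, being one of simultaneous eigenspaces of \<open>a\<close> for distinct
  functionals.\<close>

definition B_I :: "(real^'n^'n) set \<Rightarrow> (real^'n^'n) set \<Rightarrow> (real^'n^'n) set \<Rightarrow> nat \<Rightarrow>
    (nat \<Rightarrow> complex^'n^'n \<Rightarrow> complex) \<Rightarrow> nat set \<Rightarrow> (real^'n^'n) set" where
  "B_I g a h l \<alpha> I = span (\<Union>\<mu>\<in>restr a ` Phi_I g h l \<alpha> I. restricted_root_space g a \<mu>)"

end

theory Submission
  imports Defs
begin

text \<open>Let \<open>V\<close> be the natural module with its form of signature \<open>(p, q)\<close>; the Lie algebra is the exterior
  square of \<open>V\<close>. As \<open>dim V\<close> is odd, every element kills a vector, and this forces an element of an
  abelian inner ideal to have cube zero on \<open>V\<close>. The ideal is then \<open>u \<and> u\<^sup>\<bottom>\<close> with \<open>u\<close> isotropic, or the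
  exterior square of a totally isotropic \<open>M\<close>, or \<open>z \<and> N\<close> with \<open>z \<in> N\<close> totally isotropic. By Witt's
  theorem the isometries of \<open>V\<close> act transitively on ideals of the same kind and dimension, and
  invariants of the inclusion order tell the remaining ones apart.

  On the other side, \<open>a\<close> and \<open>h\<close> are simultaneously put in normal form by a basis of \<open>V\<close> made of
  hyperbolic pairs and planes rotated by \<open>h\<close>. The weights of \<open>h\<close> on \<open>V\<close> are \<open>0\<close> and \<open>\<plusminus>\<epsilon>\<^sub>1, \<dots>, \<plusminus>\<epsilon>\<^sub>l\<close>, the
  Cartan integers force \<open>\<alpha>\<^sub>i = \<epsilon>\<^sub>i - \<epsilon>\<^sub>i\<^sub>+\<^sub>1\<close> and \<open>\<alpha>\<^sub>l = \<epsilon>\<^sub>l\<close> up to a signed permutation, and positivity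
  of the restricted roots makes \<open>\<epsilon>\<^sub>1, \<dots>, \<epsilon>\<^sub>p\<close> the weights that are non-zero on \<open>a\<close>. Reading off the
  coefficients of the roots identifies each \<open>\<B>\<^sub>I\<close> as one of the ideals above.\<close>

section \<open>The form and wedge operators\<close>

text \<open>For \<open>b\<close> in an abelian inner ideal, \<open>ad b\<close> has cube zero,
  because \<open>[b, [b, x]]\<close> lies in the ideal and so commutes with \<open>b\<close>. If
  some \<open>b\<close> has non-zero square on V, then \<open>b = u \<and> w\<close> with
  \<open>w\<close> anisotropic, and this single element forces the ideal to be
  \<open>u \<and> perp u\<close>. Otherwise all products of two elements vanish, and what remains is
  incidence geometry of the planes of decomposable elements. The exterior square of a plane is also
  a product with a vector, so such products are counted from dimension 3 on: p - 2 of them beside p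
  - 1 exterior squares and \<open>u \<and> perp u\<close>. Dimension does not separate them: a
  product with a vector in dimension 4 and an exterior square in dimension 3 both have dimension 3,
  and an exterior square can be as large as \<open>u \<and> perp u\<close>. Chains are bounded by a
  rank of the classes with values 1, ..., p that grows strictly along inclusions. As
  \<open>a\<close> and \<open>h\<close> are arbitrary, their normal form has to come from the bare
  definitions; a given Cartan involution enters only through the positive definite form it yields,
  for which \<open>ad t\<close> is symmetric when t lies in \<open>a\<close>.\<close>

definition sg :: "'p::finite + 'q::finite \<Rightarrow> 'a::comm_ring_1" where
  "sg i = (case i of Inl _ \<Rightarrow> 1 | Inr _ \<Rightarrow> -1)"

definition fm :: "'a::comm_ring_1^('p::finite + 'q::finite) \<Rightarrow> 'a^('p + 'q) \<Rightarrow> 'a" where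
  "fm u v = (\<Sum>i\<in>UNIV. sg i * u$i * v$i)"

text \<open>Under the identification of the orthogonal Lie algebra with the second exterior power of the
  natural module, \<open>wd u v\<close> is \<open>u \<and> v\<close>.\<close>

definition wd :: "'a::comm_ring_1^('p::finite + 'q::finite) \<Rightarrow> 'a^('p + 'q) \<Rightarrow> 'a^('p + 'q)^('p + 'q)" where
  "wd u v = (\<chi> i j. sg j * (u$i * v$j - v$i * u$j))"

definition skw :: "'a::comm_ring_1^('p::finite + 'q::finite)^('p + 'q) \<Rightarrow> bool" where
  "skw x \<longleftrightarrow> (\<forall>u v. fm (x *v u) v = - fm u (x *v v))"

lemma sg_square [simp]: "sg i * sg i = 1"
  by (cases i) (auto simp: sg_def)

lemma fm_sym: "fm u v = fm v u"
  by (simp add: fm_def mult_ac)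

lemma fm_add_left [simp]: "fm (u + w) v = fm u v + fm w v"
  by (simp add: fm_def algebra_simps sum.distrib)

lemma fm_add_right [simp]: "fm v (u + w) = fm v u + fm v w"
  by (simp add: fm_def algebra_simps sum.distrib)

lemma fm_diff_left [simp]: "fm (u - w) v = fm u v - fm w v"
  by (simp add: fm_def algebra_simps sum_subtractf)

lemma fm_diff_right [simp]: "fm v (u - w) = fm v u - fm v w"
  by (simp add: fm_def algebra_simps sum_subtractf)

lemma fm_minus_left [simp]: "fm (- u) v = - fm u v"
  by (simp add: fm_def sum_negf)

lemma fm_minus_right [simp]: "fm v (- u) = - fm v u"
  by (simp add: fm_def sum_negf)

lemma fm_zero_left [simp]: "fm 0 v = 0"
  by (simp add: fm_def)

lemma fm_zero_right [simp]: "fm v 0 = 0"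
  by (simp add: fm_def)

lemma fm_scale_left [simp]: "fm (c *s u) v = c * fm u v"
  by (simp add: fm_def sum_distrib_left mult_ac)

lemma fm_scale_right [simp]: "fm v (c *s u) = c * fm v u"
  by (simp add: fm_def sum_distrib_left mult_ac)

lemma fm_scaleR_left [simp]: "fm (c *\<^sub>R u) v = c * fm u (v :: real^('p::finite + 'q::finite))"
  using fm_scale_left[of c u v] by (simp add: scalar_mult_eq_scaleR)

lemma fm_scaleR_right [simp]: "fm v (c *\<^sub>R u) = c * fm v (u :: real^('p::finite + 'q::finite))"
  using fm_scale_right[of v c u] by (simp add: scalar_mult_eq_scaleR)

lemma fm_sum_left: "fm (\<Sum>i\<in>I. f i) v = (\<Sum>i\<in>I. fm (f i) v)"
  by (induction I rule: infinite_finite_induct) auto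

lemma fm_sum_right: "fm v (\<Sum>i\<in>I. f i) = (\<Sum>i\<in>I. fm v (f i))"
  by (induction I rule: infinite_finite_induct) auto

lemma fm_axis_left: "fm (axis i 1) v = sg i * v $ i"
proof -
  have "fm (axis i 1) v = (\<Sum>j\<in>UNIV. if j = i then sg i * v $ i else 0)"
    unfolding fm_def by (intro sum.cong) (auto simp: axis_def)
  then show ?thesis by simp
qed

lemma fm_nondegenerate: "(\<And>v. fm u v = 0) \<Longrightarrow> u = 0"
proof -
  assume *: "\<And>v. fm u v = 0"
  have "u $ i = 0" for i
  proof -
    have "sg i * (sg i * u $ i) = 0"
      using *[of "axis i 1"] by (simp add: fm_sym[of u] fm_axis_left)
    then show ?thesis by (simp add: mult.assoc[symmetric])
  qed
  then show "u = 0" by (simp add: vec_eq_iff)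
qed

lemma matrix_eqI: "(\<And>z. A *v z = B *v z) \<Longrightarrow> A = (B :: 'a::semiring_1^'n^'m)"
  using matrix_eq by blast

lemma wd_apply: "wd u v *v z = fm v z *s u - fm u z *s v"
  by (simp add: vec_eq_iff wd_def fm_def matrix_vector_mult_def sum_distrib_left sum_distrib_right
      sum_subtractf[symmetric] algebra_simps)

lemma wd_applyR: "wd u v *v z = fm v z *\<^sub>R u - fm u z *\<^sub>R (v :: real^('p::finite + 'q::finite))"
  by (simp add: wd_apply scalar_mult_eq_scaleR)

lemma wd_add_left: "wd (u + u') v = wd u v + wd u' v"
  by (simp add: vec_eq_iff wd_def algebra_simps)

lemma wd_add_right: "wd u (v + v') = wd u v + wd u v'"
  by (simp add: vec_eq_iff wd_def algebra_simps)

lemma wd_diff_left: "wd (u - u') v = wd u v - wd u' v"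
  by (simp add: vec_eq_iff wd_def algebra_simps)

lemma wd_diff_right: "wd u (v - v') = wd u v - wd u v'"
  by (simp add: vec_eq_iff wd_def algebra_simps)

lemma wd_minus_left [simp]: "wd (- u) v = - wd u v"
  by (simp add: vec_eq_iff wd_def algebra_simps)

lemma wd_minus_right [simp]: "wd u (- v) = - wd u v"
  by (simp add: vec_eq_iff wd_def algebra_simps)

lemma wd_zero_left [simp]: "wd 0 v = 0"
  by (simp add: vec_eq_iff wd_def)

lemma wd_zero_right [simp]: "wd v 0 = 0"
  by (simp add: vec_eq_iff wd_def)

lemma wd_self [simp]: "wd u u = 0"
  by (simp add: vec_eq_iff wd_def)

lemma wd_swap: "wd u v = - wd v u"
  by (simp add: vec_eq_iff wd_def algebra_simps)

lemma wd_scaleR_left [simp]: "wd (c *\<^sub>R u) v = c *\<^sub>R wd u (v :: real^('p::finite + 'q::finite))"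
  by (simp add: vec_eq_iff wd_def algebra_simps)

lemma wd_scaleR_right [simp]: "wd u (c *\<^sub>R v) = c *\<^sub>R wd u (v :: real^('p::finite + 'q::finite))"
  by (simp add: vec_eq_iff wd_def algebra_simps)

lemma skwD: "skw x \<Longrightarrow> fm (x *v u) v = - fm u (x *v v)"
  by (simp add: skw_def)

lemma skw_wd [simp]: "skw (wd u v)"
  by (simp add: skw_def wd_apply fm_sym algebra_simps)

lemma skw_zero [simp]: "skw 0"
  by (simp add: skw_def)

lemma skw_add: "skw x \<Longrightarrow> skw y \<Longrightarrow> skw (x + y)"
  by (simp add: skw_def matrix_vector_mult_add_rdistrib)

lemma skw_diff: "skw x \<Longrightarrow> skw y \<Longrightarrow> skw (x - y)"
  by (simp add: skw_def matrix_vector_mult_diff_rdistrib)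

lemma skw_scaleR: "skw x \<Longrightarrow> skw (c *\<^sub>R (x :: real^('p::finite + 'q::finite)^('p + 'q)))"
  by (simp add: skw_def scaleR_matrix_vector_assoc[symmetric])

lemma lie_br_apply: "lie_br x y *v z = x *v (y *v z) - y *v (x *v z)"
  by (simp add: lie_br_def matrix_vector_mult_diff_rdistrib matrix_vector_mul_assoc)

lemma skw_lie_br: "skw x \<Longrightarrow> skw y \<Longrightarrow> skw (lie_br x y)"
  by (simp add: skw_def lie_br_apply)

lemma fm_skw_self:
  fixes x :: "'a::{idom, ring_char_0}^('p::finite + 'q::finite)^('p + 'q)"
  assumes "skw x" shows "fm (x *v u) u = 0"
proof -
  have "fm (x *v u) u = - fm (x *v u) u"
    using skwD[OF assms, of u u] fm_sym[of u "x *v u"] by simp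
  then have "2 * fm (x *v u) u = 0" by (metis add.right_inverse mult_2)
  then show ?thesis by simp
qed

lemma matrix_vector_scale: "A *v (c *s x) = c *s (A *v (x :: 'a::comm_ring_1^'n))"
  by (simp add: vec_eq_iff matrix_vector_mult_def sum_distrib_left mult_ac)

text \<open>The adjoint action on the exterior square is the derivation induced by the natural
  action; bracket computations with \<open>wd\<close> are reduced to this rule.\<close>

lemma lie_br_wd: "skw x \<Longrightarrow> lie_br x (wd u v) = wd (x *v u) v + wd u (x *v v)"
  by (rule matrix_eqI)
    (simp add: lie_br_apply wd_apply matrix_vector_mult_add_rdistrib matrix_vector_mult_diff_distrib
      matrix_vector_scale skwD vector_smult_lneg)

lemma lie_br_swap: "lie_br x y = - lie_br y x"
  by (simp add: lie_br_def)

lemma lie_br_add_left: "lie_br (x + x') y = lie_br x y + lie_br x' y"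
  by (rule matrix_eqI) (simp add: lie_br_apply algebra_simps)

lemma lie_br_add_right: "lie_br y (x + x') = lie_br y x + lie_br y x'"
  by (rule matrix_eqI) (simp add: lie_br_apply algebra_simps)

lemma lie_br_diff_left: "lie_br (x - x') y = lie_br x y - lie_br x' y"
  by (rule matrix_eqI) (simp add: lie_br_apply algebra_simps)

lemma lie_br_diff_right: "lie_br y (x - x') = lie_br y x - lie_br y x'"
  by (rule matrix_eqI) (simp add: lie_br_apply algebra_simps)

lemma lie_br_minus_left [simp]: "lie_br (- x) y = - lie_br x (y :: 'a::comm_ring_1^'n^'n)"
  using lie_br_diff_left[of 0 x y] by (simp add: lie_br_def)

lemma lie_br_minus_right [simp]: "lie_br y (- x) = - lie_br y (x :: 'a::comm_ring_1^'n^'n)"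
  using lie_br_diff_right[of y 0 x] by (simp add: lie_br_def)

lemma lie_br_zero_left [simp]: "lie_br 0 y = 0"
  by (simp add: lie_br_def)

lemma lie_br_zero_right [simp]: "lie_br y 0 = 0"
  by (simp add: lie_br_def)

lemma lie_br_scaleR_left [simp]: "lie_br (c *\<^sub>R x) (y :: real^'n^'n) = c *\<^sub>R lie_br x y"
  by (rule matrix_eqI) (simp add: lie_br_apply algebra_simps scaleR_matrix_vector_assoc[symmetric])

lemma lie_br_scaleR_right [simp]: "lie_br y (c *\<^sub>R x) = c *\<^sub>R lie_br y (x :: real^'n^'n)"
  by (rule matrix_eqI) (simp add: lie_br_apply algebra_simps scaleR_matrix_vector_assoc[symmetric])

lemma linear_lie_br: "linear (lie_br (x :: real^'n^'n))"
  by (rule linearI) (simp_all add: lie_br_add_right)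

lemma matrix_vector_mult_axis: "(x *v axis j 1) $ i = x $ i $ (j :: 'n::finite)"
proof -
  have "(x *v axis j 1) $ i = (\<Sum>k\<in>UNIV. if k = j then x $ i $ j else 0)"
    unfolding matrix_vector_mult_def vec_lambda_beta by (intro sum.cong) (auto simp: axis_def)
  then show ?thesis by simp
qed

text \<open>The coordinate form connects \<open>skw\<close> with the matrix equation of
  \<open>so_pq\<close>. Its coefficients are real, so over the complex numbers it splits into
  conditions on real and imaginary parts.\<close>

lemma skw_entries: "skw x \<longleftrightarrow> (\<forall>i j. sg i * x$i$j + sg j * x$j$i = 0)"
proof
  assume x: "skw x"
  show "\<forall>i j. sg i * x$i$j + sg j * x$j$i = 0"
  proof (intro allI)
    fix i j
    have "fm (x *v axis j 1) (axis i 1) = - fm (axis j 1) (x *v axis i 1)" by (rule skwD[OF x])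
    then have "sg i * x$i$j = - (sg j * x$j$i)"
      by (simp add: fm_sym[of _ "axis i 1"] fm_axis_left matrix_vector_mult_axis)
    then show "sg i * x$i$j + sg j * x$j$i = 0" by simp
  qed
next
  assume *: "\<forall>i j. sg i * x$i$j + sg j * x$j$i = 0"
  have e: "sg i * x$i$j = - (sg j * x$j$i)" for i j using *[rule_format, of i j] eq_neg_iff_add_eq_0 by blast
  show "skw x" unfolding skw_def
  proof (intro allI)
    fix u v
    have "fm (x *v u) v = (\<Sum>i\<in>UNIV. \<Sum>j\<in>UNIV. (sg i * x$i$j) * u$j * v$i)"
      by (simp add: fm_def matrix_vector_mult_def sum_distrib_left sum_distrib_right mult_ac)
    also have "\<dots> = (\<Sum>j\<in>UNIV. \<Sum>i\<in>UNIV. (sg i * x$i$j) * u$j * v$i)" by (rule sum.swap)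
    also have "\<dots> = (\<Sum>j\<in>UNIV. \<Sum>i\<in>UNIV. - (sg j * u$j * (x$j$i * v$i)))"
      by (intro sum.cong refl, subst e) (simp add: mult_ac)
    also have "\<dots> = - fm u (x *v v)"
      by (simp add: fm_def matrix_vector_mult_def sum_distrib_left sum_negf)
    finally show "fm (x *v u) v = - fm u (x *v v)" .
  qed
qed

lemma so_pq_skw: "so_pq = {x :: real^('p::finite + 'q::finite)^('p + 'q). skw x}"
proof -
  have I: "(I_pq :: real^('p::finite + 'q::finite)^('p + 'q)) $ i $ k = (if i = k then sg i else 0)" for i k
    by (simp add: I_pq_def sg_def)
  have "(I_pq ** x + transpose x ** I_pq :: real^('p + 'q)^('p + 'q)) $ i $ j = sg i * x$i$j + sg j * x$j$i"
    for x i j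
    by (simp add: matrix_matrix_mult_def I transpose_def if_distrib[of "\<lambda>t. t * _"] if_distrib[of "\<lambda>t. _ * t"]
        cong: if_cong)
  then show ?thesis by (simp add: so_pq_def skw_entries vec_eq_iff set_eq_iff)
qed

text \<open>The matrix of the bilinear form \<open>fm u (x *v v)\<close> is antisymmetric, and in
  odd size its determinant equals its own negative. The sign twist is invertible, so a kernel vector
  of this matrix is one of \<open>x\<close>.\<close>

lemma skw_kernel_vector:
  fixes x :: "real^('p::finite + 'q::finite)^('p + 'q)"
  assumes x: "skw x" and odd: "odd (CARD('p) + CARD('q))"
  obtains u where "u \<noteq> 0" "x *v u = 0"
proof -
  define A :: "real^('p + 'q)^('p + 'q)" where "A = (\<chi> i j. sg i * x$i$j)"
  have tr: "transpose A = (\<chi> i. (- 1) *s A $ i)"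
  proof -
    have e: "sg j * x$j$i = - (sg i * x$i$j)" for i j using x eq_neg_iff_add_eq_0 unfolding skw_entries by blast
    have "transpose A $ i $ j = (\<chi> i. (- 1) *s A $ i) $ i $ j" for i j
      unfolding A_def transpose_def by (simp, rule e)
    then show ?thesis unfolding vec_eq_iff by blast
  qed
  have "det A = det (transpose A)" by simp
  also have "\<dots> = (\<Prod>i\<in>(UNIV :: ('p + 'q) set). - 1) * det (\<chi> i. A $ i)"
    unfolding tr by (rule det_rows_mul)
  also have "\<dots> = - det A" using odd by simp
  finally have "det A = - det A" .
  then have "det A = 0" by linarith
  then have "\<not> invertible A" by (simp add: invertible_det_nz)
  then have "\<not> (\<exists>B. B ** A = mat 1)" unfolding invertible_left_inverse .
  then have "\<not> (\<forall>u. A *v u = 0 \<longrightarrow> u = 0)"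
    unfolding matrix_left_invertible_ker .
  then obtain u where u: "u \<noteq> 0" "A *v u = 0" by blast
  have "(A *v u) $ i = sg i * (x *v u) $ i" for i
    by (simp add: A_def matrix_vector_mult_def sum_distrib_left mult_ac)
  then have "sg i * (sg i * (x *v u) $ i) = 0" for i using u(2) by simp
  then have "x *v u = 0" by (simp add: mult.assoc[symmetric] vec_eq_iff)
  then show ?thesis using u that by blast
qed

section \<open>Dimension counting\<close>

text \<open>Each further functional costs at most one dimension: a vector on which it is non-zero
  spans everything lost.\<close>

lemma dim_kernel_ge:
  fixes \<phi> :: "'i \<Rightarrow> 'a::euclidean_space \<Rightarrow> real"
  assumes S: "subspace S" and I: "finite I" and lin: "\<And>i. i \<in> I \<Longrightarrow> linear (\<phi> i)"
  shows "dim S \<le> dim {z\<in>S. \<forall>i\<in>I. \<phi> i z = 0} + card I"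
  using I lin
proof (induction I)
  case empty
  then show ?case by simp
next
  case (insert k I)
  let ?T = "{z\<in>S. \<forall>i\<in>I. \<phi> i z = 0}" and ?U = "{z\<in>S. \<forall>i\<in>insert k I. \<phi> i z = 0}"
  have "dim ?T \<le> dim ?U + 1"
  proof (cases "\<exists>s\<in>?T. \<phi> k s \<noteq> 0")
    case False
    then have "?T = ?U" by auto
    then show ?thesis by simp
  next
    case True
    then obtain s where s: "s \<in> ?T" "\<phi> k s \<noteq> 0" by auto
    have "?T \<subseteq> span (insert s ?U)"
    proof
      fix z assume z: "z \<in> ?T"
      let ?c = "\<phi> k z / \<phi> k s"
      have l: "linear (\<phi> i)" if "i \<in> insert k I" for i using insert.prems that by auto
      have "z - ?c *\<^sub>R s \<in> ?U"
        using z s S l by (auto simp: linear_diff linear_scale subspace_diff subspace_scale)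
      then have "z - ?c *\<^sub>R s + ?c *\<^sub>R s \<in> span (insert s ?U)"
        by (intro span_add span_scale span_base) auto
      then show "z \<in> span (insert s ?U)" by simp
    qed
    then have "dim ?T \<le> dim (insert s ?U)" by (rule dim_mono)
    also have "\<dots> \<le> dim ?U + 1" unfolding dim_insert by simp
    finally show ?thesis .
  qed
  moreover have "dim S \<le> dim ?T + card I" using insert.IH insert.prems by blast
  ultimately show ?case using insert.hyps by simp
qed

lemma exists_in_kernel:
  fixes \<phi> :: "'i \<Rightarrow> 'a::euclidean_space \<Rightarrow> real"
  assumes "subspace S" "finite I" "\<And>i. i \<in> I \<Longrightarrow> linear (\<phi> i)" "card I < dim S"
  obtains z where "z \<in> S" "z \<noteq> 0" "\<And>i. i \<in> I \<Longrightarrow> \<phi> i z = 0"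
proof -
  have "0 < dim {z\<in>S. \<forall>i\<in>I. \<phi> i z = 0}"
    using dim_kernel_ge[OF assms(1,2), of \<phi>] assms(3,4) by fastforce
  then have "\<not> {z\<in>S. \<forall>i\<in>I. \<phi> i z = 0} \<subseteq> {0}" unfolding dim_eq_0[symmetric] by linarith
  then show ?thesis using that by blast
qed

text \<open>Dimension formulas are obtained below by exhibiting functionals dual to a spanning
  family.\<close>

lemma dual_family_independent:
  fixes x :: "'i \<Rightarrow> 'a::euclidean_space"
  assumes I: "finite I" and lin: "\<And>i. i \<in> I \<Longrightarrow> linear (\<phi> i)"
    and dual: "\<And>i j. i \<in> I \<Longrightarrow> j \<in> I \<Longrightarrow> \<phi> i (x j) = (if i = j then 1 else (0::real))"
  shows "inj_on x I" "independent (x ` I)" "dim (span (x ` I)) = card I"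
proof -
  show inj: "inj_on x I"
  proof (rule inj_onI)
    fix i j assume ij: "i \<in> I" "j \<in> I" "x i = x j"
    then have "\<phi> i (x i) = \<phi> i (x j)" by simp
    then show "i = j" using dual[OF ij(1,1)] dual[OF ij(1,2)] by (auto split: if_splits)
  qed
  show ind: "independent (x ` I)"
  proof (rule independent_if_scalars_zero)
    show "finite (x ` I)" using I by simp
    fix f v assume s: "(\<Sum>v\<in>x ` I. f v *\<^sub>R v) = 0" and v: "v \<in> x ` I"
    then obtain k where k: "k \<in> I" "v = x k" by auto
    have "(\<Sum>i\<in>I. f (x i) *\<^sub>R x i) = 0" using s by (simp add: sum.reindex[OF inj])
    then have "\<phi> k (\<Sum>i\<in>I. f (x i) *\<^sub>R x i) = 0" using lin[OF k(1)] by (simp add: linear_0)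
    then have "(\<Sum>i\<in>I. f (x i) * \<phi> k (x i)) = 0" using lin[OF k(1)] by (simp add: linear_sum linear_scale)
    moreover have "(\<Sum>i\<in>I. f (x i) * \<phi> k (x i)) = (\<Sum>i\<in>I. if i = k then f v else 0)"
      using k dual by (intro sum.cong) auto
    ultimately show "f v = 0" using I k by simp
  qed
  show "dim (span (x ` I)) = card I"
    using dim_eq_card_independent[OF ind] card_image[OF inj] by (simp add: dim_span)
qed

lemma linear_fm: "linear (fm (u :: real^('p::finite + 'q::finite)))"
  by (rule linearI) auto

text \<open>A linear functional is \<open>fm y\<close> for some \<open>y\<close>, so independent vectors have dual vectors.\<close>

lemma linear_functional_fm:
  fixes g :: "real^('p::finite + 'q::finite) \<Rightarrow> real"
  assumes "linear g"
  obtains y where "\<And>z. g z = fm y z"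
proof -
  define y :: "real^('p + 'q)" where "y = (\<chi> i. sg i * g (axis i 1))"
  have "g z = fm y z" for z
  proof -
    have "g z = g (\<Sum>i\<in>UNIV. z$i *s axis i 1)" by (simp add: basis_expansion)
    also have "\<dots> = (\<Sum>i\<in>UNIV. z$i * g (axis i 1))"
      by (simp add: linear_sum[OF assms] linear_scale[OF assms] scalar_mult_eq_scaleR)
    also have "\<dots> = fm y z"
      unfolding fm_def y_def by (intro sum.cong) (auto simp: mult.assoc[symmetric])
    finally show ?thesis .
  qed
  then show ?thesis using that by blast
qed

lemma dual_vectors:
  fixes U :: "'i \<Rightarrow> real^('p::finite + 'q::finite)"
  assumes inj: "inj_on U I" and ind: "independent (U ` I)"
  obtains F where "\<And>i j. i \<in> I \<Longrightarrow> j \<in> I \<Longrightarrow> fm (U i) (F j) = (if i = j then 1 else 0)"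
proof -
  have "\<exists>y. \<forall>i\<in>I. fm (U i) y = (if i = j then 1 else 0)" if j: "j \<in> I" for j
  proof -
    obtain g where g: "linear g" "\<forall>v\<in>U ` I. g v = (if v = U j then 1 else (0::real))"
      using linear_independent_extend[OF ind, of "\<lambda>v. if v = U j then 1 else (0::real)"] by blast
    obtain y where y: "\<And>z. g z = fm y z" using linear_functional_fm[OF g(1)] by blast
    have "fm (U i) y = (if i = j then 1 else 0)" if "i \<in> I" for i
      using g(2) y that j inj by (auto simp: fm_sym[of "U i"] inj_on_eq_iff)
    then show ?thesis by blast
  qed
  then have "\<exists>F. \<forall>j\<in>I. \<forall>i\<in>I. fm (U i) (F j) = (if i = j then 1 else 0)" by (rule bchoice[OF ballI])
  then show ?thesis using that by blast
qed

section \<open>Classification of the abelian inner ideals\<close>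

type_synonym ('p, 'q) rvec = "real^('p + 'q)"
type_synonym ('p, 'q) rmat = "real^('p + 'q)^('p + 'q)"

definition totally_isotropic :: "('p::finite, 'q::finite) rvec set \<Rightarrow> bool" where
  "totally_isotropic U \<longleftrightarrow> subspace U \<and> (\<forall>u\<in>U. \<forall>v\<in>U. fm u v = 0)"

definition perp :: "('p::finite, 'q::finite) rvec \<Rightarrow> ('p, 'q) rvec set" where
  "perp u = {z. fm u z = 0}"

text \<open>\<open>W1 u N\<close> is \<open>u \<and> N\<close>, and \<open>W2 M\<close> is the exterior square of \<open>M\<close>.\<close>

definition W1 :: "('p::finite, 'q::finite) rvec \<Rightarrow> ('p, 'q) rvec set \<Rightarrow> ('p, 'q) rmat set" where
  "W1 u N = wd u ` N"

definition W2 :: "('p::finite, 'q::finite) rvec set \<Rightarrow> ('p, 'q) rmat set" where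
  "W2 M = span {wd u v | u v. u \<in> M \<and> v \<in> M}"

lemma matrix_uminus_apply [simp]: "(- A) *v x = - (A *v (x :: 'a::comm_ring_1^'n))"
  by (simp add: vec_eq_iff matrix_vector_mult_def sum_negf)

lemma matrix_scaleR_apply [simp]: "(c *\<^sub>R A) *v x = c *\<^sub>R (A *v (x :: real^'n))"
  by (simp add: scaleR_matrix_vector_assoc)

lemma subspace_perp: "subspace (perp u)"
  by (auto simp: perp_def intro!: subspaceI)

lemma linear_wd: "linear (wd (u :: ('p::finite, 'q::finite) rvec))"
  by (rule linearI) (auto simp: wd_add_right)

lemma subspace_W1: "subspace N \<Longrightarrow> subspace (W1 u N)"
  unfolding W1_def by (rule linear_subspace_image[OF linear_wd])

lemma wd_in_W2: "u \<in> M \<Longrightarrow> v \<in> M \<Longrightarrow> wd u v \<in> W2 M"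
  unfolding W2_def by (rule span_base) blast

lemma linear_matrix_apply: "linear (\<lambda>x :: real^'n^'m. x *v u)"
  by (rule linearI) (simp_all add: matrix_vector_mult_add_rdistrib)

lemma exists_dual_vector:
  fixes u :: "('p::finite, 'q::finite) rvec"
  assumes "u \<noteq> 0" obtains y where "fm u y = 1"
proof -
  obtain v where v: "fm u v \<noteq> 0" using fm_nondegenerate assms by blast
  have "fm u ((1 / fm u v) *\<^sub>R v) = 1" using v by simp
  then show ?thesis using that by blast
qed

text \<open>The functional is the Euclidean inner product with the component of \<open>y\<close>
  orthogonal to the span, afterwards represented by \<open>fm\<close>. The form \<open>fm\<close>
  itself is indefinite and admits no orthogonal projection onto an arbitrary span.\<close>

lemma separate_from_span:
  fixes y :: "('p::finite, 'q::finite) rvec"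
  assumes "y \<notin> span S"
  obtains s where "fm y s = 1" "\<And>x. x \<in> S \<Longrightarrow> fm x s = 0"
proof -
  obtain p r where pr: "p \<in> span S" "\<And>w. w \<in> span S \<Longrightarrow> orthogonal r w" "y = p + r"
    using orthogonal_subspace_decomp_exists[of S y] by metis
  have r0: "r \<noteq> 0" using pr assms by auto
  have lin: "linear (\<lambda>z. (z \<bullet> r) / (r \<bullet> r))"
    by (rule linearI) (auto simp: inner_add_left add_divide_distrib)
  obtain s where s: "\<And>z. (z \<bullet> r) / (r \<bullet> r) = fm s z" using linear_functional_fm[OF lin] by blast
  have "(y \<bullet> r) / (r \<bullet> r) = 1"
    using pr(2)[OF pr(1)] r0 pr(3) by (simp add: inner_add_left inner_add_right orthogonal_def inner_commute)
  then have "fm y s = 1" using s[of y] fm_sym[of y s] by simp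
  moreover have "fm x s = 0" if "x \<in> S" for x
  proof -
    have "x \<bullet> r = 0" using pr(2)[OF span_base[OF that]] by (simp add: orthogonal_def inner_commute)
    then show ?thesis using s[of x] fm_sym[of x s] by simp
  qed
  ultimately show ?thesis using that by blast
qed

lemma wd_eq_0_imp:
  fixes u :: "('p::finite, 'q::finite) rvec"
  assumes "wd u v = 0" "fm u y = 1" shows "v = fm v y *\<^sub>R u"
proof -
  have "wd u v *v y = 0" using assms(1) by simp
  then show ?thesis using assms(2) by (simp add: wd_applyR)
qed

text \<open>The image of a non-zero decomposable operator is the plane of its factors: applied to a
  vector that pairs with one factor only, the operator returns the other one up to sign.\<close>

lemma wd_range:
  fixes x :: "('p::finite, 'q::finite) rvec"
  assumes "wd x y \<noteq> 0" shows "\<exists>s. wd x y *v s = x" "\<exists>s. wd x y *v s = y"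
proof -
  have "y \<notin> span {x}" using assms by (auto simp: span_singleton)
  then obtain s where "fm y s = 1" "fm x s = 0" using separate_from_span[of y "{x}"] by blast
  then have "wd x y *v s = x" by (simp add: wd_applyR)
  then show "\<exists>s. wd x y *v s = x" by blast
  have "x \<notin> span {y}" using assms by (auto simp: span_singleton)
  then obtain s where "fm x s = 1" "fm y s = 0" using separate_from_span[of x "{y}"] by blast
  then have "wd x y *v (- s) = y" by (simp add: wd_applyR)
  then show "\<exists>s. wd x y *v s = y" by blast
qed

section \<open>Elements with non-zero square\<close>

lemma ad_square_wd:
  fixes b :: "('p::finite, 'q::finite) rmat"
  assumes "skw b"
  shows "lie_br b (lie_br b (wd u v)) = wd (b *v (b *v u)) v + (wd (b *v u) (b *v v) + wd (b *v u) (b *v v)) + wd u (b *v (b *v v))"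
  by (simp only: lie_br_wd[OF assms] lie_br_add_right add_ac)

text \<open>Leibniz rule for the third power of a derivation; the two mixed terms are what is left
  when \<open>b\<close> has cube zero.\<close>

lemma ad_cube_wd:
  fixes b :: "('p::finite, 'q::finite) rmat"
  assumes "skw b"
  shows "lie_br b (lie_br b (lie_br b (wd u v))) = wd (b *v (b *v (b *v u))) v +
    3 *\<^sub>R (wd (b *v (b *v u)) (b *v v) + wd (b *v u) (b *v (b *v v))) + wd u (b *v (b *v (b *v v)))"
proof -
  let ?D = "wd (b *v (b *v u)) (b *v v) + wd (b *v u) (b *v (b *v v))"
  have "lie_br b (lie_br b (lie_br b (wd u v))) =
      wd (b *v (b *v (b *v u))) v + (?D + ?D + ?D) + wd u (b *v (b *v (b *v v)))"
    by (simp only: lie_br_wd[OF assms] lie_br_add_right add_ac)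
  moreover have "?D + ?D + ?D = 3 *\<^sub>R ?D" by (simp add: vec_eq_iff)
  ultimately show ?thesis by simp
qed

text \<open>As the dimension is odd, \<open>b\<close> kills some \<open>u \<noteq> 0\<close>, and \<open>ad\<^sub>b\<^sup>3 (u \<and> v) = u \<and> b\<^sup>3 v\<close>. So the
  image of the skew operator \<open>b\<^sup>3\<close> is at most a line.\<close>

lemma ad_cube_zero_imp_cube_zero:
  fixes b :: "('p::finite, 'q::finite) rmat"
  assumes b: "skw b" and odd: "odd (CARD('p) + CARD('q))"
    and ad: "\<And>x. skw x \<Longrightarrow> lie_br b (lie_br b (lie_br b x)) = 0"
  shows "b *v (b *v (b *v v)) = 0"
proof (rule ccontr)
  let ?c = "\<lambda>v. b *v (b *v (b *v v))"
  assume nz: "?c v \<noteq> 0"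
  obtain u where u: "u \<noteq> 0" "b *v u = 0" using skw_kernel_vector[OF b odd] .
  obtain y where y: "fm u y = 1" using exists_dual_vector[OF u(1)] .
  have e: "?c v = fm (?c v) y *\<^sub>R u" for v
  proof -
    have "wd u (?c v) = 0" using ad[OF skw_wd, of u v] ad_cube_wd[OF b, of u v] u by simp
    then show ?thesis using wd_eq_0_imp y by blast
  qed
  have self: "fm (?c v) v = 0" for v
  proof -
    have "fm (?c v) v = - fm v (?c v)" using b by (simp add: skwD)
    then show ?thesis using fm_sym[of v "?c v"] by linarith
  qed
  \<comment> \<open>A product of two linear functionals of \<open>v\<close> vanishes identically.
    Adding a vector where the first is non-zero to one where the second is non-zero will give the
    contradiction.\<close>
  have *: "fm (?c v) y * fm u v = 0" for v
    using self[of v] e[of v] fm_scaleR_left by metis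
  have p: "fm (?c v) y \<noteq> 0" using nz e[of v] by auto
  then have "fm u v = 0" using *[of v] by simp
  moreover have "fm (?c y) y = 0" using *[of y] y by simp
  ultimately have "fm (?c (v + y)) y * fm u (v + y) = fm (?c v) y"
    using y by (simp add: matrix_vector_right_distrib)
  then show False using p * by metis
qed

text \<open>Since \<open>b\<close> has cube zero, the cube of \<open>ad b\<close> leaves the
  identity \<open>e\<close> between mixed terms. For \<open>s = z\<close>, evaluated at a vector
  dual to \<open>u\<close>, it expresses \<open>b *v v\<close> through \<open>u\<close>,
  \<open>w\<close> and \<open>b *v (b *v v)\<close>. One more application of \<open>b\<close> shows
  that the square of \<open>b\<close> maps into the line of \<open>u\<close>, and skewness then
  determines all coefficients.\<close>

lemma square_nonzero_imp_wd:
  fixes b :: "('p::finite, 'q::finite) rmat"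
  assumes b: "skw b" and c: "\<And>v. b *v (b *v (b *v v)) = 0"
    and ad: "\<And>x. skw x \<Longrightarrow> lie_br b (lie_br b (lie_br b x)) = 0"
    and z: "b *v (b *v z) \<noteq> 0"
  obtains u w where "u \<noteq> 0" "fm u u = 0" "fm u w = 0" "fm w w \<noteq> 0" "b = wd u w"
proof -
  define u where "u = b *v (b *v z)"
  define w where "w = b *v z"
  obtain y where y: "fm u y = 1" using exists_dual_vector z u_def by metis
  have bu: "b *v u = 0" "b *v w = u" using c by (simp_all add: u_def w_def)
  have e: "wd (b *v (b *v s)) (b *v t) + wd (b *v s) (b *v (b *v t)) = 0" for s t
    using ad[OF skw_wd, of s t] ad_cube_wd[OF b, of s t] by (simp add: c)
  have bv: "b *v v = fm (b *v v) y *\<^sub>R u + fm (b *v (b *v v)) y *\<^sub>R w - fm w y *\<^sub>R (b *v (b *v v))" for v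
  proof -
    have "(wd u (b *v v) + wd w (b *v (b *v v))) *v y = 0"
      using e[of z v] by (simp add: u_def w_def)
    then show ?thesis using y by (simp add: matrix_vector_mult_add_rdistrib wd_applyR algebra_simps)
  qed
  have bbv: "b *v (b *v v) = fm (b *v (b *v v)) y *\<^sub>R u" for v
  proof -
    have "b *v (b *v v) = b *v (fm (b *v v) y *\<^sub>R u + fm (b *v (b *v v)) y *\<^sub>R w - fm w y *\<^sub>R (b *v (b *v v)))"
      using bv[of v] by simp
    then show ?thesis by (simp add: algebra_simps bu c)
  qed
  define k where "k = fm (b *v (b *v y)) y"
  have bby: "b *v (b *v y) = k *\<^sub>R u" using bbv[of y] k_def by simp
  have by': "b *v y = k *\<^sub>R w - (fm w y * k) *\<^sub>R u"
    using bv[of y] unfolding k_def[symmetric] unfolding bby fm_skw_self[OF b] by simp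
  have f1: "fm (b *v (b *v v)) y = k * fm v u" for v
    using b bby by (simp add: skwD)
  have f2: "fm (b *v v) y = - k * fm v w + fm w y * k * fm v u" for v
    using b by' by (simp add: skwD)
  have bw: "b = wd u (- k *\<^sub>R w)"
  proof (rule matrix_eqI)
    fix v
    have "b *v v = fm (b *v v) y *\<^sub>R u + fm (b *v (b *v v)) y *\<^sub>R w - fm w y *\<^sub>R fm (b *v (b *v v)) y *\<^sub>R u"
      using bv[of v] bbv[of v] by simp
    also have "\<dots> = wd u (- k *\<^sub>R w) *v v"
      unfolding f1 unfolding f2 by (simp add: wd_applyR fm_sym[of v] algebra_simps)
    finally show "b *v v = wd u (- k *\<^sub>R w) *v v" .
  qed
  have uu: "fm u u = 0" using b c by (simp add: u_def skwD)
  have uw: "fm u w = 0"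
    unfolding u_def w_def using fm_skw_self[OF b] by blast
  \<comment> \<open>Comparing coefficients of \<open>u\<close> forces
    \<open>k * fm w w = -1\<close>, so the second factor is anisotropic.\<close>
  have "u = b *v w" using bu by simp
  also have "\<dots> = - (k * fm w w) *\<^sub>R u" by (subst bw) (simp add: wd_applyR uw)
  finally have "u + (k * fm w w) *\<^sub>R u = 0" by (metis add.left_inverse scaleR_minus_left)
  then have "(1 + k * fm w w) *\<^sub>R u = 0" by (simp add: scaleR_left_distrib)
  then have "1 + k * fm w w = 0" using z u_def by simp
  then have "k * fm w w = - 1" by linarith
  then have ww: "fm (- k *\<^sub>R w) (- k *\<^sub>R w) \<noteq> 0" by auto
  have "u \<noteq> 0" "fm u (- k *\<^sub>R w) = 0" using z uw by (simp_all add: u_def)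
  then show ?thesis using that uu ww bw by blast
qed

text \<open>A vector is a part orthogonal to \<open>u\<close> and \<open>v\<close> plus multiples of
  \<open>u\<close> and of \<open>v\<close>. The operator sends the first part into the line of
  \<open>u\<close>, where skewness expresses the coefficient by \<open>y *v v\<close>, and it kills
  the second part.\<close>

lemma W1_perp_I:
  fixes u :: "('p::finite, 'q::finite) rvec"
  assumes y: "skw y" and u: "fm u u = 0" and v: "fm u v = 1" and yu: "y *v u = 0"
    and yz: "\<And>z. fm u z = 0 \<Longrightarrow> fm v z = 0 \<Longrightarrow> y *v z = fm (y *v z) v *\<^sub>R u"
  shows "y = wd u (- (y *v v))" "y \<in> W1 u (perp u)"
proof -
  show e: "y = wd u (- (y *v v))"
  proof (rule matrix_eqI)
    fix s
    define s' where "s' = s - fm u s *\<^sub>R v"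
    define z where "z = s' - fm s' v *\<^sub>R u"
    have s: "s = z + fm s' v *\<^sub>R u + fm u s *\<^sub>R v" by (simp add: z_def s'_def)
    have z: "fm u z = 0" "fm v z = 0"
      using u v fm_sym[of v s'] fm_sym[of v u] by (simp_all add: z_def) (simp add: s'_def)
    have a: "y *v s = fm (y *v z) v *\<^sub>R u + fm u s *\<^sub>R (y *v v)"
      using arg_cong[OF s, of "(*v) y"] yu yz[OF z] by (simp add: matrix_vector_right_distrib matrix_vector_mult_scaleR)
    have "fm (y *v v) s = fm (y *v v) z + fm s' v * fm (y *v v) u + fm u s * fm (y *v v) v"
      using arg_cong[OF s, of "fm (y *v v)"] by simp
    also have "\<dots> = - fm (y *v z) v"
      using fm_skw_self[OF y] skwD[OF y, of v z] skwD[OF y, of v u] yu by (simp add: fm_sym)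
    finally show "y *v s = wd u (- (y *v v)) *v s" using a by (simp add: wd_applyR)
  qed
  have "fm u (y *v v) = 0" using skwD[OF y, of u v] yu by simp
  then show "y \<in> W1 u (perp u)" unfolding W1_def perp_def by (subst e) (rule imageI, simp)
qed

text \<open>As \<open>fm w w \<noteq> 0\<close>, the square of \<open>ad (wd u w)\<close> sends
  \<open>wd v z\<close> to a non-zero multiple of \<open>wd u z\<close> plus a multiple of
  \<open>wd u w\<close>, so the ideal contains \<open>W1 u (perp u)\<close>. Conversely an operator
  that commutes with all of \<open>W1 u (perp u)\<close> belongs to it.\<close>

lemma abelian_inner_ideal_with_rank_2_square:
  fixes B :: "('p::finite, 'q::finite) rmat set"
  assumes B: "inner_ideal so_pq B" "abelian B"
    and u: "u \<noteq> 0" "fm u u = 0" "fm u w = 0" "fm w w \<noteq> 0" "wd u w \<in> B"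
  shows "B = W1 u (perp u)"
proof
  have sub: "subspace B" using B by (simp add: inner_ideal_def)
  obtain v0 where v0: "fm u v0 = 1" using exists_dual_vector[OF u(1)] .
  \<comment> \<open>Removing the \<open>w\<close>-component keeps the pairing with \<open>u\<close>
    equal to 1, because \<open>w\<close> is orthogonal to \<open>u\<close>.\<close>
  define v where "v = v0 - (fm w v0 / fm w w) *\<^sub>R w"
  have v: "fm u v = 1" "fm w v = 0" using v0 u by (simp_all add: v_def)
  show "W1 u (perp u) \<subseteq> B"
  proof
    fix x assume "x \<in> W1 u (perp u)"
    then obtain z where z: "x = wd u z" "fm u z = 0" by (auto simp: W1_def perp_def)
    let ?b = "wd u w"
    have "lie_br ?b (lie_br ?b (wd v z)) \<in> B"
      using B u(5) by (simp add: inner_ideal_def so_pq_skw)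
    moreover have "lie_br ?b (lie_br ?b (wd v z)) = - fm w w *\<^sub>R wd u z + (2 * fm w z) *\<^sub>R wd u w"
      unfolding ad_square_wd[OF skw_wd]
      using u v z by (simp add: wd_applyR matrix_vector_mult_scaleR matrix_vector_mult_diff_distrib
          fm_sym[of w u] wd_swap[of w u] scaleR_left_distrib[symmetric])
    ultimately have "- fm w w *\<^sub>R wd u z + (2 * fm w z) *\<^sub>R wd u w - (2 * fm w z) *\<^sub>R wd u w \<in> B"
      using u(5) sub by (metis subspace_diff subspace_scale)
    then have "(- 1 / fm w w) *\<^sub>R (- fm w w *\<^sub>R wd u z) \<in> B" using sub by (simp only: add_diff_cancel subspace_scale)
    then show "x \<in> B" using u z by simp
  qed
  then have comm: "lie_br y (wd u z) = 0" if "y \<in> B" "fm u z = 0" for y z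
    using that B by (auto simp: abelian_def W1_def perp_def image_subset_iff)
  show "B \<subseteq> W1 u (perp u)"
  proof
    fix y assume y: "y \<in> B"
    then have sk: "skw y" using B by (auto simp: inner_ideal_def so_pq_skw)
    have e: "fm z s *\<^sub>R (y *v u) - fm (y *v u) s *\<^sub>R z + fm (y *v z) s *\<^sub>R u - fm u s *\<^sub>R (y *v z) = 0"
      if "fm u z = 0" for z s
    proof -
      have "lie_br y (wd u z) *v s = 0" using comm[OF y that] by simp
      then show ?thesis using sk by (simp add: lie_br_wd matrix_vector_mult_add_rdistrib wd_applyR algebra_simps)
    qed
    have yz: "y *v z = fm z v *\<^sub>R (y *v u) - fm (y *v u) v *\<^sub>R z + fm (y *v z) v *\<^sub>R u" if "fm u z = 0" for z
    proof -
      have "fm z v *\<^sub>R (y *v u) - fm (y *v u) v *\<^sub>R z + fm (y *v z) v *\<^sub>R u - y *v z = 0"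
        using e[OF that, of v] unfolding v(1) scaleR_one .
      then show ?thesis by (metis right_minus_eq)
    qed
    have wv: "fm w v = 0" "fm u w = 0" using u v by auto
    \<comment> \<open>Pairing the formula for \<open>y *v w\<close> with \<open>w\<close> itself
      isolates \<open>fm (y *v u) v\<close>, by anisotropy of \<open>w\<close>.\<close>
    have "0 = fm (y *v w) w" using fm_skw_self[OF sk] by simp
    also have "\<dots> = - fm (y *v u) v * fm w w" using arg_cong[OF yz[OF u(3)], of "\<lambda>t. fm t w"] u v by simp
    finally have l: "fm (y *v u) v = 0" using u by simp
    have yz': "y *v z = fm (y *v z) v *\<^sub>R u" if "fm u z = 0" "fm v z = 0" for z
      using yz[OF that(1)] that l by (simp add: fm_sym[of z])
    have "fm (y *v u) w = - fm u (y *v w)" using skwD[OF sk] by simp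
    also have "\<dots> = 0" using yz'[OF u(3)] v u by (metis fm_scaleR_right fm_sym mult_zero_right neg_0_equal_iff_equal)
    finally have "fm w w *\<^sub>R (y *v u) = 0" using e[OF u(3), of w] u fm_skw_self[OF sk, of w] by simp
    then have "y *v u = 0" using u by simp
    then show "y \<in> W1 u (perp u)" using W1_perp_I(2)[OF sk u(2) v(1) _ yz'] by blast
  qed
qed

section \<open>Ideals in which all products vanish\<close>

lemma span2_iff: "r \<in> span {x, y} \<longleftrightarrow> (\<exists>a b. r = a *\<^sub>R x + b *\<^sub>R (y :: ('p::finite, 'q::finite) rvec))"
  by (auto simp: span_insert span_singleton eq_diff_eq diff_eq_eq add.commute)

lemma span3_iff: "r \<in> span {x, y, z} \<longleftrightarrow> (\<exists>a b c. r = a *\<^sub>R x + b *\<^sub>R y + c *\<^sub>R (z :: ('p::finite, 'q::finite) rvec))"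
  unfolding span_insert[of x "{y, z}"] span2_iff mem_Collect_eq
  by (simp add: diff_eq_eq add_ac)

text \<open>Vanishing of all products as operators on the natural module is stronger than
  commutativity: it makes the images of the elements mutually orthogonal and leaves only mixed terms
  in double brackets.\<close>

locale square_zero_ideal =
  fixes B :: "('p::finite, 'q::finite) rmat set"
  assumes inner: "inner_ideal so_pq B" and prod: "b \<in> B \<Longrightarrow> b' \<in> B \<Longrightarrow> b *v (b' *v z) = 0"
begin

lemma sub: "subspace B" and skew: "b \<in> B \<Longrightarrow> skw b"
  using inner by (auto simp: inner_ideal_def so_pq_skw)

text \<open>In the expanded double bracket, the terms where \<open>b\<close> and \<open>b'\<close>
  hit the same factor contain a product of the two and vanish.\<close>

lemma polar: "b \<in> B \<Longrightarrow> b' \<in> B \<Longrightarrow> wd (b *v s) (b' *v t) + wd (b' *v s) (b *v t) \<in> B"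
proof -
  assume b: "b \<in> B" "b' \<in> B"
  have "lie_br b (lie_br b' (wd s t)) \<in> B" using inner b by (simp add: inner_ideal_def so_pq_skw)
  then show ?thesis using b skew[of b] skew[of b'] by (simp add: lie_br_wd lie_br_add_right prod add.commute)
qed

lemma wd_images: "b \<in> B \<Longrightarrow> wd (b *v s) (b *v t) \<in> B"
proof -
  assume b: "b \<in> B"
  have "(1/2) *\<^sub>R (wd (b *v s) (b *v t) + wd (b *v s) (b *v t)) \<in> B"
    using polar[OF b b] sub by (blast intro: subspace_scale)
  moreover have "(1/2) *\<^sub>R (x + x) = x" for x :: "('p, 'q) rmat" by (simp add: vec_eq_iff)
  ultimately show ?thesis by simp
qed

definition U where "U = span {b *v z | b z. b \<in> B}"

lemma totally_isotropic_U: "totally_isotropic U"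
proof -
  have "fm (b *v z) (b' *v z') = 0" if "b \<in> B" "b' \<in> B" for b b' z z'
    using skwD[OF skew[OF that(1)]] prod[OF that] by simp
  then have 1: "fm x y = 0" if "x \<in> {b *v z | b z. b \<in> B}" "y \<in> {b *v z | b z. b \<in> B}" for x y
    using that by blast
  have 2: "fm x y = 0" if "x \<in> {b *v z | b z. b \<in> B}" "y \<in> U" for x y
    using that(2) unfolding U_def by (induction rule: span_induct) (auto simp: subspace_def 1[OF that(1)])
  have "fm x y = 0" if "x \<in> U" "y \<in> U" for x y
    using that(1) unfolding U_def by (induction rule: span_induct) (auto simp: subspace_def 2[OF _ that(2)])
  then show ?thesis by (auto simp: totally_isotropic_def U_def)
qed

lemma wd_in_U: "wd x y \<in> B \<Longrightarrow> wd x y \<noteq> 0 \<Longrightarrow> x \<in> U \<and> y \<in> U"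
  using wd_range[of x y] unfolding U_def by (metis (mono_tags, lifting) mem_Collect_eq span_base)

text \<open>Elimination for an alternating operator: as \<open>fm (b *v t) s = 1\<close>,
  subtracting \<open>wd (b *v s) (b *v t)\<close>, which lies in the ideal, keeps the kernel and
  adds \<open>t\<close> to it. The induction is on the rank.\<close>

lemma span_decomposables: "b \<in> B \<Longrightarrow> b \<in> span {wd x y | x y. wd x y \<in> B}"
proof (induction "DIM(('p, 'q) rvec) - dim {z. b *v z = 0}" arbitrary: b rule: less_induct)
  case less
  have sk: "skw b" using skew less.prems by blast
  show ?case
  proof (cases "b = 0")
    case True
    then show ?thesis by (simp add: span_zero)
  next
    case False
    then obtain t where t: "b *v t \<noteq> 0" by (metis matrix_eqI matrix_vector_mult_0)
    then obtain s where s: "fm (b *v t) s = 1" using exists_dual_vector by blast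
    define b' where "b' = b - wd (b *v s) (b *v t)"
    have w: "wd (b *v s) (b *v t) \<in> B" using wd_images less.prems by blast
    then have b': "b' \<in> B" unfolding b'_def using less.prems sub by (blast intro: subspace_diff)
    have s': "fm (b *v s) t = - 1" using skwD[OF sk, of s t] s by (simp add: fm_sym)
    have "{z. b *v z = 0} \<subset> {z. b' *v z = 0}"
    proof
      show "{z. b *v z = 0} \<subseteq> {z. b' *v z = 0}"
        using skwD[OF sk] by (auto simp: b'_def matrix_vector_mult_diff_rdistrib wd_applyR)
      have "b' *v t = 0" using fm_skw_self[OF sk, of t] s'
        by (simp add: b'_def matrix_vector_mult_diff_rdistrib wd_applyR)
      then show "{z. b *v z = 0} \<noteq> {z. b' *v z = 0}" using t by blast
    qed
    moreover have ss: "subspace {z. c *v z = 0}" for c :: "('p, 'q) rmat"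
      by (auto simp: subspace_def matrix_vector_right_distrib matrix_vector_mult_scaleR)
    ultimately have "dim {z. b *v z = 0} < dim {z. b' *v z = 0}"
      by (metis dim_psubset span_eq_iff)
    moreover have "dim {z. b' *v z = 0} \<le> DIM(('p, 'q) rvec)" by (rule dim_subset_UNIV)
    ultimately have "b' \<in> span {wd x y | x y. wd x y \<in> B}"
      by (intro less.hyps b') linarith
    moreover have "wd (b *v s) (b *v t) \<in> span {wd x y | x y. wd x y \<in> B}"
      using w by (intro span_base) blast
    ultimately have "b' + wd (b *v s) (b *v t) \<in> span {wd x y | x y. wd x y \<in> B}"
      by (rule span_add)
    then show ?thesis by (simp add: b'_def)
  qed
qed

text \<open>With \<open>s\<close> pairing only with \<open>y\<close>, and \<open>t\<close> only with
  \<open>w\<close>, the polarised square collapses to \<open>wd x z\<close>. The two span conditions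
  are what such vectors require.\<close>

lemma exchange:
  assumes "wd x y \<in> B" "wd z w \<in> B" "y \<notin> span {x, z, w}" "w \<notin> span {x, y, z}"
  shows "wd x z \<in> B"
proof -
  obtain s where s: "fm y s = 1" "\<And>a. a \<in> {x, z, w} \<Longrightarrow> fm a s = 0"
    using separate_from_span[OF assms(3)] by blast
  obtain t where t: "fm w t = 1" "\<And>a. a \<in> {x, y, z} \<Longrightarrow> fm a t = 0"
    using separate_from_span[OF assms(4)] by blast
  have "wd (wd x y *v s) (wd z w *v t) + wd (wd z w *v s) (wd x y *v t) \<in> B"
    using polar[OF assms(1,2)] .
  then show ?thesis using s t by (simp add: wd_applyR)
qed

text \<open>The ideal is spanned by decomposable elements \<open>wd x y\<close>. If a largest flat subspace \<open>M\<close> has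
  dimension at least 3, it absorbs all of them and the ideal is \<open>W2 M\<close>. Otherwise any two of the
  planes meet, and they share a common line.\<close>

definition flat where "flat M \<longleftrightarrow> subspace M \<and> (\<forall>x\<in>M. \<forall>y\<in>M. wd x y \<in> B)"

text \<open>Maximality is by dimension, not by inclusion: when the largest dimension is 2, every
  flat plane qualifies, which the classification uses for two planes at once.\<close>

definition maxflat where
  "maxflat M \<longleftrightarrow> flat M \<and> 2 \<le> dim M \<and> (\<forall>M'. flat M' \<longrightarrow> dim M' \<le> dim M)"

lemma wd_combine: "wd (a *\<^sub>R x + b *\<^sub>R y) (c *\<^sub>R x + d *\<^sub>R y) = (a * d - b * c) *\<^sub>R wd x (y :: ('p, 'q) rvec)"
  by (simp add: wd_add_left wd_add_right algebra_simps wd_swap[of y x])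

lemma flat_pair: "wd x y \<in> B \<Longrightarrow> flat (span {x, y})"
  unfolding flat_def
proof (intro conjI ballI)
  fix r s assume w: "wd x y \<in> B" and "r \<in> span {x, y}" "s \<in> span {x, y}"
  then obtain a b c d where "r = a *\<^sub>R x + b *\<^sub>R y" "s = c *\<^sub>R x + d *\<^sub>R y"
    by (metis span2_iff)
  then show "wd r s \<in> B" using w sub wd_combine by (simp add: subspace_scale)
qed (rule subspace_span)

text \<open>Adjoining such a \<open>z\<close> from outside would produce a flat subspace of larger
  dimension.\<close>

lemma maxflat_absorbs:
  assumes M: "maxflat M" and z: "\<And>x. x \<in> M \<Longrightarrow> wd x z \<in> B"
  shows "z \<in> M"
proof (rule ccontr)
  assume n: "z \<notin> M"
  have sM: "subspace M" and fM: "\<And>x y. x \<in> M \<Longrightarrow> y \<in> M \<Longrightarrow> wd x y \<in> B"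
    using M by (auto simp: maxflat_def flat_def)
  have sp: "span M = M" using sM by (simp add: span_eq_iff)
  have "flat (span (insert z M))"
    unfolding flat_def
  proof (intro conjI ballI)
    fix r s assume "r \<in> span (insert z M)" "s \<in> span (insert z M)"
    then obtain c d where cd: "r - c *\<^sub>R z \<in> M" "s - d *\<^sub>R z \<in> M"
      by (auto simp: span_insert sp)
    let ?r = "r - c *\<^sub>R z" and ?s = "s - d *\<^sub>R z"
    have "wd r s = wd ?r ?s + d *\<^sub>R wd ?r z - c *\<^sub>R wd ?s z"
      by (simp add: wd_diff_left wd_diff_right wd_swap[of z s] algebra_simps)
    then show "wd r s \<in> B" using fM[OF cd] z[OF cd(1)] z[OF cd(2)] sub
      by (metis subspace_add subspace_diff subspace_scale)
  qed (rule subspace_span)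
  then have "dim (insert z M) \<le> dim M" using M by (auto simp: maxflat_def)
  then show False using n sp by (simp add: dim_insert)
qed

lemma exists_outside:
  assumes "subspace M" "finite S" "card S < dim M"
  obtains y where "y \<in> M" "y \<notin> span (S :: ('p, 'q) rvec set)"
proof -
  have "\<not> M \<subseteq> span S"
    using assms by (metis dim_le_card dim_mono dual_order.strict_trans2 leD le_trans span_mono order_refl)
  then show ?thesis using that by blast
qed

text \<open>If the plane of \<open>z\<close> and \<open>w\<close> missed \<open>M\<close>, then
  \<open>exchange\<close>, applied to it and to planes inside \<open>M\<close>, would give
  \<open>wd x z \<in> B\<close> for every \<open>x\<close> in \<open>M\<close>, and \<open>z\<close>
  would be absorbed by \<open>M\<close>.\<close>

lemma maxflat_meets:
  assumes M: "maxflat M" and w: "wd z w \<in> B" "wd z w \<noteq> 0"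
  obtains r where "r \<in> M" "r \<in> span {z, w}" "r \<noteq> 0"
proof -
  have "\<exists>r. r \<in> M \<and> r \<in> span {z, w} \<and> r \<noteq> 0"
  proof (rule ccontr)
    assume no: "\<not> ?thesis"
    have sM: "subspace M" and fM: "\<And>x y. x \<in> M \<Longrightarrow> y \<in> M \<Longrightarrow> wd x y \<in> B" and d: "2 \<le> dim M"
      using M by (auto simp: maxflat_def flat_def)
    have nz: "c = 0 \<and> d = 0" if "c *\<^sub>R z + d *\<^sub>R w \<in> M" for c d
    proof -
      have "c *\<^sub>R z + d *\<^sub>R w = 0" using no that unfolding span2_iff by blast
      then have "wd (c *\<^sub>R z + d *\<^sub>R w) w = 0" "wd z (c *\<^sub>R z + d *\<^sub>R w) = 0" by simp_all
      then show ?thesis using w by (simp add: wd_add_left wd_add_right)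
    qed
    have "wd x z \<in> B" if x: "x \<in> M" for x
    proof (cases "x = 0")
      case True
      then show ?thesis using sub by (simp add: subspace_0)
    next
      case False
      obtain y where y: "y \<in> M" "y \<notin> span {x}"
        using exists_outside[OF sM, of "{x}"] d by auto
      have "y \<notin> span {x, z, w}"
      proof
        assume "y \<in> span {x, z, w}"
        then obtain a b c where e: "y = a *\<^sub>R x + b *\<^sub>R z + c *\<^sub>R w" unfolding span3_iff by blast
        then have "b *\<^sub>R z + c *\<^sub>R w = y - a *\<^sub>R x" by simp
        also have "\<dots> \<in> M" using sM x y by (blast intro: subspace_diff subspace_scale)
        finally have "b = 0 \<and> c = 0" by (rule nz)
        then show False using e y(2) by (auto simp: span_singleton)
      qed
      moreover have "w \<notin> span {x, y, z}"
      proof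
        assume "w \<in> span {x, y, z}"
        then obtain a b c where e: "w = a *\<^sub>R x + b *\<^sub>R y + c *\<^sub>R z" unfolding span3_iff by blast
        then have "(- c) *\<^sub>R z + 1 *\<^sub>R w = a *\<^sub>R x + b *\<^sub>R y" by simp
        also have "\<dots> \<in> M" using sM x y by (blast intro: subspace_add subspace_scale)
        finally show False using nz[of "- c" 1] by simp
      qed
      ultimately show ?thesis using exchange[OF fM[OF x y(1)] w(1)] by blast
    qed
    then have "z \<in> M" using maxflat_absorbs[OF M] by blast
    then show False using nz[of 1 0] by simp
  qed
  then show ?thesis using that by blast
qed

lemma rewrite_pair:
  assumes "r \<in> span {z, w}" "r \<noteq> 0"
  obtains w' where "wd z w = wd r (w' :: ('p, 'q) rvec)"
proof -
  obtain a b where ab: "r = a *\<^sub>R z + b *\<^sub>R w" using assms span2_iff by blast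
  show ?thesis
  proof (cases "a = 0")
    case False
    then have "wd r ((1/a) *\<^sub>R w) = wd z w" by (simp add: ab wd_add_left)
    then show ?thesis using that by metis
  next
    case True
    then have "wd r ((- 1/b) *\<^sub>R z) = wd z w" using ab assms(2) by (simp add: wd_swap[of w z])
    then show ?thesis using that by metis
  qed
qed

text \<open>Dimension 3 leaves room for a third vector \<open>y\<close> of \<open>M\<close> outside
  the span of \<open>x\<close> and \<open>z\<close>; \<open>exchange\<close> for the planes of
  \<open>x\<close>, \<open>y\<close> and of \<open>w\<close>, \<open>z\<close> then gives
  \<open>wd x w \<in> B\<close>.\<close>

lemma large_maxflat_absorbs:
  assumes M: "maxflat M" and d: "3 \<le> dim M" and z: "z \<in> M" "z \<noteq> 0" and w: "wd z w \<in> B"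
  shows "w \<in> M"
proof (rule ccontr)
  assume n: "w \<notin> M"
  have sM: "subspace M" and fM: "\<And>x y. x \<in> M \<Longrightarrow> y \<in> M \<Longrightarrow> wd x y \<in> B"
    using M by (auto simp: maxflat_def flat_def)
  have c0: "c = 0" if "c *\<^sub>R w \<in> M" for c
  proof (rule ccontr)
    assume "c \<noteq> 0"
    then have "w = (1/c) *\<^sub>R (c *\<^sub>R w)" by simp
    also have "\<dots> \<in> M" using that sM by (blast intro: subspace_scale)
    finally show False using n by blast
  qed
  have "wd x w \<in> B" if x: "x \<in> M" for x
  proof (cases "x \<in> span {z}")
    case True
    then show ?thesis using w sub by (auto simp: span_singleton subspace_scale)
  next
    case False
    have "card {x, z} \<le> 2" by (simp add: card_insert_if)
    then obtain y where y: "y \<in> M" "y \<notin> span {x, z}"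
      using exists_outside[OF sM, of "{x, z}"] d by auto
    have "y \<notin> span {x, w, z}"
    proof
      assume "y \<in> span {x, w, z}"
      then obtain a b c where e: "y = a *\<^sub>R x + b *\<^sub>R w + c *\<^sub>R z" unfolding span3_iff by blast
      then have "b *\<^sub>R w = y - a *\<^sub>R x - c *\<^sub>R z" by simp
      also have "\<dots> \<in> M" using sM x y z by (blast intro: subspace_diff subspace_scale)
      finally have "b = 0" by (rule c0)
      then show False using e y(2) by (auto simp: span2_iff)
    qed
    moreover have "z \<notin> span {x, y, w}"
    proof
      assume "z \<in> span {x, y, w}"
      then obtain a b c where e: "z = a *\<^sub>R x + b *\<^sub>R y + c *\<^sub>R w" unfolding span3_iff by blast
      then have "c *\<^sub>R w = z - a *\<^sub>R x - b *\<^sub>R y" by simp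
      also have "\<dots> \<in> M" using sM x y z by (blast intro: subspace_diff subspace_scale)
      finally have c: "c = 0" by (rule c0)
      show False
      proof (cases "b = 0")
        case True
        then have zx: "z = a *\<^sub>R x" using e c by simp
        then have "a \<noteq> 0" using z by auto
        then have "x = (1/a) *\<^sub>R z" using zx by simp
        then show False using False by (auto simp: span_singleton)
      next
        case False
        then have "y = (- a / b) *\<^sub>R x + (1 / b) *\<^sub>R z" using e c by (simp add: scaleR_add_right)
        then show False using y(2) span2_iff by blast
      qed
    qed
    moreover have "wd w z \<in> B" using w sub by (metis subspace_neg wd_swap)
    ultimately show ?thesis using exchange[OF fM[OF x y(1)]] by blast
  qed
  then have "w \<in> M" using maxflat_absorbs[OF M] by blast
  then show False using n by blast
qed

lemma W2_subset: "flat M \<Longrightarrow> W2 M \<subseteq> B"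
  unfolding W2_def flat_def using sub by (intro span_minimal) auto

lemma subset_by_decomposables:
  assumes "subspace C" "\<And>x y. wd x y \<in> B \<Longrightarrow> wd x y \<noteq> 0 \<Longrightarrow> wd x y \<in> C"
  shows "B \<subseteq> C"
proof
  fix b assume "b \<in> B"
  then have "b \<in> span {wd x y | x y. wd x y \<in> B}" by (rule span_decomposables)
  moreover have "span {wd x y | x y. wd x y \<in> B} \<subseteq> C"
    using assms subspace_0[OF assms(1)] by (intro span_minimal) (auto, metis)
  ultimately show "b \<in> C" by blast
qed

lemma flat_in_U: assumes "flat M" "2 \<le> dim M" shows "M \<subseteq> U"
proof
  fix x assume x: "x \<in> M"
  show "x \<in> U"
  proof (cases "x = 0")
    case True
    then show ?thesis by (simp add: U_def span_zero)
  next
    case False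
    obtain y where y: "y \<in> M" "y \<notin> span {x}"
      using exists_outside[of M "{x}"] assms by (auto simp: flat_def)
    obtain s where "fm x s = 1" using exists_dual_vector[OF False] .
    then have "wd x y \<noteq> 0" using y(2) wd_eq_0_imp span_base span_scale
      by (metis insertI1)
    then show ?thesis using wd_in_U x y assms by (auto simp: flat_def)
  qed
qed

lemma exists_maxflat: assumes "B \<noteq> {0}" shows "\<exists>M. maxflat M"
proof -
  have "\<exists>x y. wd x y \<in> B \<and> wd x y \<noteq> 0"
  proof (rule ccontr)
    assume "\<not> ?thesis"
    then have "B \<subseteq> {0}" by (intro subset_by_decomposables) (auto simp: subspace_def)
    then show False using assms subspace_0[OF sub] by blast
  qed
  then obtain x y where xy: "wd x y \<in> B" "wd x y \<noteq> 0" by blast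
  have f: "flat (span {x, y})" using flat_pair xy by blast
  have y: "y \<notin> span {x}" using xy by (auto simp: span_singleton)
  have d: "2 \<le> dim (span {x, y})"
  proof -
    have "x \<noteq> 0" using xy by auto
    then have "dim {x} = 1" by (simp add: dim_insert)
    then have "dim {y, x} = 2" using y by (simp add: dim_insert)
    then show ?thesis by (simp add: insert_commute)
  qed
  define m where "m = Max (dim ` Collect flat)"
  have fin: "finite (dim ` Collect flat)"
    by (rule finite_subset[of _ "{..DIM(('p, 'q) rvec)}"]) (rule image_subsetI, simp only: atMost_iff dim_subset_UNIV, rule finite_atMost)
  have "m \<in> dim ` Collect flat" unfolding m_def using fin f by (intro Max_in) auto
  then obtain M where M: "flat M" "dim M = m" by auto
  have le: "dim M' \<le> m" if "flat M'" for M' unfolding m_def using fin that by auto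
  have "maxflat M" unfolding maxflat_def using M le d le[OF f] by auto
  then show ?thesis by blast
qed

lemma classification:
  assumes nz: "B \<noteq> {0}"
  shows "(\<exists>M. totally_isotropic M \<and> 2 \<le> dim M \<and> B = W2 M) \<or>
         (\<exists>z N. totally_isotropic N \<and> z \<in> N \<and> z \<noteq> 0 \<and> 3 \<le> dim N \<and> B = W1 z N)"
proof -
  obtain M where M: "maxflat M" using exists_maxflat nz by blast
  have fl: "flat M" and sM: "subspace M" and fM: "\<And>x y. x \<in> M \<Longrightarrow> y \<in> M \<Longrightarrow> wd x y \<in> B" and d: "2 \<le> dim M"
    using M by (auto simp: maxflat_def flat_def)
  have tM: "totally_isotropic M" using totally_isotropic_U flat_in_U[OF fl d] sM by (auto simp: totally_isotropic_def)
  show ?thesis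
  proof (cases "\<forall>x y. wd x y \<in> B \<longrightarrow> wd x y \<noteq> 0 \<longrightarrow> wd x y \<in> W2 M")
    case True
    then have "B \<subseteq> W2 M" by (intro subset_by_decomposables) (auto simp: W2_def)
    then show ?thesis using W2_subset[OF fl] tM d by blast
  next
    case False
    then obtain x y where xy: "wd x y \<in> B" "wd x y \<noteq> 0" "wd x y \<notin> W2 M" by blast
    obtain z where z: "z \<in> M" "z \<in> span {x, y}" "z \<noteq> 0" using maxflat_meets[OF M xy(1,2)] .
    obtain w where w: "wd x y = wd z w" using rewrite_pair[OF z(2,3)] .
    have wM: "w \<notin> M" using wd_in_W2[OF z(1)] xy w by auto
    have "\<not> 3 \<le> dim M" using large_maxflat_absorbs[OF M _ z(1,3)] xy w wM by metis
    then have d2: "dim M = 2" using d by simp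
    \<comment> \<open>By this choice \<open>W1 z N\<close> is contained in the ideal, so only the
      opposite inclusion has to be shown.\<close>
    define N where "N = {v. wd z v \<in> B}"
    have sN: "subspace N" unfolding N_def
      using sub by (auto simp: subspace_def wd_add_right)
    have MN: "M \<subseteq> N" using fM z by (auto simp: N_def)
    have wN: "w \<in> N" using xy w by (simp add: N_def)
    have "dim (insert w M) \<le> dim N" using MN wN by (intro dim_subset) auto
    moreover have "w \<notin> span M" using wM sM by (metis span_eq_iff)
    ultimately have dN: "3 \<le> dim N" using d2 by (simp add: dim_insert)
    have wz: "w \<notin> span {z}" using xy w by (auto simp: span_singleton)
    have f2: "flat (span {z, w})" using flat_pair xy w by metis
    have d2': "dim (span {z, w}) = 2"
    proof -
      have "dim {z} = 1" using z by (simp add: dim_insert)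
      then have "dim {w, z} = 2" using wz by (simp add: dim_insert)
      then show ?thesis by (simp add: insert_commute)
    qed
    \<comment> \<open>Now both planes \<open>M\<close> and \<open>span {z, w}\<close> are largest
      flats, so every plane of the ideal meets both of them.\<close>
    have M2: "maxflat (span {z, w})" using M f2 d2 d2' by (auto simp: maxflat_def)
    obtain z' where z': "z' \<in> M" "z' \<notin> span {z}" using exists_outside[OF sM, of "{z}"] d by auto
    have Mspan: "M = span {z, z'}"
    proof -
      have "dim {z} = 1" using z by (simp add: dim_insert)
      then have "dim {z', z} = 2" using z' by (simp add: dim_insert)
      then have "dim (span {z, z'}) = 2" by (simp add: insert_commute)
      moreover have "span {z, z'} \<subseteq> M" using z z' sM by (intro span_minimal) auto
      ultimately show ?thesis using d2 sM by (metis subspace_dim_equal subspace_span order_refl)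
    qed
    have "B \<subseteq> W1 z N"
    proof (rule subset_by_decomposables[OF subspace_W1[OF sN]])
      fix r s assume rs: "wd r s \<in> B" "wd r s \<noteq> 0"
      have through_z: "wd r s \<in> W1 z N" if zrs: "z \<in> span {r, s}"
      proof -
        obtain s' where "wd r s = wd z s'" using rewrite_pair[OF zrs z(3)] .
        then show ?thesis using rs by (auto simp: W1_def N_def)
      qed
      obtain r1 where r1: "r1 \<in> M" "r1 \<in> span {r, s}" "r1 \<noteq> 0" using maxflat_meets[OF M rs] .
      obtain r2 where r2: "r2 \<in> span {z, w}" "r2 \<in> span {r, s}" "r2 \<noteq> 0" using maxflat_meets[OF M2 rs] .
      obtain a b where ab: "r1 = a *\<^sub>R z + b *\<^sub>R z'" using r1 Mspan span2_iff by blast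
      obtain c e where ce: "r2 = c *\<^sub>R z + e *\<^sub>R w" using r2 span2_iff by blast
      have fromz: "z \<in> span {r, s}" if "k *\<^sub>R z \<in> span {r, s}" "k *\<^sub>R z \<noteq> 0" for k
      proof -
        have "z = (1/k) *\<^sub>R (k *\<^sub>R z)" using that by simp
        then show ?thesis using that span_scale by metis
      qed
      show "wd r s \<in> W1 z N"
      proof (cases "b = 0 \<or> e = 0")
        case True
        then have "z \<in> span {r, s}" using ab ce r1 r2 fromz by auto
        then show ?thesis by (rule through_z)
      next
        case False
        \<comment> \<open>A plane that meets the two flats off their common line contains
          \<open>wd r1 r2\<close>, which supplies \<open>wd z' w\<close>; then \<open>w\<close>
          pairs into the ideal with all of \<open>M\<close> and would be absorbed.\<close>
        have "wd r1 r2 \<in> B" using flat_pair[OF rs(1)] r1 r2 by (auto simp: flat_def)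
        moreover have "wd r1 r2 = (a * e) *\<^sub>R wd z w - (b * c) *\<^sub>R wd z z' + (b * e) *\<^sub>R wd z' w"
          by (simp add: ab ce wd_add_left wd_add_right algebra_simps wd_swap[of z' z])
        ultimately have "(b * e) *\<^sub>R wd z' w + ((a * e) *\<^sub>R wd z w - (b * c) *\<^sub>R wd z z') \<in> B"
          by (simp add: algebra_simps)
        moreover have "(a * e) *\<^sub>R wd z w - (b * c) *\<^sub>R wd z z' \<in> B"
          using xy w fM z z' sub by (metis subspace_diff subspace_scale)
        ultimately have "(b * e) *\<^sub>R wd z' w \<in> B" using sub by (metis add_diff_cancel_right' subspace_diff)
        then have "(1 / (b * e)) *\<^sub>R (b * e) *\<^sub>R wd z' w \<in> B" using sub by (blast intro: subspace_scale)
        then have z'w: "wd z' w \<in> B" using False by simp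
        have "wd v w \<in> B" if vM: "v \<in> M" for v
        proof -
          obtain k k' where "v = k *\<^sub>R z + k' *\<^sub>R z'" using vM unfolding Mspan span2_iff by blast
          then have "wd v w = k *\<^sub>R wd z w + k' *\<^sub>R wd z' w" by (simp add: wd_add_left)
          then show ?thesis using z'w xy w sub by (metis subspace_add subspace_scale)
        qed
        then have "w \<in> M" using maxflat_absorbs[OF M] by blast
        then show ?thesis using wM by blast
      qed
    qed
    then have BN: "B = W1 z N" by (auto simp: W1_def N_def)
    have "N \<subseteq> U"
    proof
      fix v assume v: "v \<in> N"
      have zU: "z \<in> U" using flat_in_U[OF fl d] z by blast
      show "v \<in> U"
      proof (cases "wd z v = 0")
        case False
        then show ?thesis using v wd_in_U by (auto simp: N_def)
      next
        case True
        obtain s where "fm z s = 1" using exists_dual_vector[OF z(3)] .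
        then have "v = fm v s *\<^sub>R z" using wd_eq_0_imp[OF True] by blast
        moreover have "fm v s *\<^sub>R z \<in> U" using zU unfolding U_def by (rule span_scale)
        ultimately show ?thesis by metis
      qed
    qed
    then have "totally_isotropic N" using totally_isotropic_U sN by (auto simp: totally_isotropic_def)
    then show ?thesis using BN dN z MN by blast
  qed
qed

end

theorem abelian_inner_ideal_classification:
  fixes B :: "('p::finite, 'q::finite) rmat set"
  assumes odd: "odd (CARD('p) + CARD('q))" and B: "B \<in> nonzero_abelian_inner_ideals so_pq"
  shows "(\<exists>u. u \<noteq> 0 \<and> fm u u = 0 \<and> B = W1 u (perp u)) \<or>
         (\<exists>M. totally_isotropic M \<and> 2 \<le> dim M \<and> B = W2 M) \<or>
         (\<exists>z N. totally_isotropic N \<and> z \<in> N \<and> z \<noteq> 0 \<and> 3 \<le> dim N \<and> B = W1 z N)"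
proof -
  have inner: "inner_ideal so_pq B" and ab: "abelian B" and nz: "B \<noteq> {0}"
    using B by (auto simp: nonzero_abelian_inner_ideals_def)
  have skew: "skw b" if "b \<in> B" for b using inner that by (auto simp: inner_ideal_def so_pq_skw)
  have ad: "lie_br b (lie_br b (lie_br b x)) = 0" if "b \<in> B" "skw x" for b x
    using inner ab that by (simp add: inner_ideal_def so_pq_skw abelian_def)
  show ?thesis
  proof (cases "\<forall>b\<in>B. \<forall>z. b *v (b *v z) = 0")
    case False
    then obtain b z where b: "b \<in> B" "b *v (b *v z) \<noteq> 0" by blast
    obtain u w where "u \<noteq> 0" "fm u u = 0" "fm u w = 0" "fm w w \<noteq> 0" "b = wd u w"
      using square_nonzero_imp_wd[OF skew[OF b(1)] ad_cube_zero_imp_cube_zero[OF skew[OF b(1)] odd ad[OF b(1)]]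
          ad[OF b(1)] b(2)] by blast
    then show ?thesis using abelian_inner_ideal_with_rank_2_square[OF inner ab] b by blast
  next
    case True
    \<comment> \<open>Since the squares of \<open>b\<close>, \<open>b'\<close> and
      \<open>b + b'\<close> vanish, the two products are opposite; commutativity makes them
      equal.\<close>
    have prod: "b *v (b' *v z) = 0" if b: "b \<in> B" "b' \<in> B" for b b' z
    proof -
      have "b + b' \<in> B" using inner b by (auto simp: inner_ideal_def subspace_add)
      then have "(b + b') *v ((b + b') *v z) = 0" using True by blast
      then have 1: "b *v (b' *v z) + b' *v (b *v z) = 0"
        using True b by (simp add: algebra_simps)
      have "lie_br b b' = 0" using ab b by (simp add: abelian_def)
      then have "b *v (b' *v z) = b' *v (b *v z)" using lie_br_apply[of b b' z] by simp
      then show ?thesis using 1 by (simp add: vec_eq_iff)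
    qed
    interpret square_zero_ideal B by (rule square_zero_ideal.intro[OF inner]) (rule prod)
    show ?thesis using classification[OF nz] by blast
  qed
qed

section \<open>The three types are abelian inner ideals\<close>

lemma subspace_so_pq: "subspace (so_pq :: ('p::finite, 'q::finite) rmat set)"
  unfolding so_pq_skw by (auto simp: subspace_def skw_add skw_scaleR)

lemma double_bracket_wd:
  fixes b :: "('p::finite, 'q::finite) rmat"
  assumes "skw b" "skw x"
  shows "lie_br b (lie_br (wd u v) x) =
    - (wd (b *v (x *v u)) v + wd (x *v u) (b *v v) + wd (b *v u) (x *v v) + wd u (b *v (x *v v)))"
proof -
  have "lie_br (wd u v) x = - (wd (x *v u) v + wd u (x *v v))"
    using lie_br_swap[of "wd u v" x] lie_br_wd[OF assms(2)] by simp
  then show ?thesis by (simp add: lie_br_add_right lie_br_diff_right lie_br_wd[OF assms(1)])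
qed

text \<open>The double bracket is \<open>- wd u z\<close>, and the only term of \<open>z\<close>
  that could leave \<open>N\<close> is \<open>fm w v *\<^sub>R (x *v u)\<close>. It vanishes for
  isotropic \<open>N\<close>, and it stays inside when \<open>N\<close> is all of
  \<open>perp u\<close>, since \<open>x *v u\<close> is orthogonal to \<open>u\<close>.\<close>

lemma W1_inner_ideal:
  fixes N :: "('p::finite, 'q::finite) rvec set"
  assumes N: "subspace N" "u \<in> N" "N \<subseteq> perp u"
    and c: "(\<forall>v\<in>N. \<forall>w\<in>N. fm v w = 0) \<or> N = perp u"
  shows "inner_ideal so_pq (W1 u N)" "abelian (W1 u N)"
proof -
  have u0: "fm u v = 0" "fm v u = 0" if "v \<in> N" for v
    using that N(3) by (auto simp: perp_def fm_sym[of _ u])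
  have uu: "fm u u = 0" using u0 N(2) by blast
  show "abelian (W1 u N)"
    unfolding abelian_def W1_def
    by (auto simp: lie_br_wd wd_applyR u0 uu)
  have "lie_br (wd u w) (lie_br (wd u v) x) \<in> W1 u N" if v: "v \<in> N" and w: "w \<in> N" and x: "skw x" for v w x
  proof -
    define z where "z = fm w (x *v u) *\<^sub>R v - fm w v *\<^sub>R (x *v u) + (fm w (x *v v) *\<^sub>R u - fm u (x *v v) *\<^sub>R w)"
    have ux: "fm u (x *v u) = 0" using fm_skw_self[OF x, of u] fm_sym[of u] by metis
    have "fm w v *\<^sub>R (x *v u) \<in> N"
    proof (cases "N = perp u")
      case True
      then show ?thesis using ux by (simp add: perp_def)
    next
      case False
      then have "fm w v = 0" using c v w by blast
      then show ?thesis using N(1) by (simp add: subspace_0)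
    qed
    then have "z \<in> N" unfolding z_def using N v w
      by (intro subspace_add subspace_diff) (auto intro: subspace_scale)
    moreover have "lie_br (wd u w) (lie_br (wd u v) x) = - wd u z"
      unfolding double_bracket_wd[OF skw_wd x] z_def
      using u0 v w N(2) ux
      by (simp add: wd_applyR wd_add_right wd_diff_right wd_swap[of "x *v u" u] algebra_simps)
    ultimately show ?thesis using N(1) unfolding W1_def by (metis image_eqI subspace_neg wd_minus_right)
  qed
  then show "inner_ideal so_pq (W1 u N)"
    unfolding inner_ideal_def using subspace_W1[OF N(1)] by (auto simp: so_pq_skw W1_def)
qed

lemma W2_acts:
  assumes M: "totally_isotropic M" and b: "b \<in> W2 M"
  shows "skw b" "b *v z \<in> M" "m \<in> M \<Longrightarrow> b *v m = 0"
proof -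
  have sM: "subspace M" and iso: "\<And>u v. u \<in> M \<Longrightarrow> v \<in> M \<Longrightarrow> fm u v = 0"
    using M by (auto simp: totally_isotropic_def)
  show "skw b" using b unfolding W2_def
    by (induction rule: span_induct) (auto simp: subspace_def skw_add skw_scaleR)
  show "b *v z \<in> M" using b unfolding W2_def
  proof (induction rule: span_induct)
    case base
    then show ?case using sM by (auto simp: subspace_def matrix_vector_mult_add_rdistrib)
  next
    case (step x)
    then show ?case using sM by (auto simp: wd_applyR intro!: subspace_diff subspace_scale)
  qed
  show "b *v m = 0" if "m \<in> M" using b unfolding W2_def
    by (induction rule: span_induct) (use that iso in \<open>auto simp: subspace_def matrix_vector_mult_add_rdistrib wd_applyR\<close>)
qed

text \<open>Members of \<open>W2 M\<close> kill \<open>M\<close> and map into \<open>M\<close>, so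
  products of two vanish, and in the double bracket only the terms with one factor moved into
  \<open>M\<close> by \<open>b'\<close> survive.\<close>

lemma W2_inner_ideal:
  assumes M: "totally_isotropic M"
  shows "inner_ideal so_pq (W2 M)" "abelian (W2 M)"
proof -
  have sub: "subspace (W2 M)" by (simp add: W2_def)
  show "abelian (W2 M)"
    unfolding abelian_def
    by (intro ballI matrix_eqI) (simp add: lie_br_apply W2_acts[OF M])
  have "lie_br b' (lie_br b x) \<in> W2 M" if b: "b \<in> W2 M" and b': "b' \<in> W2 M" and x: "skw x" for b b' x
    using b unfolding W2_def[of M]
  proof (induction rule: span_induct)
    case base
    have "subspace {b. lie_br b' (lie_br b x) \<in> W2 M}"
      using sub by (auto simp: subspace_def lie_br_add_left lie_br_add_right)
    then show ?case by (simp add: W2_def)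
  next
    case (step b)
    then obtain u v where uv: "b = wd u v" "u \<in> M" "v \<in> M" by blast
    have "lie_br b' (lie_br b x) = - (wd (b' *v (x *v u)) v + wd u (b' *v (x *v v)))"
      unfolding uv(1) double_bracket_wd[OF W2_acts(1)[OF M b'] x] using W2_acts(3)[OF M b'] uv by simp
    moreover have "\<dots> \<in> W2 M"
      using W2_acts(2)[OF M b'] uv sub by (intro subspace_neg subspace_add wd_in_W2) auto
    ultimately show ?case by (simp add: W2_def)
  qed
  then show "inner_ideal so_pq (W2 M)"
    unfolding inner_ideal_def using sub W2_acts(1)[OF M] by (auto simp: so_pq_skw)
qed

section \<open>Dimensions\<close>

lemma dim_perp:
  fixes u :: "('p::finite, 'q::finite) rvec"
  assumes "u \<noteq> 0" shows "dim (perp u) = CARD('p) + CARD('q) - 1"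
proof -
  have "dim (UNIV :: ('p, 'q) rvec set) \<le> dim {z\<in>UNIV. \<forall>i\<in>{u}. fm i z = 0} + card {u}"
    by (rule dim_kernel_ge) (auto simp: linear_fm)
  then have 1: "CARD('p) + CARD('q) \<le> dim (perp u) + 1" by (simp add: perp_def)
  obtain y where "fm u y = 1" using exists_dual_vector[OF assms] .
  then have "y \<notin> perp u" by (simp add: perp_def)
  then have "perp u \<subset> UNIV" by blast
  then have "dim (perp u) < dim (UNIV :: ('p, 'q) rvec set)"
    by (metis dim_psubset span_eq_iff subspace_perp subspace_UNIV)
  then show ?thesis using 1 by simp
qed

text \<open>\<open>wd u\<close> kills the line of \<open>u\<close>. On the other members of a basis
  containing \<open>u\<close>, dual functionals arise by evaluating at the vector dual to
  \<open>u\<close> and pairing with the remaining dual vectors.\<close>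

lemma dim_W1:
  fixes N :: "('p::finite, 'q::finite) rvec set"
  assumes N: "subspace N" "u \<in> N" "u \<noteq> 0"
  shows "dim (W1 u N) = dim N - 1"
proof -
  obtain B where B: "{u} \<subseteq> B" "B \<subseteq> N" "independent B" "N \<subseteq> span B"
    using maximal_independent_subset_extend[of "{u}" N] N by auto
  have fin: "finite B" using B(3) by (rule independent_bound_general[THEN conjunct1])
  obtain F where F: "\<And>i j. i \<in> B \<Longrightarrow> j \<in> B \<Longrightarrow> fm i (F j) = (if i = j then 1 else 0)"
    using dual_vectors[of "\<lambda>x. x" B] B(3) by (auto simp: image_ident)
  have uB: "u \<in> B" using B by simp
  have spB: "span B = N" using B N(1) by (metis span_minimal subset_antisym)
  have lin: "linear (\<lambda>x :: ('p, 'q) rmat. - fm (x *v a) c)" for a c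
    by (rule linearI) (simp_all add: matrix_vector_mult_add_rdistrib)
  have "dim (span (wd u ` (B - {u}))) = card (B - {u})"
    by (rule dual_family_independent(3)[where \<phi> = "\<lambda>b x. - fm (x *v F u) (F b)"])
      (use fin F uB in \<open>auto simp: lin wd_applyR\<close>)
  moreover have "span (wd u ` (B - {u})) = W1 u N"
  proof
    show "span (wd u ` (B - {u})) \<subseteq> W1 u N"
      using B by (intro span_minimal subspace_W1 N) (auto simp: W1_def)
    have "W1 u N \<subseteq> span (wd u ` B)"
      unfolding W1_def spB[symmetric] using linear_span_image[OF linear_wd] by blast
    also have "\<dots> \<subseteq> span (wd u ` (B - {u}))"
      by (intro span_minimal subspace_span) (auto simp: span_zero intro: span_base, metis DiffI imageI singletonD span_base span_zero wd_self)
    finally show "W1 u N \<subseteq> span (wd u ` (B - {u}))" .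
  qed
  moreover have "dim N = card B" using spB B(3) by (metis dim_eq_card_independent dim_span)
  ultimately show ?thesis using uB fin by simp
qed

text \<open>The prescribed vector comes first, so that a subspace with a distinguished line in it
  can be transported by mapping bases.\<close>

lemma obtain_indexed_basis:
  fixes M :: "'a::euclidean_space set"
  assumes "subspace M" "u \<in> M" "u \<noteq> 0"
  obtains U :: "nat \<Rightarrow> 'a" where "inj_on U {1..dim M}" "independent (U ` {1..dim M})"
    "span (U ` {1..dim M}) = M" "U 1 = u"
proof -
  obtain B where B: "{u} \<subseteq> B" "B \<subseteq> M" "independent B" "M \<subseteq> span B"
    using maximal_independent_subset_extend[of "{u}" M] assms by auto
  have fin: "finite B" using B(3) by (rule independent_bound_general[THEN conjunct1])
  have spB: "span B = M" using B assms(1) by (metis span_minimal subset_antisym)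
  have card: "card B = dim M" using spB B(3) by (metis dim_eq_card_independent dim_span)
  have pos: "1 \<le> dim M" using card B(1) fin by (metis One_nat_def Suc_leI card_gt_0_iff empty_iff insert_subset)
  obtain h where h: "bij_betw h {1..dim M} B"
    using fin card by (metis card_atLeastAtMost diff_Suc_1 finite_atLeastAtMost finite_same_card_bij)
  have "u \<in> h ` {1..dim M}" using h B(1) by (auto simp: bij_betw_def)
  then obtain k where k: "k \<in> {1..dim M}" "h k = u" by auto
  define U where "U = h \<circ> Transposition.transpose 1 k"
  have "bij_betw (Transposition.transpose 1 k) {1..dim M} {1..dim M}"
    by (rule bij_betw_transpose_iff) (use k pos in auto)
  then have U: "bij_betw U {1..dim M} B" unfolding U_def using h by (rule bij_betw_trans)
  then have "U ` {1..dim M} = B" by (simp add: bij_betw_def)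
  moreover have "U 1 = u" using k by (simp add: U_def)
  ultimately show ?thesis using that U B(3) spB by (simp add: bij_betw_def)
qed

lemma double_card_pairs: "2 * card (SIGMA j:{1..k::nat}. {1..<j}) = k * (k - 1)"
proof -
  have "card (SIGMA j:{1..k}. {1..<j}) = (\<Sum>j\<in>{1..k}. j - 1)" by simp
  moreover have "2 * (\<Sum>j\<in>{1..k}. j - 1) = k * (k - 1)"
  proof (induction k)
    case (Suc k)
    then have "2 * (\<Sum>j\<in>{1..Suc k}. j - 1) = k * (k - 1) + 2 * k" by simp
    also have "\<dots> = Suc k * (Suc k - 1)" by (cases k) simp_all
    finally show ?case .
  qed simp
  ultimately show ?thesis by simp
qed

text \<open>Products of basis vectors with increasing indices are separated by evaluating at one
  dual vector and pairing with another. Doubling avoids division of natural numbers.\<close>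

lemma dim_W2:
  fixes M :: "('p::finite, 'q::finite) rvec set"
  assumes sM: "subspace M"
  shows "2 * dim (W2 M) = dim M * (dim M - 1)"
proof (cases "M = {0}")
  case True
  then show ?thesis by (simp add: W2_def)
next
  case False
  then obtain u where "u \<in> M" "u \<noteq> 0" using subspace_0[OF sM] by auto
  then obtain U :: "nat \<Rightarrow> ('p, 'q) rvec" where inj: "inj_on U {1..dim M}" and ind: "independent (U ` {1..dim M})"
    and sp: "span (U ` {1..dim M}) = M" using obtain_indexed_basis[OF sM] by metis
  obtain F where F: "\<And>i j. i \<in> {1..dim M} \<Longrightarrow> j \<in> {1..dim M} \<Longrightarrow> fm (U i) (F j) = (if i = j then 1 else 0)"
    using dual_vectors[OF inj ind] by blast
  let ?I = "SIGMA j:{1..dim M}. {1..<j}"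
  let ?x = "\<lambda>(j, i). wd (U i) (U j)"
  have lin: "linear (\<lambda>x :: ('p, 'q) rmat. fm (x *v a) c)" for a c
    by (rule linearI) (simp_all add: matrix_vector_mult_add_rdistrib)
  have "dim (span (?x ` ?I)) = card ?I"
  proof (rule dual_family_independent(3)[where \<phi> = "\<lambda>(b, a) x. fm (x *v F b) (F a)"])
    fix s t assume s: "s \<in> ?I" and t: "t \<in> ?I"
    obtain b a where ba: "s = (b, a)" "a < b" "a \<in> {1..dim M}" "b \<in> {1..dim M}" using s by auto
    obtain j i where ji: "t = (j, i)" "i < j" "i \<in> {1..dim M}" "j \<in> {1..dim M}" using t by auto
    have "fm (wd (U i) (U j) *v F b) (F a) =
      (if j = b then 1 else 0) * (if i = a then 1 else 0) - (if i = b then 1 else 0) * (if j = a then 1 else 0)"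
      using F[OF ji(4) ba(4)] F[OF ji(3) ba(4)] F[OF ji(3) ba(3)] F[OF ji(4) ba(3)] by (simp add: wd_applyR)
    then show "(case s of (b, a) \<Rightarrow> \<lambda>x. fm (x *v F b) (F a)) (?x t) = (if s = t then 1 else 0)"
      using ba ji by auto
  qed (auto simp: lin)
  moreover have "span (?x ` ?I) = W2 M"
  proof
    have UM: "U i \<in> M" if "i \<in> {1..dim M}" for i using sp that by (metis imageI span_base)
    show "span (?x ` ?I) \<subseteq> W2 M"
    proof (rule span_minimal)
      show "?x ` ?I \<subseteq> W2 M" by (auto intro!: wd_in_W2 UM)
    qed (simp add: W2_def)
    define S where "S = span (?x ` ?I)"
    have sS: "subspace S" by (simp add: S_def)
    have base: "wd (U i) (U j) \<in> S" if ij: "i \<in> {1..dim M}" "j \<in> {1..dim M}" for i j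
    proof -
      consider "i < j" | "i = j" | "j < i" by linarith
      then show ?thesis
      proof cases
        case 1
        then show ?thesis using ij unfolding S_def by (intro span_base image_eqI[of _ _ "(j, i)"]) auto
      next
        case 2
        then show ?thesis using sS by (simp add: subspace_0)
      next
        case 3
        then have "wd (U j) (U i) \<in> S" using ij unfolding S_def by (intro span_base image_eqI[of _ _ "(i, j)"]) auto
        then show ?thesis using sS subspace_neg wd_swap by metis
      qed
    qed
    have s1: "wd (U i) v \<in> S" if i: "i \<in> {1..dim M}" and v: "v \<in> M" for i v
    proof -
      have "v \<in> span (U ` {1..dim M})" using v sp by simp
      then show ?thesis
    proof (induction rule: span_induct)
      case base
      show ?case using sS by (auto simp: subspace_def wd_add_right)
    next
      case (step x)
      then show ?case using base i by auto
    qed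
    qed
    have s2: "wd u v \<in> S" if u: "u \<in> M" and v: "v \<in> M" for u v
    proof -
      have "u \<in> span (U ` {1..dim M})" using u sp by simp
      then show ?thesis
    proof (induction rule: span_induct)
      case base
      show ?case using sS by (auto simp: subspace_def wd_add_left)
    next
      case (step x)
      then show ?case using s1[OF _ v] by auto
    qed
    qed
    have "W2 M \<subseteq> S" unfolding W2_def using sS by (intro span_minimal) (auto intro: s2)
    then show "W2 M \<subseteq> span (?x ` ?I)" by (simp add: S_def)
  qed
  ultimately show ?thesis using double_card_pairs[of "dim M"] dim_span by metis
qed

section \<open>Semidefinite and isotropic subspaces\<close>

lemma fm_split:
  fixes u v :: "'a::comm_ring_1^('p::finite + 'q::finite)"
  shows "fm u v = (\<Sum>i\<in>UNIV. u $ Inl i * v $ Inl i) - (\<Sum>j\<in>UNIV. u $ Inr j * (v $ Inr j))"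
proof -
  have "fm u v = (\<Sum>i\<in>UNIV <+> UNIV. sg i * u $ i * v $ i)" by (simp add: fm_def)
  also have "\<dots> = (\<Sum>i\<in>UNIV. sg (Inl i :: 'p + 'q) * u $ Inl i * v $ Inl i) + (\<Sum>j\<in>UNIV. sg (Inr j :: 'p + 'q) * u $ Inr j * v $ Inr j)"
    by (subst sum.Plus) auto
  finally show ?thesis by (simp add: sg_def sum_negf)
qed

lemma fm_definite_part:
  fixes z :: "('p::finite, 'q::finite) rvec"
  assumes "z \<noteq> 0"
  shows "(\<And>i. z $ Inl i = 0) \<Longrightarrow> fm z z < 0" "(\<And>j. z $ Inr j = 0) \<Longrightarrow> 0 < fm z z"
proof -
  obtain k where k: "z $ k \<noteq> 0" using assms by (auto simp: vec_eq_iff)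
  show "fm z z < 0" if z0: "\<And>i. z $ Inl i = 0"
  proof -
    obtain j where "k = Inr j" using k z0 by (cases k) auto
    then have "0 < (\<Sum>j\<in>UNIV. z $ Inr j * z $ Inr j)" using k by (intro sum_pos2[of _ j]) (auto simp: zero_less_mult_iff)
    then show ?thesis using z0 by (simp add: fm_split)
  qed
  show "0 < fm z z" if z0: "\<And>j. z $ Inr j = 0"
  proof -
    obtain j where "k = Inl j" using k z0 by (cases k) auto
    then have "0 < (\<Sum>j\<in>UNIV. z $ Inl j * z $ Inl j)" using k by (intro sum_pos2[of _ j]) (auto simp: zero_less_mult_iff)
    then show ?thesis using z0 by (simp add: fm_split)
  qed
qed

text \<open>A larger subspace would contain a non-zero vector whose positive coordinates all vanish,
  and on it the form is negative.\<close>

lemma dim_nonneg_le: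
  fixes S :: "('p::finite, 'q::finite) rvec set"
  assumes S: "subspace S" and nonneg: "\<And>z. z \<in> S \<Longrightarrow> 0 \<le> fm z z"
  shows "dim S \<le> CARD('p)"
proof (rule ccontr)
  assume "\<not> ?thesis"
  then obtain z where "z \<in> S" "z \<noteq> 0" "\<And>i :: 'p. z $ Inl i = 0"
    using exists_in_kernel[OF S, of "UNIV :: 'p set" "\<lambda>i z. z $ Inl i"]
    by (auto simp: bounded_linear.linear bounded_linear_vec_nth)
  then show False using fm_definite_part(1)[of z] nonneg[of z] by auto
qed

lemma dim_nonpos_le:
  fixes S :: "('p::finite, 'q::finite) rvec set"
  assumes S: "subspace S" and nonpos: "\<And>z. z \<in> S \<Longrightarrow> fm z z \<le> 0"
  shows "dim S \<le> CARD('q)"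
proof (rule ccontr)
  assume "\<not> ?thesis"
  then obtain z where "z \<in> S" "z \<noteq> 0" "\<And>i :: 'q. z $ Inr i = 0"
    using exists_in_kernel[OF S, of "UNIV :: 'q set" "\<lambda>i z. z $ Inr i"]
    by (auto simp: bounded_linear.linear bounded_linear_vec_nth)
  then show False using fm_definite_part(2)[of z] nonpos[of z] by auto
qed

lemma dim_totally_isotropic_le: "totally_isotropic (U :: ('p::finite, 'q::finite) rvec set) \<Longrightarrow> dim U \<le> CARD('p)"
  by (rule dim_nonneg_le) (auto simp: totally_isotropic_def)

lemma W1_perp_mem:
  fixes u :: "('p::finite, 'q::finite) rvec"
  assumes u: "u \<noteq> 0" "fm u u = 0" and n: "3 \<le> CARD('p) + CARD('q)"
  shows "W1 u (perp u) \<in> nonzero_abelian_inner_ideals so_pq"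
    "dim (W1 u (perp u)) = CARD('p) + CARD('q) - 2"
proof -
  have uu: "u \<in> perp u" using u by (simp add: perp_def)
  show d: "dim (W1 u (perp u)) = CARD('p) + CARD('q) - 2"
    using dim_W1[OF subspace_perp uu u(1)] dim_perp[OF u(1)] by simp
  then have "dim (W1 u (perp u)) \<noteq> 0" using n by simp
  then have "W1 u (perp u) \<noteq> {0}" by auto
  then show "W1 u (perp u) \<in> nonzero_abelian_inner_ideals so_pq"
    using W1_inner_ideal[OF subspace_perp uu subset_refl] by (simp add: nonzero_abelian_inner_ideals_def)
qed

lemma W1_totally_isotropic_mem:
  fixes N :: "('p::finite, 'q::finite) rvec set"
  assumes N: "totally_isotropic N" "u \<in> N" "u \<noteq> 0" "2 \<le> dim N"
  shows "W1 u N \<in> nonzero_abelian_inner_ideals so_pq" "dim (W1 u N) = dim N - 1"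
proof -
  have sN: "subspace N" and iso: "\<forall>v\<in>N. \<forall>w\<in>N. fm v w = 0" using N by (auto simp: totally_isotropic_def)
  have "N \<subseteq> perp u" using iso N(2) by (auto simp: perp_def)
  note i = W1_inner_ideal[OF sN N(2) this disjI1[OF iso]]
  show d: "dim (W1 u N) = dim N - 1" using dim_W1[OF sN N(2,3)] .
  then have "dim (W1 u N) \<noteq> 0" using N by simp
  then have "W1 u N \<noteq> {0}" by auto
  then show "W1 u N \<in> nonzero_abelian_inner_ideals so_pq"
    using i by (simp add: nonzero_abelian_inner_ideals_def)
qed

lemma W2_totally_isotropic_mem:
  assumes M: "totally_isotropic M" "2 \<le> dim M"
  shows "W2 M \<in> nonzero_abelian_inner_ideals so_pq"
proof -
  have "2 * dim (W2 M) = dim M * (dim M - 1)" using M by (intro dim_W2) (simp add: totally_isotropic_def)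
  moreover have "2 * 1 \<le> dim M * (dim M - 1)" using M by (intro mult_le_mono) auto
  ultimately have "dim (W2 M) \<noteq> 0" by linarith
  then have "W2 M \<noteq> {0}" by (metis dim_eq_0 order_refl)
  then show ?thesis using W2_inner_ideal[OF M(1)] by (simp add: nonzero_abelian_inner_ideals_def)
qed

section \<open>Conjugacy\<close>

text \<open>An automorphism is linear on the Lie algebra only and arbitrary elsewhere; a linear map
  of the whole matrix space that agrees with it makes facts about linear maps applicable.\<close>

lemma linear_on_extends:
  fixes f :: "'a::euclidean_space \<Rightarrow> 'b::euclidean_space"
  assumes g: "subspace g" and add: "\<And>x y. x \<in> g \<Longrightarrow> y \<in> g \<Longrightarrow> f (x + y) = f x + f y"
    and sc: "\<And>c x. x \<in> g \<Longrightarrow> f (c *\<^sub>R x) = c *\<^sub>R f x"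
  obtains f' where "linear f'" "\<And>x. x \<in> g \<Longrightarrow> f' x = f x"
proof -
  obtain B where B: "B \<subseteq> g" "independent B" "g \<subseteq> span B" using maximal_independent_subset[of g] by auto
  obtain f' where f': "linear f'" "\<forall>x\<in>B. f' x = f x" using linear_independent_extend[OF B(2)] by blast
  have sp: "span B = g" using B g by (metis span_minimal subset_antisym)
  have "x \<in> g \<and> f' x = f x" if "x \<in> span B" for x
    using that
  proof (induction rule: span_induct_alt)
    case base
    then show ?case using sc[of 0 0] g linear_0[OF f'(1)] by (simp add: subspace_0)
  next
    case (step c x y)
    then have "x \<in> g" "c *\<^sub>R x \<in> g" using B(1) g by (auto intro: subspace_scale)
    then show ?case using step f' g add[of "c *\<^sub>R x" y] sc[of x c]
      by (simp add: linear_add linear_scale subspace_add)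
  qed
  then show ?thesis using that f'(1) sp by blast
qed

lemma lie_automorphism_id: "lie_automorphism g (\<lambda>x. x)"
  by (auto simp: lie_automorphism_def bij_betw_def)

lemma lie_automorphism_inv:
  fixes g :: "(real^'n^'n) set"
  assumes f: "lie_automorphism g f" and g: "subspace g" and br: "\<And>x y. x \<in> g \<Longrightarrow> y \<in> g \<Longrightarrow> lie_br x y \<in> g"
  shows "lie_automorphism g (inv_into g f)"
proof -
  let ?h = "inv_into g f"
  have b: "bij_betw f g g" using f by (simp add: lie_automorphism_def)
  have h: "?h x \<in> g" "f (?h x) = x" if "x \<in> g" for x
    using b that by (auto simp: bij_betw_def inv_into_into f_inv_into_f)
  have l: "?h (f x) = x" if "x \<in> g" for x using b that by (simp add: bij_betw_def)
  have "?h (x + y) = ?h x + ?h y" if "x \<in> g" "y \<in> g" for x y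
  proof -
    have "f (?h x + ?h y) = x + y" using f h that by (simp add: lie_automorphism_def)
    then show ?thesis using l[of "?h x + ?h y"] h that g by (simp add: subspace_add)
  qed
  moreover have "?h (c *\<^sub>R x) = c *\<^sub>R ?h x" if "x \<in> g" for x c
  proof -
    have "f (c *\<^sub>R ?h x) = c *\<^sub>R x" using f h that by (simp add: lie_automorphism_def)
    then show ?thesis using l[of "c *\<^sub>R ?h x"] h that g by (simp add: subspace_scale)
  qed
  moreover have "?h (lie_br x y) = lie_br (?h x) (?h y)" if "x \<in> g" "y \<in> g" for x y
  proof -
    have "f (lie_br (?h x) (?h y)) = lie_br x y" using f h that by (simp add: lie_automorphism_def)
    then show ?thesis using l[of "lie_br (?h x) (?h y)"] h that br by simp
  qed
  ultimately show ?thesis using bij_betw_inv_into[OF b] by (simp add: lie_automorphism_def)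
qed

lemma conjugate_refl: "conjugate g B B"
  unfolding conjugate_def using lie_automorphism_id by (metis image_ident)

lemma so_pq_lie_br: "x \<in> so_pq \<Longrightarrow> y \<in> so_pq \<Longrightarrow> lie_br x y \<in> so_pq"
  by (simp add: so_pq_skw skw_lie_br)

lemma conjugate_sym:
  assumes "conjugate so_pq A B" "A \<subseteq> so_pq" shows "conjugate so_pq B A"
proof -
  obtain f where f: "lie_automorphism so_pq f" "f ` A = B" using assms by (auto simp: conjugate_def)
  have "inj_on f so_pq" using f(1) by (simp add: lie_automorphism_def bij_betw_def)
  then have "inv_into so_pq f ` B = A" unfolding f(2)[symmetric] using assms(2) by (rule inv_into_image_cancel)
  then show ?thesis using lie_automorphism_inv[OF f(1) subspace_so_pq so_pq_lie_br] by (auto simp: conjugate_def)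
qed

lemma automorphism_image_ideal:
  assumes f: "lie_automorphism so_pq f" and B: "B \<in> nonzero_abelian_inner_ideals (so_pq :: ('p::finite, 'q::finite) rmat set)"
  shows "f ` B \<in> nonzero_abelian_inner_ideals so_pq" "dim (f ` B) = dim B"
proof -
  let ?g = "so_pq :: ('p, 'q) rmat set"
  have sB: "subspace B" and Bg: "B \<subseteq> ?g" and inner: "\<And>b b' x. b \<in> B \<Longrightarrow> b' \<in> B \<Longrightarrow> x \<in> ?g \<Longrightarrow> lie_br b (lie_br b' x) \<in> B"
    and ab: "\<And>b b'. b \<in> B \<Longrightarrow> b' \<in> B \<Longrightarrow> lie_br b b' = 0" and nz: "B \<noteq> {0}"
    using B by (auto simp: nonzero_abelian_inner_ideals_def inner_ideal_def abelian_def)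
  have bij: "bij_betw f ?g ?g" and fbr: "\<And>x y. x \<in> ?g \<Longrightarrow> y \<in> ?g \<Longrightarrow> f (lie_br x y) = lie_br (f x) (f y)"
    using f by (auto simp: lie_automorphism_def)
  obtain f' where f': "linear f'" "\<And>x. x \<in> ?g \<Longrightarrow> f' x = f x"
    using linear_on_extends[OF subspace_so_pq, of f] f by (auto simp: lie_automorphism_def)
  have img: "f ` B = f' ` B" using f'(2) Bg by (intro image_cong) auto
  have inj: "inj_on f B" using bij Bg by (auto simp: bij_betw_def intro: inj_on_subset)
  then have "inj_on f' (span B)" using f'(2) Bg sB by (metis inj_on_cong span_eq_iff subsetD)
  then show dim: "dim (f ` B) = dim B" unfolding img by (rule dim_image_eq[OF f'(1)])
  have fg: "f x \<in> ?g" if "x \<in> ?g" for x using bij that by (auto simp: bij_betw_def)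
  have "inner_ideal ?g (f ` B)" unfolding inner_ideal_def
  proof (intro conjI ballI)
    show "subspace (f ` B)" unfolding img using f'(1) sB by (rule linear_subspace_image)
    show "f ` B \<subseteq> ?g" using fg Bg by blast
    fix b b' x assume "b \<in> f ` B" "b' \<in> f ` B" and x: "x \<in> ?g"
    then obtain c c' where c: "c \<in> B" "c' \<in> B" "b = f c" "b' = f c'" by blast
    obtain y where y: "y \<in> ?g" "x = f y" using x bij by (auto simp: bij_betw_def)
    have cg: "c \<in> ?g" "c' \<in> ?g" using c Bg by auto
    have "f (lie_br c (lie_br c' y)) = lie_br b (lie_br b' x)"
      by (simp only: fbr[OF cg(1) so_pq_lie_br[OF cg(2) y(1)]] fbr[OF cg(2) y(1)] c(3,4) y(2))
    then have "lie_br b (lie_br b' x) = f (lie_br c (lie_br c' y))" by simp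
    then show "lie_br b (lie_br b' x) \<in> f ` B" using inner[OF c(1,2) y(1)] by blast
  qed
  moreover have "abelian (f ` B)" unfolding abelian_def
  proof (intro ballI)
    fix b b' assume "b \<in> f ` B" "b' \<in> f ` B"
    then obtain c c' where c: "c \<in> B" "c' \<in> B" "b = f c" "b' = f c'" by blast
    have cg: "c \<in> ?g" "c' \<in> ?g" using c Bg by auto
    have "lie_br b b' = f 0" using fbr[OF cg] ab[OF c(1,2)] c(3,4) by simp
    then show "lie_br b b' = 0" using f'(2)[of 0] linear_0[OF f'(1)] subspace_0[OF subspace_so_pq] by simp
  qed
  moreover have "f ` B \<noteq> {0}"
  proof
    assume "f ` B = {0}"
    then have "dim B = 0" using dim by simp
    then show False using nz subspace_0[OF sB] by (auto simp: dim_eq_0)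
  qed
  ultimately show "f ` B \<in> nonzero_abelian_inner_ideals so_pq"
    by (simp add: nonzero_abelian_inner_ideals_def)
qed

text \<open>Reduces conjugacy of ideals to transitivity of the isometries on isotropic
  subspaces.\<close>

lemma isometry_automorphism:
  fixes T :: "('p::finite, 'q::finite) rmat"
  assumes T: "T ** T' = mat 1" "T' ** T = mat 1" and iso: "\<And>u v. fm (T *v u) (T *v v) = fm u v"
  shows "lie_automorphism so_pq (\<lambda>x. T ** x ** T')"
    "T ** wd u v ** T' = wd (T *v u) (T *v v)"
    "(\<lambda>x. T ** x ** T') ` W1 u N = W1 (T *v u) ((*v) T ` N)"
    "(\<lambda>x. T ** x ** T') ` W2 M = W2 ((*v) T ` M)"
proof -
  let ?f = "\<lambda>x. T ** x ** T'"
  have TT: "T *v (T' *v z) = z" "T' *v (T *v z) = z" for z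
    using T by (simp_all add: matrix_vector_mul_assoc)
  have iso': "fm (T' *v u) v = fm u (T *v v)" for u v using iso[of "T' *v u" v] TT by simp
  have app: "?f x *v z = T *v (x *v (T' *v z))" for x z by (simp add: matrix_vector_mul_assoc matrix_mul_assoc)
  have sk: "skw (T ** x ** T')" if "skw x" for x
    unfolding skw_def using that iso iso' by (simp add: app skwD TT fm_sym) (metis TT(1) app fm_sym iso iso' skwD that)
  have sk': "skw (T' ** x ** T)" if "skw x" for x
  proof -
    have app': "(T' ** x ** T) *v z = T' *v (x *v (T *v z))" for z by (simp add: matrix_vector_mul_assoc matrix_mul_assoc)
    show ?thesis unfolding skw_def app' using that by (metis fm_sym iso' skwD)
  qed
  have inv: "T ** (T' ** x ** T) ** T' = x" "T' ** (T ** x ** T') ** T = x" for x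
    by (metis T matrix_mul_assoc matrix_mul_lid matrix_mul_rid)+
  have bij: "bij_betw ?f so_pq so_pq"
    by (rule bij_betw_byWitness[where f' = "\<lambda>x. T' ** x ** T"]) (auto simp: inv so_pq_skw sk sk')
  have lin: "linear ?f"
    by (rule linearI; rule matrix_eqI)
      (simp_all add: app matrix_vector_mult_add_rdistrib matrix_vector_right_distrib matrix_vector_mult_scaleR)
  have "?f (lie_br x y) = lie_br (?f x) (?f y)" for x y
    by (rule matrix_eqI) (simp add: app lie_br_apply TT matrix_vector_mult_diff_distrib)
  then show "lie_automorphism so_pq ?f"
    using bij by (simp add: lie_automorphism_def linear_add[OF lin] linear_scale[OF lin])
  have w: "?f (wd u v) = wd (T *v u) (T *v v)" for u v
  proof (rule matrix_eqI)
    fix z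
    have "fm u (T' *v z) = fm (T *v u) z" for u using iso'[of z u] fm_sym[of u] fm_sym[of z] by metis
    then show "?f (wd u v) *v z = wd (T *v u) (T *v v) *v z"
      by (simp add: app wd_applyR matrix_vector_mult_diff_distrib matrix_vector_mult_scaleR)
  qed
  show "T ** wd u v ** T' = wd (T *v u) (T *v v)" by (rule w)
  show "?f ` W1 u N = W1 (T *v u) ((*v) T ` N)" unfolding W1_def by (auto simp: w image_image)
  have "?f ` {wd u v | u v. u \<in> M \<and> v \<in> M} = {wd u v | u v. u \<in> (*v) T ` M \<and> v \<in> (*v) T ` M}"
  proof (intro set_eqI iffI)
    fix x assume "x \<in> ?f ` {wd u v | u v. u \<in> M \<and> v \<in> M}"
    then obtain u v where "x = ?f (wd u v)" "u \<in> M" "v \<in> M" by blast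
    then show "x \<in> {wd u v | u v. u \<in> (*v) T ` M \<and> v \<in> (*v) T ` M}" using w by blast
  next
    fix x assume "x \<in> {wd u v | u v. u \<in> (*v) T ` M \<and> v \<in> (*v) T ` M}"
    then obtain u v where "x = wd (T *v u) (T *v v)" "u \<in> M" "v \<in> M" by blast
    then show "x \<in> ?f ` {wd u v | u v. u \<in> M \<and> v \<in> M}" unfolding w[symmetric] by blast
  qed
  then show "?f ` W2 M = W2 ((*v) T ` M)"
    unfolding W2_def linear_span_image[OF lin, symmetric] by (rule arg_cong)
qed

section \<open>The Killing form\<close>

text \<open>Any spanning family with coefficient functionals computes the trace, even a redundant
  one: expand each vector of the chosen basis over the family and exchange the sums.\<close>

lemma trace_on_frame:
  fixes f :: "'a::euclidean_space \<Rightarrow> 'a"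
  assumes V: "subspace V" and f: "linear f" and fV: "\<And>z. z \<in> V \<Longrightarrow> f z \<in> V"
    and I: "finite I" and x: "\<And>i. i \<in> I \<Longrightarrow> x i \<in> V" and \<phi>: "\<And>i. i \<in> I \<Longrightarrow> linear (\<phi> i)"
    and frame: "\<And>z. z \<in> V \<Longrightarrow> z = (\<Sum>i\<in>I. \<phi> i z *\<^sub>R x i)"
  shows "trace_on V f = (\<Sum>i\<in>I. \<phi> i (f (x i)))"
proof -
  define B where "B = (SOME B. B \<subseteq> V \<and> independent B \<and> span B = V)"
  have "\<exists>B. B \<subseteq> V \<and> independent B \<and> span B = V"
    using maximal_independent_subset[of V] V by (metis span_minimal subset_antisym)
  then have B: "B \<subseteq> V" "independent B" "span B = V"
    unfolding B_def by (rule someI2_ex, blast)+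
  have fin: "finite B" using B(2) by (rule independent_bound_general[THEN conjunct1])
  let ?r = "representation B"
  have rep: "?r (f b) b = (\<Sum>i\<in>I. \<phi> i b * ?r (f (x i)) b)" if b: "b \<in> B" for b
  proof -
    have bV: "b \<in> V" using b B by blast
    have "f b = f (\<Sum>i\<in>I. \<phi> i b *\<^sub>R x i)" using frame[OF bV] by simp
    also have "\<dots> = (\<Sum>i\<in>I. \<phi> i b *\<^sub>R f (x i))" by (simp add: linear_sum[OF f] linear_scale[OF f])
    finally have e: "f b = (\<Sum>i\<in>I. \<phi> i b *\<^sub>R f (x i))" .
    have sp: "f (x i) \<in> span B" if "i \<in> I" for i using fV x that B by auto
    have "?r (f b) = (\<lambda>b'. \<Sum>i\<in>I. ?r (\<phi> i b *\<^sub>R f (x i)) b')"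
      unfolding e by (rule representation_sum[OF B(2)]) (auto intro: span_scale sp)
    then have "?r (f b) b = (\<Sum>i\<in>I. ?r (\<phi> i b *\<^sub>R f (x i)) b)" by simp
    also have "\<dots> = (\<Sum>i\<in>I. \<phi> i b * ?r (f (x i)) b)"
      by (intro sum.cong refl) (simp add: representation_scale[OF B(2) sp])
    finally show ?thesis .
  qed
  have "trace_on V f = (\<Sum>b\<in>B. ?r (f b) b)" unfolding trace_on_def B_def Let_def ..
  also have "\<dots> = (\<Sum>b\<in>B. \<Sum>i\<in>I. \<phi> i b * ?r (f (x i)) b)" using rep by simp
  also have "\<dots> = (\<Sum>i\<in>I. \<Sum>b\<in>B. \<phi> i b * ?r (f (x i)) b)" by (rule sum.swap)
  also have "\<dots> = (\<Sum>i\<in>I. \<phi> i (f (x i)))"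
  proof (rule sum.cong[OF refl])
    fix i assume i: "i \<in> I"
    have "f (x i) \<in> span B" using fV x i B by auto
    then have "(\<Sum>b\<in>B. ?r (f (x i)) b *\<^sub>R b) = f (x i)"
      by (intro sum_representation_eq B fin) auto
    then have "\<phi> i (f (x i)) = \<phi> i (\<Sum>b\<in>B. ?r (f (x i)) b *\<^sub>R b)" by simp
    also have "\<dots> = (\<Sum>b\<in>B. \<phi> i b * ?r (f (x i)) b)"
      by (simp add: linear_sum[OF \<phi>[OF i]] linear_scale[OF \<phi>[OF i]] mult.commute)
    finally show "(\<Sum>b\<in>B. \<phi> i b * ?r (f (x i)) b) = \<phi> i (f (x i))" by simp
  qed
  finally show ?thesis .
qed

lemma sg_mult_sg [simp]: "sg i * (sg i * x) = x"
  by (simp add: mult.assoc[symmetric])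

text \<open>The family runs over all ordered pairs, so each decomposable element occurs twice up to
  sign; hence the factor 1/2.\<close>

lemma skw_frame:
  fixes z :: "('p::finite, 'q::finite) rmat"
  assumes "skw z"
  shows "z = (\<Sum>(i, j)\<in>UNIV. z $ j $ i *\<^sub>R ((sg i / 2) *\<^sub>R wd (axis j 1) (axis i 1)))"
proof -
  have "(\<Sum>(i, j)\<in>UNIV. z $ j $ i *\<^sub>R ((sg i / 2) *\<^sub>R wd (axis j 1) (axis i 1))) $ a $ b = z $ a $ b" for a b
  proof -
    have "(\<Sum>(i, j)\<in>UNIV. z $ j $ i *\<^sub>R ((sg i / 2) *\<^sub>R wd (axis j 1) (axis i 1))) $ a $ b =
      (\<Sum>i\<in>UNIV. \<Sum>j\<in>UNIV. z $ j $ i * (sg i / 2 * (sg b * (axis j 1 $ a * axis i 1 $ b - axis i 1 $ a * axis j 1 $ b))))"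
      unfolding UNIV_Times_UNIV[symmetric] sum.cartesian_product[symmetric] by (simp add: wd_def mult.assoc)
    also have "\<dots> = (\<Sum>i\<in>UNIV. \<Sum>j\<in>UNIV. (if j = a then (if i = b then z $ j $ i * sg i * sg b / 2 else 0) else 0)) -
      (\<Sum>i\<in>UNIV. \<Sum>j\<in>UNIV. (if j = b then (if i = a then z $ j $ i * sg i * sg b / 2 else 0) else 0))"
      unfolding sum_subtractf[symmetric] by (intro sum.cong refl) (auto simp: axis_def)
    also have "\<dots> = z $ a $ b * (sg b * sg b) / 2 - z $ b $ a * sg a * sg b / 2" by (simp add: mult.assoc)
    also have "\<dots> = z $ a $ b / 2 - sg a * (sg b * z $ b $ a) / 2" by (simp add: mult_ac)
    also have "sg b * z $ b $ a = - (sg a * z $ a $ b)" using assms unfolding skw_entries by (metis add.commute eq_neg_iff_add_eq_0)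
    also have "z $ a $ b / 2 - sg a * - (sg a * z $ a $ b) / 2 = z $ a $ b" by (simp add: mult.assoc[symmetric])
    finally show ?thesis .
  qed
  then show ?thesis by (simp add: vec_eq_iff)
qed

lemma sum_wd_entries:
  fixes A C :: "('p::finite, 'q::finite) rmat"
  shows "(\<Sum>(i, j)\<in>UNIV. sg i * wd (A *v axis j 1) (C *v axis i 1) $ j $ i) = trace A * trace C - trace (A ** C)"
proof -
  have "(\<Sum>(i, j)\<in>UNIV. sg i * wd (A *v axis j 1) (C *v axis i 1) $ j $ i) =
    (\<Sum>i\<in>UNIV. \<Sum>j\<in>UNIV. (sg i * sg i) * (A $ j $ j * C $ i $ i - C $ j $ i * A $ i $ j))"
    unfolding UNIV_Times_UNIV[symmetric] sum.cartesian_product[symmetric]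
    by (simp add: wd_def matrix_vector_mult_axis mult.assoc)
  also have "\<dots> = (\<Sum>i\<in>UNIV. \<Sum>j\<in>UNIV. A $ j $ j * C $ i $ i) - (\<Sum>i\<in>UNIV. \<Sum>j\<in>UNIV. A $ i $ j * C $ j $ i)"
    by (simp add: sum_subtractf mult.commute)
  also have "\<dots> = trace A * trace C - trace (A ** C)"
    by (simp add: trace_def matrix_matrix_mult_def sum_product sum.swap[of "\<lambda>i j. A $ j $ j * C $ i $ i"])
  finally show ?thesis .
qed

lemma trace_skw:
  assumes "skw (x :: ('p::finite, 'q::finite) rmat)" shows "trace x = 0"
proof -
  have "x $ i $ i = 0" for i
  proof -
    have "sg i * x $ i $ i + sg i * x $ i $ i = 0" using assms unfolding skw_entries by blast
    then have "sg i * (sg i * x $ i $ i) = 0" by (simp del: sg_mult_sg)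
    then show ?thesis by simp
  qed
  then show ?thesis by (simp add: trace_def)
qed

text \<open>Of the four Leibniz terms, two contribute (n - 1) times \<open>trace (x ** y)\<close>
  each, where n is the size, and two contribute \<open>- trace (x ** y)\<close> each, skew matrices
  being traceless. Half of the sum has the factor n - 2.\<close>

lemma killing_form_so_pq:
  fixes x y :: "('p::finite, 'q::finite) rmat"
  assumes x: "skw x" and y: "skw y"
  shows "killing_form so_pq x y = (real (CARD('p) + CARD('q)) - 2) * trace (x ** y)"
proof -
  let ?f = "\<lambda>z. lie_br x (lie_br y z)"
  let ?e = "\<lambda>i. axis i 1 :: ('p, 'q) rvec"
  let ?S = "\<lambda>A C :: ('p, 'q) rmat. \<Sum>(i, j)\<in>UNIV. sg i * wd (A *v ?e j) (C *v ?e i) $ j $ i"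
  have lin: "linear ?f" using linear_compose[OF linear_lie_br[of y] linear_lie_br[of x]] by (simp add: o_def)
  have f: "?f (wd u v) = wd ((x ** y) *v u) (mat 1 *v v) + wd (y *v u) (x *v v) + wd (x *v u) (y *v v) + wd (mat 1 *v u) ((x ** y) *v v)" for u v
    using x y by (simp add: lie_br_wd lie_br_add_right matrix_vector_mul_assoc)
  have "killing_form so_pq x y = (\<Sum>i\<in>UNIV. (case i of (i, j) \<Rightarrow> \<lambda>z. z $ j $ i) (?f (case i of (i, j) \<Rightarrow> (sg i / 2) *\<^sub>R wd (?e j) (?e i))))"
    unfolding killing_form_def
  proof (rule trace_on_frame[OF subspace_so_pq lin])
    show "?f z \<in> so_pq" if "z \<in> so_pq" for z using that x y by (simp add: so_pq_skw skw_lie_br)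
    show "(case i of (i, j) \<Rightarrow> (sg i / 2) *\<^sub>R wd (?e j) (?e i)) \<in> so_pq" for i
      by (auto simp: so_pq_skw skw_scaleR split: prod.split)
    show "linear (case i of (i, j) \<Rightarrow> \<lambda>z :: ('p, 'q) rmat. z $ j $ i)" for i
      by (auto intro!: linearI split: prod.split)
    show "z = (\<Sum>i\<in>UNIV. (case i of (i, j) \<Rightarrow> \<lambda>z. z $ j $ i) z *\<^sub>R (case i of (i, j) \<Rightarrow> (sg i / 2) *\<^sub>R wd (?e j) (?e i)))"
      if "z \<in> so_pq" for z :: "('p, 'q) rmat"
      using skw_frame[of z] that by (simp add: so_pq_skw case_prod_unfold)
  qed simp
  also have "\<dots> = (\<Sum>(i, j)\<in>UNIV. (1 / 2) * (sg i * ?f (wd (?e j) (?e i)) $ j $ i))"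
    by (intro sum.cong refl) (auto split: prod.split)
  also have "\<dots> = (1 / 2) * (?S (x ** y) (mat 1) + ?S y x + ?S x y + ?S (mat 1) (x ** y))"
    unfolding f by (simp add: case_prod_unfold sum.distrib sum_distrib_left algebra_simps)
  also have "\<dots> = (real (CARD('p) + CARD('q)) - 2) * trace (x ** y)"
    unfolding sum_wd_entries by (simp add: trace_skw[OF x] trace_skw[OF y] trace_I trace_mul_sym[of y x] algebra_simps)
  finally show ?thesis .
qed

section \<open>Commuting symmetric and diagonalizable families\<close>

text \<open>The Rayleigh quotient of \<open>f\<close> attains its maximum \<open>l\<close> on the
  compact unit sphere of \<open>S\<close>. The form \<open>l * Q y z - Q (f y) z\<close> is then
  positive semidefinite and vanishes at the maximiser, which therefore lies in its radical and is an
  eigenvector.\<close>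

lemma symmetric_eigenvector:
  fixes S :: "'a::euclidean_space set" and Q :: "'a \<Rightarrow> 'a \<Rightarrow> real"
  assumes S: "subspace S" "S \<noteq> {0}" and Q: "bilinear Q" "\<And>x y. Q x y = Q y x"
    and pos: "\<And>x. x \<in> S \<Longrightarrow> x \<noteq> 0 \<Longrightarrow> 0 < Q x x"
    and f: "linear f" "\<And>x. x \<in> S \<Longrightarrow> f x \<in> S" and sym: "\<And>x y. x \<in> S \<Longrightarrow> y \<in> S \<Longrightarrow> Q (f x) y = Q x (f y)"
  obtains x l where "x \<in> S" "x \<noteq> 0" "f x = l *\<^sub>R x"
proof -
  let ?K = "{x\<in>S. norm x = 1}"
  let ?r = "\<lambda>x. Q (f x) x / Q x x"
  have bb: "bounded_bilinear Q" using Q(1) by (simp add: bilinear_conv_bounded_bilinear)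
  interpret bounded_bilinear Q by (rule bb)
  have dual_coeff: "continuous_on ?K f" using f(1) by (rule linear_continuous_on_compose[OF continuous_on_id])
  have "?K = S \<inter> sphere 0 1" by auto
  then have K: "compact ?K" using closed_subspace[OF S(1)] by (auto intro: closed_Int_compact)
  obtain s where s: "s \<in> S" "s \<noteq> 0" using S subspace_0 by blast
  have "(1 / norm s) *\<^sub>R s \<in> ?K" using s S by (simp add: subspace_scale)
  then have ne: "?K \<noteq> {}" by blast
  have "continuous_on ?K ?r"
    by (intro continuous_intros continuous_on dual_coeff) (use pos in force)
  then obtain x where x: "x \<in> ?K" "\<And>y. y \<in> ?K \<Longrightarrow> ?r y \<le> ?r x"
    using continuous_attains_sup[OF K ne] by blast
  define l where "l = ?r x"
  have xS: "x \<in> S" "x \<noteq> 0" using x by auto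
  have le: "Q (f y) y \<le> l * Q y y" if y: "y \<in> S" for y
  proof (cases "y = 0")
    case True
    then show ?thesis by (simp add: zero_right)
  next
    case False
    let ?y = "(1 / norm y) *\<^sub>R y"
    have "?y \<in> ?K" using y False S by (simp add: subspace_scale)
    then have "?r ?y \<le> l" using x l_def by blast
    moreover have "?r ?y = ?r y" using False by (simp add: linear_scale[OF f(1)] scaleR_left scaleR_right)
    ultimately show ?thesis using pos[OF y False] by (simp add: divide_le_eq)
  qed
  let ?P = "\<lambda>y z. l * Q y z - Q (f y) z"
  have x0: "?P x x = 0" using pos[OF xS] by (simp add: l_def)
  have orth: "?P x y = 0" if y: "y \<in> S" for y
  proof -
    let ?b = "?P x y" and ?c = "?P y y"
    have c: "0 \<le> ?c" using le[OF y] by simp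
    \<comment> \<open>The minimum of the quadratic polynomial would be at \<open>- ?b / ?c\<close>;
      the added 1 keeps the denominator non-zero when \<open>?c = 0\<close>, and the value is still
      negative unless \<open>?b = 0\<close>.\<close>
    define t where "t = - ?b / (?c + 1)"
    have "x + t *\<^sub>R y \<in> S" using xS y S by (simp add: subspace_add subspace_scale)
    then have "0 \<le> ?P (x + t *\<^sub>R y) (x + t *\<^sub>R y)" using le by simp
    also have "\<dots> = ?P x x + 2 * t * ?b + t * t * ?c"
      using sym[OF xS(1) y] Q(2)[of x y] Q(2)[of x "f y"]
      by (simp add: linear_add[OF f(1)] linear_scale[OF f(1)] add_left add_right scaleR_left scaleR_right algebra_simps)
    finally have ge: "0 \<le> 2 * t * ?b + t * t * ?c" using x0 by simp
    have tb: "?b = - t * (?c + 1)" using c by (simp add: t_def)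
    have "2 * t * ?b + t * t * ?c = - (t * t) * (?c + 2)" by (subst tb) (simp add: algebra_simps)
    then have "0 \<le> - (t * t) * (?c + 2)" using ge by linarith
    then have "t * t * (?c + 2) \<le> 0" by simp
    then have "t * t \<le> 0" using c by (simp add: mult_le_0_iff)
    then have "t = 0" by (auto simp: mult_le_0_iff)
    then show ?thesis using tb by simp
  qed
  let ?y = "l *\<^sub>R x - f x"
  have yS: "?y \<in> S" using xS f S by (simp add: subspace_diff subspace_scale)
  have "Q ?y ?y = ?P x ?y" by (simp add: diff_left scaleR_left)
  then have "Q ?y ?y = 0" using orth[OF yS] by simp
  then have "?y = 0" using pos[OF yS] by force
  then show ?thesis using that[OF xS, of l] by simp
qed

text \<open>An eigenspace of a member that is not scalar on \<open>S\<close> is smaller and, by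
  commutativity, stable under the whole family.\<close>

lemma symmetric_family_eigenvector:
  fixes S :: "'a::euclidean_space set" and Q :: "'a \<Rightarrow> 'a \<Rightarrow> real" and F :: "('a \<Rightarrow> 'a) set"
  assumes S: "subspace S" "S \<noteq> {0}" and Q: "bilinear Q" "\<And>x y. Q x y = Q y x"
    and pos: "\<And>x. x \<in> S \<Longrightarrow> x \<noteq> 0 \<Longrightarrow> 0 < Q x x"
    and F: "\<And>f. f \<in> F \<Longrightarrow> linear f" "\<And>f x. f \<in> F \<Longrightarrow> x \<in> S \<Longrightarrow> f x \<in> S"
    and sym: "\<And>f x y. f \<in> F \<Longrightarrow> x \<in> S \<Longrightarrow> y \<in> S \<Longrightarrow> Q (f x) y = Q x (f y)"
    and comm: "\<And>f h x. f \<in> F \<Longrightarrow> h \<in> F \<Longrightarrow> x \<in> S \<Longrightarrow> f (h x) = h (f x)"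
  shows "\<exists>x\<in>S. x \<noteq> 0 \<and> (\<forall>f\<in>F. \<exists>l. f x = l *\<^sub>R x)"
  using S pos F(2) sym comm
proof (induction "dim S" arbitrary: S rule: less_induct)
  case less
  show ?case
  proof (cases "\<forall>f\<in>F. \<exists>l. \<forall>x\<in>S. f x = l *\<^sub>R x")
    case True
    obtain s where "s \<in> S" "s \<noteq> 0" using less.prems(1,2) subspace_0 by blast
    then show ?thesis using True by meson
  next
    case False
    then obtain f where f: "f \<in> F" "\<And>l. \<exists>x\<in>S. f x \<noteq> l *\<^sub>R x" by blast
    obtain x l where x: "x \<in> S" "x \<noteq> 0" "f x = l *\<^sub>R x"
      using symmetric_eigenvector[OF less.prems(1,2) Q less.prems(3) F(1)[OF f(1)] less.prems(4)[OF f(1)] less.prems(5)[OF f(1)]]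
      by blast
    let ?E = "{x\<in>S. f x = l *\<^sub>R x}"
    have E: "subspace ?E" using less.prems(1) F(1)[OF f(1)]
      by (auto simp: subspace_def linear_0 linear_add linear_scale scaleR_add_right mult.commute)
    have "?E \<subset> S" using f(2)[of l] by auto
    then have "dim ?E < dim S" using E less.prems(1) by (metis dim_psubset span_eq_iff)
    moreover have "?E \<noteq> {0}" using x by blast
    ultimately have "\<exists>x\<in>?E. x \<noteq> 0 \<and> (\<forall>f\<in>F. \<exists>l. f x = l *\<^sub>R x)"
    proof (rule less.hyps[OF _ E])
      show "h x \<in> ?E" if "h \<in> F" "x \<in> ?E" for h x
        using that less.prems(4)[of h x] less.prems(6)[of f h x] f(1) F(1)[of h] by (auto simp: linear_scale)
    qed (use less.prems(3,5,6) in auto)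
    then show ?thesis by blast
  qed
qed

text \<open>By symmetry the \<open>Q\<close>-orthogonal complement of all common eigenvectors is
  stable; were it non-zero, it would contain a common eigenvector orthogonal to itself.\<close>

lemma symmetric_family_span:
  fixes S :: "'a::euclidean_space set" and Q :: "'a \<Rightarrow> 'a \<Rightarrow> real" and F :: "('a \<Rightarrow> 'a) set"
  assumes S: "subspace S" and Q: "bilinear Q" "\<And>x y. Q x y = Q y x"
    and pos: "\<And>x. x \<in> S \<Longrightarrow> x \<noteq> 0 \<Longrightarrow> 0 < Q x x"
    and F: "\<And>f. f \<in> F \<Longrightarrow> linear f" "\<And>f x. f \<in> F \<Longrightarrow> x \<in> S \<Longrightarrow> f x \<in> S"
    and sym: "\<And>f x y. f \<in> F \<Longrightarrow> x \<in> S \<Longrightarrow> y \<in> S \<Longrightarrow> Q (f x) y = Q x (f y)"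
    and comm: "\<And>f h x. f \<in> F \<Longrightarrow> h \<in> F \<Longrightarrow> x \<in> S \<Longrightarrow> f (h x) = h (f x)"
  shows "S \<subseteq> span {x\<in>S. \<forall>f\<in>F. \<exists>l. f x = l *\<^sub>R x}"
proof (rule ccontr)
  let ?C = "{x\<in>S. \<forall>f\<in>F. \<exists>l. f x = l *\<^sub>R x}"
  assume no: "\<not> ?thesis"
  obtain B where B: "B \<subseteq> ?C" "independent B" "?C \<subseteq> span B" using maximal_independent_subset[of ?C] by auto
  have fin: "finite B" using B(2) by (rule independent_bound_general[THEN conjunct1])
  have lin: "linear (\<lambda>x. Q x y)" for y using Q(1) by (simp add: bilinear_def)
  have lin': "linear (Q y)" for y using Q(1) by (simp add: bilinear_def)
  have spBS: "span B \<subseteq> S" using B(1) S by (intro span_minimal) auto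
  have "\<not> S \<subseteq> span B" using no span_mono[OF B(1)] by blast
  then have "card B < dim S" using spBS S B(2) by (metis dim_eq_card_independent dim_psubset psubsetI span_eq_iff span_span subset_refl dim_span)
  then obtain z where z: "z \<in> S" "z \<noteq> 0" "\<And>b. b \<in> B \<Longrightarrow> Q z b = 0"
    using exists_in_kernel[OF S fin, of "\<lambda>b z. Q z b"] lin by blast
  let ?T = "{z\<in>S. \<forall>e\<in>?C. Q z e = 0}"
  have T: "subspace ?T" using S by (auto simp: subspace_def linear_0[OF lin] linear_add[OF lin] linear_scale[OF lin])
  have "Q z e = 0" if "e \<in> span B" for e
    using that
  proof (induction rule: span_induct)
    case base
    show ?case by (auto simp: subspace_def linear_0[OF lin'] linear_add[OF lin'] linear_scale[OF lin'])
  qed (use z in auto)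
  then have "z \<in> ?T" using z B(3) by blast
  then have Tn: "?T \<noteq> {0}" using z by blast
  have "\<exists>x\<in>?T. x \<noteq> 0 \<and> (\<forall>f\<in>F. \<exists>l. f x = l *\<^sub>R x)"
  proof (rule symmetric_family_eigenvector[OF T Tn Q _ F(1)])
    show "f x \<in> ?T" if f: "f \<in> F" and x: "x \<in> ?T" for f x
    proof -
      have "Q (f x) e = 0" if e: "e \<in> ?C" for e
      proof -
        obtain l where l: "f e = l *\<^sub>R e" using e f by blast
        have "Q (f x) e = Q x (f e)" using sym[OF f] x e by blast
        also have "\<dots> = l * Q x e" by (simp add: l linear_scale[OF lin'])
        finally show ?thesis using x e by simp
      qed
      then show ?thesis using F(2)[OF f] x by blast
    qed
  qed (use pos sym comm in auto)
  then obtain x where x: "x \<in> ?T" "x \<noteq> 0" "\<forall>f\<in>F. \<exists>l. f x = l *\<^sub>R x" by blast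
  then have "x \<in> ?C" by blast
  then have "Q x x = 0" using x(1) by blast
  then show False using pos[of x] x by auto
qed

definition eigenvectors :: "(real^'n^'n) \<Rightarrow> (real^'n) set" where
  "eigenvectors f = {v. \<exists>l. f *v v = l *\<^sub>R v}"

definition common_eigenvector :: "(real^'n^'n) set \<Rightarrow> real^'n \<Rightarrow> bool" where
  "common_eigenvector A v \<longleftrightarrow> (\<forall>t\<in>A. v \<in> eigenvectors t)"

lemma span_eigenvectors_sum:
  assumes "v \<in> span (eigenvectors f)"
  shows "\<exists>L w. finite L \<and> (\<forall>l. f *v w l = l *\<^sub>R w l) \<and> v = (\<Sum>l\<in>L. w l)"
  using assms
proof (induction rule: span_induct_alt)
  case base
  show ?case by (rule exI[of _ "{}"], rule exI[of _ "\<lambda>_. 0"]) simp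
next
  case (step c x y)
  obtain L w where Lw: "finite L" "\<forall>l. f *v w l = l *\<^sub>R w l" "y = (\<Sum>l\<in>L. w l)" using step by blast
  obtain m where m: "f *v x = m *\<^sub>R x" using step by (auto simp: eigenvectors_def)
  let ?w = "\<lambda>l. (if l = m then c *\<^sub>R x else 0) + (if l \<in> L then w l else 0)"
  have "(\<Sum>l\<in>insert m L. ?w l) = c *\<^sub>R x + y"
    unfolding sum.distrib Lw(3)
    by (rule arg_cong2[of _ _ _ _ "(+)"]) (use Lw(1) in \<open>simp_all add: sum.inter_restrict[symmetric] Int_insert_left insert_absorb\<close>)
  moreover have "f *v ?w l = l *\<^sub>R ?w l" for l
    using Lw(2) m by (simp add: matrix_vector_right_distrib matrix_vector_mult_scaleR scaleR_add_right)
  ultimately show ?case using Lw(1) by (intro exI[of _ "insert m L"] exI[of _ ?w]) auto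
qed

text \<open>Applying \<open>f\<close> minus the scalar \<open>k\<close> removes the component for
  \<open>k\<close> and multiplies the others by non-zero factors.\<close>

lemma invariant_contains_components:
  fixes f :: "real^'n^'n"
  assumes W: "subspace W" "\<And>w. w \<in> W \<Longrightarrow> f *v w \<in> W"
    and L: "finite L" and w: "\<And>l. f *v w l = l *\<^sub>R w l" and s: "(\<Sum>l\<in>L. w l) \<in> W"
  shows "\<forall>l\<in>L. w l \<in> W"
  using L w s
proof (induction L arbitrary: w)
  case (insert k L)
  let ?u = "\<lambda>l. (l - k) *\<^sub>R w l"
  have "f *v (\<Sum>l\<in>insert k L. w l) - k *\<^sub>R (\<Sum>l\<in>insert k L. w l) \<in> W"
    using insert.prems W by (blast intro: subspace_diff subspace_scale)
  moreover have "f *v (\<Sum>l\<in>insert k L. w l) - k *\<^sub>R (\<Sum>l\<in>insert k L. w l) = (\<Sum>l\<in>insert k L. ?u l)"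
    by (simp only: linear_sum[OF matrix_vector_mul_linear] insert.prems(1) scaleR_sum_right sum_subtractf[symmetric] scaleR_diff_left)
  moreover have "\<dots> = (\<Sum>l\<in>L. ?u l)" using insert.hyps by simp
  ultimately have "(\<Sum>l\<in>L. ?u l) \<in> W" by metis
  then have u: "\<forall>l\<in>L. ?u l \<in> W"
    using insert.prems(1) by (intro insert.IH) (simp_all add: matrix_vector_mult_scaleR)
  have wl: "w l \<in> W" if "l \<in> L" for l
  proof -
    have "w l = (1 / (l - k)) *\<^sub>R ?u l" using that insert.hyps by auto
    also have "\<dots> \<in> W" using u that W(1) by (blast intro: subspace_scale)
    finally show ?thesis .
  qed
  have "(\<Sum>l\<in>insert k L. w l) - (\<Sum>l\<in>L. w l) \<in> W"
    using insert.prems(2) W(1) wl by (blast intro: subspace_diff subspace_sum)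
  then have "w k \<in> W" using insert.hyps by simp
  then show ?case using wl by blast
qed simp

lemma invariant_subspace_eigenvectors:
  assumes f: "span (eigenvectors f) = UNIV" and W: "subspace W" "\<And>w. w \<in> W \<Longrightarrow> f *v w \<in> W"
  shows "W \<subseteq> span (eigenvectors f \<inter> W)"
proof
  fix v assume v: "v \<in> W"
  obtain L w where Lw: "finite L" "\<And>l. f *v w l = l *\<^sub>R w l" "v = (\<Sum>l\<in>L. w l)"
    using span_eigenvectors_sum[of v f] f by auto
  then have "\<forall>l\<in>L. w l \<in> W" using invariant_contains_components[OF W] v by blast
  then have "w l \<in> eigenvectors f \<inter> W" if "l \<in> L" for l using that Lw(2) by (auto simp: eigenvectors_def)
  then show "v \<in> span (eigenvectors f \<inter> W)" unfolding Lw(3) by (intro span_sum) (auto intro: span_base)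
qed

text \<open>A member that is not scalar on \<open>W\<close> splits it into proper eigenspaces, and
  the rest of the family preserves them.\<close>

lemma commuting_diagonalizable:
  fixes A :: "(real^'n^'n) set"
  assumes diag: "\<And>t. t \<in> A \<Longrightarrow> span (eigenvectors t) = UNIV" and comm: "\<And>s t v. s \<in> A \<Longrightarrow> t \<in> A \<Longrightarrow> s *v (t *v v) = t *v (s *v v)"
    and W: "subspace W" "\<And>t w. t \<in> A \<Longrightarrow> w \<in> W \<Longrightarrow> t *v w \<in> W"
  shows "W \<subseteq> span {v\<in>W. common_eigenvector A v}"
  using W
proof (induction "dim W" arbitrary: W rule: less_induct)
  case less
  show ?case
  proof (cases "\<forall>t\<in>A. \<exists>c. \<forall>w\<in>W. t *v w = c *\<^sub>R w")
    case True
    then have "W \<subseteq> {v\<in>W. common_eigenvector A v}" by (fastforce simp: common_eigenvector_def eigenvectors_def)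
    then show ?thesis using span_superset by blast
  next
    case False
    then obtain t where t: "t \<in> A" "\<And>c. \<exists>w\<in>W. t *v w \<noteq> c *\<^sub>R w" by blast
    have "eigenvectors t \<inter> W \<subseteq> span {v\<in>W. common_eigenvector A v}"
    proof
      fix v assume "v \<in> eigenvectors t \<inter> W"
      then obtain c where c: "v \<in> W" "t *v v = c *\<^sub>R v" by (auto simp: eigenvectors_def)
      let ?E = "{w\<in>W. t *v w = c *\<^sub>R w}"
      have E: "subspace ?E" using less.prems(1)
        by (auto simp: subspace_def matrix_vector_right_distrib matrix_vector_mult_scaleR scaleR_add_right mult.commute)
      have "?E \<subset> W" using t(2)[of c] by auto
      then have "dim ?E < dim W" using E less.prems(1) by (metis dim_psubset span_eq_iff)
      moreover have "s *v w \<in> ?E" if "s \<in> A" "w \<in> ?E" for s w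
        using that less.prems(2) comm[OF t(1) that(1), of w] by (auto simp: matrix_vector_mult_scaleR)
      ultimately have "?E \<subseteq> span {v\<in>?E. common_eigenvector A v}" using less.hyps E by blast
      also have "\<dots> \<subseteq> span {v\<in>W. common_eigenvector A v}" by (rule span_mono) auto
      finally show "v \<in> span {v\<in>W. common_eigenvector A v}" using c by blast
    qed
    then have "span (eigenvectors t \<inter> W) \<subseteq> span {v\<in>W. common_eigenvector A v}" by (simp add: span_minimal)
    then show ?thesis using invariant_subspace_eigenvectors[OF diag[OF t(1)] less.prems(1)] less.prems(2)[OF t(1)] by blast
  qed
qed

section \<open>Split abelian subspaces act diagonalizably\<close>

lemma trace_lie_br: "trace (lie_br x y ** w) = - trace (y ** lie_br x (w :: real^'n^'n))"
proof -
  have "trace ((x ** y) ** w) = trace (y ** (w ** x))"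
    by (metis matrix_mul_assoc trace_mul_sym)
  moreover have "(A - B) ** w = A ** w - B ** w" "y ** (A - B) = y ** A - y ** B" for A B :: "real^'n^'n"
    by (simp_all add: vec_eq_iff matrix_matrix_mult_def algebra_simps sum_subtractf)
  ultimately show ?thesis by (simp add: lie_br_def trace_sub matrix_mul_assoc)
qed

text \<open>The Killing form is a positive multiple of the trace form, so the Cartan involution
  makes \<open>Q\<close> positive definite. Adding the expression with \<open>y\<close> and
  \<open>z\<close> exchanged makes \<open>Q\<close> symmetric without an argument that \<theta>
  preserves the trace form. As \<open>\<theta> t = - t\<close>, the skewness of \<open>ad t\<close>
  for the trace form becomes symmetry for \<open>Q\<close>.\<close>

lemma split_abelian_form:
  fixes a :: "('p::finite, 'q::finite) rmat set"
  assumes a: "split_abelian so_pq a" and n: "3 \<le> CARD('p) + CARD('q)"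
  obtains Q where "bilinear Q" "\<And>x y. Q x y = Q y x" "\<And>y :: ('p, 'q) rmat. skw y \<Longrightarrow> y \<noteq> 0 \<Longrightarrow> (0::real) < Q y y"
    "\<And>t y z. t \<in> a \<Longrightarrow> skw y \<Longrightarrow> skw z \<Longrightarrow> Q (lie_br t y) z = Q y (lie_br t z)"
proof -
  let ?g = "so_pq :: ('p, 'q) rmat set"
  obtain \<theta> where \<theta>: "cartan_involution ?g \<theta>" "\<And>x. x \<in> a \<Longrightarrow> \<theta> x = - x" using a by (auto simp: split_abelian_def)
  have aut: "lie_automorphism ?g \<theta>" and neg: "\<And>x. x \<in> ?g \<Longrightarrow> x \<noteq> 0 \<Longrightarrow> killing_form ?g x (\<theta> x) < 0"
    using \<theta>(1) by (auto simp: cartan_involution_def)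
  obtain T where T: "linear T" "\<And>x. x \<in> ?g \<Longrightarrow> T x = \<theta> x"
    using linear_on_extends[OF subspace_so_pq, of \<theta>] aut by (auto simp: lie_automorphism_def)
  have Tg: "T x \<in> ?g" if "x \<in> ?g" for x using aut T(2)[OF that] that by (auto simp: lie_automorphism_def bij_betw_def)
  define Q where "Q y z = - trace (y ** T z) - trace (z ** T y)" for y z
  have add: "(x + y) ** z = x ** z + y ** z" "z ** (x + y) = z ** x + z ** y"
    "(c *\<^sub>R x) ** z = c *\<^sub>R (x ** z)" "z ** (c *\<^sub>R x) = c *\<^sub>R (z ** x)" for x y z :: "('p, 'q) rmat" and c
    by (simp_all add: vec_eq_iff matrix_matrix_mult_def algebra_simps sum.distrib sum_distrib_left)
  have trs: "trace (c *\<^sub>R x) = c * trace x" for c and x :: "('p, 'q) rmat"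
    by (simp add: trace_def sum_distrib_left)
  have q1: "bilinear Q" unfolding bilinear_def
    by (auto intro!: linearI simp: Q_def linear_add[OF T(1)] linear_scale[OF T(1)] add trace_add trs algebra_simps)
  have q2: "Q x y = Q y x" for x y by (simp add: Q_def)
  have q3: "0 < Q y y" if y: "skw y" "y \<noteq> 0" for y
  proof -
    have yg: "y \<in> ?g" using y by (simp add: so_pq_skw)
    then have "skw (T y)" using Tg by (auto simp: so_pq_skw)
    then have "(real (CARD('p) + CARD('q)) - 2) * trace (y ** T y) < 0"
      using neg[OF yg y(2)] T(2)[OF yg] killing_form_so_pq[OF y(1)] by metis
    then have "trace (y ** T y) < 0" using n by (simp add: mult_less_0_iff)
    then show ?thesis by (simp add: Q_def)
  qed
  have q4: "Q (lie_br t y) z = Q y (lie_br t z)" if t: "t \<in> a" and y: "skw y" and z: "skw z" for t y z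
  proof -
    have tg: "t \<in> ?g" using a t by (auto simp: split_abelian_def)
    have key: "trace (lie_br t y ** T z) = trace (y ** T (lie_br t z))" if y: "skw y" and z: "skw z" for y z
    proof -
      have zg: "z \<in> ?g" using z by (simp add: so_pq_skw)
      have "T (lie_br t z) = lie_br (\<theta> t) (\<theta> z)"
        using T(2)[OF so_pq_lie_br[OF tg zg]] aut tg zg by (simp add: lie_automorphism_def)
      also have "\<dots> = - lie_br t (T z)" using \<theta>(2)[OF t] T(2)[OF zg] by simp
      finally have "T (lie_br t z) = - lie_br t (T z)" .
      moreover have "y ** (- w) = - (y ** w)" and "trace (- w) = - trace w" for w :: "('p, 'q) rmat"
        by (simp_all add: vec_eq_iff matrix_matrix_mult_def trace_def sum_negf)
      ultimately show ?thesis by (simp add: trace_lie_br)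
    qed
    show ?thesis unfolding Q_def using key[OF y z] key[OF z y] by simp
  qed
  show ?thesis by (rule that[OF q1 q2 q3 q4])
qed

text \<open>If \<open>u\<close> is in the kernel of \<open>x\<close>, then \<open>y \<mapsto> y u\<close> maps eigenvectors of \<open>ad x\<close> to eigenvectors of
  \<open>x\<close>, so \<open>u\<^sup>\<bottom>\<close> is spanned by eigenvectors. Only a Jordan block for the eigenvalue 0 is left to exclude.\<close>

lemma split_abelian_diagonalizable:
  fixes a :: "('p::finite, 'q::finite) rmat set"
  assumes a: "split_abelian so_pq a" and odd: "odd (CARD('p) + CARD('q))" and n: "3 \<le> CARD('p) + CARD('q)"
    and x: "x \<in> a"
  shows "span (eigenvectors x) = UNIV"
proof -
  have sk: "skw x" using a x by (auto simp: split_abelian_def so_pq_skw)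
  obtain Q where Q: "bilinear Q" "\<And>x y. Q x y = Q y x" "\<And>y :: ('p, 'q) rmat. skw y \<Longrightarrow> y \<noteq> 0 \<Longrightarrow> (0::real) < Q y y"
    "\<And>t y z. t \<in> a \<Longrightarrow> skw y \<Longrightarrow> skw z \<Longrightarrow> Q (lie_br t y) z = Q y (lie_br t z)"
  proof (rule split_abelian_form[OF a n])
    fix Q :: "('p, 'q) rmat \<Rightarrow> ('p, 'q) rmat \<Rightarrow> real"
    assume "bilinear Q" "\<And>x y. Q x y = Q y x" "\<And>y. skw y \<Longrightarrow> y \<noteq> 0 \<Longrightarrow> 0 < Q y y"
      "\<And>t y z. t \<in> a \<Longrightarrow> skw y \<Longrightarrow> skw z \<Longrightarrow> Q (lie_br t y) z = Q y (lie_br t z)"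
    then show thesis by (rule that)
  qed
  let ?D = "{y\<in>so_pq. \<forall>f\<in>{lie_br x}. \<exists>l. f y = l *\<^sub>R y}"
  have gD: "so_pq \<subseteq> span ?D"
  proof (rule symmetric_family_span[OF subspace_so_pq Q(1) Q(2)])
    show "Q (f y) z = Q y (f z)" if "f \<in> {lie_br x}" "y \<in> so_pq" "z \<in> so_pq" for f y z
      using that Q(4)[OF x, of y z] by (simp add: so_pq_skw)
    show "0 < Q y y" if "y \<in> so_pq" "y \<noteq> 0" for y
      using that Q(3)[of y] by (simp add: so_pq_skw)
    show "f y \<in> so_pq" if "f \<in> {lie_br x}" "y \<in> so_pq" for f y
      using that sk by (simp add: so_pq_skw skw_lie_br)
  qed (auto simp: linear_lie_br)
  obtain u where u: "u \<noteq> 0" "x *v u = 0" using skw_kernel_vector[OF sk odd] .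
  obtain v where v: "fm u v = 1" using exists_dual_vector[OF u(1)] .
  let ?E = "span (eigenvectors x)"
  have uE: "perp u \<subseteq> ?E"
  proof
    fix z assume "z \<in> perp u"
    then have zv: "wd z v *v u = z" using v by (simp add: perp_def wd_applyR fm_sym[of v] fm_sym[of z])
    have "wd z v \<in> so_pq" by (simp add: so_pq_skw)
    then have "wd z v \<in> span ?D" using gD by blast
    then have "wd z v *v u \<in> (\<lambda>y. y *v u) ` span ?D" by (rule imageI)
    then have "z \<in> span ((\<lambda>y. y *v u) ` ?D)" unfolding zv linear_span_image[OF linear_matrix_apply] .
    moreover have "(\<lambda>y. y *v u) ` ?D \<subseteq> eigenvectors x"
    proof
      fix w assume "w \<in> (\<lambda>y. y *v u) ` ?D"
      then obtain y l where y: "w = y *v u" "lie_br x y = l *\<^sub>R y" by auto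
      have "lie_br x y *v u = x *v w" using u(2) y(1) by (simp add: lie_br_apply)
      then have "x *v w = l *\<^sub>R w" using y by simp
      then show "w \<in> eigenvectors x" by (auto simp: eigenvectors_def)
    qed
    ultimately show "z \<in> ?E" using span_mono by blast
  qed
  \<comment> \<open>Each vector of \<open>?E\<close> is a kernel vector plus \<open>x *v r\<close>
    with \<open>r\<close> in \<open>?E\<close>. Applied to \<open>x *v v\<close>, this will give a
    vector \<open>v - r\<close> killed by the square of \<open>x\<close>.\<close>
  have split: "\<exists>k r. x *v k = 0 \<and> r \<in> ?E \<and> z = k + x *v r" if "z \<in> ?E" for z
    using that
  proof (induction rule: span_induct_alt)
    case base
    show ?case by (rule exI[of _ 0], rule exI[of _ 0]) (simp add: span_zero)
  next
    case (step c w y)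
    obtain k r where kr: "x *v k = 0" "r \<in> ?E" "y = k + x *v r" using step by blast
    obtain l where l: "x *v w = l *\<^sub>R w" using step by (auto simp: eigenvectors_def)
    show ?case
    proof (cases "l = 0")
      case True
      then show ?thesis using kr l
        by (intro exI[of _ "k + c *\<^sub>R w"] exI[of _ r]) (simp add: matrix_vector_right_distrib matrix_vector_mult_scaleR)
    next
      case False
      have "r + (c / l) *\<^sub>R w \<in> ?E" using kr step by (blast intro: span_add span_scale span_base)
      then show ?thesis using kr l False
        by (intro exI[of _ k] exI[of _ "r + (c / l) *\<^sub>R w"]) (simp add: matrix_vector_right_distrib matrix_vector_mult_scaleR)
    qed
  qed
  \<comment> \<open>If \<open>?k = x *v z\<close> were non-zero and killed by \<open>x\<close>, an
    eigenvector \<open>w\<close> independent of \<open>?k\<close> would turn \<open>wd z w\<close>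
    and \<open>wd ?k w\<close> into a Jordan block of \<open>ad x\<close>, which cannot be symmetric
    for a definite form.\<close>
  have no_jordan: "x *v z = 0" if xz: "x *v (x *v z) = 0" for z
  proof (rule ccontr)
    let ?k = "x *v z"
    assume k: "?k \<noteq> 0"
    have "\<not> eigenvectors x \<subseteq> span {?k}"
    proof
      assume "eigenvectors x \<subseteq> span {?k}"
      then have "?E \<subseteq> span {?k}" by (rule span_minimal) (rule subspace_span)
      then have "perp u \<subseteq> span {?k}" using uE by blast
      then have "dim (perp u) \<le> card {?k}" by (intro dim_le_card) auto
      then show False using dim_perp[OF u(1)] n by simp
    qed
    then obtain w l where w: "x *v w = l *\<^sub>R w" "w \<notin> span {?k}" by (auto simp: eigenvectors_def)
    obtain s where s: "fm ?k s = 1" using exists_dual_vector[OF k] .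
    have nz: "wd ?k w \<noteq> 0"
    proof
      assume "wd ?k w = 0"
      then have "w = fm w s *\<^sub>R ?k" using wd_eq_0_imp s by blast
      moreover have "fm w s *\<^sub>R ?k \<in> span {?k}" by (simp add: span_scale span_base)
      ultimately show False using w(2) by metis
    qed
    have 1: "lie_br x (wd z w) = wd ?k w + l *\<^sub>R wd z w" using sk w by (simp add: lie_br_wd)
    have 2: "lie_br x (wd ?k w) = l *\<^sub>R wd ?k w" using sk w xz by (simp add: lie_br_wd)
    have lin: "linear (\<lambda>y. Q y w)" "linear (Q w)" for w using Q(1) by (simp_all add: bilinear_def)
    have "Q (lie_br x (wd z w)) (wd ?k w) = Q (wd z w) (lie_br x (wd ?k w))" using Q(4)[OF x] by simp
    then have "Q (wd ?k w) (wd ?k w) = 0"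
      unfolding 1 2 by (simp add: linear_add[OF lin(1)] linear_scale[OF lin(1)] linear_scale[OF lin(2)])
    then show False using Q(3)[OF skw_wd nz] by simp
  qed
  have "fm u (x *v v) = 0" using skwD[OF sk, of u v] u(2) by simp
  then have "x *v v \<in> ?E" using uE by (auto simp: perp_def)
  then obtain k r where kr: "x *v k = 0" "r \<in> ?E" "x *v v = k + x *v r" using split by blast
  have "x *v (v - r) = k" using kr(3) by (simp add: matrix_vector_mult_diff_distrib)
  then have "x *v (v - r) = 0" using no_jordan[of "v - r"] kr(1) by simp
  then have "v - r \<in> ?E" by (intro span_base) (auto simp: eigenvectors_def intro: exI[of _ 0])
  then have vE: "v \<in> ?E" using kr(2) span_add[of "v - r" _ r] by simp
  show ?thesis
  proof (rule equalityI[OF subset_UNIV], rule subsetI)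
    fix z
    have "fm u (z - fm u z *\<^sub>R v) = 0" using v by simp
    then have "z - fm u z *\<^sub>R v \<in> ?E" using uE by (auto simp: perp_def)
    then have "z - fm u z *\<^sub>R v + fm u z *\<^sub>R v \<in> ?E" using vE by (intro span_add span_scale)
    then show "z \<in> ?E" by simp
  qed
qed

section \<open>Hyperbolic systems\<close>

definition hyperbolic :: "nat \<Rightarrow> (nat \<Rightarrow> ('p::finite, 'q::finite) rvec) \<Rightarrow> (nat \<Rightarrow> ('p, 'q) rvec) \<Rightarrow> bool" where
  "hyperbolic r E F \<longleftrightarrow> (\<forall>i\<in>{1..r}. \<forall>j\<in>{1..r}. fm (E i) (E j) = 0 \<and> fm (F i) (F j) = 0 \<and>
     fm (E i) (F j) = (if i = j then 1 else 0))"

definition hyperbolic_complement :: "nat \<Rightarrow> (nat \<Rightarrow> ('p::finite, 'q::finite) rvec) \<Rightarrow> (nat \<Rightarrow> ('p, 'q) rvec) \<Rightarrow> ('p, 'q) rvec set" where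
  "hyperbolic_complement r E F = {z. \<forall>i\<in>{1..r}. fm (E i) z = 0 \<and> fm (F i) z = 0}"

lemma matrix_vector_uminus [simp]: "A *v (- z) = - (A *v (z :: 'a::comm_ring_1^'n))"
  by (simp add: vec_eq_iff matrix_vector_mult_def sum_negf)

lemma hyperbolic_dual: "hyperbolic r E F \<Longrightarrow> i \<in> {1..r} \<Longrightarrow> j \<in> {1..r} \<Longrightarrow> fm (F i) (E j) = (if i = j then 1 else 0)"
  unfolding hyperbolic_def using fm_sym[of "F i" "E j"] by auto

lemma subspace_hyperbolic_complement: "subspace (hyperbolic_complement r E F)"
  by (auto simp: hyperbolic_complement_def subspace_def)

lemma hyperbolic_projection:
  assumes h: "hyperbolic r E F"
  obtains w where "w \<in> hyperbolic_complement r E F" "\<And>z. z \<in> hyperbolic_complement r E F \<Longrightarrow> fm z w = fm z y"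
proof -
  define w where "w = y - (\<Sum>i\<in>{1..r}. fm (F i) y *\<^sub>R E i + fm (E i) y *\<^sub>R F i)"
  have "fm (E k) w = 0 \<and> fm (F k) w = 0" if k: "k \<in> {1..r}" for k
  proof
    have "fm (E k) w = fm (E k) y - (\<Sum>i\<in>{1..r}. if i = k then fm (E k) y else 0)"
      unfolding w_def fm_diff_right fm_sum_right using h k
      by (intro arg_cong2[of _ _ _ _ "(-)"] refl sum.cong) (auto simp: hyperbolic_def)
    then show "fm (E k) w = 0" using k by simp
    have "fm (F k) w = fm (F k) y - (\<Sum>i\<in>{1..r}. if i = k then fm (F k) y else 0)"
      unfolding w_def fm_diff_right fm_sum_right using h k
      by (intro arg_cong2[of _ _ _ _ "(-)"] refl sum.cong) (auto simp: hyperbolic_def fm_sym[of "F k"])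
    then show "fm (F k) w = 0" using k by simp
  qed
  then have "w \<in> hyperbolic_complement r E F" by (simp add: hyperbolic_complement_def)
  moreover have "fm z w = fm z y" if z: "z \<in> hyperbolic_complement r E F" for z
    unfolding w_def fm_diff_right fm_sum_right
    using z by (simp add: hyperbolic_complement_def fm_sym[of z])
  ultimately show ?thesis using that by blast
qed

lemma hyperbolic_complement_nondegenerate:
  assumes h: "hyperbolic r E F" and z: "z \<in> hyperbolic_complement r E F" "z \<noteq> 0"
  obtains w where "w \<in> hyperbolic_complement r E F" "fm z w = 1"
proof -
  obtain y where "fm z y = 1" using exists_dual_vector[OF z(2)] .
  then show ?thesis using hyperbolic_projection[OF h, of y] z(1) that by metis
qed

lemma dim_hyperbolic_complement_ge: "CARD('p) + CARD('q) \<le> dim (hyperbolic_complement r E F :: ('p::finite, 'q::finite) rvec set) + 2 * r"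
proof -
  let ?\<phi> = "\<lambda>(i, b). fm (if b then E i else F i)"
  have "dim (UNIV :: ('p, 'q) rvec set) \<le> dim {z\<in>UNIV. \<forall>i\<in>{1..r} \<times> UNIV. ?\<phi> i z = 0} + card ({1..r} \<times> (UNIV :: bool set))"
    by (rule dim_kernel_ge) (auto simp: linear_fm)
  moreover have "{z\<in>UNIV. \<forall>i\<in>{1..r} \<times> UNIV. ?\<phi> i z = 0} = hyperbolic_complement r E F"
    by (auto simp: hyperbolic_complement_def)
  ultimately show ?thesis by (simp add: card_cartesian_product)
qed

text \<open>Adjoining the isotropic vectors \<open>E i\<close> to a subspace of the complement adds
  r to the dimension and changes no value of the quadratic form. This is how the signature bounds
  the complement.\<close>

lemma hyperbolic_sum_dim:
  assumes h: "hyperbolic r E F" and T: "subspace T" "T \<subseteq> hyperbolic_complement r E F"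
  shows "dim {x + y | x y. x \<in> span (E ` {1..r}) \<and> y \<in> T} = r + dim T"
    and "subspace {x + y | x y. x \<in> span (E ` {1..r}) \<and> y \<in> T}"
    and "x \<in> span (E ` {1..r}) \<Longrightarrow> y \<in> T \<Longrightarrow> fm (x + y) (x + y) = fm y y"
proof -
  let ?S = "span (E ` {1..r})"
  have dS: "dim ?S = r"
    using dual_family_independent(3)[of "{1..r}" "\<lambda>i. fm (F i)" E] hyperbolic_dual[OF h]
    by (simp add: linear_fm)
  have exp: "z = (\<Sum>i\<in>{1..r}. fm (F i) z *\<^sub>R E i)" if "z \<in> ?S" for z
  proof (rule linear_eq_on_span[of "\<lambda>z. z" "\<lambda>z. \<Sum>i\<in>{1..r}. fm (F i) z *\<^sub>R E i" "E ` {1..r}"])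
    show "linear (\<lambda>z. \<Sum>i\<in>{1..r}. fm (F i) z *\<^sub>R E i)"
      by (rule linearI) (simp_all add: scaleR_left_distrib sum.distrib scaleR_sum_right)
    fix x assume "x \<in> E ` {1..r}"
    then obtain k where k: "k \<in> {1..r}" "x = E k" by blast
    have "(\<Sum>i\<in>{1..r}. fm (F i) x *\<^sub>R E i) = (\<Sum>i\<in>{1..r}. if i = k then E k else 0)"
      using hyperbolic_dual[OF h] k by (intro sum.cong) auto
    then show "x = (\<Sum>i\<in>{1..r}. fm (F i) x *\<^sub>R E i)" using k by simp
  qed (use that in \<open>auto simp: linear_ident\<close>)
  have "?S \<inter> T \<subseteq> {0}"
  proof
    fix z assume z: "z \<in> ?S \<inter> T"
    then have "fm (F i) z = 0" if "i \<in> {1..r}" for i using T(2) that by (auto simp: hyperbolic_complement_def)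
    then show "z \<in> {0}" using exp[of z] z by simp
  qed
  then have d0: "dim (?S \<inter> T) = 0" by (simp only: dim_eq_0)
  then show "dim {x + y | x y. x \<in> ?S \<and> y \<in> T} = r + dim T"
    using dim_sums_Int[OF subspace_span T(1), of "E ` {1..r}"] d0 dS by linarith
  show "subspace {x + y | x y. x \<in> ?S \<and> y \<in> T}"
    using subspace_sums[OF subspace_span T(1)] .
  show "fm (x + y) (x + y) = fm y y" if x: "x \<in> ?S" and y: "y \<in> T"
  proof -
    have 1: "fm (E i) z = 0" if "i \<in> {1..r}" "z \<in> ?S" for i z
      using h that(1) by (subst exp[OF that(2)]) (simp add: fm_sum_right hyperbolic_def)
    have "fm x (E i) = 0" if "i \<in> {1..r}" for i using 1[OF that x] fm_sym by metis
    then have "fm x x = 0" by (subst (2) exp[OF x]) (simp add: fm_sum_right)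
    moreover have "fm (E i) y = 0" if "i \<in> {1..r}" for i using T(2) y that by (auto simp: hyperbolic_complement_def)
    then have "fm x y = 0" by (subst exp[OF x]) (simp add: fm_sum_left)
    ultimately show ?thesis using fm_sym[of y x] by simp
  qed
qed

lemma hyperbolic_nonneg_dim:
  fixes E F :: "nat \<Rightarrow> ('p::finite, 'q::finite) rvec"
  assumes h: "hyperbolic r E F" and T: "subspace T" "T \<subseteq> hyperbolic_complement r E F" and "\<And>z. z \<in> T \<Longrightarrow> 0 \<le> fm z z"
  shows "r + dim T \<le> CARD('p)"
  unfolding hyperbolic_sum_dim(1)[OF h T, symmetric]
  by (rule dim_nonneg_le[OF hyperbolic_sum_dim(2)[OF h T]]) (use hyperbolic_sum_dim(3)[OF h T] assms(4) in force)

lemma hyperbolic_nonpos_dim: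
  fixes E F :: "nat \<Rightarrow> ('p::finite, 'q::finite) rvec"
  assumes h: "hyperbolic r E F" and T: "subspace T" "T \<subseteq> hyperbolic_complement r E F" and "\<And>z. z \<in> T \<Longrightarrow> fm z z \<le> 0"
  shows "r + dim T \<le> CARD('q)"
  unfolding hyperbolic_sum_dim(1)[OF h T, symmetric]
  by (rule dim_nonpos_le[OF hyperbolic_sum_dim(2)[OF h T]]) (use hyperbolic_sum_dim(3)[OF h T] assms(4) in force)

text \<open>\<open>t\<close> is a root of the quadratic polynomial
  \<open>fm (x + t *\<^sub>R y) (x + t *\<^sub>R y)\<close>, whose outer coefficients have opposite
  signs, so that its discriminant \<open>D\<close> is not negative.\<close>

lemma isotropic_between:
  fixes x y :: "('p::finite, 'q::finite) rvec"
  assumes x: "0 < fm x x" and y: "fm y y < 0"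
  obtains t where "fm (x + t *\<^sub>R y) (x + t *\<^sub>R y) = 0" "x + t *\<^sub>R y \<noteq> 0"
proof -
  let ?a = "fm y y" and ?b = "fm x y" and ?c = "fm x x"
  define D where "D = ?b * ?b - ?a * ?c"
  have D: "0 \<le> D" using x y mult_neg_pos[OF y x] by (simp add: D_def) (smt (verit) zero_le_square)
  define t where "t = (- ?b - sqrt D) / ?a"
  have at: "?a * t = - ?b - sqrt D" using y by (simp add: t_def)
  have "?a * fm (x + t *\<^sub>R y) (x + t *\<^sub>R y) = ?a * ?c + 2 * (?a * t) * ?b + (?a * t) * (?a * t)"
    using fm_sym[of y x] by (simp add: algebra_simps)
  also have "\<dots> = ?a * ?c - ?b * ?b + sqrt D * sqrt D" unfolding at by (simp add: algebra_simps)
  also have "\<dots> = 0" using D by (simp add: D_def)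
  finally have 1: "fm (x + t *\<^sub>R y) (x + t *\<^sub>R y) = 0" using y by simp
  have "x + t *\<^sub>R y \<noteq> 0"
  proof
    assume "x + t *\<^sub>R y = 0"
    then have "x = - (t *\<^sub>R y)" by (simp add: eq_neg_iff_add_eq_0)
    then have "fm x x = (t * t) * fm y y" by simp
    also have "\<dots> \<le> 0" using y by (simp add: mult_nonneg_nonpos)
    finally show False using x by simp
  qed
  then show ?thesis using that 1 by blast
qed

definition diag_family :: "('p::finite, 'q::finite) rmat set \<Rightarrow> bool" where
  "diag_family A \<longleftrightarrow> (\<forall>t\<in>A. skw t \<and> span (eigenvectors t) = UNIV) \<and> (\<forall>s\<in>A. \<forall>t\<in>A. \<forall>v. s *v (t *v v) = t *v (s *v v))"

lemma hyperbolic_complement_invariant: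
  assumes "skw t" "\<And>i. i \<in> {1..r} \<Longrightarrow> E i \<in> eigenvectors t \<and> F i \<in> eigenvectors t" "z \<in> hyperbolic_complement r E F"
  shows "t *v z \<in> hyperbolic_complement r E F"
proof -
  have "fm u (t *v z) = 0" if "u \<in> eigenvectors t" "fm u z = 0" for u
  proof -
    have "fm u (t *v z) = - fm (t *v u) z" using skwD[OF assms(1), of u z] by simp
    then show ?thesis using that by (auto simp: eigenvectors_def)
  qed
  then show ?thesis using assms(2,3) by (auto simp: hyperbolic_complement_def)
qed

lemma hyperbolic_complement_span_common_eigenvector:
  assumes A: "diag_family A" and ev: "\<And>i. i \<in> {1..r} \<Longrightarrow> common_eigenvector A (E i) \<and> common_eigenvector A (F i)"
  shows "hyperbolic_complement r E F \<subseteq> span {v\<in>hyperbolic_complement r E F. common_eigenvector A v}"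
proof (rule commuting_diagonalizable[OF _ _ subspace_hyperbolic_complement])
  fix t w assume t: "t \<in> A" and w: "w \<in> hyperbolic_complement r E F"
  show "t *v w \<in> hyperbolic_complement r E F"
    by (rule hyperbolic_complement_invariant[OF _ _ w]) (use A ev t in \<open>auto simp: diag_family_def common_eigenvector_def\<close>)
qed (use A in \<open>auto simp: diag_family_def\<close>)

text \<open>If some member acts non-trivially on the complement, a common eigenvector with non-zero
  eigenvalue is isotropic and pairs with another common eigenvector, necessarily of opposite
  eigenvalue and hence isotropic too. Otherwise the family kills the complement, which is indefinite
  by counting dimensions, and any hyperbolic pair in it will do.\<close>

lemma hyperbolic_extend_step:
  fixes E F :: "nat \<Rightarrow> ('p::finite, 'q::finite) rvec"
  assumes A: "diag_family A" and h: "hyperbolic r E F" and ev: "\<And>i. i \<in> {1..r} \<Longrightarrow> common_eigenvector A (E i) \<and> common_eigenvector A (F i)"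
    and r: "r < CARD('p)" and pq: "CARD('p) < CARD('q)"
  shows "\<exists>e f. e \<in> hyperbolic_complement r E F \<and> f \<in> hyperbolic_complement r E F \<and> fm e e = 0 \<and> fm f f = 0 \<and> fm e f = 1 \<and> common_eigenvector A e \<and> common_eigenvector A f"
proof -
  let ?W = "hyperbolic_complement r E F"
  note sW = subspace_hyperbolic_complement[of r E F]
  have sp: "?W \<subseteq> span {v\<in>?W. common_eigenvector A v}" using ev by (rule hyperbolic_complement_span_common_eigenvector[OF A])
  have iso: "fm v v = 0" if "t \<in> A" "t *v v = m *\<^sub>R v" "m \<noteq> 0" for t v m
  proof -
    have "skw t" using A that by (simp add: diag_family_def)
    then show ?thesis using fm_skw_self[of t v] that by simp
  qed
  show ?thesis
  proof (cases "\<exists>e\<in>?W. common_eigenvector A e \<and> (\<exists>t\<in>A. t *v e \<noteq> 0)")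
    case True
    then obtain e t where e: "e \<in> ?W" "common_eigenvector A e" "t \<in> A" "t *v e \<noteq> 0" by blast
    then obtain m where m: "t *v e = m *\<^sub>R e" "m \<noteq> 0" by (auto simp: common_eigenvector_def eigenvectors_def)
    have e0: "e \<noteq> 0" using e by auto
    obtain w where w: "w \<in> ?W" "fm e w = 1" using hyperbolic_complement_nondegenerate[OF h e(1) e0] .
    have "\<exists>f\<in>?W. common_eigenvector A f \<and> fm e f \<noteq> 0"
    proof (rule ccontr)
      assume no: "\<not> ?thesis"
      have "w \<in> span {v\<in>?W. common_eigenvector A v}" using sp w by blast
      then have "fm e w = 0"
        by (induction rule: span_induct) (use no in \<open>auto simp: subspace_def\<close>)
      then show False using w by simp
    qed
    then obtain f where f: "f \<in> ?W" "common_eigenvector A f" "fm e f \<noteq> 0" by blast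
    obtain k where k: "t *v f = k *\<^sub>R f" using f e(3) by (auto simp: common_eigenvector_def eigenvectors_def)
    have "skw t" using A e by (simp add: diag_family_def)
    then have "m * fm e f = - (k * fm e f)" using skwD[of t e f] m k by simp
    then have "(m + k) * fm e f = 0" by (simp add: algebra_simps)
    then have "k \<noteq> 0" using f m by auto
    then have "fm f f = 0" "fm e e = 0" using iso e(3) k m by blast+
    moreover have "(1 / fm e f) *\<^sub>R f \<in> ?W" using f sW by (simp add: subspace_scale)
    moreover have "common_eigenvector A ((1 / fm e f) *\<^sub>R f)" using f(2) by (auto simp: common_eigenvector_def eigenvectors_def matrix_vector_mult_scaleR mult.commute)
    ultimately show ?thesis using e f by (intro exI[of _ e] exI[of _ "(1 / fm e f) *\<^sub>R f"]) simp
  next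
    case False
    have kill: "t *v w = 0" if t: "t \<in> A" and w: "w \<in> ?W" for t w
    proof -
      have "w \<in> span {v\<in>?W. common_eigenvector A v}" using sp w by blast
      then show ?thesis
        by (induction rule: span_induct) (use False t in \<open>auto simp: subspace_def matrix_vector_right_distrib matrix_vector_mult_scaleR\<close>)
    qed
    then have common_eigenvector: "common_eigenvector A w" if "w \<in> ?W" for w using that by (auto simp: common_eigenvector_def eigenvectors_def intro: exI[of _ 0])
    have d: "CARD('p) + CARD('q) \<le> dim ?W + 2 * r" by (rule dim_hyperbolic_complement_ge)
    have "\<exists>x\<in>?W. 0 < fm x x"
    proof (rule ccontr)
      assume "\<not> ?thesis"
      then have "r + dim ?W \<le> CARD('q)" using hyperbolic_nonpos_dim[OF h sW subset_refl] by force
      then show False using d r by linarith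
    qed
    then obtain x where x: "x \<in> ?W" "0 < fm x x" by blast
    have "\<exists>y\<in>?W. fm y y < 0"
    proof (rule ccontr)
      assume "\<not> ?thesis"
      then have "r + dim ?W \<le> CARD('p)" using hyperbolic_nonneg_dim[OF h sW subset_refl] by force
      then show False using d r pq by linarith
    qed
    then obtain y where y: "y \<in> ?W" "fm y y < 0" by blast
    obtain s where s: "fm (x + s *\<^sub>R y) (x + s *\<^sub>R y) = 0" "x + s *\<^sub>R y \<noteq> 0" using isotropic_between[OF x(2) y(2)] .
    define e where "e = x + s *\<^sub>R y"
    have e: "e \<in> ?W" "fm e e = 0" "e \<noteq> 0" using s x y sW by (auto simp: e_def subspace_add subspace_scale)
    obtain w where w: "w \<in> ?W" "fm e w = 1" using hyperbolic_complement_nondegenerate[OF h e(1,3)] .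
    define f where "f = w - (fm w w / 2) *\<^sub>R e"
    have f: "f \<in> ?W" "fm e f = 1" "fm f f = 0"
      using w e sW fm_sym[of w e] by (simp_all add: f_def subspace_diff subspace_scale)
    then show ?thesis using e common_eigenvector by blast
  qed
qed

text \<open>For \<open>A = {}\<close> this completes a hyperbolic system as in Witt's theorem; for a
  split abelian family the added pairs are also common eigenvectors.\<close>

lemma hyperbolic_extend:
  fixes E F :: "nat \<Rightarrow> ('p::finite, 'q::finite) rvec"
  assumes A: "diag_family A" and pq: "CARD('p) < CARD('q)"
    and "hyperbolic r E F" "\<And>i. i \<in> {1..r} \<Longrightarrow> common_eigenvector A (E i) \<and> common_eigenvector A (F i)" "r \<le> CARD('p)"
  shows "\<exists>E' F'. hyperbolic CARD('p) E' F' \<and> (\<forall>i\<in>{1..r}. E' i = E i \<and> F' i = F i) \<and>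
    (\<forall>i\<in>{1..CARD('p)}. common_eigenvector A (E' i) \<and> common_eigenvector A (F' i))"
  using assms(3-5)
proof (induction "CARD('p) - r" arbitrary: r E F)
  case 0
  then have "r = CARD('p)" by simp
  then show ?case using 0 by blast
next
  case (Suc k)
  then have r: "r < CARD('p)" by simp
  obtain e f where ef: "e \<in> hyperbolic_complement r E F" "f \<in> hyperbolic_complement r E F" "fm e e = 0" "fm f f = 0" "fm e f = 1" "common_eigenvector A e" "common_eigenvector A f"
    using hyperbolic_extend_step[OF A Suc.prems(1,2) r pq] by blast
  let ?E = "E(Suc r := e)" and ?F = "F(Suc r := f)"
  have h: "hyperbolic (Suc r) ?E ?F"
    unfolding hyperbolic_def
  proof (intro ballI)
    fix i j assume i: "i \<in> {1..Suc r}" and j: "j \<in> {1..Suc r}"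
    have o: "fm (E i) e = 0 \<and> fm (F i) e = 0 \<and> fm (E i) f = 0 \<and> fm (F i) f = 0" if "i \<in> {1..r}" for i
      using ef that by (auto simp: hyperbolic_complement_def)
    have o': "fm e (E i) = 0 \<and> fm e (F i) = 0 \<and> fm f (E i) = 0 \<and> fm f (F i) = 0" if "i \<in> {1..r}" for i
      using o[OF that] by (simp add: fm_sym)
    consider "i \<in> {1..r}" "j \<in> {1..r}" | "i = Suc r" "j \<in> {1..r}" | "i \<in> {1..r}" "j = Suc r" | "i = Suc r" "j = Suc r"
      using i j by (metis atLeastAtMost_iff le_SucE)
    then show "fm (?E i) (?E j) = 0 \<and> fm (?F i) (?F j) = 0 \<and> fm (?E i) (?F j) = (if i = j then 1 else 0)"
      by cases (use o o' ef Suc.prems(1) in \<open>auto simp: hyperbolic_def\<close>)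
  qed
  have "\<exists>E' F'. hyperbolic CARD('p) E' F' \<and> (\<forall>i\<in>{1..Suc r}. E' i = ?E i \<and> F' i = ?F i) \<and>
    (\<forall>i\<in>{1..CARD('p)}. common_eigenvector A (E' i) \<and> common_eigenvector A (F' i))"
  proof (rule Suc.hyps(1)[OF _ h])
    show "k = CARD('p) - Suc r" using Suc.hyps(2) by simp
    show "common_eigenvector A (?E i) \<and> common_eigenvector A (?F i)" if "i \<in> {1..Suc r}" for i
      using that Suc.prems(2)[of i] ef by (cases "i = Suc r") auto
    show "Suc r \<le> CARD('p)" using r by simp
  qed
  then obtain E' F' where 1: "hyperbolic CARD('p) E' F'" "\<forall>i\<in>{1..Suc r}. E' i = ?E i \<and> F' i = ?F i"
    "\<forall>i\<in>{1..CARD('p)}. common_eigenvector A (E' i) \<and> common_eigenvector A (F' i)" by blast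
  have "E' i = E i \<and> F' i = F i" if "i \<in> {1..r}" for i
    using bspec[OF 1(2), of i] that by auto
  then show ?case using 1(1,3) by blast
qed

text \<open>A non-zero vector of the complement with non-negative square would span, with the p
  isotropic vectors \<open>E i\<close>, a non-negative subspace of dimension p + 1.\<close>

lemma hyperbolic_complement_negative_definite:
  fixes E F :: "nat \<Rightarrow> ('p::finite, 'q::finite) rvec"
  assumes h: "hyperbolic CARD('p) E F"
  shows "z \<in> hyperbolic_complement CARD('p) E F \<Longrightarrow> z \<noteq> 0 \<Longrightarrow> fm z z < 0"
    and "dim (hyperbolic_complement CARD('p) E F) = CARD('q) - CARD('p)"
proof -
  let ?W = "hyperbolic_complement CARD('p) E F"
  show neg: "fm z z < 0" if z: "z \<in> ?W" "z \<noteq> 0" for z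
  proof (rule ccontr)
    assume "\<not> ?thesis"
    then have coroot_scale: "0 \<le> fm y y" if "y \<in> span {z}" for y using that
      by (auto simp: span_singleton mult.assoc[symmetric] intro!: mult_nonneg_nonneg)
    have "span {z} \<subseteq> ?W" using z by (intro span_minimal[OF _ subspace_hyperbolic_complement]) simp
    then have "CARD('p) + dim (span {z}) \<le> CARD('p)" using hyperbolic_nonneg_dim[OF h subspace_span _ coroot_scale] by blast
    moreover have "dim (span {z}) = 1" using z by (simp add: dim_insert)
    ultimately show False by simp
  qed
  have "fm z z \<le> 0" if "z \<in> ?W" for z using neg[OF that] by (cases "z = 0") auto
  then have "CARD('p) + dim ?W \<le> CARD('q)" using hyperbolic_nonpos_dim[OF h subspace_hyperbolic_complement subset_refl] by blast
  then show "dim ?W = CARD('q) - CARD('p)" using dim_hyperbolic_complement_ge[of "CARD('p)" E F] by linarith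
qed

text \<open>Dual vectors \<open>G j\<close> become isotropic and mutually orthogonal after
  subtracting half of their Gram matrix applied to the \<open>U i\<close>; the isotropic
  \<open>U i\<close> do not notice the correction.\<close>

lemma isotropic_basis_hyperbolic:
  fixes U :: "nat \<Rightarrow> ('p::finite, 'q::finite) rvec"
  assumes inj: "inj_on U {1..r}" and ind: "independent (U ` {1..r})"
    and iso: "\<And>i j. i \<in> {1..r} \<Longrightarrow> j \<in> {1..r} \<Longrightarrow> fm (U i) (U j) = 0"
  obtains F where "hyperbolic r U F"
proof -
  obtain G where G: "\<And>i j. i \<in> {1..r} \<Longrightarrow> j \<in> {1..r} \<Longrightarrow> fm (U i) (G j) = (if i = j then 1 else 0)"
    using dual_vectors[OF inj ind] by blast
  define S where "S j = (\<Sum>i\<in>{1..r}. (fm (G j) (G i) / 2) *\<^sub>R U i)" for j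
  have US: "fm (U i) (S j) = 0" if "i \<in> {1..r}" for i j
    using that iso by (simp add: S_def fm_sum_right)
  have GS: "fm (G m) (S j) = fm (G j) (G m) / 2" if "m \<in> {1..r}" "j \<in> {1..r}" for m j
  proof -
    have "fm (G m) (S j) = (\<Sum>i\<in>{1..r}. if i = m then fm (G j) (G m) / 2 else 0)"
      unfolding S_def fm_sum_right using that G by (intro sum.cong) (auto simp: fm_sym[of "G m"])
    then show ?thesis using that by simp
  qed
  have SS: "fm (S i) (S j) = 0" for i j
    unfolding S_def[of i] by (simp add: fm_sum_left US)
  have "hyperbolic r U (\<lambda>j. G j - S j)"
    unfolding hyperbolic_def
  proof (intro ballI conjI)
    fix i j assume i: "i \<in> {1..r}" and j: "j \<in> {1..r}"
    show "fm (U i) (U j) = 0" using iso i j .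
    show "fm (G i - S i) (G j - S j) = 0"
      using GS[OF i j] GS[OF j i] SS by (simp add: fm_sym[of "S i" "G j"] fm_sym[of "G j" "G i"])
    show "fm (U i) (G j - S j) = (if i = j then 1 else 0)" using G[OF i j] US[OF i] by simp
  qed
  then show ?thesis using that by blast
qed

section \<open>Commuting rotations of a definite space\<close>

definition rotates :: "('p::finite, 'q::finite) rmat set \<Rightarrow> ('p, 'q) rvec \<Rightarrow> ('p, 'q) rvec \<Rightarrow> bool" where
  "rotates H c d \<longleftrightarrow> (\<forall>x\<in>H. \<exists>s. x *v c = s *\<^sub>R d \<and> x *v d = (- s) *\<^sub>R c)"

definition commuting_skew_on :: "('p::finite, 'q::finite) rmat set \<Rightarrow> ('p, 'q) rvec set \<Rightarrow> bool" where
  "commuting_skew_on H W \<longleftrightarrow> subspace W \<and> (\<forall>z\<in>W. z \<noteq> 0 \<longrightarrow> fm z z < 0) \<and>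
     (\<forall>x\<in>H. skw x \<and> (\<forall>z\<in>W. x *v z \<in> W)) \<and> (\<forall>x\<in>H. \<forall>y\<in>H. \<forall>z\<in>W. x *v (y *v z) = y *v (x *v z))"

text \<open>On a definite space a skew operator has no non-zero real eigenvalue, but the product of
  two commuting skew operators is symmetric. Eigenvectors of all products therefore take the place
  of common eigenvectors.\<close>

definition product_eigenvector :: "('p::finite, 'q::finite) rmat set \<Rightarrow> ('p, 'q) rvec \<Rightarrow> bool" where
  "product_eigenvector H w \<longleftrightarrow> (\<forall>x\<in>H. \<forall>y\<in>H. \<exists>l. x *v (y *v w) = l *\<^sub>R w)"

lemma normalize_negative:
  fixes z :: "('p::finite, 'q::finite) rvec"
  assumes "fm z z < 0"
  shows "fm ((1 / sqrt (- fm z z)) *\<^sub>R z) ((1 / sqrt (- fm z z)) *\<^sub>R z) = -1"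
proof -
  have "sqrt (- fm z z) * sqrt (- fm z z) = - fm z z" using assms by simp
  then show ?thesis using assms by (simp add: field_simps)
qed

lemma commuting_skew_product_eigenvector:
  fixes H :: "('p::finite, 'q::finite) rmat set"
  assumes H: "commuting_skew_on H W" and ne: "W \<noteq> {0}"
  obtains w where "w \<in> W" "w \<noteq> 0" "product_eigenvector H w"
proof -
  have sW: "subspace W" and neg: "\<And>z. z \<in> W \<Longrightarrow> z \<noteq> 0 \<Longrightarrow> fm z z < 0"
    and inv: "\<And>x z. x \<in> H \<Longrightarrow> z \<in> W \<Longrightarrow> x *v z \<in> W" and sk: "\<And>x. x \<in> H \<Longrightarrow> skw x"
    and comm: "\<And>x y z. x \<in> H \<Longrightarrow> y \<in> H \<Longrightarrow> z \<in> W \<Longrightarrow> x *v (y *v z) = y *v (x *v z)"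
    using H by (auto simp: commuting_skew_on_def)
  let ?F = "{\<lambda>v. x *v (y *v v) | x y. x \<in> H \<and> y \<in> H}"
  have "\<exists>x\<in>W. x \<noteq> 0 \<and> (\<forall>f\<in>?F. \<exists>l. f x = l *\<^sub>R x)"
  proof (rule symmetric_family_eigenvector[OF sW ne, of "\<lambda>u v. - fm u v"])
    show "bilinear (\<lambda>u v :: ('p, 'q) rvec. - fm u v)" by (auto simp: bilinear_def intro!: linearI)
    show "- fm x y = - fm y x" for x y :: "('p, 'q) rvec" by (simp add: fm_sym)
    show "0 < - fm x x" if "x \<in> W" "x \<noteq> 0" for x using neg[OF that] by simp
    show "linear f" if "f \<in> ?F" for f
      using that by (auto intro!: linearI simp: matrix_vector_right_distrib matrix_vector_mult_scaleR)
    show "f z \<in> W" if "f \<in> ?F" "z \<in> W" for f z using that inv by blast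
    show "- fm (f u) v = - fm u (f v)" if f: "f \<in> ?F" and u: "u \<in> W" and v: "v \<in> W" for f u v
    proof -
      obtain x y where xy: "f = (\<lambda>v. x *v (y *v v))" "x \<in> H" "y \<in> H" using f by blast
      have "fm (x *v (y *v u)) v = fm u (y *v (x *v v))"
        using skwD[OF sk[OF xy(2)], of "y *v u" v] skwD[OF sk[OF xy(3)], of u "x *v v"] by simp
      then show ?thesis using xy comm[OF xy(2,3) v] by simp
    qed
    show "f (h z) = h (f z)" if f: "f \<in> ?F" and h: "h \<in> ?F" and z: "z \<in> W" for f h z
    proof -
      obtain x y where xy: "f = (\<lambda>v. x *v (y *v v))" "x \<in> H" "y \<in> H" using f by blast
      obtain x' y' where xy': "h = (\<lambda>v. x' *v (y' *v v))" "x' \<in> H" "y' \<in> H" using h by blast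
      note i = inv[OF xy'(3) z] inv[OF xy(3) z] inv[OF xy'(2) z] inv[OF xy(2) z]
      have "f (h z) = x *v (x' *v (y *v (y' *v z)))" using comm[OF xy(3) xy'(2) i(1)] xy xy' by simp
      also have "\<dots> = x *v (x' *v (y' *v (y *v z)))" using comm[OF xy(3) xy'(3) z] by simp
      also have "\<dots> = x' *v (x *v (y' *v (y *v z)))" using comm[OF xy(2) xy'(2) inv[OF xy'(3) i(2)]] by simp
      also have "\<dots> = x' *v (y' *v (x *v (y *v z)))" using comm[OF xy(2) xy'(3) i(2)] by simp
      finally show ?thesis using xy xy' by simp
    qed
  qed
  then obtain w where w: "w \<in> W" "w \<noteq> 0" "\<forall>f\<in>?F. \<exists>l. f w = l *\<^sub>R w" by blast
  have "product_eigenvector H w" unfolding product_eigenvector_def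
  proof (intro ballI)
    fix x y assume "x \<in> H" "y \<in> H"
    then have "(\<lambda>v. x *v (y *v v)) \<in> ?F" by blast
    from bspec[OF w(3) this] show "\<exists>l. x *v (y *v w) = l *\<^sub>R w" .
  qed
  then show ?thesis using that w by blast
qed

text \<open>The plane is that of \<open>w\<close> and \<open>x *v w\<close>. With
  \<open>e = x *v c\<close>, each \<open>y\<close> in \<open>H\<close> maps \<open>e\<close> to a
  multiple of \<open>c\<close>, as \<open>y x\<close> is a product. Since \<open>x *v e\<close> is a
  non-zero multiple of \<open>c\<close>, commuting \<open>y\<close> with \<open>x\<close> shows that
  \<open>y\<close> maps \<open>c\<close> to a multiple of \<open>e\<close>.\<close>

lemma plane_from_product_eigenvector:
  fixes H :: "('p::finite, 'q::finite) rmat set"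
  assumes H: "commuting_skew_on H W" and w: "w \<in> W" "w \<noteq> 0" "product_eigenvector H w" and x: "x \<in> H" "x *v w \<noteq> 0"
  obtains c d where "c \<in> W" "d \<in> W" "fm c c = -1" "fm d d = -1" "fm c d = 0" "rotates H c d"
proof -
  have sW: "subspace W" and neg: "\<And>z. z \<in> W \<Longrightarrow> z \<noteq> 0 \<Longrightarrow> fm z z < 0"
    and inv: "\<And>x z. x \<in> H \<Longrightarrow> z \<in> W \<Longrightarrow> x *v z \<in> W" and sk: "\<And>x. x \<in> H \<Longrightarrow> skw x"
    and comm: "\<And>x y z. x \<in> H \<Longrightarrow> y \<in> H \<Longrightarrow> z \<in> W \<Longrightarrow> x *v (y *v z) = y *v (x *v z)"
    using H by (auto simp: commuting_skew_on_def)
  define c where "c = (1 / sqrt (- fm w w)) *\<^sub>R w"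
  have wn: "fm w w < 0" using neg w by blast
  have c: "c \<in> W" "fm c c = -1" using normalize_negative[OF wn] w sW by (simp_all add: c_def subspace_scale)
  define e where "e = x *v c"
  have "e = (1 / sqrt (- fm w w)) *\<^sub>R (x *v w)" by (simp add: e_def c_def matrix_vector_mult_scaleR)
  then have e: "e \<in> W" "e \<noteq> 0" using x inv[OF x(1) w(1)] wn sW by (auto simp: subspace_scale)
  have pc: "\<exists>l. y *v (z *v c) = l *\<^sub>R c" if "y \<in> H" "z \<in> H" for y z
  proof -
    obtain l where "y *v (z *v w) = l *\<^sub>R w" using w(3) \<open>y \<in> H\<close> \<open>z \<in> H\<close> unfolding product_eigenvector_def by blast
    then show ?thesis by (intro exI[of _ l]) (simp add: c_def matrix_vector_mult_scaleR)
  qed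
  define k where "k = - fm e e"
  have k: "0 < k" using neg[OF e] by (simp add: k_def)
  obtain l0 where l0: "x *v e = l0 *\<^sub>R c" using pc[OF x(1) x(1)] by (auto simp: e_def)
  have "fm e e = - fm c (x *v e)" using skwD[OF sk[OF x(1)], of c e] by (simp add: e_def)
  then have "l0 = - k" using l0 c by (simp add: k_def)
  then have xe: "x *v e = (- k) *\<^sub>R c" using l0 by simp
  define d where "d = (1 / sqrt k) *\<^sub>R e"
  have d: "d \<in> W" "fm d d = -1" using normalize_negative[OF neg[OF e]] e sW by (simp_all add: d_def k_def subspace_scale)
  have cd: "fm c d = 0" using fm_skw_self[OF sk[OF x(1)], of c] by (simp add: d_def e_def fm_sym[of c])
  have sq: "sqrt k * sqrt k = k" "sqrt k \<noteq> 0" using k by simp_all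
  have "rotates H c d" unfolding rotates_def
  proof
    fix y assume y: "y \<in> H"
    obtain l where l: "y *v e = l *\<^sub>R c" using pc[OF y x(1)] by (auto simp: e_def)
    have "(- k) *\<^sub>R (y *v c) = y *v (x *v e)" by (simp add: xe matrix_vector_mult_scaleR)
    also have "\<dots> = x *v (y *v e)" using comm[OF y x(1) e(1)] .
    also have "\<dots> = l *\<^sub>R e" unfolding l matrix_vector_mult_scaleR by (simp only: e_def)
    finally have "(- 1 / k) *\<^sub>R ((- k) *\<^sub>R (y *v c)) = (- 1 / k) *\<^sub>R (l *\<^sub>R e)" by simp
    then have "y *v c = (- l / k) *\<^sub>R e" using k by simp
    also have "\<dots> = (- l / sqrt k) *\<^sub>R d" using sq by (simp add: d_def)
    finally have "y *v c = (- l / sqrt k) *\<^sub>R d" .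
    moreover have "y *v d = (- (- l / sqrt k)) *\<^sub>R c" by (simp add: d_def matrix_vector_mult_scaleR l)
    ultimately show "\<exists>s. y *v c = s *\<^sub>R d \<and> y *v d = (- s) *\<^sub>R c" by blast
  qed
  then show ?thesis using that c d cd by blast
qed

text \<open>If \<open>H\<close> kills the first product eigenvector, a second one is sought in its
  orthogonal complement; if that is killed too, the two span a plane rotated with speed
  zero.\<close>

lemma exists_plane:
  fixes H :: "('p::finite, 'q::finite) rmat set"
  assumes H: "commuting_skew_on H W" and d: "2 \<le> dim W"
  obtains c d where "c \<in> W" "d \<in> W" "fm c c = -1" "fm d d = -1" "fm c d = 0" "rotates H c d"
proof -
  have sW: "subspace W" and neg: "\<And>z. z \<in> W \<Longrightarrow> z \<noteq> 0 \<Longrightarrow> fm z z < 0"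
    and sk: "\<And>x. x \<in> H \<Longrightarrow> skw x" using H by (auto simp: commuting_skew_on_def)
  have "W \<noteq> {0}" using d by auto
  then obtain w where w: "w \<in> W" "w \<noteq> 0" "product_eigenvector H w" using commuting_skew_product_eigenvector[OF H] by blast
  show ?thesis
  proof (cases "\<exists>x\<in>H. x *v w \<noteq> 0")
    case True
    then show ?thesis using plane_from_product_eigenvector[OF H w] that by blast
  next
    case kw: False
    let ?V = "{z\<in>W. fm w z = 0}"
    have V: "commuting_skew_on H ?V"
      unfolding commuting_skew_on_def
    proof (intro conjI ballI impI)
      show "subspace ?V" using sW by (auto simp: subspace_def)
      show "x *v z \<in> ?V" if "x \<in> H" "z \<in> ?V" for x z
        using that H kw skwD[OF sk[OF that(1)], of w z] by (auto simp: commuting_skew_on_def)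
    qed (use H in \<open>auto simp: commuting_skew_on_def\<close>)
    obtain v where "v \<in> W" "v \<noteq> 0" "fm w v = 0"
      using exists_in_kernel[OF sW, of "{w}" fm] d by (auto simp: linear_fm)
    then have "?V \<noteq> {0}" by blast
    then obtain w' where w': "w' \<in> ?V" "w' \<noteq> 0" "product_eigenvector H w'" using commuting_skew_product_eigenvector[OF V] by blast
    show ?thesis
    proof (cases "\<exists>x\<in>H. x *v w' \<noteq> 0")
      case True
      then obtain x where "x \<in> H" "x *v w' \<noteq> 0" by blast
      then obtain c d where "c \<in> ?V" "d \<in> ?V" "fm c c = -1" "fm d d = -1" "fm c d = 0" "rotates H c d"
        using plane_from_product_eigenvector[OF V w'] by blast
      then show ?thesis using that by blast
    next
      case False
      let ?c = "(1 / sqrt (- fm w w)) *\<^sub>R w" and ?d = "(1 / sqrt (- fm w' w')) *\<^sub>R w'"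
      have "rotates H ?c ?d" unfolding rotates_def
        using False kw by (auto simp: matrix_vector_mult_scaleR intro!: exI[of _ 0])
      moreover have "fm w w < 0" "fm w' w' < 0" using neg w w' by auto
      note normalize_negative[OF this(1)] normalize_negative[OF this(2)]
      moreover have "?c \<in> W" "?d \<in> W" "fm ?c ?d = 0" using w w' sW by (auto simp: subspace_scale)
      ultimately show ?thesis using that by blast
    qed
  qed
qed

text \<open>Planes are split off until one dimension is left; a skew operator that preserves a
  definite line kills it.\<close>

lemma rotation_basis:
  fixes H :: "('p::finite, 'q::finite) rmat set"
  assumes "commuting_skew_on H W" "dim W = 2 * m + 1"
  shows "\<exists>c d w. (\<forall>i\<in>{1..m}. c i \<in> W \<and> d i \<in> W \<and> rotates H (c i) (d i) \<and> fm w (c i) = 0 \<and> fm w (d i) = 0) \<and>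
    (\<forall>i\<in>{1..m}. \<forall>j\<in>{1..m}. fm (c i) (c j) = (if i = j then -1 else 0) \<and> fm (d i) (d j) = (if i = j then -1 else 0)
       \<and> fm (c i) (d j) = 0) \<and> w \<in> W \<and> fm w w = -1 \<and> (\<forall>x\<in>H. x *v w = 0)"
  using assms
proof (induction m arbitrary: W)
  case 0
  have sW: "subspace W" and neg: "\<And>z. z \<in> W \<Longrightarrow> z \<noteq> 0 \<Longrightarrow> fm z z < 0"
    and inv: "\<And>x z. x \<in> H \<Longrightarrow> z \<in> W \<Longrightarrow> x *v z \<in> W" and sk: "\<And>x. x \<in> H \<Longrightarrow> skw x"
    using 0 by (auto simp: commuting_skew_on_def)
  have "W \<noteq> {0}" using 0(2) by auto
  then obtain z where z: "z \<in> W" "z \<noteq> 0" using subspace_0[OF sW] by blast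
  let ?w = "(1 / sqrt (- fm z z)) *\<^sub>R z"
  have w: "?w \<in> W" "fm ?w ?w = -1" using z normalize_negative[OF neg[OF z]] sW by (auto simp: subspace_scale)
  have "dim {z} = 1" using z by (simp add: dim_insert)
  then have W: "W = span {z}" using 0(2) z sW by (metis One_nat_def add_0 dim_eq_span empty_subsetI insert_subset mult_0_right order_refl span_eq_iff)
  have "x *v ?w = 0" if x: "x \<in> H" for x
  proof -
    obtain k where k: "x *v z = k *\<^sub>R z" using inv[OF x z(1)] W by (auto simp: span_singleton)
    have "k * fm z z = 0" using fm_skw_self[OF sk[OF x], of z] k by simp
    then have "k = 0" using neg[OF z] by simp
    then show ?thesis using k by (simp add: matrix_vector_mult_scaleR)
  qed
  then show ?case using w by (intro exI[of _ "\<lambda>_. 0"] exI[of _ ?w]) simp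
next
  case (Suc m)
  have sW: "subspace W" and neg: "\<And>z. z \<in> W \<Longrightarrow> z \<noteq> 0 \<Longrightarrow> fm z z < 0"
    and inv: "\<And>x z. x \<in> H \<Longrightarrow> z \<in> W \<Longrightarrow> x *v z \<in> W" and sk: "\<And>x. x \<in> H \<Longrightarrow> skw x"
    using Suc.prems(1) by (auto simp: commuting_skew_on_def)
  have "2 \<le> dim W" using Suc.prems(2) by simp
  then obtain c0 d0 where cd: "c0 \<in> W" "d0 \<in> W" "fm c0 c0 = -1" "fm d0 d0 = -1" "fm c0 d0 = 0" "rotates H c0 d0"
    using exists_plane[OF Suc.prems(1)] by blast
  have dc: "fm d0 c0 = 0" using cd fm_sym by metis
  let ?V = "{z\<in>W. fm c0 z = 0 \<and> fm d0 z = 0}"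
  have V: "commuting_skew_on H ?V"
    unfolding commuting_skew_on_def
  proof (intro conjI ballI impI)
    show "subspace ?V" using sW by (auto simp: subspace_def)
    fix x z assume x: "x \<in> H" and z: "z \<in> ?V"
    obtain s where s: "x *v c0 = s *\<^sub>R d0" "x *v d0 = (- s) *\<^sub>R c0" using cd(6) x unfolding rotates_def by blast
    show "x *v z \<in> ?V" using inv[OF x] z skwD[OF sk[OF x], of c0 z] skwD[OF sk[OF x], of d0 z] s by auto
  qed (use Suc.prems(1) in \<open>auto simp: commuting_skew_on_def\<close>)
  have sV: "subspace ?V" using V by (simp add: commuting_skew_on_def)
  have spV: "span ?V = ?V" using sV by (rule span_eq_iff[THEN iffD2])
  have dV: "dim ?V = 2 * m + 1"
  proof (rule antisym)
    have "dim W \<le> dim {z\<in>W. \<forall>i\<in>{c0, d0}. fm i z = 0} + card {c0, d0}"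
      by (rule dim_kernel_ge[OF sW]) (auto simp: linear_fm)
    moreover have "card {c0, d0} \<le> 2" by (simp add: card_insert_if)
    moreover have "{z\<in>W. \<forall>i\<in>{c0, d0}. fm i z = 0} = ?V" by auto
    ultimately show "2 * m + 1 \<le> dim ?V" using Suc.prems(2) by simp
    have "d0 \<notin> span ?V"
    proof
      assume "d0 \<in> span ?V"
      then have "d0 \<in> ?V" unfolding spV .
      then show False using cd by simp
    qed
    then have "dim (insert d0 ?V) = dim ?V + 1" by (simp add: dim_insert)
    moreover have "c0 \<notin> span (insert d0 ?V)"
    proof
      assume "c0 \<in> span (insert d0 ?V)"
      then obtain k where "c0 - k *\<^sub>R d0 \<in> span ?V" by (auto simp: span_insert)
      then have "c0 - k *\<^sub>R d0 \<in> ?V" unfolding spV .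
      then show False using cd by simp
    qed
    ultimately have "dim (insert c0 (insert d0 ?V)) = dim ?V + 2" by (simp add: dim_insert)
    moreover have "dim (insert c0 (insert d0 ?V)) \<le> dim W" using cd by (intro dim_subset) auto
    ultimately show "dim ?V \<le> 2 * m + 1" using Suc.prems(2) by simp
  qed
  obtain c d w where IH: "\<forall>i\<in>{1..m}. c i \<in> ?V \<and> d i \<in> ?V \<and> rotates H (c i) (d i) \<and> fm w (c i) = 0 \<and> fm w (d i) = 0"
    "\<forall>i\<in>{1..m}. \<forall>j\<in>{1..m}. fm (c i) (c j) = (if i = j then -1 else 0) \<and> fm (d i) (d j) = (if i = j then -1 else 0)
       \<and> fm (c i) (d j) = 0" "w \<in> ?V" "fm w w = -1" "\<forall>x\<in>H. x *v w = 0"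
    using Suc.IH[OF V dV] by blast
  let ?c = "c(Suc m := c0)" and ?d = "d(Suc m := d0)"
  have split: "i \<in> {1..m} \<or> i = Suc m" if "i \<in> {1..Suc m}" for i using that by (metis atLeastAtMost_iff le_SucE)
  have o: "fm c0 (c i) = 0 \<and> fm d0 (c i) = 0 \<and> fm c0 (d i) = 0 \<and> fm d0 (d i) = 0" if "i \<in> {1..m}" for i using IH(1) that by auto
  have o': "fm (c i) c0 = 0 \<and> fm (c i) d0 = 0 \<and> fm (d i) c0 = 0 \<and> fm (d i) d0 = 0" if "i \<in> {1..m}" for i
    using o[OF that] by (simp add: fm_sym)
  have ow: "fm w c0 = 0 \<and> fm w d0 = 0" using IH(3) by (simp add: fm_sym[of w])
  have "\<forall>i\<in>{1..Suc m}. ?c i \<in> W \<and> ?d i \<in> W \<and> rotates H (?c i) (?d i) \<and> fm w (?c i) = 0 \<and> fm w (?d i) = 0"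
    using split IH(1) cd ow by fastforce
  moreover have "\<forall>i\<in>{1..Suc m}. \<forall>j\<in>{1..Suc m}. fm (?c i) (?c j) = (if i = j then -1 else 0) \<and>
      fm (?d i) (?d j) = (if i = j then -1 else 0) \<and> fm (?c i) (?d j) = 0"
  proof (intro ballI)
    fix i j assume i: "i \<in> {1..Suc m}" and j: "j \<in> {1..Suc m}"
    have ne: "k \<noteq> Suc m" if "k \<in> {1..m}" for k using that by auto
    show "fm (?c i) (?c j) = (if i = j then -1 else 0) \<and> fm (?d i) (?d j) = (if i = j then -1 else 0) \<and> fm (?c i) (?d j) = 0"
      using split[OF i] split[OF j]
      by (elim disjE) (use IH(2) o o' cd ne in auto)
  qed
  ultimately show ?case using IH(3-5) by (intro exI[of _ ?c] exI[of _ ?d] exI[of _ w]) simp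
qed

section \<open>Adapted bases\<close>

text \<open>The basis vectors are indexed by \<open>{-l..l}\<close>: for \<open>1 \<le> i \<le> p\<close> the vectors with indices \<open>i\<close> and
  \<open>-i\<close> form a hyperbolic pair, and the other vectors are orthogonal of square \<open>-1\<close>.
  The functional dual to \<open>B a\<close> is \<open>dual_sign p a\<close> times the pairing with \<open>B (dual_index p a)\<close>.\<close>

definition idx :: "nat \<Rightarrow> int set" where
  "idx l = {- int l..int l}"

definition dual_index :: "nat \<Rightarrow> int \<Rightarrow> int" where
  "dual_index p a = (if a \<noteq> 0 \<and> \<bar>a\<bar> \<le> int p then - a else a)"

definition dual_sign :: "nat \<Rightarrow> int \<Rightarrow> real" where
  "dual_sign p a = (if a \<noteq> 0 \<and> \<bar>a\<bar> \<le> int p then 1 else -1)"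

definition adapted :: "nat \<Rightarrow> (int \<Rightarrow> ('p::finite, 'q::finite) rvec) \<Rightarrow> bool" where
  "adapted l B \<longleftrightarrow> (\<forall>a\<in>idx l. \<forall>b\<in>idx l. fm (B a) (B b) = (if b = dual_index CARD('p) a then dual_sign CARD('p) a else 0))"

definition dual_coeff :: "(int \<Rightarrow> ('p::finite, 'q::finite) rvec) \<Rightarrow> int \<Rightarrow> ('p, 'q) rvec \<Rightarrow> real" where
  "dual_coeff B a z = dual_sign CARD('p) a * fm (B (dual_index CARD('p) a)) z"

lemma finite_idx [simp]: "finite (idx l)" and card_idx: "card (idx l) = 2 * l + 1"
  by (simp_all add: idx_def nat_add_distrib)

lemma dual_index_dual_index [simp]: "dual_index p (dual_index p a) = a" and dual_sign_dual_index [simp]: "dual_sign p (dual_index p a) = dual_sign p a"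
  and dual_sign_dual_sign [simp]: "dual_sign p a * dual_sign p a = 1" and dual_index_idx [simp]: "dual_index p a \<in> idx l \<longleftrightarrow> a \<in> idx l"
  by (auto simp: dual_index_def dual_sign_def idx_def)

lemma linear_dual_coeff: "linear (dual_coeff B a)"
  by (rule linearI) (simp_all add: dual_coeff_def algebra_simps)

lemma dual_coeff_basis:
  assumes "adapted l B" "a \<in> idx l" "b \<in> idx l" shows "dual_coeff B a (B b) = (if a = b then 1 else 0)"
  using assms by (auto simp: dual_coeff_def adapted_def)

lemma adapted_span:
  fixes B :: "int \<Rightarrow> ('p::finite, 'q::finite) rvec"
  assumes B: "adapted l B" and n: "CARD('p) + CARD('q) = 2 * l + 1"
  shows "span (B ` idx l) = UNIV"
proof -
  have "dim (span (B ` idx l)) = card (idx l)"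
    by (rule dual_family_independent(3)[where \<phi> = "dual_coeff B"]) (auto simp: linear_dual_coeff dual_coeff_basis[OF B])
  then have "dim (span (B ` idx l)) = DIM(('p, 'q) rvec)" using n card_idx by simp
  then show ?thesis by (metis dim_eq_full span_span)
qed

lemma adapted_linear_eqI:
  fixes B :: "int \<Rightarrow> ('p::finite, 'q::finite) rvec"
  assumes B: "adapted l B" and n: "CARD('p) + CARD('q) = 2 * l + 1"
    and "linear f" "linear g" "\<And>a. a \<in> idx l \<Longrightarrow> f (B a) = g (B a)"
  shows "f z = g z"
  by (rule linear_eq_on_span[OF assms(3,4), of "B ` idx l"]) (use assms(5) adapted_span[OF B n] in auto)

lemma adapted_matrix_eqI:
  fixes B :: "int \<Rightarrow> ('p::finite, 'q::finite) rvec"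
  assumes B: "adapted l B" and n: "CARD('p) + CARD('q) = 2 * l + 1"
    and "\<And>a. a \<in> idx l \<Longrightarrow> X *v B a = Y *v B a"
  shows "X = Y"
  by (rule matrix_eqI, rule adapted_linear_eqI[OF B n]) (simp_all add: assms(3))

lemma adapted_expand:
  fixes B :: "int \<Rightarrow> ('p::finite, 'q::finite) rvec"
  assumes B: "adapted l B" and n: "CARD('p) + CARD('q) = 2 * l + 1"
  shows "z = (\<Sum>a\<in>idx l. dual_coeff B a z *\<^sub>R B a)"
proof (rule adapted_linear_eqI[OF B n, where f = "\<lambda>z. z"])
  show "linear (\<lambda>z. \<Sum>a\<in>idx l. dual_coeff B a z *\<^sub>R B a)"
    by (rule linearI) (simp_all add: linear_add[OF linear_dual_coeff] linear_scale[OF linear_dual_coeff] scaleR_left_distrib sum.distrib scaleR_sum_right)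
  fix b assume b: "b \<in> idx l"
  have "(\<Sum>a\<in>idx l. dual_coeff B a (B b) *\<^sub>R B a) = (\<Sum>a\<in>idx l. if a = b then B b else 0)"
    using dual_coeff_basis[OF B _ b] by (intro sum.cong) auto
  then show "B b = (\<Sum>a\<in>idx l. dual_coeff B a (B b) *\<^sub>R B a)" using b by simp
qed (rule linear_ident)

lemma adapted_map:
  fixes B C :: "int \<Rightarrow> ('p::finite, 'q::finite) rvec"
  assumes B: "adapted l B" and n: "CARD('p) + CARD('q) = 2 * l + 1"
  obtains T where "\<And>a. a \<in> idx l \<Longrightarrow> T *v B a = C a"
proof -
  define f where "f z = (\<Sum>a\<in>idx l. dual_coeff B a z *\<^sub>R C a)" for z
  have lin: "linear f" unfolding f_def
    by (rule linearI) (simp_all add: linear_add[OF linear_dual_coeff] linear_scale[OF linear_dual_coeff] scaleR_left_distrib sum.distrib scaleR_sum_right)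
  have "f (B b) = C b" if b: "b \<in> idx l" for b
  proof -
    have "f (B b) = (\<Sum>a\<in>idx l. if a = b then C b else 0)"
      unfolding f_def using dual_coeff_basis[OF B _ b] by (intro sum.cong) auto
    then show ?thesis using b by simp
  qed
  moreover have "matrix f *v z = f z" for z using lin by (simp add: matrix_works linear_matrix_vector_mul_eq)
  ultimately show ?thesis using that[of "matrix f"] by simp
qed

text \<open>Two adapted bases have the same Gram matrix. This is the form in which Witt's theorem is
  used.\<close>

lemma adapted_isometry:
  fixes B C :: "int \<Rightarrow> ('p::finite, 'q::finite) rvec"
  assumes B: "adapted l B" and C: "adapted l C" and n: "CARD('p) + CARD('q) = 2 * l + 1"
  obtains T T' where "T ** T' = mat 1" "T' ** T = mat 1" "\<And>u v. fm (T *v u) (T *v v) = fm u v"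
    "\<And>a. a \<in> idx l \<Longrightarrow> T *v B a = C a" "\<And>a. a \<in> idx l \<Longrightarrow> T' *v C a = B a"
proof -
  obtain T where T: "\<And>a. a \<in> idx l \<Longrightarrow> T *v B a = C a" using adapted_map[OF B n] by blast
  obtain T' where T': "\<And>a. a \<in> idx l \<Longrightarrow> T' *v C a = B a" using adapted_map[OF C n] by blast
  have 1: "T ** T' = mat 1"
    by (rule adapted_matrix_eqI[OF C n]) (simp add: matrix_vector_mul_assoc[symmetric] T T')
  have 2: "T' ** T = mat 1"
    by (rule adapted_matrix_eqI[OF B n]) (simp add: matrix_vector_mul_assoc[symmetric] T T')
  have lin: "linear (\<lambda>z. fm u (T *v z))" "linear (\<lambda>z. fm (T *v z) u)" "linear (\<lambda>z. fm z u)" for u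
    by (auto intro!: linearI simp: matrix_vector_right_distrib matrix_vector_mult_scaleR)
  have s1: "fm (C a) (T *v v) = fm (B a) v" if a: "a \<in> idx l" for a v
    by (rule adapted_linear_eqI[OF B n lin(1) linear_fm])
      (use a B C T in \<open>simp add: adapted_def\<close>)
  have "fm (T *v u) (T *v v) = fm u v" for u v
    by (rule adapted_linear_eqI[OF B n lin(2) lin(3)]) (simp add: T s1)
  then show ?thesis using that 1 2 T T' by blast
qed

text \<open>The complement of p hyperbolic pairs has odd dimension 2 (l - p) + 1, hence consists of
  planes rotated by \<open>H\<close> and a line killed by \<open>H\<close>, which receives the index
  0. With \<open>H = {}\<close> the basis merely extends the pairs.\<close>

lemma adapted_from_hyperbolic:
  fixes E F :: "nat \<Rightarrow> ('p::finite, 'q::finite) rvec"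
  assumes h: "hyperbolic CARD('p) E F" and H: "commuting_skew_on H (hyperbolic_complement CARD('p) E F)"
    and n: "CARD('p) + CARD('q) = 2 * l + 1" and p: "CARD('p) \<le> l"
  obtains B where "adapted l B" "\<And>i. i \<in> {1..CARD('p)} \<Longrightarrow> B (int i) = E i \<and> B (- int i) = F i"
    "\<And>x. x \<in> H \<Longrightarrow> x *v B 0 = 0" "\<And>j. j \<in> {CARD('p) + 1..l} \<Longrightarrow> rotates H (B (int j)) (B (- int j))"
    "\<And>b. b \<in> idx l \<Longrightarrow> b = 0 \<or> int CARD('p) < \<bar>b\<bar> \<Longrightarrow> B b \<in> hyperbolic_complement CARD('p) E F"
proof -
  let ?p = "CARD('p)" and ?W = "hyperbolic_complement CARD('p) E F"
  have dW: "dim ?W = 2 * (l - ?p) + 1" using hyperbolic_complement_negative_definite(2)[OF h] n p by simp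
  obtain c d w where cd: "\<forall>i\<in>{1..l - ?p}. c i \<in> ?W \<and> d i \<in> ?W \<and> rotates H (c i) (d i) \<and> fm w (c i) = 0 \<and> fm w (d i) = 0"
    and g: "\<forall>i\<in>{1..l - ?p}. \<forall>j\<in>{1..l - ?p}. fm (c i) (c j) = (if i = j then -1 else 0) \<and> fm (d i) (d j) = (if i = j then -1 else 0)
       \<and> fm (c i) (d j) = 0" and w: "w \<in> ?W" "fm w w = -1" "\<forall>x\<in>H. x *v w = 0"
    using rotation_basis[OF H dW] by blast
  define B :: "int \<Rightarrow> ('p, 'q) rvec" where "B a = (if a = 0 then w
    else if \<bar>a\<bar> \<le> int ?p then (if 0 < a then E (nat a) else F (nat (- a)))
    else (if 0 < a then c (nat a - ?p) else d (nat (- a) - ?p)))" for a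
  have cs: "a = 0 \<or> (\<exists>i\<in>{1..?p}. a = int i) \<or> (\<exists>i\<in>{1..?p}. a = - int i) \<or>
      (\<exists>i\<in>{1..l - ?p}. a = int (i + ?p)) \<or> (\<exists>i\<in>{1..l - ?p}. a = - int (i + ?p))" if "a \<in> idx l" for a
  proof -
    consider "a = 0" | "0 < a" "a \<le> int ?p" | "a < 0" "- a \<le> int ?p" | "int ?p < a" | "int ?p < - a" by linarith
    then show ?thesis
    proof cases
      case 2
      then have "nat a \<in> {1..?p}" "a = int (nat a)" by auto
      then show ?thesis by blast
    next
      case 3
      then have "nat (- a) \<in> {1..?p}" "a = - int (nat (- a))" by auto
      then show ?thesis by blast
    next
      case 4
      then have "nat a - ?p \<in> {1..l - ?p}" "a = int (nat a - ?p + ?p)" using that by (auto simp: idx_def)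
      then show ?thesis by blast
    next
      case 5
      then have "nat (- a) - ?p \<in> {1..l - ?p}" "a = - int (nat (- a) - ?p + ?p)" using that by (auto simp: idx_def)
      then show ?thesis by blast
    qed simp
  qed
  have B0: "B 0 = w" by (simp add: B_def)
  have BE: "B (int i) = E i" and BF: "B (- int i) = F i" if "i \<in> {1..?p}" for i using that by (auto simp: B_def)
  have Bc: "B (int (i + ?p)) = c i" and Bd: "B (- int (i + ?p)) = d i" if "i \<in> {1..l - ?p}" for i
    using that by (auto simp: B_def nat_add_distrib)
  have o: "fm (E i) z = 0 \<and> fm (F i) z = 0 \<and> fm z (E i) = 0 \<and> fm z (F i) = 0" if "i \<in> {1..?p}" "z \<in> ?W" for i z
    using that by (auto simp: hyperbolic_complement_def fm_sym[of z])
  have dc: "fm (d i) (c j) = 0" if "i \<in> {1..l - ?p}" "j \<in> {1..l - ?p}" for i j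
    using g that by (simp add: fm_sym[of "d i"])
  have cw: "fm (c i) w = 0 \<and> fm (d i) w = 0" if "i \<in> {1..l - ?p}" for i
    using cd that by (simp add: fm_sym[of _ w])
  have "adapted l B" unfolding adapted_def
  proof (intro ballI)
    fix a b assume a: "a \<in> idx l" and b: "b \<in> idx l"
    have dls: "dual_index ?p 0 = 0" "dual_sign ?p 0 = -1"
      "\<And>i. i \<in> {1..?p} \<Longrightarrow> dual_index ?p (int i) = - int i \<and> dual_index ?p (- int i) = int i \<and> dual_sign ?p (int i) = 1 \<and> dual_sign ?p (- int i) = 1"
      "\<And>i. i \<in> {1..l - ?p} \<Longrightarrow> dual_index ?p (int (i + ?p)) = int (i + ?p) \<and> dual_index ?p (- int (i + ?p)) = - int (i + ?p)
         \<and> dual_sign ?p (int (i + ?p)) = -1 \<and> dual_sign ?p (- int (i + ?p)) = -1"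
      by (auto simp: dual_index_def dual_sign_def)
    note facts = dls B0 BE BF Bc Bd
    from cs[OF a] cs[OF b] show "fm (B a) (B b) = (if b = dual_index ?p a then dual_sign ?p a else 0)"
    proof (elim disjE bexE)
      fix i j assume ij: "i \<in> {1..?p}" "j \<in> {1..?p}"
      have hh: "fm (E i) (E j) = 0" "fm (F i) (F j) = 0" "fm (E i) (F j) = (if i = j then 1 else 0)" "fm (F i) (E j) = (if i = j then 1 else 0)"
        using h hyperbolic_dual[OF h ij] ij by (auto simp: hyperbolic_def)
      show "fm (B a) (B b) = (if b = dual_index ?p a then dual_sign ?p a else 0)" if "a = int i" "b = int j"
        unfolding that BE[OF ij(1)] BE[OF ij(2)] hh using dls(3)[OF ij(1)] ij by auto
      show "fm (B a) (B b) = (if b = dual_index ?p a then dual_sign ?p a else 0)" if "a = int i" "b = - int j"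
        unfolding that BE[OF ij(1)] BF[OF ij(2)] hh using dls(3)[OF ij(1)] ij by auto
      show "fm (B a) (B b) = (if b = dual_index ?p a then dual_sign ?p a else 0)" if "a = - int i" "b = int j"
        unfolding that BF[OF ij(1)] BE[OF ij(2)] hh using dls(3)[OF ij(1)] ij by auto
      show "fm (B a) (B b) = (if b = dual_index ?p a then dual_sign ?p a else 0)" if "a = - int i" "b = - int j"
        unfolding that BF[OF ij(1)] BF[OF ij(2)] hh using dls(3)[OF ij(1)] ij by auto
    next
      fix i j assume ij: "i \<in> {1..l - ?p}" "j \<in> {1..l - ?p}"
      show "fm (B a) (B b) = (if b = dual_index ?p a then dual_sign ?p a else 0)" if "a = int (i + ?p)" "b = int (j + ?p)"
        unfolding that Bc[OF ij(1)] Bc[OF ij(2)] using dls(4)[OF ij(1)] ij g by auto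
      show "fm (B a) (B b) = (if b = dual_index ?p a then dual_sign ?p a else 0)" if "a = int (i + ?p)" "b = - int (j + ?p)"
        unfolding that Bc[OF ij(1)] Bd[OF ij(2)] using dls(4)[OF ij(1)] ij g by auto
      show "fm (B a) (B b) = (if b = dual_index ?p a then dual_sign ?p a else 0)" if "a = - int (i + ?p)" "b = int (j + ?p)"
        unfolding that Bd[OF ij(1)] Bc[OF ij(2)] using dls(4)[OF ij(1)] ij dc[OF ij] by auto
      show "fm (B a) (B b) = (if b = dual_index ?p a then dual_sign ?p a else 0)" if "a = - int (i + ?p)" "b = - int (j + ?p)"
        unfolding that Bd[OF ij(1)] Bd[OF ij(2)] using dls(4)[OF ij(1)] ij g by auto
    next
      fix i j assume ij: "i \<in> {1..?p}" "j \<in> {1..l - ?p}"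
      have cdj: "c j \<in> ?W" "d j \<in> ?W" using cd ij by auto
      note oo = o[OF ij(1) cdj(1)] o[OF ij(1) cdj(2)]
      show "fm (B a) (B b) = (if b = dual_index ?p a then dual_sign ?p a else 0)" if "a = int i" "b = int (j + ?p)"
        unfolding that BE[OF ij(1)] Bc[OF ij(2)] using dls(3)[OF ij(1)] ij oo by auto
      show "fm (B a) (B b) = (if b = dual_index ?p a then dual_sign ?p a else 0)" if "a = int i" "b = - int (j + ?p)"
        unfolding that BE[OF ij(1)] Bd[OF ij(2)] using dls(3)[OF ij(1)] ij oo by auto
      show "fm (B a) (B b) = (if b = dual_index ?p a then dual_sign ?p a else 0)" if "a = - int i" "b = int (j + ?p)"
        unfolding that BF[OF ij(1)] Bc[OF ij(2)] using dls(3)[OF ij(1)] ij oo by auto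
      show "fm (B a) (B b) = (if b = dual_index ?p a then dual_sign ?p a else 0)" if "a = - int i" "b = - int (j + ?p)"
        unfolding that BF[OF ij(1)] Bd[OF ij(2)] using dls(3)[OF ij(1)] ij oo by auto
      show "fm (B a) (B b) = (if b = dual_index ?p a then dual_sign ?p a else 0)" if "b = int i" "a = int (j + ?p)"
        unfolding that BE[OF ij(1)] Bc[OF ij(2)] using dls(4)[OF ij(2)] ij oo by auto
      show "fm (B a) (B b) = (if b = dual_index ?p a then dual_sign ?p a else 0)" if "b = int i" "a = - int (j + ?p)"
        unfolding that BE[OF ij(1)] Bd[OF ij(2)] using dls(4)[OF ij(2)] ij oo by auto
      show "fm (B a) (B b) = (if b = dual_index ?p a then dual_sign ?p a else 0)" if "b = - int i" "a = int (j + ?p)"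
        unfolding that BF[OF ij(1)] Bc[OF ij(2)] using dls(4)[OF ij(2)] ij oo by auto
      show "fm (B a) (B b) = (if b = dual_index ?p a then dual_sign ?p a else 0)" if "b = - int i" "a = - int (j + ?p)"
        unfolding that BF[OF ij(1)] Bd[OF ij(2)] using dls(4)[OF ij(2)] ij oo by auto
    qed (use dls B0 BE BF Bc Bd o[OF _ w(1)] w(2) cd cw in auto)
  qed
  moreover have "B b \<in> ?W" if b: "b \<in> idx l" "b = 0 \<or> int ?p < \<bar>b\<bar>" for b
    using cs[OF b(1)] b(2) w(1) cd Bc Bd B0 by (elim disjE bexE) auto
  moreover have "rotates H (B (int j)) (B (- int j))" if j: "j \<in> {?p + 1..l}" for j
  proof -
    have i: "j - ?p \<in> {1..l - ?p}" and e: "j - ?p + ?p = j" using j by auto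
    show ?thesis using Bc[OF i] Bd[OF i] cd i unfolding e by metis
  qed
  ultimately show ?thesis using that BE BF w(3) B0 by metis
qed

lemma diag_family_empty: "diag_family {}" and common_eigenvector_empty: "common_eigenvector {} v"
  by (simp_all add: diag_family_def common_eigenvector_def)

lemma commuting_skew_on_empty:
  "hyperbolic CARD('p) E F \<Longrightarrow> commuting_skew_on {} (hyperbolic_complement CARD('p) E (F :: nat \<Rightarrow> ('p::finite, 'q::finite) rvec))"
  using hyperbolic_complement_negative_definite(1) by (auto simp: commuting_skew_on_def subspace_hyperbolic_complement)

lemma flag_adapted:
  fixes N :: "('p::finite, 'q::finite) rvec set"
  assumes n: "CARD('p) + CARD('q) = 2 * l + 1" and p: "CARD('p) \<le> l"
    and N: "totally_isotropic N" "u \<in> N" "u \<noteq> 0"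
  obtains B where "adapted l B" "B 1 = u" "span (B ` int ` {1..dim N}) = N"
proof -
  have sN: "subspace N" using N by (simp add: totally_isotropic_def)
  obtain U :: "nat \<Rightarrow> ('p, 'q) rvec" where U: "inj_on U {1..dim N}" "independent (U ` {1..dim N})"
    "span (U ` {1..dim N}) = N" "U 1 = u" using obtain_indexed_basis[OF sN N(2,3)] .
  have UN: "U i \<in> N" if "i \<in> {1..dim N}" for i using U(3) that by (metis imageI span_base)
  obtain F where F: "hyperbolic (dim N) U F"
    using isotropic_basis_hyperbolic[OF U(1,2)] N(1) UN by (auto simp: totally_isotropic_def)
  have d: "dim N \<le> CARD('p)" using dim_totally_isotropic_le N by blast
  obtain E' F' where EF: "hyperbolic CARD('p) E' F'" "\<forall>i\<in>{1..dim N}. E' i = U i \<and> F' i = F i"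
    using hyperbolic_extend[OF diag_family_empty _ F _ d] common_eigenvector_empty n p by fastforce
  obtain B where B: "adapted l B" "\<And>i. i \<in> {1..CARD('p)} \<Longrightarrow> B (int i) = E' i \<and> B (- int i) = F' i"
    using adapted_from_hyperbolic[OF EF(1) commuting_skew_on_empty[OF EF(1)] n p] by metis
  have BU: "B (int i) = U i" if "i \<in> {1..dim N}" for i using B(2)[of i] EF(2) that d by auto
  have "1 \<le> dim N"
  proof (rule ccontr)
    assume "\<not> 1 \<le> dim N"
    then have "dim N = 0" by linarith
    then have "N \<subseteq> {0}" by (simp only: dim_eq_0)
    then show False using N by blast
  qed
  then have "B 1 = u" using BU[of 1] U(4) by simp
  moreover have "B ` int ` {1..dim N} = U ` {1..dim N}" using BU by (simp add: image_image)
  ultimately show ?thesis using that B(1) U(3) by metis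
qed

text \<open>Witt's theorem for a totally isotropic subspace together with a line in it.\<close>

lemma flag_isometry:
  fixes N N' :: "('p::finite, 'q::finite) rvec set"
  assumes n: "CARD('p) + CARD('q) = 2 * l + 1" and p: "CARD('p) \<le> l"
    and N: "totally_isotropic N" "u \<in> N" "u \<noteq> 0" and N': "totally_isotropic N'" "u' \<in> N'" "u' \<noteq> 0" and d: "dim N = dim N'"
  obtains T T' :: "('p, 'q) rmat" where "T ** T' = mat 1" "T' ** T = mat 1" "\<And>u v. fm (T *v u) (T *v v) = fm u v"
    "T *v u = u'" "(*v) T ` N = N'"
proof -
  obtain B where B: "adapted l B" "B 1 = u" "span (B ` int ` {1..dim N}) = N" using flag_adapted[OF n p N] .
  obtain C where C: "adapted l C" "C 1 = u'" "span (C ` int ` {1..dim N}) = N'"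
    using flag_adapted[OF n p N'] unfolding d .
  obtain T T' :: "('p, 'q) rmat" where T: "T ** T' = mat 1" "T' ** T = mat 1" "\<And>u v. fm (T *v u) (T *v v) = fm u v"
    "\<And>a. a \<in> idx l \<Longrightarrow> T *v B a = C a" using adapted_isometry[OF B(1) C(1) n] by metis
  have "0 < CARD('p)" by simp
  then have "1 \<le> l" using p by linarith
  then have "T *v u = u'" using T(4)[of 1] B(2) C(2) by (simp add: idx_def)
  moreover have "(*v) T ` N = N'"
  proof -
    have "dim N \<le> l" using dim_totally_isotropic_le[OF N(1)] p by simp
    then have "T *v B (int i) = C (int i)" if "i \<in> {1..dim N}" for i using T(4)[of "int i"] that by (simp add: idx_def)
    then have "(*v) T ` (B ` int ` {1..dim N}) = C ` int ` {1..dim N}" by (simp add: image_image)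
    then show ?thesis using linear_span_image[OF matrix_vector_mul_linear, of T "B ` int ` {1..dim N}"] B(3) C(3) by simp
  qed
  ultimately show ?thesis using that T(1-3) by blast
qed

section \<open>Maximal split abelian and maximal abelian subalgebras\<close>

text \<open>Independent scalings of the hyperbolic pairs: the split part of \<open>htorus\<close>,
  which in addition rotates the remaining planes.\<close>

definition atorus :: "nat \<Rightarrow> (int \<Rightarrow> ('p::finite, 'q::finite) rvec) \<Rightarrow> ('p, 'q) rmat set" where
  "atorus l B = {t. skw t \<and> (\<forall>i\<in>{1..CARD('p)}. \<exists>c. t *v B (int i) = c *\<^sub>R B (int i) \<and> t *v B (- int i) = (- c) *\<^sub>R B (- int i)) \<and>
     (\<forall>b\<in>idx l. b = 0 \<or> int CARD('p) < \<bar>b\<bar> \<longrightarrow> t *v B b = 0)}"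

definition htorus :: "nat \<Rightarrow> (int \<Rightarrow> ('p::finite, 'q::finite) rvec) \<Rightarrow> ('p, 'q) rmat set" where
  "htorus l B = {t. skw t \<and> (\<forall>i\<in>{1..CARD('p)}. \<exists>c. t *v B (int i) = c *\<^sub>R B (int i) \<and> t *v B (- int i) = (- c) *\<^sub>R B (- int i)) \<and>
     (\<forall>j\<in>{CARD('p) + 1..l}. \<exists>s. t *v B (int j) = s *\<^sub>R B (- int j) \<and> t *v B (- int j) = (- s) *\<^sub>R B (int j)) \<and> t *v B 0 = 0}"

lemma idx_cases:
  assumes "a \<in> idx l"
  obtains "a = 0" | i where "i \<in> {1..p}" "a = int i \<or> a = - int i" | j where "j \<in> {p + 1..l}" "a = int j \<or> a = - int j"
proof -
  have a: "\<bar>a\<bar> \<le> int l" using assms by (auto simp: idx_def)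
  have e: "a = int (nat \<bar>a\<bar>) \<or> a = - int (nat \<bar>a\<bar>)" by linarith
  consider "a = 0" | "nat \<bar>a\<bar> \<in> {1..p}" | "nat \<bar>a\<bar> \<in> {p + 1..l}" using a by (cases "a = 0"; cases "nat \<bar>a\<bar> \<le> p") auto
  then show ?thesis using e that by cases metis+
qed

lemma atorus_subset_htorus:
  "CARD('p) \<le> l \<Longrightarrow> atorus l B \<subseteq> htorus l (B :: int \<Rightarrow> ('p::finite, 'q::finite) rvec)"
  by (auto simp: atorus_def htorus_def idx_def intro!: exI[of _ 0])

lemma subspace_tori:
  fixes B :: "int \<Rightarrow> ('p::finite, 'q::finite) rvec"
  shows "subspace (atorus l B)" "subspace (htorus l B)"
proof -
  have c: "\<exists>c. (x + y) *v u = c *\<^sub>R u' \<and> (x + y) *v v = (- c) *\<^sub>R v'"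
    if xy: "\<exists>c. x *v u = c *\<^sub>R u' \<and> x *v v = (- c) *\<^sub>R v'" "\<exists>c. y *v u = c *\<^sub>R u' \<and> y *v v = (- c) *\<^sub>R v'"
    for x y :: "('p, 'q) rmat" and u u' v v'
  proof -
    obtain c d where "x *v u = c *\<^sub>R u'" "x *v v = (- c) *\<^sub>R v'" "y *v u = d *\<^sub>R u'" "y *v v = (- d) *\<^sub>R v'" using xy by blast
    then show ?thesis by (intro exI[of _ "c + d"]) (simp add: matrix_vector_mult_add_rdistrib algebra_simps)
  qed
  have m: "\<exists>c. (k *\<^sub>R x) *v u = c *\<^sub>R u' \<and> (k *\<^sub>R x) *v v = (- c) *\<^sub>R v'"
    if xk: "\<exists>c. x *v u = c *\<^sub>R u' \<and> x *v v = (- c) *\<^sub>R v'" for x :: "('p, 'q) rmat" and u u' v v' k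
  proof -
    obtain c where "x *v u = c *\<^sub>R u'" "x *v v = (- c) *\<^sub>R v'" using xk by blast
    then show ?thesis by (intro exI[of _ "k * c"]) simp
  qed
  have z: "\<exists>c. 0 *v u = c *\<^sub>R u' \<and> 0 *v v = (- c) *\<^sub>R v'" for u v u' v' :: "('p, 'q) rvec"
    by (rule exI[of _ 0]) simp
  show "subspace (atorus l B)" unfolding atorus_def
    by (rule subspaceI) (use c m z in \<open>auto simp: skw_add skw_scaleR matrix_vector_mult_add_rdistrib\<close>)
  show "subspace (htorus l B)" unfolding htorus_def
    by (rule subspaceI) (use c m z in \<open>auto simp: skw_add skw_scaleR matrix_vector_mult_add_rdistrib\<close>)
qed

lemma abelian_htorus:
  fixes B :: "int \<Rightarrow> ('p::finite, 'q::finite) rvec"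
  assumes B: "adapted l B" and n: "CARD('p) + CARD('q) = 2 * l + 1"
  shows "abelian (htorus l B)"
  unfolding abelian_def
proof (intro ballI)
  fix x y assume x: "x \<in> htorus l B" and y: "y \<in> htorus l B"
  show "lie_br x y = 0"
  proof (rule adapted_matrix_eqI[OF B n])
    fix a assume "a \<in> idx l"
    then have "x *v (y *v B a) = y *v (x *v B a)"
    proof (cases rule: idx_cases[where p = "CARD('p)"])
      case 1
      then show ?thesis using x y by (simp add: htorus_def)
    next
      case (2 i)
      obtain c where "x *v B (int i) = c *\<^sub>R B (int i)" "x *v B (- int i) = (- c) *\<^sub>R B (- int i)" using x 2 unfolding htorus_def by blast
      moreover obtain d where "y *v B (int i) = d *\<^sub>R B (int i)" "y *v B (- int i) = (- d) *\<^sub>R B (- int i)" using y 2 unfolding htorus_def by blast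
      ultimately show ?thesis using 2(2) by (auto simp: matrix_vector_mult_scaleR)
    next
      case (3 j)
      obtain c where "x *v B (int j) = c *\<^sub>R B (- int j)" "x *v B (- int j) = (- c) *\<^sub>R B (int j)" using x 3 unfolding htorus_def by blast
      moreover obtain d where "y *v B (int j) = d *\<^sub>R B (- int j)" "y *v B (- int j) = (- d) *\<^sub>R B (int j)" using y 3 unfolding htorus_def by blast
      ultimately show ?thesis using 3(2) by (auto simp: matrix_vector_mult_scaleR)
    qed
    then show "lie_br x y *v B a = 0 *v B a" by (simp add: lie_br_apply)
  qed
qed

lemma trace_adapted:
  fixes B :: "int \<Rightarrow> ('p::finite, 'q::finite) rvec"
  assumes B: "adapted l B" and n: "CARD('p) + CARD('q) = 2 * l + 1"
  shows "trace X = (\<Sum>a\<in>idx l. dual_coeff B a (X *v B a))"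
proof -
  have "trace X = (\<Sum>i\<in>UNIV. (X *v axis i 1) $ i)" by (simp add: trace_def matrix_vector_mult_axis)
  also have "\<dots> = (\<Sum>i\<in>UNIV. \<Sum>a\<in>idx l. dual_coeff B a (axis i 1) * (X *v B a) $ i)"
  proof (rule sum.cong[OF refl])
    fix i
    have "X *v axis i 1 = (\<Sum>a\<in>idx l. dual_coeff B a (axis i 1) *\<^sub>R (X *v B a))"
      by (subst adapted_expand[OF B n, of "axis i 1"])
        (simp add: linear_sum[OF matrix_vector_mul_linear] matrix_vector_mult_scaleR)
    then show "(X *v axis i 1) $ i = (\<Sum>a\<in>idx l. dual_coeff B a (axis i 1) * (X *v B a) $ i)" by simp
  qed
  also have "\<dots> = (\<Sum>a\<in>idx l. \<Sum>i\<in>UNIV. dual_coeff B a (axis i 1) * (X *v B a) $ i)" by (rule sum.swap)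
  also have "\<dots> = (\<Sum>a\<in>idx l. dual_coeff B a (X *v B a))"
  proof (rule sum.cong[OF refl])
    fix a
    have "dual_coeff B a (X *v B a) = dual_coeff B a (\<Sum>i\<in>UNIV. (X *v B a) $ i *\<^sub>R axis i 1)"
      using basis_expansion[of "X *v B a"] by (simp add: scalar_mult_eq_scaleR)
    then show "(\<Sum>i\<in>UNIV. dual_coeff B a (axis i 1) * (X *v B a) $ i) = dual_coeff B a (X *v B a)"
      by (simp add: linear_sum[OF linear_dual_coeff] linear_scale[OF linear_dual_coeff] mult.commute)
  qed
  finally show ?thesis .
qed

text \<open>Conjugation by the isometry \<open>R\<close> with \<open>R (B a) = \<plusminus> B (dual_index p a)\<close> is a Cartan involution, as
  \<open>fm x (R y)\<close> is the inner product for which the adapted basis is orthonormal.\<close>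

lemma split_abelian_atorus:
  fixes B :: "int \<Rightarrow> ('p::finite, 'q::finite) rvec"
  assumes B: "adapted l B" and n: "CARD('p) + CARD('q) = 2 * l + 1" and p: "CARD('p) \<le> l" and l: "1 \<le> l"
  shows "split_abelian so_pq (atorus l B)"
proof -
  let ?p = "CARD('p)" and ?g = "so_pq :: ('p, 'q) rmat set"
  \<comment> \<open>\<open>R\<close> will exchange the two vectors of each hyperbolic pair and
    negate the other basis vectors, which compensates their negative squares.\<close>
  define C where "C a = dual_sign ?p a *\<^sub>R B (dual_index ?p a)" for a
  have "adapted l C" unfolding adapted_def
  proof (intro ballI)
    fix a b assume ab: "a \<in> idx l" "b \<in> idx l"
    have "fm (C a) (C b) = dual_sign ?p a * (dual_sign ?p b * (if dual_index ?p b = a then dual_sign ?p a else 0))"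
      using B ab by (simp add: C_def adapted_def)
    then show "fm (C a) (C b) = (if b = dual_index ?p a then dual_sign ?p a else 0)"
      by (auto simp: mult.assoc[symmetric])
  qed
  then obtain R R' :: "('p, 'q) rmat" where R: "\<And>u v. fm (R *v u) (R *v v) = fm u v" "\<And>a. a \<in> idx l \<Longrightarrow> R *v B a = C a"
    using adapted_isometry[OF B _ n] by metis
  have RR: "R ** R = mat 1"
  proof (rule adapted_matrix_eqI[OF B n])
    fix a assume a: "a \<in> idx l"
    have "R *v (R *v B a) = dual_sign ?p a *\<^sub>R (dual_sign ?p a *\<^sub>R B a)"
      using R(2)[OF a] R(2)[of "dual_index ?p a"] a by (simp add: C_def matrix_vector_mult_scaleR)
    then show "(R ** R) *v B a = mat 1 *v B a" by (simp add: matrix_vector_mul_assoc)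
  qed
  have RRv: "R *v (R *v z) = z" for z using RR by (simp add: matrix_vector_mul_assoc)
  have Rsym: "fm (R *v u) v = fm u (R *v v)" for u v using R(1)[of u "R *v v"] RRv by simp
  have cfR: "dual_coeff B a z = fm (R *v B a) z" if "a \<in> idx l" for a z using R(2)[OF that] by (simp add: dual_coeff_def C_def)
  have pos: "fm z (R *v z) = (\<Sum>a\<in>idx l. dual_coeff B a z * dual_coeff B a z)" for z
  proof -
    have "R *v z = (\<Sum>a\<in>idx l. dual_coeff B a z *\<^sub>R (R *v B a))"
      by (subst adapted_expand[OF B n, of z]) (simp add: linear_sum[OF matrix_vector_mul_linear] matrix_vector_mult_scaleR)
    then have "fm z (R *v z) = (\<Sum>a\<in>idx l. dual_coeff B a z * fm z (R *v B a))" by (simp add: fm_sum_right)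
    then show ?thesis using cfR by (simp add: fm_sym[of z])
  qed
  let ?\<theta> = "\<lambda>x. R ** x ** R"
  have aut: "lie_automorphism ?g ?\<theta>" by (rule isometry_automorphism(1)[OF RR RR R(1)])
  have \<theta>v: "?\<theta> x *v z = R *v (x *v (R *v z))" for x z by (simp add: matrix_vector_mul_assoc matrix_mul_assoc)
  have n2: "0 < real (?p + CARD('q)) - 2" using n l by simp
  have neg: "killing_form ?g x (?\<theta> x) < 0" if x: "x \<in> ?g" "x \<noteq> 0" for x
  proof -
    have sk: "skw x" using x by (simp add: so_pq_skw)
    have "?\<theta> x \<in> ?g" using aut x(1) by (auto simp: lie_automorphism_def bij_betw_def)
    then have sk': "skw (?\<theta> x)" by (simp add: so_pq_skw)
    let ?z = "\<lambda>a. x *v (R *v B a)"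
    have "trace (x ** ?\<theta> x) = (\<Sum>a\<in>idx l. fm (R *v B a) (x *v (R *v (x *v (R *v B a)))))"
      unfolding trace_adapted[OF B n] by (intro sum.cong refl) (simp add: cfR \<theta>v matrix_vector_mul_assoc[symmetric])
    also have "\<dots> = - (\<Sum>a\<in>idx l. fm (?z a) (R *v ?z a))"
      unfolding sum_negf[symmetric] by (intro sum.cong refl) (simp add: skwD[OF sk])
    finally have tr: "trace (x ** ?\<theta> x) = - (\<Sum>a\<in>idx l. \<Sum>b\<in>idx l. dual_coeff B b (?z a) * dual_coeff B b (?z a))" by (simp add: pos)
    have "\<exists>a\<in>idx l. \<exists>b\<in>idx l. dual_coeff B b (?z a) \<noteq> 0"
    proof (rule ccontr)
      assume no: "\<not> ?thesis"
      have "?z a = 0" if "a \<in> idx l" for a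
        using no that by (subst adapted_expand[OF B n]) simp
      then have "x ** R = 0" by (intro adapted_matrix_eqI[OF B n]) (simp add: matrix_vector_mul_assoc[symmetric])
      then have "x ** R ** R = 0" by simp
      then show False using RR x(2) by (simp add: matrix_mul_assoc[symmetric])
    qed
    then obtain a b where ab: "a \<in> idx l" "b \<in> idx l" "dual_coeff B b (?z a) \<noteq> 0" by blast
    have "0 < (\<Sum>b\<in>idx l. dual_coeff B b (?z a) * dual_coeff B b (?z a))"
      by (rule sum_pos2[OF finite_idx ab(2)]) (use ab in \<open>auto simp: zero_less_mult_iff\<close>)
    then have "0 < (\<Sum>a\<in>idx l. \<Sum>b\<in>idx l. dual_coeff B b (?z a) * dual_coeff B b (?z a))"
      by (rule sum_pos2[OF finite_idx ab(1)]) (auto intro: sum_nonneg)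
    then show ?thesis unfolding killing_form_so_pq[OF sk sk'] tr using n2 by (simp add: mult_pos_neg)
  qed
  have cart: "cartan_involution ?g ?\<theta>"
    unfolding cartan_involution_def using aut neg
    by (auto simp: matrix_mul_assoc[symmetric] RR) (metis RR matrix_mul_assoc matrix_mul_lid)
  have inv: "?\<theta> t = - t" if t: "t \<in> atorus l B" for t
  proof (rule adapted_matrix_eqI[OF B n])
    fix a assume a: "a \<in> idx l"
    then show "?\<theta> t *v B a = - t *v B a"
    proof (cases "a = 0 \<or> int ?p < \<bar>a\<bar>")
      case True
      then have "dual_index ?p a = a" by (auto simp: dual_index_def)
      moreover have "t *v B a = 0" using t a True by (auto simp: atorus_def)
      ultimately show ?thesis using R(2)[OF a] unfolding \<theta>v by (simp add: C_def matrix_vector_mult_scaleR)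
    next
      case False
      then have d: "dual_index ?p a = - a" "dual_sign ?p a = 1" "- a \<in> idx l" "dual_index ?p (- a) = a" "dual_sign ?p (- a) = 1" using a by (auto simp: dual_index_def dual_sign_def idx_def)
      have "nat \<bar>a\<bar> \<in> {1..?p}" "a = int (nat \<bar>a\<bar>) \<or> a = - int (nat \<bar>a\<bar>)" using False by auto
      then obtain i where i: "i \<in> {1..?p}" "a = int i \<or> a = - int i" by blast
      obtain c where c: "t *v B (int i) = c *\<^sub>R B (int i)" "t *v B (- int i) = (- c) *\<^sub>R B (- int i)" using t i unfolding atorus_def by blast
      have Ra: "R *v B a = B (- a)" "R *v B (- a) = B a" using R(2)[OF a] R(2)[OF d(3)] d by (simp_all add: C_def)
      then show ?thesis using i(2) c unfolding \<theta>v by (auto simp: matrix_vector_mult_scaleR)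
    qed
  qed
  have posk: "0 < killing_form ?g x x" if x: "x \<in> atorus l B" "x \<noteq> 0" for x
  proof -
    have sk: "skw x" "skw (- x)" using x skw_diff[of 0 x] by (auto simp: atorus_def)
    have "killing_form ?g x (- x) < 0" using neg[of x] inv[OF x(1)] x(2) sk by (simp add: so_pq_skw)
    moreover have "trace (x ** (- x)) = - trace (x ** x)" by (simp add: trace_def matrix_matrix_mult_def sum_negf)
    ultimately show ?thesis using killing_form_so_pq[OF sk(1) sk(1)] killing_form_so_pq[OF sk(1) sk(2)] by simp
  qed
  have "abelian (atorus l B)" using abelian_htorus[OF B n] atorus_subset_htorus[OF p, of B] unfolding abelian_def by blast
  then show ?thesis unfolding split_abelian_def
    using subspace_tori(1) posk cart inv by (auto simp: atorus_def so_pq_skw)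
qed

text \<open>Only inclusions in the standard tori are shown directly; maximality turns them into
  equalities, as \<open>atorus\<close> is split abelian and \<open>htorus\<close> abelian. The
  hyperbolic pairs come from \<open>a\<close> alone; \<open>h\<close> acts on the definite
  complement by commuting rotations, and these fix the rest of the basis.\<close>

theorem maximal_tori:
  fixes a h :: "('p::finite, 'q::finite) rmat set"
  assumes n: "CARD('p) + CARD('q) = 2 * l + 1" and p: "CARD('p) \<le> l" and l: "1 \<le> l"
    and a: "maximal_split_abelian so_pq a" and h: "maximal_abelian_subalgebra so_pq h" and ah: "a \<subseteq> h"
  obtains B where "adapted l B" "a = atorus l B" "h = htorus l B"
proof -
  let ?p = "CARD('p)"
  have split: "split_abelian so_pq a" and maxa: "\<And>a'. split_abelian so_pq a' \<Longrightarrow> a \<subseteq> a' \<Longrightarrow> a' = a"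
    using a by (auto simp: maximal_split_abelian_def)
  have maxh: "\<And>h'. subspace h' \<Longrightarrow> h' \<subseteq> so_pq \<Longrightarrow> abelian h' \<Longrightarrow> h \<subseteq> h' \<Longrightarrow> h' = h"
    and abh: "abelian h" and hg: "h \<subseteq> so_pq"
    using h unfolding maximal_abelian_subalgebra_def by blast+
  have odd: "odd (?p + CARD('q))" and n3: "3 \<le> ?p + CARD('q)" and pq: "?p < CARD('q)" using n l p by auto
  have comm: "x *v (y *v v) = y *v (x *v v)" if "x \<in> h" "y \<in> h" for x y v
  proof -
    have "lie_br x y *v v = 0" using abh that by (simp add: abelian_def)
    then show ?thesis by (simp add: lie_br_apply)
  qed
  have ska: "skw t" if "t \<in> a" for t using that split by (auto simp: split_abelian_def so_pq_skw)
  have dA: "diag_family a" unfolding diag_family_def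
    using ska split_abelian_diagonalizable[OF split odd n3] comm ah by blast
  obtain E F :: "nat \<Rightarrow> ('p, 'q) rvec" where EF: "hyperbolic ?p E F" "\<forall>i\<in>{1..?p}. common_eigenvector a (E i) \<and> common_eigenvector a (F i)"
    using hyperbolic_extend[OF dA pq, of 0 "\<lambda>_. 0" "\<lambda>_. 0"] by (auto simp: hyperbolic_def)
  let ?W = "hyperbolic_complement ?p E F"
  note negW = hyperbolic_complement_negative_definite(1)[OF EF(1)]
  have kill: "t *v w = 0" if t: "t \<in> a" and w: "w \<in> ?W" for t w
  proof -
    have "w \<in> span {v\<in>?W. common_eigenvector a v}" using hyperbolic_complement_span_common_eigenvector[OF dA, of ?p E F] EF(2) w by blast
    then show ?thesis
    proof (induction rule: span_induct)
      case base
      show ?case by (auto simp: subspace_def matrix_vector_right_distrib matrix_vector_mult_scaleR)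
    next
      case (step v)
      then obtain m where m: "t *v v = m *\<^sub>R v" using t by (auto simp: common_eigenvector_def eigenvectors_def)
      have "m * fm v v = 0" using fm_skw_self[OF ska[OF t], of v] m by simp
      then have "m = 0 \<or> v = 0" using negW[of v] step by force
      then show ?case using m by auto
    qed
  qed
  have aE: "\<exists>c. t *v E i = c *\<^sub>R E i \<and> t *v F i = (- c) *\<^sub>R F i" if t: "t \<in> a" and i: "i \<in> {1..?p}" for t i
  proof -
    obtain c d where cd: "t *v E i = c *\<^sub>R E i" "t *v F i = d *\<^sub>R F i" using EF(2) t i by (fastforce simp: common_eigenvector_def eigenvectors_def)
    have "fm (E i) (F i) = 1" using EF(1) i by (simp add: hyperbolic_def)
    then have "c = - d" using skwD[OF ska[OF t], of "E i" "F i"] cd by simp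
    then show ?thesis using cd by (intro exI[of _ c]) simp
  qed
  \<comment> \<open>Stated for every adapted basis that extends the pairs by vectors of
    \<open>?W\<close>: it serves for the auxiliary \<open>B0\<close> and again for the basis adapted
    to \<open>h\<close>.\<close>
  have a_eq: "a = atorus l B" if B: "adapted l B" "\<And>i. i \<in> {1..?p} \<Longrightarrow> B (int i) = E i \<and> B (- int i) = F i"
    "\<And>b. b \<in> idx l \<Longrightarrow> b = 0 \<or> int ?p < \<bar>b\<bar> \<Longrightarrow> B b \<in> ?W" for B
  proof -
    have "a \<subseteq> atorus l B"
    proof
      fix t assume t: "t \<in> a"
      show "t \<in> atorus l B" unfolding atorus_def
      proof (intro CollectI conjI ballI impI)
        show "skw t" using ska[OF t] .
        show "\<exists>c. t *v B (int i) = c *\<^sub>R B (int i) \<and> t *v B (- int i) = (- c) *\<^sub>R B (- int i)" if "i \<in> {1..?p}" for i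
          using aE[OF t that] B(2)[OF that] by simp
        show "t *v B b = 0" if "b \<in> idx l" "b = 0 \<or> int ?p < \<bar>b\<bar>" for b
          using kill[OF t B(3)[OF that]] .
      qed
    qed
    then show ?thesis using maxa split_abelian_atorus[OF B(1) n p l] by blast
  qed
  obtain B0 where B0: "adapted l B0" "\<And>i. i \<in> {1..?p} \<Longrightarrow> B0 (int i) = E i \<and> B0 (- int i) = F i"
    "\<And>b. b \<in> idx l \<Longrightarrow> b = 0 \<or> int ?p < \<bar>b\<bar> \<Longrightarrow> B0 b \<in> ?W"
    using adapted_from_hyperbolic[OF EF(1) commuting_skew_on_empty[OF EF(1)] n p] by metis
  \<comment> \<open>Maximality of \<open>a\<close> puts the scaling of each single pair into
    \<open>a\<close>.\<close>
  have wda: "wd (E i) (F i) \<in> a" if i: "i \<in> {1..?p}" for i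
  proof -
    have "wd (E i) (F i) \<in> atorus l B0" unfolding atorus_def
    proof (intro CollectI conjI ballI impI)
      fix j assume j: "j \<in> {1..?p}"
      show "\<exists>c. wd (E i) (F i) *v B0 (int j) = c *\<^sub>R B0 (int j) \<and> wd (E i) (F i) *v B0 (- int j) = (- c) *\<^sub>R B0 (- int j)"
        using EF(1) i j B0(2)[OF j] hyperbolic_dual[OF EF(1) i j]
        by (intro exI[of _ "if i = j then 1 else 0"]) (auto simp: hyperbolic_def wd_applyR)
    next
      fix b assume "b \<in> idx l" "b = 0 \<or> int ?p < \<bar>b\<bar>"
      then show "wd (E i) (F i) *v B0 b = 0" using B0(3)[of b] i by (simp add: hyperbolic_complement_def wd_applyR)
    qed simp
    then show ?thesis using a_eq[OF B0] by simp
  qed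
  \<comment> \<open>An element of \<open>h\<close> commutes with \<open>wd (E i) (F i)\<close>,
    whose eigenspaces for 1 and -1 are the lines of \<open>E i\<close> and \<open>F i\<close>, so it
    preserves both lines.\<close>
  have hE: "\<exists>c. x *v E i = c *\<^sub>R E i \<and> x *v F i = (- c) *\<^sub>R F i" if x: "x \<in> h" and i: "i \<in> {1..?p}" for x i
  proof -
    let ?t = "wd (E i) (F i)"
    have sk: "skw x" using x hg by (auto simp: so_pq_skw)
    have c: "x *v (?t *v v) = ?t *v (x *v v)" for v using comm[OF x] wda[OF i] ah by blast
    have ef: "fm (E i) (F i) = 1" "fm (F i) (E i) = 1" "fm (E i) (E i) = 0" "fm (F i) (F i) = 0" using EF(1) hyperbolic_dual[OF EF(1) i i] i by (auto simp: hyperbolic_def)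
    have s: "fm (E i) (x *v E i) = 0" "fm (F i) (x *v F i) = 0" using fm_skw_self[OF sk] by (metis fm_sym)+
    have "x *v E i = fm (F i) (x *v E i) *\<^sub>R E i" using c[of "E i"] ef s by (simp add: wd_applyR)
    moreover have "x *v F i = fm (E i) (x *v F i) *\<^sub>R F i" using c[of "F i"] ef s by (simp add: wd_applyR)
    moreover have "fm (E i) (x *v F i) = - fm (F i) (x *v E i)" using skwD[OF sk, of "F i" "E i"] by (simp add: fm_sym)
    ultimately show ?thesis by metis
  qed
  have csk: "commuting_skew_on h ?W" unfolding commuting_skew_on_def
  proof (intro conjI ballI impI)
    show "x *v z \<in> ?W" if "x \<in> h" "z \<in> ?W" for x z
    proof (rule hyperbolic_complement_invariant[OF _ _ that(2)])
      show "skw x" using that hg by (auto simp: so_pq_skw)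
      show "E i \<in> eigenvectors x \<and> F i \<in> eigenvectors x" if "i \<in> {1..?p}" for i using hE[OF \<open>x \<in> h\<close> that] unfolding eigenvectors_def by blast
    qed
  qed (use negW comm hg in \<open>auto simp: subspace_hyperbolic_complement so_pq_skw\<close>)
  obtain B where B: "adapted l B" "\<And>i. i \<in> {1..?p} \<Longrightarrow> B (int i) = E i \<and> B (- int i) = F i"
    "\<And>x. x \<in> h \<Longrightarrow> x *v B 0 = 0" "\<And>j. j \<in> {?p + 1..l} \<Longrightarrow> rotates h (B (int j)) (B (- int j))"
    "\<And>b. b \<in> idx l \<Longrightarrow> b = 0 \<or> int ?p < \<bar>b\<bar> \<Longrightarrow> B b \<in> ?W"
    using adapted_from_hyperbolic[OF EF(1) csk n p] by metis
  have "h \<subseteq> htorus l B"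
  proof
    fix x assume x: "x \<in> h"
    show "x \<in> htorus l B" unfolding htorus_def
    proof (intro CollectI conjI ballI)
      show "skw x" using x hg by (auto simp: so_pq_skw)
      show "\<exists>c. x *v B (int i) = c *\<^sub>R B (int i) \<and> x *v B (- int i) = (- c) *\<^sub>R B (- int i)" if "i \<in> {1..?p}" for i
        using hE[OF x that] B(2)[OF that] by simp
      show "\<exists>s. x *v B (int j) = s *\<^sub>R B (- int j) \<and> x *v B (- int j) = (- s) *\<^sub>R B (int j)" if "j \<in> {?p + 1..l}" for j
        using B(4)[OF that] x unfolding rotates_def by blast
      show "x *v B 0 = 0" using B(3)[OF x] .
    qed
  qed
  then have "h = htorus l B"
    using maxh[OF subspace_tori(2) _ abelian_htorus[OF B(1) n]] by (auto simp: htorus_def so_pq_skw)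
  then show ?thesis using that B(1) a_eq[OF B(1,2,5)] by blast
qed

section \<open>Weights and roots\<close>

definition cvec :: "real^'n \<Rightarrow> complex^'n" where
  "cvec u = (\<chi> i. complex_of_real (u $ i))"

abbreviation cmat :: "real^'n^'m \<Rightarrow> complex^'n^'m" where
  "cmat \<equiv> map_matrix complex_of_real"

lemma cvec_simps [simp]: "cvec (u + v) = cvec u + cvec v" "cvec (u - v) = cvec u - cvec v"
  "cvec (c *\<^sub>R u) = complex_of_real c *s cvec u" "cvec (- u) = - cvec u" "cvec 0 = 0"
  by (simp_all add: cvec_def vec_eq_iff)

lemma of_real_sg: "complex_of_real (sg i) = sg (i :: 'p::finite + 'q::finite)"
  by (cases i) (auto simp: sg_def)

lemma fm_cvec: "fm (cvec u) (cvec v) = complex_of_real (fm u v)"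
  by (simp add: fm_def cvec_def of_real_sg)

lemma cmat_cvec: "cmat x *v cvec u = cvec (x *v u)"
  by (simp add: vec_eq_iff cvec_def matrix_vector_mult_def map_matrix_def)

lemma cmat_wd: "cmat (wd u v) = wd (cvec u) (cvec v)"
  by (simp add: vec_eq_iff wd_def cvec_def map_matrix_def of_real_sg)

lemma scale_mat_apply [simp]: "scale_mat k x *v z = k *s (x *v z)"
  by (simp add: vec_eq_iff scale_mat_def matrix_vector_mult_def map_matrix_def sum_distrib_left mult.assoc)

lemma scale_mat_nth [simp]: "scale_mat k x $ i $ j = k * x $ i $ j"
  by (simp add: scale_mat_def map_matrix_def)

lemma scale_mat_wd: "wd (k *s u) v = scale_mat k (wd u v)" "wd u (k *s v) = scale_mat k (wd u v)"
  by (simp_all add: vec_eq_iff wd_def algebra_simps)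

lemma scale_mat_scale_mat [simp]: "scale_mat k (scale_mat m x) = scale_mat (k * m) x"
  by (simp add: vec_eq_iff)

lemma scale_mat_minus: "scale_mat (- k) x = - scale_mat k x" "scale_mat k (- x) = - scale_mat k x"
  by (simp_all add: vec_eq_iff)

lemma scale_mat_0_1 [simp]: "scale_mat 0 x = 0" "scale_mat 1 x = x"
  by (simp_all add: vec_eq_iff)

lemma lie_br_scale_mat: "lie_br (scale_mat k x) (scale_mat m y) = scale_mat (k * m) (lie_br x y)"
  by (rule matrix_eqI) (simp add: lie_br_apply matrix_vector_scale algebra_simps vector_smult_assoc vector_ssub_ldistrib)

lemma complexification_decompose:
  "x *v z = cmat (map_matrix Re x) *v z + \<i> *s (cmat (map_matrix Im x) *v z)"
proof -
  have "(x *v z) $ i = (cmat (map_matrix Re x) *v z + \<i> *s (cmat (map_matrix Im x) *v z)) $ i" for i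
  proof -
    have "(x *v z) $ i = (\<Sum>j\<in>UNIV. (complex_of_real (Re (x $ i $ j)) + \<i> * complex_of_real (Im (x $ i $ j))) * z $ j)"
      unfolding matrix_vector_mult_def vec_lambda_beta by (intro sum.cong refl) (simp only: complex_eq[symmetric])
    then show ?thesis
      by (simp add: matrix_vector_mult_def map_matrix_def distrib_right sum.distrib sum_distrib_left mult.assoc)
  qed
  then show ?thesis by (simp add: vec_eq_iff)
qed

lemma complexification_add:
  "subspace V \<Longrightarrow> x \<in> complexification V \<Longrightarrow> y \<in> complexification V \<Longrightarrow> x + y \<in> complexification V"
proof -
  assume V: "subspace V" "x \<in> complexification V" "y \<in> complexification V"
  have "map_matrix Re (x + y) = map_matrix Re x + map_matrix Re y" "map_matrix Im (x + y) = map_matrix Im x + map_matrix Im y"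
    by (simp_all add: map_matrix_def vec_eq_iff)
  then show ?thesis using V by (simp add: complexification_def subspace_add)
qed

lemma complexification_scale:
  "subspace V \<Longrightarrow> x \<in> complexification V \<Longrightarrow> scale_mat c x \<in> complexification V"
proof -
  assume V: "subspace V" "x \<in> complexification V"
  have "map_matrix Re (scale_mat c x) = Re c *\<^sub>R map_matrix Re x - Im c *\<^sub>R map_matrix Im x"
    "map_matrix Im (scale_mat c x) = Re c *\<^sub>R map_matrix Im x + Im c *\<^sub>R map_matrix Re x"
    by (simp_all add: map_matrix_def vec_eq_iff scale_mat_def)
  then show ?thesis using V by (simp add: complexification_def subspace_add subspace_diff subspace_scale)
qed

lemma complexification_cmat: "subspace V \<Longrightarrow> x \<in> V \<Longrightarrow> cmat x \<in> complexification V"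
proof -
  assume V: "subspace V" "x \<in> V"
  have "map_matrix Re (cmat x) = x" "map_matrix Im (cmat x) = 0" by (simp_all add: map_matrix_def vec_eq_iff)
  then show ?thesis using V by (simp add: complexification_def subspace_0)
qed

lemma complexification_so_pq: "complexification so_pq = {x :: complex^('p::finite + 'q::finite)^('p + 'q). skw x}"
proof -
  have sg: "Re (sg i) = sg i" "Im (sg i) = 0" for i :: "'p + 'q" by (cases i; simp add: sg_def)+
  have "sg i * x $ i $ j + sg j * x $ j $ i = 0 \<longleftrightarrow>
     sg i * Re (x $ i $ j) + sg j * Re (x $ j $ i) = 0 \<and> sg i * Im (x $ i $ j) + sg j * Im (x $ j $ i) = 0"
    for x :: "complex^('p + 'q)^('p + 'q)" and i j
    by (simp add: complex_eq_iff sg)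
  then show ?thesis by (auto simp: complexification_def so_pq_skw skw_entries map_matrix_def)
qed

text \<open>The inner product of the weights \<open>\<epsilon>\<^sub>b\<close> and
  \<open>\<epsilon>\<^sub>a\<close>, where
  \<open>\<epsilon>\<^sub>-\<^sub>a = - \<epsilon>\<^sub>a\<close>; the two terms cancel for a = b =
  0, in accordance with \<open>\<epsilon>\<^sub>0 = 0\<close>.\<close>

definition wt_pairing :: "int \<Rightarrow> int \<Rightarrow> int" where
  "wt_pairing b a = (if b = a then 1 else 0) - (if b = - a then 1 else 0)"

lemma idx_uminus [simp]: "- a \<in> idx l \<longleftrightarrow> a \<in> idx l"
  by (auto simp: idx_def)

text \<open>Pairing with \<open>\<epsilon>\<^sub>a\<close> and \<open>\<epsilon>\<^sub>c\<close>
  identifies the non-zero indices; an index left over pairs to zero with itself and is 0.\<close>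

lemma wt_pairing_pair_unique:
  assumes "a \<in> idx l" "c \<in> idx l" "a \<noteq> c" "a \<noteq> - c" "a' \<in> idx l" "c' \<in> idx l" "a' \<noteq> c'"
    and e: "\<And>j. j \<in> idx l \<Longrightarrow> wt_pairing a' j + wt_pairing c' j = wt_pairing a j + wt_pairing c j"
  shows "(a' = a \<and> c' = c) \<or> (a' = c \<and> c' = a)"
proof -
  have self: "wt_pairing x x = (if x = 0 then 0 else 1)" for x by (simp add: wt_pairing_def)
  have A: "a' = a \<or> c' = a" if "a \<noteq> 0"
    using e[OF assms(1)] that assms(3,4) unfolding wt_pairing_def by (auto split: if_splits)
  have C: "a' = c \<or> c' = c" if "c \<noteq> 0"
    using e[OF assms(2)] that assms(3,4) unfolding wt_pairing_def by (auto split: if_splits)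
  have zero: "x = 0" if "x \<in> idx l" "wt_pairing x x = 0" for x using that self[of x] by (simp split: if_splits)
  have d0: "wt_pairing 0 x = 0" for x by (simp add: wt_pairing_def)
  consider "a \<noteq> 0" "c \<noteq> 0" | "a = 0" "c \<noteq> 0" | "a \<noteq> 0" "c = 0" using assms(3) by blast
  then show ?thesis
  proof cases
    case 1
    then show ?thesis using A C assms(3) by blast
  next
    case 2
    from C[OF 2(2)] show ?thesis
    proof
      assume "a' = c"
      then have "wt_pairing c' c' = 0" using e[OF assms(6)] 2 d0 by simp
      then show ?thesis using zero[OF assms(6)] \<open>a' = c\<close> 2 by simp
    next
      assume "c' = c"
      then have "wt_pairing a' a' = 0" using e[OF assms(5)] 2 d0 by simp
      then show ?thesis using zero[OF assms(5)] \<open>c' = c\<close> 2 by simp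
    qed
  next
    case 3
    from A[OF 3(1)] show ?thesis
    proof
      assume "a' = a"
      then have "wt_pairing c' c' = 0" using e[OF assms(6)] 3 d0 by simp
      then show ?thesis using zero[OF assms(6)] \<open>a' = a\<close> 3 by simp
    next
      assume "c' = a"
      then have "wt_pairing a' a' = 0" using e[OF assms(5)] 3 d0 by simp
      then show ?thesis using zero[OF assms(5)] \<open>c' = a\<close> 3 by simp
    qed
  qed
qed

locale weights =
  fixes l :: nat and B :: "int \<Rightarrow> ('p::finite, 'q::finite) rvec"
  assumes B: "adapted l B" and n: "CARD('p) + CARD('q) = 2 * l + 1" and p: "CARD('p) \<le> l"
begin

abbreviation (input) h where "h \<equiv> htorus l B"
abbreviation (input) H where "H \<equiv> complexification (htorus l B)"

text \<open>For \<open>\<bar>a\<bar> > p\<close> the plane of \<open>B a\<close> and \<open>B (- a)\<close> is rotated by \<open>h\<close>, and the two isotropic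
  lines of its complexification are weight spaces.\<close>

definition v :: "int \<Rightarrow> complex^('p + 'q)" where
  "v a = (if a = 0 then \<i> *s cvec (B 0) else if \<bar>a\<bar> \<le> int CARD('p) then cvec (B a)
     else (\<i> / complex_of_real (sqrt 2)) *s (cvec (B \<bar>a\<bar>) + (of_int (sgn a) * \<i>) *s cvec (B (- \<bar>a\<bar>))))"

lemma fm_B: "a \<in> idx l \<Longrightarrow> b \<in> idx l \<Longrightarrow> fm (cvec (B a)) (cvec (B b)) = (if b = dual_index CARD('p) a then complex_of_real (dual_sign CARD('p) a) else 0)"
  using B by (simp add: fm_cvec adapted_def)

text \<open>The factors in \<open>v\<close> are made for this: a basis vector outside the hyperbolic
  pairs has square -1, and the two isotropic combinations in a rotated plane pair to -2 before
  scaling.\<close>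

lemma fm_v:
  assumes a: "a \<in> idx l" and b: "b \<in> idx l"
  shows "fm (v a) (v b) = (if b = - a then 1 else 0)"
proof -
  have k: "(\<i> / complex_of_real (sqrt 2)) * (\<i> / complex_of_real (sqrt 2)) = - 1 / 2"
    by (simp add: of_real_mult[symmetric] del: of_real_mult)
  have ab: "\<bar>a\<bar> \<in> idx l" "- \<bar>a\<bar> \<in> idx l" "\<bar>b\<bar> \<in> idx l" "- \<bar>b\<bar> \<in> idx l" "0 \<in> idx l" using a b by (auto simp: idx_def)
  have dl0: "dual_index CARD('p) 0 = 0" "dual_sign CARD('p) 0 = -1" by (simp_all add: dual_index_def dual_sign_def)
  consider "a = 0" | "a \<noteq> 0" "\<bar>a\<bar> \<le> int CARD('p)" | "int CARD('p) < \<bar>a\<bar>" by linarith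
  then show ?thesis
  proof cases
    case 1
    then show ?thesis using ab b by (auto simp: v_def fm_B dl0)
  next
    case 2
    then have "dual_index CARD('p) a = - a" "dual_sign CARD('p) a = 1" by (auto simp: dual_index_def dual_sign_def)
    then show ?thesis using 2 ab a b by (auto simp: v_def fm_B)
  next
    case a3: 3
    then have da: "dual_index CARD('p) \<bar>a\<bar> = \<bar>a\<bar>" "dual_sign CARD('p) \<bar>a\<bar> = -1" "dual_index CARD('p) (- \<bar>a\<bar>) = - \<bar>a\<bar>" "dual_sign CARD('p) (- \<bar>a\<bar>) = -1" by (auto simp: dual_index_def dual_sign_def)
    show ?thesis
    proof (cases "int CARD('p) < \<bar>b\<bar>")
      case False
      then show ?thesis using a3 ab a b da by (auto simp: v_def fm_B)
    next
      case b3: True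
      have nz: "a \<noteq> 0" "b \<noteq> 0" using a3 b3 by auto
      let ?k = "\<i> / complex_of_real (sqrt 2)"
      let ?P = "cvec (B \<bar>a\<bar>) + (of_int (sgn a) * \<i>) *s cvec (B (- \<bar>a\<bar>))"
      let ?Q = "cvec (B \<bar>b\<bar>) + (of_int (sgn b) * \<i>) *s cvec (B (- \<bar>b\<bar>))"
      have va: "v a = ?k *s ?P" and vb: "v b = ?k *s ?Q" using a3 b3 nz by (simp_all add: v_def)
      have "fm (v a) (v b) = ?k * ?k * fm ?P ?Q"
        unfolding va vb by (simp only: fm_scale_left fm_scale_right mult.assoc)
      also have "\<dots> = - 1 / 2 * fm ?P ?Q" unfolding k ..
      also have "\<dots> = (if \<bar>b\<bar> = \<bar>a\<bar> then (1 - of_int (sgn a) * of_int (sgn b)) / 2 else 0)"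
        using nz by (simp add: fm_B ab da algebra_simps)
      also have "\<dots> = (if b = - a then 1 else 0)" using nz by (auto simp: sgn_if abs_if)
      finally show ?thesis .
    qed
  qed
qed

lemma v_nonzero: "a \<in> idx l \<Longrightarrow> v a \<noteq> 0"
  using fm_v[of a "- a"] by auto

lemma cvec_B_combination:
  assumes "b \<in> idx l" obtains x y c d where "cvec (B b) = x *s v c + y *s v d" "c \<in> idx l" "d \<in> idx l"
proof -
  consider "b = 0" | "b \<noteq> 0" "\<bar>b\<bar> \<le> int CARD('p)" | "int CARD('p) < b" | "int CARD('p) < - b" by linarith
  then show ?thesis
  proof cases
    case 1
    then have "cvec (B b) = (- \<i>) *s v 0 + 0 *s v 0" by (simp add: v_def vector_smult_assoc)
    then show ?thesis using that assms 1 by blast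
  next
    case 2
    then have "cvec (B b) = 1 *s v b + 0 *s v b" by (simp add: v_def)
    then show ?thesis using that assms by blast
  next
    case 3
    let ?k = "\<i> / complex_of_real (sqrt 2)"
    have "v b + v (- b) = (2 * ?k) *s cvec (B b)" using 3
      by (simp add: v_def vec_eq_iff algebra_simps)
    then have "(1 / (2 * ?k)) *s (v b + v (- b)) = cvec (B b)" by (simp add: vector_smult_assoc)
    then have "cvec (B b) = (1 / (2 * ?k)) *s v b + (1 / (2 * ?k)) *s v (- b)" by (simp add: vector_add_ldistrib)
    then show ?thesis using that assms idx_uminus by blast
  next
    case 4
    let ?k = "\<i> / complex_of_real (sqrt 2)"
    have "v (- b) - v b = (2 * ?k * \<i>) *s cvec (B b)" using 4
      by (simp add: v_def vec_eq_iff algebra_simps)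
    then have "(1 / (2 * ?k * \<i>)) *s (v (- b) - v b) = cvec (B b)" by (simp add: vector_smult_assoc)
    then have "cvec (B b) = (1 / (2 * ?k * \<i>)) *s v (- b) + (- 1 / (2 * ?k * \<i>)) *s v b"
      by (simp add: vec_eq_iff algebra_simps)
    then show ?thesis using that assms idx_uminus by blast
  qed
qed

lemma v_separates:
  assumes "\<And>a. a \<in> idx l \<Longrightarrow> fm (v a) z = 0" shows "z = 0"
proof -
  have B0: "fm (cvec (B b)) z = 0" if "b \<in> idx l" for b
    using cvec_B_combination[OF that] assms by (metis add.right_neutral fm_add_left fm_scale_left mult_zero_right)
  define x :: "('p, 'q) rvec" where "x = (\<chi> i. Re (z $ i))"
  define y :: "('p, 'q) rvec" where "y = (\<chi> i. Im (z $ i))"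
  have z: "z = cvec x + \<i> *s cvec y" by (simp add: vec_eq_iff x_def y_def cvec_def complex_eq_iff)
  have "fm (B b) x = 0 \<and> fm (B b) y = 0" if "b \<in> idx l" for b
    using B0[OF that] unfolding z by (simp add: fm_cvec complex_eq_iff)
  then have e: "dual_coeff B b x = 0" "dual_coeff B b y = 0" if "b \<in> idx l" for b using that by (simp_all add: dual_coeff_def)
  have "x = 0" by (subst adapted_expand[OF B n]) (simp add: e)
  moreover have "y = 0" by (subst adapted_expand[OF B n]) (simp add: e)
  ultimately show ?thesis by (simp add: z)
qed

lemma v_expand: "z = (\<Sum>a\<in>idx l. fm (v (- a)) z *s v a)"
proof -
  have "fm (v b) (z - (\<Sum>a\<in>idx l. fm (v (- a)) z *s v a)) = 0" if b: "b \<in> idx l" for b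
  proof -
    have "fm (v b) (\<Sum>a\<in>idx l. fm (v (- a)) z *s v a) = (\<Sum>a\<in>idx l. if a = - b then fm (v b) z else 0)"
      unfolding fm_sum_right using b by (intro sum.cong) (auto simp: fm_v)
    then show ?thesis using b by simp
  qed
  then show ?thesis using v_separates by fastforce
qed

lemma v_matrix_eqI:
  assumes "\<And>b. b \<in> idx l \<Longrightarrow> X *v v b = Y *v v b" shows "X = (Y :: complex^('p + 'q)^('p + 'q))"
proof (rule matrix_eqI)
  fix z
  have lin: "A *v (\<Sum>a\<in>idx l. fm (v (- a)) z *s v a) = (\<Sum>a\<in>idx l. fm (v (- a)) z *s (A *v v a))"
    for A :: "complex^('p + 'q)^('p + 'q)"
    by (simp add: vec.linear_sum[OF matrix_vector_mul_linear_gen] matrix_vector_scale)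
  show "X *v z = Y *v z" by (subst (1 2) v_expand[of z]) (simp add: lin assms)
qed

lemma subspace_h: "subspace h" by (rule subspace_tori(2))

lemma H_skw: "T \<in> H \<Longrightarrow> skw T"
proof -
  assume T: "T \<in> H"
  have "htorus l B \<subseteq> so_pq" by (auto simp: htorus_def so_pq_skw)
  then have "T \<in> complexification so_pq" using T by (auto simp: complexification_def)
  then show ?thesis by (simp add: complexification_so_pq)
qed

lemma h_weight:
  assumes t: "t \<in> h" and a: "a \<in> idx l" shows "\<exists>c. cmat t *v v a = c *s v a"
  using a
proof (cases rule: idx_cases[where p = "CARD('p)"])
  case 1
  then show ?thesis using t by (simp add: v_def matrix_vector_scale cmat_cvec htorus_def)
next
  case (2 i)
  obtain c where "t *v B (int i) = c *\<^sub>R B (int i)" "t *v B (- int i) = (- c) *\<^sub>R B (- int i)" using t 2(1) unfolding htorus_def by blast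
  then obtain d where "t *v B a = d *\<^sub>R B a" using 2(2) by metis
  moreover have "v a = cvec (B a)" using 2 by (auto simp: v_def)
  ultimately show ?thesis by (intro exI[of _ "complex_of_real d"]) (simp add: cmat_cvec)
next
  case (3 j)
  obtain s where s: "t *v B (int j) = s *\<^sub>R B (- int j)" "t *v B (- int j) = (- s) *\<^sub>R B (int j)" using t 3(1) unfolding htorus_def by blast
  let ?k = "\<i> / complex_of_real (sqrt 2)" and ?o = "of_int (sgn a) :: complex"
  have va: "v a = ?k *s (cvec (B (int j)) + (?o * \<i>) *s cvec (B (- int j)))" using 3 by (auto simp: v_def)
  have o: "?o * ?o = 1" using 3 by (auto simp: sgn_if)
  have "cmat t *v v a = ?k *s (complex_of_real s *s cvec (B (- int j)) + (?o * \<i>) *s (complex_of_real (- s) *s cvec (B (int j))))"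
    unfolding va by (simp add: matrix_vector_scale matrix_vector_right_distrib cmat_cvec s del: scaleR_minus_left)
  also have "\<dots> = (- \<i> * ?o * complex_of_real s) *s v a"
  proof -
    have "s' * d = - \<i> * ?o * s' * (?o * \<i> * d)" for d s' :: complex
    proof -
      have "- \<i> * ?o * s' * (?o * \<i> * d) = (?o * ?o) * s' * d" by (simp add: algebra_simps)
      then show ?thesis using o by simp
    qed
    then show ?thesis unfolding va using o by (simp add: vec_eq_iff algebra_simps)
  qed
  finally show ?thesis by blast
qed

text \<open>The eigenvalue is read off by pairing with the dual vector \<open>v (- a)\<close>; the
  value 0 off the torus follows the convention for functionals.\<close>

definition wt :: "int \<Rightarrow> complex^('p + 'q)^('p + 'q) \<Rightarrow> complex" where
  "wt a T = (if T \<in> H then fm (v (- a)) (T *v v a) else 0)"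

lemma wt_eigen: assumes T: "T \<in> H" and a: "a \<in> idx l" shows "T *v v a = wt a T *s v a"
proof -
  have "map_matrix Re T \<in> h" "map_matrix Im T \<in> h" using T by (auto simp: complexification_def)
  then obtain c d where "cmat (map_matrix Re T) *v v a = c *s v a" "cmat (map_matrix Im T) *v v a = d *s v a"
    using h_weight a by metis
  then have e: "T *v v a = (c + \<i> * d) *s v a"
    unfolding complexification_decompose[of T] by (simp add: vector_smult_assoc vector_sadd_rdistrib)
  then have "wt a T = c + \<i> * d" using T a by (simp add: wt_def fm_v)
  then show ?thesis using e by simp
qed

lemma wt_uminus: "a \<in> idx l \<Longrightarrow> wt (- a) T = - wt a T"
proof (cases "T \<in> H")
  case True
  show ?thesis using True skwD[OF H_skw[OF True], of "v a" "v (- a)"] by (simp add: wt_def fm_sym[of "v (- a)"])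
qed (simp add: wt_def)

lemma wt_0: "wt 0 T = 0"
  using wt_uminus[of 0 T] by (simp add: idx_def)

lemma wt_add: "S \<in> H \<Longrightarrow> T \<in> H \<Longrightarrow> wt a (S + T) = wt a S + wt a T"
  using complexification_add[OF subspace_h] by (simp add: wt_def matrix_vector_mult_add_rdistrib)

lemma wt_scale: "T \<in> H \<Longrightarrow> wt a (scale_mat c T) = c * wt a T"
  using complexification_scale[OF subspace_h] by (simp add: wt_def)

text \<open>For a \<noteq> 0 this acts by 1 on \<open>v a\<close>, by -1 on \<open>v (- a)\<close>
  and by 0 on the other weight vectors, so it represents \<open>\<epsilon>\<^sub>a\<close> in the
  torus.\<close>

definition Hh :: "int \<Rightarrow> complex^('p + 'q)^('p + 'q)" where
  "Hh a = wd (v a) (v (- a))"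

lemma wd_B_torus:
  assumes "j \<in> {1..l}"
  shows "wd (B (int j)) (B (- int j)) \<in> h" "j \<le> CARD('p) \<Longrightarrow> wd (B (int j)) (B (- int j)) \<in> atorus l B"
proof -
  let ?w = "wd (B (int j)) (B (- int j))"
  have i: "int j \<in> idx l" "- int j \<in> idx l" using assms by (auto simp: idx_def)
  have f: "fm (B (int j)) (B b) = (if b = dual_index CARD('p) (int j) then dual_sign CARD('p) (int j) else 0)"
    "fm (B (- int j)) (B b) = (if b = dual_index CARD('p) (- int j) then dual_sign CARD('p) (int j) else 0)" if "b \<in> idx l" for b
    using B i that by (auto simp: adapted_def dual_sign_def)
  show at: "?w \<in> atorus l B" if jp: "j \<le> CARD('p)"
  proof -
    have d: "dual_index CARD('p) (int j) = - int j" "dual_index CARD('p) (- int j) = int j" "dual_sign CARD('p) (int j) = 1" using jp assms by (auto simp: dual_index_def dual_sign_def)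
    show ?thesis unfolding atorus_def
    proof (intro CollectI conjI ballI impI)
      fix k assume k: "k \<in> {1..CARD('p)}"
      then have "int k \<in> idx l" "- int k \<in> idx l" using p by (auto simp: idx_def)
      then show "\<exists>c. ?w *v B (int k) = c *\<^sub>R B (int k) \<and> ?w *v B (- int k) = (- c) *\<^sub>R B (- int k)"
        using k assms by (intro exI[of _ "if k = j then 1 else 0"]) (auto simp: wd_applyR f d)
    next
      fix b assume "b \<in> idx l" "b = 0 \<or> int CARD('p) < \<bar>b\<bar>"
      then show "?w *v B b = 0" using jp assms by (auto simp: wd_applyR f d)
    qed simp
  qed
  show "?w \<in> h"
  proof (cases "j \<le> CARD('p)")
    case True
    then show ?thesis using at atorus_subset_htorus[OF p, of B] by blast
  next
    case False
    have d: "dual_index CARD('p) (int j) = int j" "dual_index CARD('p) (- int j) = - int j" "dual_sign CARD('p) (int j) = -1" using False assms by (auto simp: dual_index_def dual_sign_def)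
    show ?thesis unfolding htorus_def
    proof (intro CollectI conjI ballI impI)
      fix k assume k: "k \<in> {1..CARD('p)}"
      then have "int k \<in> idx l" "- int k \<in> idx l" using p by (auto simp: idx_def)
      then show "\<exists>c. ?w *v B (int k) = c *\<^sub>R B (int k) \<and> ?w *v B (- int k) = (- c) *\<^sub>R B (- int k)"
        using k False by (intro exI[of _ 0]) (auto simp: wd_applyR f d)
    next
      fix k assume k: "k \<in> {CARD('p) + 1..l}"
      then have "int k \<in> idx l" "- int k \<in> idx l" by (auto simp: idx_def)
      then show "\<exists>s. ?w *v B (int k) = s *\<^sub>R B (- int k) \<and> ?w *v B (- int k) = (- s) *\<^sub>R B (int k)"
        using k assms by (intro exI[of _ "if k = j then 1 else 0"]) (auto simp: wd_applyR f d)
    next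
      show "?w *v B 0 = 0" using assms by (simp add: wd_applyR f d idx_def)
    qed simp
  qed
qed

lemma Hh_mem: assumes a: "a \<in> idx l" shows "Hh a \<in> H"
proof -
  have pos: "Hh (int j) \<in> H" if j: "j \<in> {1..l}" for j
  proof (cases "j \<le> CARD('p)")
    case True
    then have "Hh (int j) = cmat (wd (B (int j)) (B (- int j)))" using j by (simp add: Hh_def v_def cmat_wd)
    then show ?thesis using complexification_cmat[OF subspace_h wd_B_torus(1)[OF j]] by simp
  next
    case False
    let ?c = "cvec (B (int j))" and ?d = "cvec (B (- int j))"
    have k: "(\<i> / complex_of_real (sqrt 2)) * (\<i> / complex_of_real (sqrt 2)) = - 1 / 2"
      by (simp add: of_real_mult[symmetric] del: of_real_mult)
    let ?k = "\<i> / complex_of_real (sqrt 2)"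
    have v1: "v (int j) = ?k *s (?c + \<i> *s ?d)" and v2: "v (- int j) = ?k *s (?c + (- \<i>) *s ?d)"
      using False j by (simp_all add: v_def)
    have "Hh (int j) = scale_mat (?k * ?k) (wd (?c + \<i> *s ?d) (?c + (- \<i>) *s ?d))"
      unfolding Hh_def v1 v2 by (simp only: scale_mat_wd scale_mat_scale_mat)
    then have "Hh (int j) = scale_mat (- 1 / 2) (wd (?c + \<i> *s ?d) (?c + (- \<i>) *s ?d))" unfolding k .
    also have "wd (?c + \<i> *s ?d) (?c + (- \<i>) *s ?d) = scale_mat (- 2 * \<i>) (wd ?c ?d)"
      by (simp add: vec_eq_iff wd_def algebra_simps)
    also have "scale_mat (- 1 / 2) (scale_mat (- 2 * \<i>) (wd ?c ?d)) = scale_mat \<i> (cmat (wd (B (int j)) (B (- int j))))"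
      by (simp add: cmat_wd)
    finally show ?thesis
      using complexification_scale[OF subspace_h complexification_cmat[OF subspace_h wd_B_torus(1)[OF j]]] by simp
  qed
  have neg: "Hh (- b) = scale_mat (- 1) (Hh b)" for b
    by (simp add: Hh_def wd_swap[of "v (- b)"] scale_mat_minus)
  consider "a = 0" | j where "j \<in> {1..l}" "a = int j" | j where "j \<in> {1..l}" "a = - int j"
    using a by (cases rule: idx_cases[where p = l]) auto
  then show ?thesis
  proof cases
    case 1
    have "Hh 0 = cmat 0" by (simp add: Hh_def map_matrix_def vec_eq_iff)
    then show ?thesis using 1 complexification_cmat[OF subspace_h subspace_0[OF subspace_h]] by simp
  next
    case 2
    then show ?thesis using pos by simp
  next
    case 3
    then show ?thesis using complexification_scale[OF subspace_h pos[OF 3(1)]] neg by simp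
  qed
qed

lemma wt_Hh: "a \<in> idx l \<Longrightarrow> b \<in> idx l \<Longrightarrow> wt b (Hh a) = of_int (wt_pairing b a)"
  using Hh_mem[of a] by (auto simp: wt_def Hh_def wd_apply fm_v wt_pairing_def)

section \<open>Roots, root spaces and coroots\<close>

definition rt :: "int \<Rightarrow> int \<Rightarrow> complex^('p + 'q)^('p + 'q) \<Rightarrow> complex" where
  "rt a c = (\<lambda>T. wt a T + wt c T)"

lemma rt_commute: "rt a c = rt c a"
  by (simp add: rt_def add.commute)

lemma rt_Hh: "a \<in> idx l \<Longrightarrow> c \<in> idx l \<Longrightarrow> j \<in> idx l \<Longrightarrow> rt a c (Hh j) = of_int (wt_pairing a j + wt_pairing c j)"
  by (simp add: rt_def wt_Hh)

lemma root_space_wd: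
  assumes a: "a \<in> idx l" and c: "c \<in> idx l"
  shows "scale_mat k (wd (v a) (v c)) \<in> root_space so_pq h (rt a c)"
proof -
  have "lie_br T (scale_mat k (wd (v a) (v c))) = scale_mat (rt a c T) (scale_mat k (wd (v a) (v c)))" if T: "T \<in> H" for T
  proof -
    have "lie_br T (wd (v a) (v c)) = scale_mat (rt a c T) (wd (v a) (v c))"
      unfolding lie_br_wd[OF H_skw[OF T]] wt_eigen[OF T a] wt_eigen[OF T c]
      by (simp add: scale_mat_wd rt_def vec_eq_iff algebra_simps)
    then show ?thesis using lie_br_scale_mat[of 1 T k] by (simp add: mult.commute)
  qed
  moreover have "skw (scale_mat k (wd (v a) (v c)))"
    by (metis scale_mat_wd(1) skw_wd)
  ultimately show ?thesis by (simp add: root_space_def complexification_so_pq)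
qed

text \<open>An entry of a root vector in the weight basis can be non-zero only if the root is the
  difference of the weights of its row and column.\<close>

lemma root_space_entry:
  assumes x: "x \<in> root_space so_pq h \<beta>" and a: "a \<in> idx l" and b: "b \<in> idx l" and T: "T \<in> H"
  shows "(wt a T + wt (- b) T) * fm (v (- a)) (x *v v b) = \<beta> T * fm (v (- a)) (x *v v b)"
proof -
  have "lie_br T x = scale_mat (\<beta> T) x" using x T by (simp add: root_space_def)
  then have "fm (v (- a)) (lie_br T x *v v b) = \<beta> T * fm (v (- a)) (x *v v b)" by simp
  moreover have "fm (v (- a)) (T *v (x *v v b)) = wt a T * fm (v (- a)) (x *v v b)"
    using skwD[OF H_skw[OF T], of "v (- a)" "x *v v b"] wt_eigen[OF T, of "- a"] a by (simp add: wt_uminus)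
  ultimately show ?thesis using wt_eigen[OF T b] b
    by (simp add: lie_br_apply matrix_vector_scale wt_uminus algebra_simps)
qed

lemma entry_diagonal:
  assumes "x \<in> root_space so_pq h \<beta>" shows "fm (v a) (x *v v a) = 0"
proof -
  have "skw x" using assms by (simp add: root_space_def complexification_so_pq)
  then show ?thesis using fm_skw_self[of x "v a"] fm_sym by metis
qed

lemma off_H: "T \<notin> H \<Longrightarrow> rt a c T = 0"
  by (simp add: rt_def wt_def)

lemma rt_nonzero:
  assumes "a \<in> idx l" "c \<in> idx l" "a \<noteq> c" "a \<noteq> - c" shows "rt a c \<noteq> (\<lambda>_. 0)"
proof (cases "a = 0")
  case True
  then have "rt a c (Hh c) = 1" using assms by (simp add: rt_Hh wt_pairing_def)
  then show ?thesis by auto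
next
  case False
  then have "rt a c (Hh a) = 1" using assms by (auto simp: rt_Hh wt_pairing_def)
  then show ?thesis by auto
qed

text \<open>A root vector has a non-zero entry, which makes the root a difference of weights;
  skewness excludes equal indices, and non-vanishing of the root excludes opposite ones. The index 0
  is allowed and gives the short roots.\<close>

lemma roots_eq: "roots so_pq h = {rt a c | a c. a \<in> idx l \<and> c \<in> idx l \<and> a \<noteq> c \<and> a \<noteq> - c}"
proof (intro set_eqI iffI)
  fix \<beta> assume \<beta>: "\<beta> \<in> roots so_pq h"
  then obtain x where x: "x \<in> root_space so_pq h \<beta>" "x \<noteq> 0"
    and nz: "\<beta> \<noteq> (\<lambda>_. 0)" and off: "\<And>T. T \<notin> H \<Longrightarrow> \<beta> T = 0"
  proof -
    have "0 \<in> root_space so_pq h \<beta>" by (simp add: root_space_def complexification_so_pq scale_mat_def map_matrix_def vec_eq_iff)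
    then show ?thesis using \<beta> that unfolding roots_def complex_functional_def by blast
  qed
  have "\<exists>a\<in>idx l. \<exists>b\<in>idx l. fm (v (- a)) (x *v v b) \<noteq> 0"
  proof (rule ccontr)
    assume no: "\<not> ?thesis"
    have "x *v v b = 0" if b: "b \<in> idx l" for b
    proof (rule v_separates)
      show "fm (v a) (x *v v b) = 0" if "a \<in> idx l" for a using no b that by (metis idx_uminus minus_minus)
    qed
    then have "x = 0" by (intro v_matrix_eqI) simp
    then show False using x by simp
  qed
  then obtain a b where ab: "a \<in> idx l" "b \<in> idx l" "fm (v (- a)) (x *v v b) \<noteq> 0" by blast
  have e: "\<beta> = rt a (- b)"
  proof
    fix T
    show "\<beta> T = rt a (- b) T"
    proof (cases "T \<in> H")
      case True
      then show ?thesis using root_space_entry[OF x(1) ab(1,2) True] ab(3) by (simp add: rt_def)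
    qed (simp add: off off_H)
  qed
  have "a \<noteq> - b" using ab(3) entry_diagonal[OF x(1), of b] by auto
  moreover have "a \<noteq> b"
  proof
    assume "a = b"
    then have "\<beta> = (\<lambda>_. 0)" using ab(2) by (auto simp: e rt_def wt_uminus)
    then show False using nz by simp
  qed
  ultimately show "\<beta> \<in> {rt a c | a c. a \<in> idx l \<and> c \<in> idx l \<and> a \<noteq> c \<and> a \<noteq> - c}"
    using e ab(1,2) idx_uminus by (metis (mono_tags, lifting) mem_Collect_eq minus_minus)
next
  fix \<beta> assume "\<beta> \<in> {rt a c | a c. a \<in> idx l \<and> c \<in> idx l \<and> a \<noteq> c \<and> a \<noteq> - c}"
  then obtain a c where ac: "\<beta> = rt a c" "a \<in> idx l" "c \<in> idx l" "a \<noteq> c" "a \<noteq> - c" by blast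
  have "wd (v a) (v c) *v v (- a) = - v c" using ac by (simp add: wd_apply fm_v)
  then have "wd (v a) (v c) \<noteq> 0" using v_nonzero[OF ac(3)] by auto
  moreover have "wd (v a) (v c) \<in> root_space so_pq h \<beta>" using root_space_wd[OF ac(2,3), of 1] ac(1) by simp
  moreover have "complex_functional H \<beta>"
    unfolding complex_functional_def ac(1) using off_H by (auto simp: rt_def wt_add wt_scale algebra_simps)
  ultimately show "\<beta> \<in> roots so_pq h" using rt_nonzero[OF ac(2-5)] ac(1) by (auto simp: roots_def)
qed

lemma rt_inject:
  assumes "a \<in> idx l" "c \<in> idx l" "a \<noteq> c" "a \<noteq> - c" "a' \<in> idx l" "c' \<in> idx l" "a' \<noteq> c'"
    and "\<And>j. j \<in> idx l \<Longrightarrow> rt a' c' (Hh j) = rt a c (Hh j)"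
  shows "(a' = a \<and> c' = c) \<or> (a' = c \<and> c' = a)"
proof (rule wt_pairing_pair_unique[OF assms(1-7)])
  fix j assume j: "j \<in> idx l"
  have "complex_of_int (wt_pairing a' j + wt_pairing c' j) = of_int (wt_pairing a j + wt_pairing c j)"
    using assms(8)[OF j] unfolding rt_Hh[OF assms(1,2) j] rt_Hh[OF assms(5,6) j] .
  then show "wt_pairing a' j + wt_pairing c' j = wt_pairing a j + wt_pairing c j" by (simp only: of_int_eq_iff)
qed

text \<open>By \<open>rt_inject\<close> only two entries can be non-zero, and skewness ties them
  together.\<close>

lemma root_space_line:
  assumes ac: "a \<in> idx l" "c \<in> idx l" "a \<noteq> c" "a \<noteq> - c" and x: "x \<in> root_space so_pq h (rt a c)"
  obtains k where "x = scale_mat k (wd (v a) (v c))"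
proof -
  have sk: "skw x" using x by (simp add: root_space_def complexification_so_pq)
  have zero: "fm (v (- a')) (x *v v b) = 0" if ab: "a' \<in> idx l" "b \<in> idx l" "\<not> (a' = a \<and> b = - c) \<and> \<not> (a' = c \<and> b = - a)" for a' b
  proof (rule ccontr)
    assume nz: "fm (v (- a')) (x *v v b) \<noteq> 0"
    then have ne: "a' \<noteq> - b" using entry_diagonal[OF x, of b] by auto
    have "rt a' (- b) (Hh j) = rt a c (Hh j)" if "j \<in> idx l" for j
      using root_space_entry[OF x ab(1,2) Hh_mem[OF that]] nz by (simp add: rt_def)
    then show False using rt_inject[OF ac ab(1) _ ne] ab(2,3) by auto
  qed
  define k where "k = fm (v (- a)) (x *v v (- c))"
  have k': "fm (v (- c)) (x *v v (- a)) = - k" using skwD[OF sk, of "v (- a)" "v (- c)"] fm_sym by (metis k_def minus_minus)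
  have "x = scale_mat k (wd (v a) (v c))"
  proof (rule v_matrix_eqI)
    fix b assume b: "b \<in> idx l"
    have "x *v v b - k *s (wd (v a) (v c) *v v b) = 0"
    proof (rule v_separates)
      fix e assume e: "e \<in> idx l"
      have f1: "fm (v e) (wd (v a) (v c) *v v b) = (if b = - c \<and> e = - a then 1 else 0) - (if b = - a \<and> e = - c then 1 else 0)"
        using ac b e by (auto simp: wd_apply fm_v)
      have f2: "fm (v e) (x *v v b) = (if b = - c \<and> e = - a then k else 0) - (if b = - a \<and> e = - c then k else 0)"
      proof -
        consider "b = - c" "e = - a" | "b = - a" "e = - c" | "\<not> (e = - a \<and> b = - c)" "\<not> (e = - c \<and> b = - a)" by blast
        then show ?thesis
        proof cases
          case 1
          then show ?thesis using ac by (auto simp: k_def)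
        next
          case 2
          then show ?thesis using ac k' by auto
        next
          case 3
          then have "\<not> (- e = a \<and> b = - c) \<and> \<not> (- e = c \<and> b = - a)" by auto
          then have "fm (v e) (x *v v b) = 0" using zero[of "- e" b] e b by simp
          moreover have "(if b = - c \<and> e = - a then k else 0) = 0" by (rule if_not_P) (use 3 in blast)
          moreover have "(if b = - a \<and> e = - c then k else 0) = 0" by (rule if_not_P) (use 3 in blast)
          ultimately show ?thesis by (simp only: diff_zero)
        qed
      qed
      have key: "(if P then k else 0) - (if Q then k else 0) = k * ((if P then 1 else 0) - (if Q then 1 else 0))"
        for P Q by simp
      have "fm (v e) (x *v v b) = k * fm (v e) (wd (v a) (v c) *v v b)" unfolding f1 f2 key ..
      then show "fm (v e) (x *v v b - k *s (wd (v a) (v c) *v v b)) = 0"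
        unfolding fm_diff_right fm_scale_right by simp
    qed
    then show "x *v v b = scale_mat k (wd (v a) (v c)) *v v b" by simp
  qed
  then show ?thesis using that by blast
qed

text \<open>Brackets between the two root spaces are multiples of \<open>Hh a + Hh c\<close>, on
  which the root has the value \<open>N\<close>: 2 for a long root, 1 for a short one.\<close>

lemma coroot_rt:
  assumes ac: "a \<in> idx l" "c \<in> idx l" "a \<noteq> c" "a \<noteq> - c"
  defines "N \<equiv> (if a = 0 \<or> c = 0 then 1 else 2 :: complex)"
  shows "coroot so_pq h (rt a c) = scale_mat (2 / N) (Hh a + Hh c)"
proof -
  have ac': "- a \<in> idx l" "- c \<in> idx l" "- a \<noteq> - c" "- a \<noteq> - (- c)" using ac by auto
  have neg: "(\<lambda>s. - rt a c s) = rt (- a) (- c)" using ac by (simp add: rt_def wt_uminus)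
  have br: "lie_br (scale_mat k (wd (v a) (v c))) (scale_mat m (wd (v (- a)) (v (- c)))) = scale_mat (- k * m) (Hh a + Hh c)" for k m
  proof -
    have "lie_br (wd (v a) (v c)) (wd (v (- a)) (v (- c))) = - (Hh a + Hh c)"
      using ac by (simp add: lie_br_wd wd_apply fm_v Hh_def wd_swap[of "v (- a)" "v a"])
    then show ?thesis by (simp only: lie_br_scale_mat) (simp add: vec_eq_iff algebra_simps)
  qed
  have Hac: "Hh a + Hh c \<in> H" by (intro complexification_add[OF subspace_h] Hh_mem ac)
  have val: "rt a c (scale_mat k (Hh a + Hh c)) = k * N" for k
  proof -
    have "wt b (Hh a + Hh c) = of_int (wt_pairing b a + wt_pairing b c)" if "b \<in> idx l" for b
      using that ac by (simp add: wt_add Hh_mem wt_Hh)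
    then have "rt a c (scale_mat k (Hh a + Hh c)) = k * of_int (wt_pairing a a + wt_pairing a c + wt_pairing c a + wt_pairing c c)"
      using ac by (simp add: rt_def wt_scale[OF Hac] algebra_simps)
    moreover have "complex_of_int (wt_pairing a a + wt_pairing a c + wt_pairing c a + wt_pairing c c) = N" using ac by (auto simp: wt_pairing_def N_def)
    ultimately show ?thesis by simp
  qed
  have N: "N \<noteq> 0" by (simp add: N_def)
  show ?thesis unfolding coroot_def neg
  proof (rule the_equality)
    have eq: "scale_mat (2 / N) (Hh a + Hh c) = lie_br (scale_mat (- 2 / N) (wd (v a) (v c))) (scale_mat 1 (wd (v (- a)) (v (- c))))"
      by (simp add: br del: scale_mat_0_1)
    have two: "rt a c (scale_mat (2 / N) (Hh a + Hh c)) = 2" using val N by simp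
    show "(\<exists>x\<in>root_space so_pq h (rt a c). \<exists>y\<in>root_space so_pq h (rt (- a) (- c)).
        scale_mat (2 / N) (Hh a + Hh c) = lie_br x y) \<and> rt a c (scale_mat (2 / N) (Hh a + Hh c)) = 2"
    proof (rule conjI[OF _ two])
      show "\<exists>x\<in>root_space so_pq h (rt a c). \<exists>y\<in>root_space so_pq h (rt (- a) (- c)). scale_mat (2 / N) (Hh a + Hh c) = lie_br x y"
        by (rule bexI[OF _ root_space_wd[OF ac(1,2)]], rule bexI[OF _ root_space_wd[OF ac'(1,2)]], rule eq)
    qed
  next
    fix t assume t: "(\<exists>x\<in>root_space so_pq h (rt a c). \<exists>y\<in>root_space so_pq h (rt (- a) (- c)). t = lie_br x y) \<and> rt a c t = 2"
    obtain x where x: "x \<in> root_space so_pq h (rt a c)" "\<exists>y\<in>root_space so_pq h (rt (- a) (- c)). t = lie_br x y"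
      using conjunct1[OF t] by (rule bexE)
    obtain y where y: "y \<in> root_space so_pq h (rt (- a) (- c))" "t = lie_br x y"
      using x(2) by (rule bexE)
    note xy = x(1) y
    note t = conjunct2[OF t]
    obtain k where k: "x = scale_mat k (wd (v a) (v c))" using root_space_line[OF ac xy(1)] .
    obtain m where m: "y = scale_mat m (wd (v (- a)) (v (- c)))" using root_space_line[OF ac' xy(2)] .
    have t': "t = scale_mat (- k * m) (Hh a + Hh c)" using xy(3) k m br by simp
    then have "- k * m = 2 / N" using t val[of "- k * m"] N by (simp add: field_simps)
    then show "t = scale_mat (2 / N) (Hh a + Hh c)" using t' by simp
  qed
qed

lemma cartan_integer_rt:
  assumes ac: "a \<in> idx l" "c \<in> idx l" "a \<noteq> c" "a \<noteq> - c" and bd: "b \<in> idx l" "d \<in> idx l"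
  shows "cartan_integer so_pq h (rt b d) (rt a c) =
    (if a = 0 \<or> c = 0 then 2 else 1) * of_int (wt_pairing b a + wt_pairing d a + wt_pairing b c + wt_pairing d c)"
proof -
  have Hac: "Hh a + Hh c \<in> H" by (intro complexification_add[OF subspace_h] Hh_mem ac)
  have "wt e (Hh a + Hh c) = of_int (wt_pairing e a + wt_pairing e c)" if "e \<in> idx l" for e
    using that ac by (simp add: wt_add Hh_mem wt_Hh)
  then show ?thesis unfolding cartan_integer_def coroot_rt[OF ac]
    using bd by (auto simp: rt_def wt_scale[OF Hac] algebra_simps add_divide_distrib)
qed

end

section \<open>Simple roots and the Satake diagram\<close>

lemma wt_pairing_sym: "wt_pairing a b = wt_pairing b a" and wt_pairing_uminus: "wt_pairing a (- b) = - wt_pairing a b" "wt_pairing (- a) b = - wt_pairing a b"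
  and wt_pairing_self: "a \<noteq> 0 \<Longrightarrow> wt_pairing a a = 1" and wt_pairing_0: "wt_pairing 0 a = 0" "wt_pairing a 0 = 0"
  and wt_pairing_other: "\<bar>a\<bar> \<noteq> \<bar>b\<bar> \<Longrightarrow> wt_pairing a b = 0"
  by (auto simp: wt_pairing_def)

text \<open>\<open>wd e f\<close> has eigenvalue 1 on the line of \<open>e\<close>, -1 on that of
  \<open>f\<close> and 0 on their orthogonal complement, and \<open>x\<close> raises eigenvalues by
  1. So \<open>x\<close> kills \<open>e\<close> and sends the complement into the line of
  \<open>e\<close>.\<close>

lemma lie_br_eigen_1:
  fixes x :: "('p::finite, 'q::finite) rmat"
  assumes x: "skw x" and ef: "fm e e = 0" "fm f f = 0" "fm e f = 1" and br: "lie_br (wd e f) x = x"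
  shows "x = wd e (- (x *v f))" "x \<in> W1 e (perp e)"
proof -
  have fe: "fm f e = 1" using ef fm_sym by metis
  have eq: "wd e f *v (x *v z) - x *v (wd e f *v z) = x *v z" for z
    using arg_cong[OF br, of "\<lambda>y. y *v z"] by (simp add: lie_br_apply)
  have s: "fm e (x *v e) = 0" using fm_skw_self[OF x] fm_sym by metis
  have "fm f (x *v e) *\<^sub>R e - x *v e = x *v e" using eq[of e] ef fe s by (simp add: wd_applyR)
  then have 1: "fm f (x *v e) *\<^sub>R e - x *v e = x *v e" .
  have "fm f (fm f (x *v e) *\<^sub>R e - x *v e) = fm f (x *v e)" unfolding 1 ..
  then have "fm f (x *v e) = 0" using fe by simp
  then have "- (x *v e) = x *v e" using 1 by simp
  then have xe: "x *v e = 0" by (simp add: vec_eq_iff)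
  have xz: "x *v z = fm (x *v z) f *\<^sub>R e" if "fm e z = 0" "fm f z = 0" for z
  proof -
    have 2: "fm f (x *v z) *\<^sub>R e - fm e (x *v z) *\<^sub>R f = x *v z" using eq[of z] that by (simp add: wd_applyR)
    then have "fm e (fm f (x *v z) *\<^sub>R e - fm e (x *v z) *\<^sub>R f) = fm e (x *v z)" by simp
    then have "fm e (x *v z) = 0" using ef by simp
    then show ?thesis using 2 fm_sym[of f] by simp
  qed
  show "x = wd e (- (x *v f))" "x \<in> W1 e (perp e)"
    using W1_perp_I[OF x ef(1,3) xe] xz by blast+
qed

text \<open>The first eigenvalue gives \<open>x = wd e y\<close>, and the second confines
  \<open>y\<close> to the span of \<open>e\<close> and \<open>e'\<close>.\<close>

lemma lie_br_eigen_2: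
  fixes x :: "('p::finite, 'q::finite) rmat"
  assumes x: "skw x" and ef: "fm e e = 0" "fm f f = 0" "fm e f = 1" and br: "lie_br (wd e f) x = x"
    and ef': "fm e' e' = 0" "fm f' f' = 0" "fm e' f' = 1" and br': "lie_br (wd e' f') x = x"
    and o: "fm e' e = 0" "fm f' e = 0"
  obtains k where "x = k *\<^sub>R wd e e'"
proof -
  define y where "y = - (x *v f)"
  have xy: "x = wd e y" using lie_br_eigen_1(1)[OF x ef br] y_def by simp
  have "lie_br (wd e' f') (wd e y) = wd e (wd e' f' *v y)" using o by (simp add: lie_br_wd wd_applyR)
  then have "wd e (wd e' f' *v y - y) = 0" using br' xy by (simp add: wd_diff_right)
  then have 1: "wd e' f' *v y - y = fm (wd e' f' *v y - y) f *\<^sub>R e" using wd_eq_0_imp ef(3) by blast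
  define m where "m = fm (wd e' f' *v y - y) f"
  have 2: "wd e' f' *v y - y = m *\<^sub>R e" unfolding m_def by (rule 1)
  then have "fm e' (wd e' f' *v y - y) = fm e' (m *\<^sub>R e)" by simp
  then have "fm e' y = 0" using ef' o by (simp add: wd_applyR)
  then have "y = fm f' y *\<^sub>R e' - m *\<^sub>R e" using 2 by (simp add: wd_applyR algebra_simps)
  then have "wd e y = fm f' y *\<^sub>R wd e e'" by (metis wd_diff_right wd_scaleR_right wd_self scaleR_zero_right diff_zero)
  then show ?thesis using that[of "fm f' y"] xy by simp
qed

lemma W2_span:
  fixes A :: "('p::finite, 'q::finite) rvec set"
  shows "W2 (span A) = span {wd x y | x y. x \<in> A \<and> y \<in> A}"
proof
  let ?S = "span {wd x y | x y. x \<in> A \<and> y \<in> A}"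
  have sub: "subspace ?S" by simp
  have s1: "wd x y \<in> ?S" if x: "x \<in> A" and y: "y \<in> span A" for x y
    using y
  proof (induction rule: span_induct)
    case base
    show ?case unfolding subspace_def using sub by (auto simp: wd_add_right subspace_add subspace_scale subspace_0)
  qed (use x in \<open>blast intro: span_base\<close>)
  have s2: "wd x y \<in> ?S" if x: "x \<in> span A" and y: "y \<in> span A" for x y
    using x
  proof (induction rule: span_induct)
    case base
    show ?case unfolding subspace_def using sub by (auto simp: wd_add_left subspace_add subspace_scale subspace_0)
  qed (use s1 y in blast)
  show "W2 (span A) \<subseteq> ?S" unfolding W2_def by (rule span_minimal) (use s2 in auto)
  show "?S \<subseteq> W2 (span A)" unfolding W2_def by (rule span_mono) (blast intro: span_base)
qed

locale satake = weights l B for l and B :: "int \<Rightarrow> ('p::finite, 'q::finite) rvec" +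
  fixes \<alpha> :: "nat \<Rightarrow> complex^('p + 'q)^('p + 'q) \<Rightarrow> complex"
  assumes l2: "2 \<le> l" and basis: "satake_basis so_pq (atorus l B) (htorus l B) l \<alpha>"
    and lab: "labelled_B so_pq (htorus l B) l \<alpha>"
begin

abbreviation (input) ta where "ta \<equiv> atorus l B"
abbreviation (input) \<Phi> where "\<Phi> \<equiv> roots so_pq (htorus l B)"

lemma \<alpha>_root: "i \<in> {1..l} \<Longrightarrow> \<exists>a c. \<alpha> i = rt a c \<and> a \<in> idx l \<and> c \<in> idx l \<and> a \<noteq> c \<and> a \<noteq> - c"
proof -
  assume "i \<in> {1..l}"
  then have "\<alpha> i \<in> \<Phi>" using basis by (auto simp: satake_basis_def root_basis_def)
  then show ?thesis unfolding roots_eq by blast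
qed

definition coroot_scale :: "int \<Rightarrow> int \<Rightarrow> int" where
  "coroot_scale a c = (if a = 0 \<or> c = 0 then 2 else 1)"

lemma cartan_int:
  assumes i: "i \<in> {1..l}" and j: "j \<in> {1..l}" and ne: "i \<noteq> j"
    and ac: "\<alpha> j = rt a c" "a \<in> idx l" "c \<in> idx l" "a \<noteq> c" "a \<noteq> - c"
    and bd: "\<alpha> i = rt b d" "b \<in> idx l" "d \<in> idx l"
  shows "coroot_scale a c * (wt_pairing b a + wt_pairing d a + wt_pairing b c + wt_pairing d c) =
    (if j = l \<and> i + 1 = l then -2 else if i + 1 = j \<or> j + 1 = i then -1 else 0)"
proof -
  have "complex_of_int (coroot_scale a c * (wt_pairing b a + wt_pairing d a + wt_pairing b c + wt_pairing d c)) = cartan_integer so_pq h (\<alpha> i) (\<alpha> j)"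
    unfolding ac(1) bd(1) cartan_integer_rt[OF ac(2-5) bd(2,3)] by (simp add: coroot_scale_def)
  also have "\<dots> = (if j = l \<and> i + 1 = l then -2 else if i + 1 = j \<or> j + 1 = i then -1 else 0)"
    using lab i j ne unfolding labelled_B_def by blast
  also have "\<dots> = complex_of_int (if j = l \<and> i + 1 = l then -2 else if i + 1 = j \<or> j + 1 = i then -1 else 0)" by simp
  finally show ?thesis by (simp only: of_int_eq_iff)
qed

text \<open>The Cartan integers determine \<open>\<alpha>\<^sub>i = \<epsilon>\<^bsub>s i\<^esub> - \<epsilon>\<^bsub>s (i + 1)\<^esub>\<close> step by step from the short root \<open>\<alpha>\<^sub>l\<close>
  downwards, where \<open>\<epsilon>\<^sub>-\<^sub>a = - \<epsilon>\<^sub>a\<close> and \<open>\<epsilon>\<^sub>0 = 0\<close>.\<close>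

definition chain_from :: "nat \<Rightarrow> (nat \<Rightarrow> int) \<Rightarrow> bool" where
  "chain_from k s \<longleftrightarrow> s (l + 1) = 0 \<and> (\<forall>i\<in>{k..l}. s i \<in> idx l \<and> s i \<noteq> 0 \<and> \<alpha> i = rt (s i) (- s (i + 1)) \<and>
     (\<forall>j\<in>{k..l}. j \<noteq> i \<longrightarrow> \<bar>s i\<bar> \<noteq> \<bar>s j\<bar>))"

text \<open>The two Cartan integers between the last simple roots are \<open>S\<close> times 2 or 1,
  with 2 when the root whose coroot is taken is short. The values -2 and -1 are possible only if the
  last root is short.\<close>

lemma chain_last: "\<exists>s. chain_from l s"
proof -
  have l1: "l \<in> {1..l}" "l - 1 \<in> {1..l}" "l \<noteq> l - 1" "l - 1 \<noteq> l" using l2 by auto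
  obtain a c where ac: "\<alpha> l = rt a c" "a \<in> idx l" "c \<in> idx l" "a \<noteq> c" "a \<noteq> - c" using \<alpha>_root[OF l1(1)] by blast
  obtain b d where bd: "\<alpha> (l - 1) = rt b d" "b \<in> idx l" "d \<in> idx l" "b \<noteq> d" "b \<noteq> - d" using \<alpha>_root[OF l1(2)] by blast
  define S where "S = wt_pairing b a + wt_pairing d a + wt_pairing b c + wt_pairing d c"
  have 1: "coroot_scale a c * S = -2" using cartan_int[OF l1(2,1,4) ac bd(1-3)] l2 by (simp add: S_def)
  have 2: "coroot_scale b d * S = -1" using cartan_int[OF l1(1,2,3) bd ac(1-3)] l2
    by (simp add: S_def wt_pairing_sym[of a] wt_pairing_sym[of c] add_ac)
  have "a = 0 \<or> c = 0"
  proof (rule ccontr)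
    assume "\<not> ?thesis"
    then have "S = -2" using 1 by (simp add: coroot_scale_def)
    then show False using 2 by (simp add: coroot_scale_def split: if_splits)
  qed
  then obtain s0 where s0: "\<alpha> l = rt s0 0" "s0 \<in> idx l" "s0 \<noteq> 0" using ac rt_commute by metis
  then have "chain_from l ((\<lambda>_. 0)(l := s0))" by (simp add: chain_from_def)
  then show ?thesis by blast
qed

text \<open>\<open>D x\<close> pairs \<open>\<alpha>\<^sub>i\<close> with
  \<open>\<epsilon>\<^sub>x\<close>. The Cartan integers with the later simple roots telescope from
  the short end and give -1 at \<open>s (i + 1)\<close> and 0 at all later indices. So one index of
  \<open>\<alpha>\<^sub>i\<close> is \<open>- s (i + 1)\<close> and the other is new.\<close>

lemma chain_step:
  assumes s: "chain_from (i + 1) s" and i: "1 \<le> i" "i < l"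
  shows "\<exists>s. chain_from i s"
proof -
  have il: "i \<in> {1..l}" using i by simp
  have sl: "s (l + 1) = 0" using s by (simp add: chain_from_def)
  have sj: "s j \<in> idx l" "s j \<noteq> 0" "\<alpha> j = rt (s j) (- s (j + 1))" if "j \<in> {i + 1..l}" for j
    using s that by (auto simp: chain_from_def)
  have sne: "\<bar>s j\<bar> \<noteq> \<bar>s k\<bar>" if "j \<in> {i + 1..l}" "k \<in> {i + 1..l}" "j \<noteq> k" for j k
    using s that by (simp add: chain_from_def)
  have s1: "s (j + 1) \<in> idx l" "\<bar>s j\<bar> \<noteq> \<bar>s (j + 1)\<bar>" if j: "j \<in> {i + 1..l}" for j
  proof -
    have "s (j + 1) \<in> idx l \<and> \<bar>s j\<bar> \<noteq> \<bar>s (j + 1)\<bar>"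
    proof (cases "j = l")
      case True
      then show ?thesis using sl sj(2)[OF j] by (simp add: idx_def)
    next
      case False
      then have "j + 1 \<in> {i + 1..l}" using j by simp
      then show ?thesis using sj(1) sne[OF j] by simp
    qed
    then show "s (j + 1) \<in> idx l" "\<bar>s j\<bar> \<noteq> \<bar>s (j + 1)\<bar>" by auto
  qed
  obtain b d where bd: "\<alpha> i = rt b d" "b \<in> idx l" "d \<in> idx l" "b \<noteq> d" "b \<noteq> - d" using \<alpha>_root[OF il] by blast
  define D where "D x = wt_pairing b x + wt_pairing d x" for x
  have valid: "- s (j + 1) \<in> idx l" "s j \<noteq> - s (j + 1)" "s j \<noteq> - (- s (j + 1))" if "j \<in> {i + 1..l}" for j
    using s1[OF that] by auto
  have car: "coroot_scale (s j) (- s (j + 1)) * (D (s j) - D (s (j + 1))) =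
      (if j = l \<and> i + 1 = l then -2 else if i + 1 = j \<or> j + 1 = i then -1 else 0)" if j: "j \<in> {i + 1..l}" for j
    using cartan_int[OF il _ _ sj(3)[OF j] sj(1)[OF j] valid[OF j] bd(1-3)] j i
    by (simp add: D_def wt_pairing_uminus algebra_simps)
  have Dl: "D (s l) = (if i + 1 = l then -1 else 0)"
    using car[of l] sl i by (auto simp: coroot_scale_def D_def wt_pairing_0 split: if_splits)
  have Dj: "D (s j) = D (s (j + 1)) + (if j = i + 1 then -1 else 0)" if "j \<in> {i + 1..<l}" for j
  proof -
    have "s (j + 1) \<noteq> 0" using sj(2)[of "j + 1"] that by simp
    then have "coroot_scale (s j) (- s (j + 1)) = 1" using sj(2)[of j] that by (simp add: coroot_scale_def)
    then show ?thesis using car[of j] that by (auto split: if_splits)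
  qed
  have D0: "D (s j) = 0" if "i + 2 \<le> j" "j \<le> l" for j
    using that(2,1)
  proof (induction rule: inc_induct)
    case base
    then show ?case using Dl by simp
  next
    case (step m)
    then show ?case using Dj[of m] by simp
  qed
  have D1: "D (s (i + 1)) = -1"
  proof (cases "i + 1 = l")
    case True
    then show ?thesis using Dl by simp
  next
    case False
    then have "i + 1 \<in> {i + 1..<l}" using i by simp
    then show ?thesis using Dj[of "i + 1"] D0[of "i + 2"] False i by simp
  qed
  \<comment> \<open>Were \<open>\<alpha>\<^sub>i\<close> short, the value of the next simple root on
    its coroot would be even, but it is -1.\<close>
  have b0: "b \<noteq> 0 \<and> d \<noteq> 0"
  proof (rule ccontr)
    assume "\<not> ?thesis"
    then have n2: "coroot_scale b d = 2" by (auto simp: coroot_scale_def)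
    have i1: "i + 1 \<in> {i + 1..l}" "i + 1 \<in> {1..l}" using i by auto
    have "coroot_scale b d * (wt_pairing (s (i + 1)) b + wt_pairing (- s (i + 1 + 1)) b + wt_pairing (s (i + 1)) d + wt_pairing (- s (i + 1 + 1)) d) = -1"
      using cartan_int[OF i1(2) il _ bd sj(3)[OF i1(1)] sj(1)[OF i1(1)] valid(1)[OF i1(1)]] i by simp
    then show False unfolding n2 by presburger
  qed
  let ?x = "s (i + 1)"
  have x: "?x \<in> idx l" "?x \<noteq> 0" using sj i by auto
  have "b = - ?x \<or> d = - ?x" using D1 by (auto simp: D_def wt_pairing_def split: if_splits)
  then obtain y where y: "\<alpha> i = rt y (- ?x)" "y \<in> idx l" "y \<noteq> 0" "\<bar>y\<bar> \<noteq> \<bar>?x\<bar>" "\<And>z. D z = wt_pairing y z + wt_pairing (- ?x) z"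
  proof
    assume "b = - ?x"
    then show thesis using that[of d] bd b0 rt_commute by (auto simp: D_def)
  next
    assume "d = - ?x"
    then show thesis using that[of b] bd b0 by (auto simp: D_def)
  qed
  have ysj: "\<bar>y\<bar> \<noteq> \<bar>s j\<bar>" if j: "j \<in> {i + 1..l}" for j
  proof (cases "j = i + 1")
    case False
    then have j2: "i + 2 \<le> j" "j \<le> l" using j by auto
    have "wt_pairing (- ?x) (s j) = 0" using sne[of "i + 1" j] j False i by (intro wt_pairing_other) simp
    then have "wt_pairing y (s j) = 0" using D0[OF j2] y(5) by simp
    then show ?thesis using sj(2)[OF j] by (auto simp: wt_pairing_def split: if_splits)
  qed (use y in simp)
  have "chain_from i (s(i := y))"
    unfolding chain_from_def
  proof (intro conjI ballI impI)
    show "(s(i := y)) (l + 1) = 0" using sl i by simp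
    fix k assume k: "k \<in> {i..l}"
    then have kk: "k = i \<or> k \<in> {i + 1..l}" by auto
    show "(s(i := y)) k \<in> idx l" "(s(i := y)) k \<noteq> 0" using kk y sj by auto
    show "\<alpha> k = rt ((s(i := y)) k) (- (s(i := y)) (k + 1))" using kk y(1) sj(3)[of k] by auto
    fix j assume j: "j \<in> {i..l}" "j \<noteq> k"
    then have "j = i \<or> j \<in> {i + 1..l}" by auto
    then show "\<bar>(s(i := y)) k\<bar> \<noteq> \<bar>(s(i := y)) j\<bar>" using kk j(2) ysj sne[of k j] by fastforce
  qed
  then show ?thesis by blast
qed

lemma chain_all: "\<exists>s. chain_from 1 s"
proof -
  have "\<exists>s. chain_from k s" if "1 \<le> k" "k \<le> l" for k
    using that(2,1)
  proof (induction rule: inc_induct)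
    case base
    show ?case by (rule chain_last)
  next
    case (step m)
    then show ?case using chain_step[of m] by auto
  qed
  then show ?thesis using l2 by simp
qed

definition s :: "nat \<Rightarrow> int" where "s = (SOME s. chain_from 1 s)"

lemma chain_s: "chain_from 1 s"
  unfolding s_def using chain_all by (rule someI_ex)

lemma s_last: "s (l + 1) = 0"
  using chain_s by (simp add: chain_from_def)

lemma s_idx: "i \<in> {1..l + 1} \<Longrightarrow> s i \<in> idx l"
  using chain_s s_last by (cases "i = l + 1") (auto simp: chain_from_def idx_def)

lemma s_nz: "i \<in> {1..l} \<Longrightarrow> s i \<noteq> 0"
  using chain_s by (simp add: chain_from_def)

lemma \<alpha>_eq: "i \<in> {1..l} \<Longrightarrow> \<alpha> i = rt (s i) (- s (i + 1))"
  using chain_s by (simp add: chain_from_def)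

lemma s_ne: "i \<in> {1..l + 1} \<Longrightarrow> j \<in> {1..l + 1} \<Longrightarrow> i \<noteq> j \<Longrightarrow> \<bar>s i\<bar> \<noteq> \<bar>s j\<bar>"
proof -
  assume ij: "i \<in> {1..l + 1}" "j \<in> {1..l + 1}" "i \<noteq> j"
  consider "i = l + 1" "j \<in> {1..l}" | "j = l + 1" "i \<in> {1..l}" | "i \<in> {1..l}" "j \<in> {1..l}" using ij by fastforce
  then show ?thesis
    by cases (use s_last s_nz chain_s ij in \<open>auto simp: chain_from_def\<close>)
qed

lemma s_bij: "bij_betw (\<lambda>i. nat \<bar>s i\<bar>) {1..l} {1..l}"
  unfolding bij_betw_def
proof
  show inj: "inj_on (\<lambda>i. nat \<bar>s i\<bar>) {1..l}"
  proof (rule inj_onI)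
    fix i j assume ij: "i \<in> {1..l}" "j \<in> {1..l}" "nat \<bar>s i\<bar> = nat \<bar>s j\<bar>"
    show "i = j"
    proof (rule ccontr)
      assume "i \<noteq> j"
      then have "\<bar>s i\<bar> \<noteq> \<bar>s j\<bar>" using s_ne[of i j] ij by simp
      then show False using ij(3) by linarith
    qed
  qed
  have "(\<lambda>i. nat \<bar>s i\<bar>) ` {1..l} \<subseteq> {1..l}"
  proof
    fix x assume "x \<in> (\<lambda>i. nat \<bar>s i\<bar>) ` {1..l}"
    then obtain i where i: "i \<in> {1..l}" "x = nat \<bar>s i\<bar>" by blast
    have "s i \<in> idx l" "s i \<noteq> 0" using s_idx[of i] s_nz[of i] i by auto
    then show "x \<in> {1..l}" using i(2) by (auto simp: idx_def)
  qed
  moreover have "card ((\<lambda>i. nat \<bar>s i\<bar>) ` {1..l}) = card {1..l}" by (rule card_image[OF inj])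
  ultimately show "(\<lambda>i. nat \<bar>s i\<bar>) ` {1..l} = {1..l}" by (metis card_subset_eq finite_atLeastAtMost)
qed

lemma idx_as_s:
  assumes "b \<in> idx l" obtains i \<sigma> where "i \<in> {1..l + 1}" "\<sigma> \<in> {1, -1}" "b = \<sigma> * s i"
proof (cases "b = 0")
  case True
  then show ?thesis using that[of "l + 1" 1] s_last by simp
next
  case False
  then have "nat \<bar>b\<bar> \<in> {1..l}" using assms by (auto simp: idx_def)
  then have "nat \<bar>b\<bar> \<in> (\<lambda>i. nat \<bar>s i\<bar>) ` {1..l}" using s_bij by (simp add: bij_betw_def)
  then obtain i where i: "i \<in> {1..l}" "nat \<bar>s i\<bar> = nat \<bar>b\<bar>" by auto
  then have "b = s i \<or> b = - s i" by linarith
  then show ?thesis using that[of i 1] that[of i "-1"] i(1) by auto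
qed

section \<open>Coefficients of the roots and the maximal root\<close>

definition co :: "nat \<Rightarrow> nat \<Rightarrow> int" where
  "co i k = (if i \<le> k then 1 else 0)"

text \<open>Telescoping: the weight at \<open>s i\<close> is the sum of the simple roots from i to
  l. So \<open>co i k\<close> is its coefficient at \<open>\<alpha>\<^sub>k\<close>, and i = l + 1
  gives the weight 0.\<close>

lemma wt_s: "i \<in> {1..l + 1} \<Longrightarrow> wt (s i) T = (\<Sum>k\<in>{1..l}. of_int (co i k) * \<alpha> k T)"
proof -
  assume i: "i \<in> {1..l + 1}"
  have "wt (s i) T = (\<Sum>k\<in>{i..l}. \<alpha> k T)" if "i \<le> l + 1" "1 \<le> i" for i
    using that
  proof (induction rule: inc_induct)
    case base
    then show ?case by (simp add: s_last[unfolded Suc_eq_plus1[symmetric]] wt_0)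
  next
    case (step m)
    have "{m..l} = insert m {m + 1..l}" using step by auto
    then have "(\<Sum>k\<in>{m..l}. \<alpha> k T) = \<alpha> m T + (\<Sum>k\<in>{m + 1..l}. \<alpha> k T)" by simp
    also have "\<dots> = \<alpha> m T + wt (s (m + 1)) T" using step by simp
    also have "\<dots> = wt (s m) T" using \<alpha>_eq[of m] step s_idx[of "m + 1"] by (simp add: rt_def wt_uminus)
    finally show ?case by simp
  qed
  then have "wt (s i) T = (\<Sum>k\<in>{i..l}. \<alpha> k T)" using i by simp
  also have "\<dots> = (\<Sum>k\<in>{1..l}. of_int (co i k) * \<alpha> k T)"
    using i by (intro sum.mono_neutral_cong_left) (auto simp: co_def)
  finally show ?thesis .
qed

definition root_coeff :: "int \<Rightarrow> int \<Rightarrow> nat \<Rightarrow> nat \<Rightarrow> nat \<Rightarrow> int" where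
  "root_coeff \<sigma> \<tau> i j k = \<sigma> * co i k + \<tau> * co j k"

lemma rt_s:
  assumes "i \<in> {1..l + 1}" "j \<in> {1..l + 1}" "\<sigma> \<in> {1, -1}" "\<tau> \<in> {1, -1}"
  shows "rt (\<sigma> * s i) (\<tau> * s j) = int_comb {1..l} \<alpha> (root_coeff \<sigma> \<tau> i j)"
proof
  fix T
  have w: "wt (\<sigma> * s i) T = of_int \<sigma> * wt (s i) T" if "i \<in> {1..l + 1}" "\<sigma> \<in> {1, -1}" for i \<sigma>
    using that s_idx by (auto simp: wt_uminus)
  show "rt (\<sigma> * s i) (\<tau> * s j) T = int_comb {1..l} \<alpha> (root_coeff \<sigma> \<tau> i j) T"
    unfolding rt_def w[OF assms(1,3)] w[OF assms(2,4)] wt_s[OF assms(1)] wt_s[OF assms(2)] int_comb_def root_coeff_def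
    by (simp add: sum_distrib_left sum.distrib algebra_simps)
qed

lemma rt_s_root:
  assumes "i \<in> {1..l + 1}" "j \<in> {1..l + 1}" "i \<noteq> j" "\<sigma> \<in> {1, -1}" "\<tau> \<in> {1, -1}"
  shows "rt (\<sigma> * s i) (\<tau> * s j) \<in> \<Phi>"
proof -
  have "\<sigma> * s i \<in> idx l" "\<tau> * s j \<in> idx l" using assms s_idx by auto
  moreover have "\<bar>\<sigma> * s i\<bar> \<noteq> \<bar>\<tau> * s j\<bar>" using s_ne[OF assms(1-3)] assms(4,5) by auto
  then have "\<sigma> * s i \<noteq> \<tau> * s j" "\<sigma> * s i \<noteq> - (\<tau> * s j)" by auto
  ultimately show ?thesis unfolding roots_eq by blast
qed

lemma root_coordinates:
  assumes "\<beta> \<in> \<Phi>"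
  obtains i j \<sigma> \<tau> where "i \<in> {1..l + 1}" "j \<in> {1..l + 1}" "i < j" "\<sigma> \<in> {1, -1}" "\<tau> \<in> {1, -1}" "\<beta> = rt (\<sigma> * s i) (\<tau> * s j)"
proof -
  obtain b c where bc: "\<beta> = rt b c" "b \<in> idx l" "c \<in> idx l" "b \<noteq> c" "b \<noteq> - c" using assms unfolding roots_eq by blast
  obtain i \<sigma> where i: "i \<in> {1..l + 1}" "\<sigma> \<in> {1, -1}" "b = \<sigma> * s i" using idx_as_s[OF bc(2)] .
  obtain j \<tau> where j: "j \<in> {1..l + 1}" "\<tau> \<in> {1, -1}" "c = \<tau> * s j" using idx_as_s[OF bc(3)] .
  have "i \<noteq> j" using bc(4,5) i(2,3) j(2,3) by auto
  then consider "i < j" | "j < i" by linarith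
  then show ?thesis
  proof cases
    case 1
    then show ?thesis using that[OF i(1) j(1) _ i(2) j(2)] bc(1) i(3) j(3) by simp
  next
    case 2
    then show ?thesis using that[OF j(1) i(1) _ j(2) i(2)] bc(1) i(3) j(3) rt_commute by simp
  qed
qed

lemma int_comb_unique:
  assumes "int_comb {1..l} \<alpha> c = int_comb {1..l} \<alpha> c'" "k \<in> {1..l}" shows "c k = c' k"
proof -
  have rb: "\<forall>c :: nat \<Rightarrow> real. (\<forall>t. (\<Sum>i\<in>{1..l}. complex_of_real (c i) * \<alpha> i t) = 0) \<longrightarrow> (\<forall>i\<in>{1..l}. c i = 0)"
    using basis unfolding satake_basis_def root_basis_def by blast
  have "(\<Sum>i\<in>{1..l}. complex_of_real (real_of_int (c i - c' i)) * \<alpha> i t) = 0" for t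
    using fun_cong[OF assms(1), of t] by (simp add: int_comb_def algebra_simps sum_subtractf)
  then have "real_of_int (c k - c' k) = 0" using rb[rule_format, of "\<lambda>i. real_of_int (c i - c' i)"] assms(2) by blast
  then show ?thesis by simp
qed

text \<open>The maximal root is the sum of the weights at \<open>s 1\<close> and
  \<open>s 2\<close>.\<close>

definition max_root_coeff :: "nat \<Rightarrow> int" where "max_root_coeff k = (if k = 1 then 1 else 2)"

lemma root_coeff_le: "i < j \<Longrightarrow> 1 \<le> i \<Longrightarrow> \<sigma> \<in> {1, -1} \<Longrightarrow> \<tau> \<in> {1, -1} \<Longrightarrow> 1 \<le> k \<Longrightarrow> root_coeff \<sigma> \<tau> i j k \<le> max_root_coeff k"
  by (auto simp: root_coeff_def co_def max_root_coeff_def)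

lemma root_coeffs:
  assumes "int_comb {1..l} \<alpha> c \<in> \<Phi>"
  obtains i j \<sigma> \<tau> where "i \<in> {1..l + 1}" "j \<in> {1..l + 1}" "i < j" "\<sigma> \<in> {1, -1}" "\<tau> \<in> {1, -1}"
    "int_comb {1..l} \<alpha> c = rt (\<sigma> * s i) (\<tau> * s j)" "\<And>k. k \<in> {1..l} \<Longrightarrow> c k = root_coeff \<sigma> \<tau> i j k"
proof -
  obtain i j \<sigma> \<tau> where ij: "i \<in> {1..l + 1}" "j \<in> {1..l + 1}" "i < j" "\<sigma> \<in> {1, -1}" "\<tau> \<in> {1, -1}"
    "int_comb {1..l} \<alpha> c = rt (\<sigma> * s i) (\<tau> * s j)" using root_coordinates[OF assms] by metis
  have "int_comb {1..l} \<alpha> c = int_comb {1..l} \<alpha> (root_coeff \<sigma> \<tau> i j)" using ij(6) rt_s[OF ij(1,2,4,5)] by simp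
  then show ?thesis using that ij int_comb_unique by blast
qed

lemma max_root_coeff_comb: "int_comb {1..l} \<alpha> max_root_coeff = rt (1 * s 1) (1 * s 2)"
proof -
  have "int_comb {1..l} \<alpha> (root_coeff 1 1 1 2) = int_comb {1..l} \<alpha> max_root_coeff"
    by (rule ext) (auto simp: int_comb_def root_coeff_def co_def max_root_coeff_def intro!: sum.cong)
  then show ?thesis using rt_s[of 1 2 1 1] l2 by simp
qed

lemma maximal_root_max_root_coeff: "maximal_root \<Phi> {1..l} \<alpha> m \<longleftrightarrow> (\<forall>k\<in>{1..l}. m k = max_root_coeff k)"
proof
  have max_root_coeff: "int_comb {1..l} \<alpha> max_root_coeff \<in> \<Phi>" unfolding max_root_coeff_comb by (rule rt_s_root) (use l2 in auto)
  have le: "c k \<le> max_root_coeff k" if c: "int_comb {1..l} \<alpha> c \<in> \<Phi>" and k: "k \<in> {1..l}" for c k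
  proof -
    obtain i j \<sigma> \<tau> where "i \<in> {1..l + 1}" "i < j" "\<sigma> \<in> {1, -1}" "\<tau> \<in> {1, -1}" "\<And>k. k \<in> {1..l} \<Longrightarrow> c k = root_coeff \<sigma> \<tau> i j k"
      using root_coeffs[OF c] by metis
    then show ?thesis using root_coeff_le[of i j \<sigma> \<tau> k] k by simp
  qed
  { assume m: "maximal_root \<Phi> {1..l} \<alpha> m"
    show "\<forall>k\<in>{1..l}. m k = max_root_coeff k"
    proof
      fix k assume k: "k \<in> {1..l}"
      have "m k \<le> max_root_coeff k" using le[OF _ k] m by (simp add: maximal_root_def)
      moreover have "max_root_coeff k \<le> m k" using m max_root_coeff k unfolding maximal_root_def by blast
      ultimately show "m k = max_root_coeff k" by simp
    qed }
  { assume m: "\<forall>k\<in>{1..l}. m k = max_root_coeff k"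
    then have "int_comb {1..l} \<alpha> m = int_comb {1..l} \<alpha> max_root_coeff"
      by (auto simp: int_comb_def intro!: ext sum.cong)
    then show "maximal_root \<Phi> {1..l} \<alpha> m" using max_root_coeff le m by (simp add: maximal_root_def) }
qed

lemma Phi_I_iff:
  assumes I: "I \<subseteq> {1..l}"
  shows "\<beta> \<in> Phi_I so_pq h l \<alpha> I \<longleftrightarrow> (\<exists>i\<in>{1..l + 1}. \<exists>j\<in>{1..l + 1}. \<exists>\<sigma>\<in>{1, -1}. \<exists>\<tau>\<in>{1, -1}. i < j \<and>
    \<beta> = rt (\<sigma> * s i) (\<tau> * s j) \<and> (\<forall>k\<in>I. root_coeff \<sigma> \<tau> i j k = max_root_coeff k))"
proof
  assume "\<beta> \<in> Phi_I so_pq h l \<alpha> I"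
  then obtain m c where mc: "\<beta> \<in> \<Phi>" "maximal_root \<Phi> {1..l} \<alpha> m" "\<beta> = int_comb {1..l} \<alpha> c" "\<forall>j\<in>I. c j = m j"
    unfolding Phi_I_def by blast
  obtain i j \<sigma> \<tau> where ij: "i \<in> {1..l + 1}" "j \<in> {1..l + 1}" "i < j" "\<sigma> \<in> {1, -1}" "\<tau> \<in> {1, -1}"
    "\<beta> = rt (\<sigma> * s i) (\<tau> * s j)" "\<And>k. k \<in> {1..l} \<Longrightarrow> c k = root_coeff \<sigma> \<tau> i j k"
    using root_coeffs[of c] mc(1,3) by metis
  have "root_coeff \<sigma> \<tau> i j k = max_root_coeff k" if "k \<in> I" for k
    using ij(7)[of k] mc(4) mc(2)[unfolded maximal_root_max_root_coeff] that I by auto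
  then show "\<exists>i\<in>{1..l + 1}. \<exists>j\<in>{1..l + 1}. \<exists>\<sigma>\<in>{1, -1}. \<exists>\<tau>\<in>{1, -1}. i < j \<and>
    \<beta> = rt (\<sigma> * s i) (\<tau> * s j) \<and> (\<forall>k\<in>I. root_coeff \<sigma> \<tau> i j k = max_root_coeff k)" using ij(1-6) by blast
next
  assume "\<exists>i\<in>{1..l + 1}. \<exists>j\<in>{1..l + 1}. \<exists>\<sigma>\<in>{1, -1}. \<exists>\<tau>\<in>{1, -1}. i < j \<and>
    \<beta> = rt (\<sigma> * s i) (\<tau> * s j) \<and> (\<forall>k\<in>I. root_coeff \<sigma> \<tau> i j k = max_root_coeff k)"
  then obtain i j \<sigma> \<tau> where ij: "i \<in> {1..l + 1}" "j \<in> {1..l + 1}" "i < j" "\<sigma> \<in> {1, -1}" "\<tau> \<in> {1, -1}"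
    "\<beta> = rt (\<sigma> * s i) (\<tau> * s j)" "\<forall>k\<in>I. root_coeff \<sigma> \<tau> i j k = max_root_coeff k" by blast
  have "\<beta> \<in> \<Phi>" using rt_s_root[OF ij(1,2) _ ij(4,5)] ij(3,6) by simp
  moreover have "\<beta> = int_comb {1..l} \<alpha> (root_coeff \<sigma> \<tau> i j)" using rt_s[OF ij(1,2,4,5)] ij(6) by simp
  moreover have "maximal_root \<Phi> {1..l} \<alpha> max_root_coeff" by (rule maximal_root_max_root_coeff[THEN iffD2]) simp
  ultimately show "\<beta> \<in> Phi_I so_pq h l \<alpha> I" using ij(7) unfolding Phi_I_def by blast
qed

text \<open>The coefficient at k reaches 2 only if both weights occur with positive sign and both
  sums of simple roots have started by k.\<close>

lemma Phi_single: assumes k: "k \<in> {2..l}"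
  shows "Phi_I so_pq h l \<alpha> {k} = {rt (s i) (s j) | i j. 1 \<le> i \<and> i < j \<and> j \<le> k}"
proof (intro set_eqI iffI)
  have I: "{k} \<subseteq> {1..l}" using k by simp
  { fix \<beta> assume "\<beta> \<in> Phi_I so_pq h l \<alpha> {k}"
    then obtain i j \<sigma> \<tau> where ij: "i \<in> {1..l + 1}" "i < j" "\<sigma> \<in> {1, -1}" "\<tau> \<in> {1, -1}"
      "\<beta> = rt (\<sigma> * s i) (\<tau> * s j)" "root_coeff \<sigma> \<tau> i j k = max_root_coeff k" unfolding Phi_I_iff[OF I] by blast
    have "\<sigma> = 1 \<and> \<tau> = 1 \<and> j \<le> k" using ij(2-4,6) k by (auto simp: root_coeff_def co_def max_root_coeff_def split: if_splits)
    then have "\<beta> = rt (s i) (s j)" "1 \<le> i" "i < j" "j \<le> k" using ij by auto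
    then show "\<beta> \<in> {rt (s i) (s j) | i j. 1 \<le> i \<and> i < j \<and> j \<le> k}" by blast }
  { fix \<beta> assume "\<beta> \<in> {rt (s i) (s j) | i j. 1 \<le> i \<and> i < j \<and> j \<le> k}"
    then obtain i j where ij: "\<beta> = rt (s i) (s j)" "1 \<le> i" "i < j" "j \<le> k" by blast
    have "\<beta> = rt (1 * s i) (1 * s j)" "root_coeff 1 1 i j k = max_root_coeff k" using ij k by (auto simp: root_coeff_def co_def max_root_coeff_def)
    moreover have "i \<in> {1..l + 1}" "j \<in> {1..l + 1}" using ij k by auto
    ultimately show "\<beta> \<in> Phi_I so_pq h l \<alpha> {k}" unfolding Phi_I_iff[OF I] using ij(3) by blast }
qed

text \<open>The coefficient 1 at the first node forces one of the weights to be that at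
  \<open>s 1\<close>, the only one that contains \<open>\<alpha>\<^sub>1\<close>.\<close>

lemma Phi_pair: assumes k: "k \<in> {2..l}"
  shows "Phi_I so_pq h l \<alpha> {1, k} = {rt (s 1) (s j) | j. 2 \<le> j \<and> j \<le> k}"
proof (intro set_eqI iffI)
  have I: "{1, k} \<subseteq> {1..l}" using k by simp
  { fix \<beta> assume "\<beta> \<in> Phi_I so_pq h l \<alpha> {1, k}"
    then obtain i j \<sigma> \<tau> where ij: "i \<in> {1..l + 1}" "i < j" "\<sigma> \<in> {1, -1}" "\<tau> \<in> {1, -1}"
      "\<beta> = rt (\<sigma> * s i) (\<tau> * s j)" "root_coeff \<sigma> \<tau> i j k = max_root_coeff k" "root_coeff \<sigma> \<tau> i j 1 = max_root_coeff 1" unfolding Phi_I_iff[OF I] by blast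
    have "\<sigma> = 1 \<and> \<tau> = 1 \<and> j \<le> k" using ij(2-4,6) k by (auto simp: root_coeff_def co_def max_root_coeff_def split: if_splits)
    moreover have "i = 1" using ij(1-4,7) by (auto simp: root_coeff_def co_def max_root_coeff_def split: if_splits)
    ultimately have "\<beta> = rt (s 1) (s j)" "2 \<le> j" "j \<le> k" using ij by auto
    then show "\<beta> \<in> {rt (s 1) (s j) | j. 2 \<le> j \<and> j \<le> k}" by blast }
  { fix \<beta> assume "\<beta> \<in> {rt (s 1) (s j) | j. 2 \<le> j \<and> j \<le> k}"
    then obtain j where j: "\<beta> = rt (s 1) (s j)" "2 \<le> j" "j \<le> k" by blast
    have "\<beta> = rt (1 * s 1) (1 * s j)" "\<forall>k\<in>{1, k}. root_coeff 1 1 1 j k = max_root_coeff k" using j k by (auto simp: root_coeff_def co_def max_root_coeff_def)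
    moreover have "1 \<in> {1..l + 1}" "j \<in> {1..l + 1}" "1 < j" using j k by auto
    ultimately show "\<beta> \<in> Phi_I so_pq h l \<alpha> {1, k}" unfolding Phi_I_iff[OF I] by blast }
qed

text \<open>The first coefficient is 1 as soon as the weight at \<open>s 1\<close> occurs with
  positive sign; the other weight is free and may be 0.\<close>

lemma Phi_one: "Phi_I so_pq h l \<alpha> {1} = {rt (s 1) c | c. c \<in> idx l \<and> \<bar>c\<bar> \<noteq> \<bar>s 1\<bar>}"
proof (intro set_eqI iffI)
  have I: "{1} \<subseteq> {1..l}" using l2 by simp
  { fix \<beta> assume "\<beta> \<in> Phi_I so_pq h l \<alpha> {1}"
    then obtain i j \<sigma> \<tau> where ij: "i \<in> {1..l + 1}" "j \<in> {1..l + 1}" "i < j" "\<sigma> \<in> {1, -1}" "\<tau> \<in> {1, -1}"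
      "\<beta> = rt (\<sigma> * s i) (\<tau> * s j)" "root_coeff \<sigma> \<tau> i j 1 = max_root_coeff 1" unfolding Phi_I_iff[OF I] by blast
    have "i = 1 \<and> \<sigma> = 1" using ij(1,3-5,7) by (auto simp: root_coeff_def co_def max_root_coeff_def split: if_splits)
    moreover have "\<tau> * s j \<in> idx l" "\<bar>\<tau> * s j\<bar> = \<bar>s j\<bar>" using s_idx[OF ij(2)] ij(5) by auto
    moreover have "\<bar>s j\<bar> \<noteq> \<bar>s 1\<bar>" using s_ne[OF ij(2), of 1] ij(1,3) by auto
    ultimately show "\<beta> \<in> {rt (s 1) c | c. c \<in> idx l \<and> \<bar>c\<bar> \<noteq> \<bar>s 1\<bar>}" using ij(6) by auto }
  { fix \<beta> assume "\<beta> \<in> {rt (s 1) c | c. c \<in> idx l \<and> \<bar>c\<bar> \<noteq> \<bar>s 1\<bar>}"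
    then obtain c where c: "\<beta> = rt (s 1) c" "c \<in> idx l" "\<bar>c\<bar> \<noteq> \<bar>s 1\<bar>" by blast
    obtain j \<tau> where j: "j \<in> {1..l + 1}" "\<tau> \<in> {1, -1}" "c = \<tau> * s j" using idx_as_s[OF c(2)] .
    have "\<bar>c\<bar> = \<bar>s j\<bar>" using j(2,3) by auto
    then have j1: "1 < j" using c(3) j(1) by (cases "j = 1") auto
    have "\<beta> = rt (1 * s 1) (\<tau> * s j)" "\<forall>k\<in>{1}. root_coeff 1 \<tau> 1 j k = max_root_coeff k" using c j j1 by (auto simp: root_coeff_def co_def max_root_coeff_def)
    moreover have "1 \<in> {1..l + 1}" by simp
    ultimately show "\<beta> \<in> Phi_I so_pq h l \<alpha> {1}" unfolding Phi_I_iff[OF I] using j(1,2) j1 by blast }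
qed

section \<open>Restriction to the split torus\<close>

lemma torus_real:
  assumes t: "t \<in> ta" and b: "b \<in> idx l"
  shows "cmat t \<in> H" "t *v B b = Re (wt b (cmat t)) *\<^sub>R B b"
proof -
  have th: "t \<in> h" using t atorus_subset_htorus[OF p, of B] by blast
  show cH: "cmat t \<in> H" by (rule complexification_cmat[OF subspace_h th])
  show "t *v B b = Re (wt b (cmat t)) *\<^sub>R B b"
    using b
  proof (cases rule: idx_cases[where p = "CARD('p)"])
    case 1
    then show ?thesis using t b by (auto simp: atorus_def wt_0)
  next
    case (2 i)
    obtain c where "t *v B (int i) = c *\<^sub>R B (int i)" "t *v B (- int i) = (- c) *\<^sub>R B (- int i)" using t 2(1) unfolding atorus_def by blast
    then obtain d where d: "t *v B b = d *\<^sub>R B b" using 2(2) by metis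
    have vb: "v b = cvec (B b)" using 2 by (auto simp: v_def)
    have "wt b (cmat t) = fm (v (- b)) (complex_of_real d *s v b)" using cH d by (simp add: wt_def vb cmat_cvec)
    then show ?thesis using d b by (simp add: fm_v)
  next
    case (3 j)
    have z: "t *v B c = 0" if "\<bar>c\<bar> = int j" for c
    proof -
      have "c \<in> idx l" "int CARD('p) < \<bar>c\<bar>" using 3(1) that by (auto simp: idx_def)
      then show ?thesis using t unfolding atorus_def by blast
    qed
    have "cmat t *v v b = 0" using 3 z by (auto simp: v_def matrix_vector_scale matrix_vector_right_distrib cmat_cvec)
    then show ?thesis using z[of b] 3 by (auto simp: wt_def)
  qed
qed

lemma wt_restr_0: "t \<in> ta \<Longrightarrow> b \<in> idx l \<Longrightarrow> b = 0 \<or> int CARD('p) < \<bar>b\<bar> \<Longrightarrow> Re (wt b (cmat t)) = 0"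
proof -
  assume *: "t \<in> ta" "b \<in> idx l" "b = 0 \<or> int CARD('p) < \<bar>b\<bar>"
  have "t *v B b = 0" using * by (auto simp: atorus_def)
  moreover have "B b \<noteq> 0"
  proof
    assume "B b = 0"
    then have "dual_coeff B b (B b) = 0" using linear_0[OF linear_dual_coeff] by metis
    then show False using dual_coeff_basis[OF B *(2,2)] by simp
  qed
  ultimately show ?thesis using torus_real(2)[OF *(1,2)] by simp
qed

text \<open>The real counterpart of \<open>Hh\<close> for indices of hyperbolic pairs; these
  elements are used to evaluate restricted roots.\<close>

definition X :: "int \<Rightarrow> ('p, 'q) rmat" where "X b = wd (B b) (B (- b))"

lemma X_props:
  assumes b: "b \<noteq> 0" "\<bar>b\<bar> \<le> int CARD('p)"
  shows "X b \<in> ta" "cmat (X b) = Hh b" "b \<in> idx l"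
    "fm (B b) (B b) = 0" "fm (B (- b)) (B (- b)) = 0" "fm (B b) (B (- b)) = 1"
proof -
  show bi: "b \<in> idx l" using b p by (auto simp: idx_def)
  have d: "dual_index CARD('p) b = - b" "dual_index CARD('p) (- b) = b" "dual_sign CARD('p) b = 1" using b by (auto simp: dual_index_def dual_sign_def)
  show "fm (B b) (B b) = 0" "fm (B (- b)) (B (- b)) = 0" "fm (B b) (B (- b)) = 1"
    using B bi d b by (auto simp: adapted_def)
  show "cmat (X b) = Hh b" using b by (simp add: X_def Hh_def cmat_wd v_def)
  show "X b \<in> ta"
  proof (cases "0 < b")
    case True
    then have "X b = wd (B (int (nat b))) (B (- int (nat b)))" by (simp add: X_def)
    then show ?thesis using wd_B_torus(2)[of "nat b"] b True p by auto
  next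
    case False
    then have "X b = - wd (B (int (nat (- b)))) (B (- int (nat (- b))))" using b by (simp add: X_def wd_swap[of "B b"])
    moreover have "wd (B (int (nat (- b)))) (B (- int (nat (- b)))) \<in> ta" using wd_B_torus(2)[of "nat (- b)"] b False p by auto
    ultimately show ?thesis using subspace_neg[OF subspace_tori(1)] by metis
  qed
qed

lemma restr_X:
  assumes b: "b \<noteq> 0" "\<bar>b\<bar> \<le> int CARD('p)" and c: "c \<in> idx l" "d \<in> idx l"
  shows "restr ta (rt c d) (X b) = of_int (wt_pairing c b + wt_pairing d b)"
  using X_props(1-3)[OF b] c by (simp add: restr_def rt_Hh)

lemma restr_rt: "t \<in> ta \<Longrightarrow> restr ta (rt c d) t = Re (wt c (cmat t)) + Re (wt d (cmat t))"
  by (simp add: restr_def rt_def)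

lemma restr_off: "t \<notin> ta \<Longrightarrow> restr ta \<beta> t = 0"
  by (simp add: restr_def)

text \<open>Suppose i < j, where the weight at \<open>s i\<close> restricts to 0 and that at
  \<open>s j\<close> does not. Their sum and difference are positive roots with opposite
  restrictions, which a positive system forbids. So the indices with non-zero restriction form an
  initial segment, of length p by counting.\<close>

lemma s_range: "i \<in> {1..l} \<Longrightarrow> \<bar>s i\<bar> \<le> int CARD('p) \<longleftrightarrow> i \<le> CARD('p)"
proof -
  assume i: "i \<in> {1..l}"
  let ?P = "{i\<in>{1..l}. \<bar>s i\<bar> \<le> int CARD('p)}"
  have pos: "positive_system (restricted_roots so_pq ta h) (restr ta ` (positive_roots \<Phi> {1..l} \<alpha> - roots0 so_pq ta h))"
    using basis by (simp add: satake_basis_def)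
  have down: "i \<in> ?P" if j: "j \<in> ?P" and ij: "i < j" "1 \<le> i" for i j
  proof (rule ccontr)
    assume "i \<notin> ?P"
    then have big: "int CARD('p) < \<bar>s i\<bar>" using that by auto
    have ii: "i \<in> {1..l + 1}" "j \<in> {1..l + 1}" "i \<in> {1..l}" "j \<in> {1..l}" "i \<noteq> j" using that by auto
    have mem: "restr ta (rt (1 * s i) (\<tau> * s j)) \<in> restr ta ` (positive_roots \<Phi> {1..l} \<alpha> - roots0 so_pq ta h)" if \<tau>: "\<tau> \<in> {1, -1}" for \<tau>
    proof -
      have r: "rt (1 * s i) (\<tau> * s j) \<in> \<Phi>" using rt_s_root[OF ii(1,2,5), of 1 \<tau>] \<tau> by simp
      have "rt (1 * s i) (\<tau> * s j) = int_comb {1..l} \<alpha> (root_coeff 1 \<tau> i j)" using rt_s[OF ii(1,2), of 1 \<tau>] \<tau> by simp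
      moreover have "\<forall>k\<in>{1..l}. 0 \<le> root_coeff 1 \<tau> i j k" using ij \<tau> by (auto simp: root_coeff_def co_def)
      ultimately have "rt (1 * s i) (\<tau> * s j) \<in> positive_roots \<Phi> {1..l} \<alpha>" using r unfolding positive_roots_def by blast
      moreover have "rt (1 * s i) (\<tau> * s j) \<notin> roots0 so_pq ta h"
      proof
        assume "rt (1 * s i) (\<tau> * s j) \<in> roots0 so_pq ta h"
        then have "restr ta (rt (1 * s i) (\<tau> * s j)) (X (s j)) = 0" by (simp add: roots0_def)
        moreover have "\<tau> * s j \<in> idx l" using s_idx[OF ii(2)] \<tau> by auto
        moreover have "wt_pairing (s i) (s j) = 0" using s_ne[OF ii(1,2,5)] by (rule wt_pairing_other)
        moreover have "wt_pairing (\<tau> * s j) (s j) = \<tau>" using \<tau> s_nz[OF ii(4)] by (auto simp: wt_pairing_def)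
        ultimately have "\<tau> = 0" using restr_X[of "s j" "s i" "\<tau> * s j"] s_nz[OF ii(4)] j s_idx[OF ii(1)] by simp
        then show False using \<tau> by simp
      qed
      ultimately show ?thesis by blast
    qed
    let ?\<mu> = "restr ta (rt (1 * s i) (1 * s j))"
    have "(\<lambda>t. - ?\<mu> t) = restr ta (rt (1 * s i) (- 1 * s j))"
    proof
      fix t
      show "- ?\<mu> t = restr ta (rt (1 * s i) (- 1 * s j)) t"
      proof (cases "t \<in> ta")
        case True
        then show ?thesis using wt_restr_0[OF True s_idx[OF ii(1)]] big s_idx[OF ii(2)] by (simp add: restr_rt wt_uminus)
      qed (simp add: restr_off)
    qed
    then have "(\<lambda>t. - ?\<mu> t) \<in> restr ta ` (positive_roots \<Phi> {1..l} \<alpha> - roots0 so_pq ta h)" using mem[of "- 1"] by simp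
    moreover have "?\<mu> \<in> restr ta ` (positive_roots \<Phi> {1..l} \<alpha> - roots0 so_pq ta h)" using mem[of 1] by simp
    ultimately show False using pos unfolding positive_system_def by blast
  qed
  have "card ?P = CARD('p)"
  proof -
    have "bij_betw (\<lambda>i. nat \<bar>s i\<bar>) ?P {1..CARD('p)}"
      unfolding bij_betw_def
    proof
      show "inj_on (\<lambda>i. nat \<bar>s i\<bar>) ?P" using s_bij by (auto simp: bij_betw_def intro: inj_on_subset)
      show "(\<lambda>i. nat \<bar>s i\<bar>) ` ?P = {1..CARD('p)}"
      proof (intro set_eqI iffI)
        fix x assume "x \<in> (\<lambda>i. nat \<bar>s i\<bar>) ` ?P"
        then obtain i where i: "i \<in> {1..l}" "\<bar>s i\<bar> \<le> int CARD('p)" "x = nat \<bar>s i\<bar>" by blast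
        then show "x \<in> {1..CARD('p)}" using s_nz[OF i(1)] by auto
      next
        fix x assume x: "x \<in> {1..CARD('p)}"
        then have "x \<in> (\<lambda>i. nat \<bar>s i\<bar>) ` {1..l}" unfolding bij_betw_imp_surj_on[OF s_bij] using p by simp
        then show "x \<in> (\<lambda>i. nat \<bar>s i\<bar>) ` ?P" using x by auto
      qed
    qed
    then show ?thesis using bij_betw_same_card by fastforce
  qed
  moreover have finP: "finite ?P" by simp
  ultimately have Peq: "?P = {1..CARD('p)}"
  proof -
    have "?P \<subseteq> {1..CARD('p)}"
    proof
      fix j assume j: "j \<in> ?P"
      have "i \<in> ?P" if i: "i \<in> {1..j}" for i
      proof (cases "i = j")
        case True
        then show ?thesis using j by simp
      next
        case False
        then show ?thesis using down[OF j, of i] i by simp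
      qed
      then have "{1..j} \<subseteq> ?P" by blast
      then have "card {1..j} \<le> card ?P" using finP by (rule card_mono[rotated])
      then show "j \<in> {1..CARD('p)}" using j \<open>card ?P = CARD('p)\<close> by simp
    qed
    then show ?thesis using \<open>card ?P = CARD('p)\<close> by (intro card_subset_eq) auto
  qed
  have "\<bar>s i\<bar> \<le> int CARD('p) \<longleftrightarrow> i \<in> ?P" using i by simp
  then show ?thesis unfolding Peq using i by simp
qed

lemma s_small: "i \<in> {1..CARD('p)} \<Longrightarrow> s i \<noteq> 0 \<and> \<bar>s i\<bar> \<le> int CARD('p) \<and> i \<in> {1..l} \<and> s i \<in> idx l"
  using s_nz[of i] s_range[of i] s_idx[of i] p by auto

lemma restr_\<alpha>:
  assumes k: "k \<in> {1..CARD('p)}" and j: "j \<in> {1..l}"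
  shows "restr ta (\<alpha> j) (X (s k)) = (if j = k then 1 else if j + 1 = k then -1 else 0)"
proof -
  have sk: "s k \<noteq> 0" "\<bar>s k\<bar> \<le> int CARD('p)" "k \<in> {1..l}" using s_small[OF k] by auto
  have i: "s j \<in> idx l" "- s (j + 1) \<in> idx l" using s_idx[of j] s_idx[of "j + 1"] j by auto
  have d: "wt_pairing (s m) (s k) = (if m = k then 1 else 0)" if "m \<in> {1..l + 1}" for m
    using that wt_pairing_self[OF sk(1)] wt_pairing_other[OF s_ne[of m k]] sk(3) by auto
  show ?thesis unfolding \<alpha>_eq[OF j] restr_X[OF sk(1,2) i] using d[of j] d[of "j + 1"] j by (simp add: wt_pairing_uminus)
qed

text \<open>Among the restrictions of all simple roots, only that of \<open>\<alpha>\<^sub>k\<close>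
  has the value 1 at \<open>X (s k)\<close>; hence the nodes 1, ..., p are white and carry no
  arrows.\<close>

lemma satake_closed_small:
  assumes "I \<noteq> {}" "I \<subseteq> {1..CARD('p)}" shows "satake_closed so_pq ta h l \<alpha> I"
proof -
  have white: "\<alpha> k \<notin> roots0 so_pq ta h" if k: "k \<in> {1..CARD('p)}" for k
    using restr_\<alpha>[OF k, of k] k p by (auto simp: roots0_def)
  have arrow: "j = k" if k: "k \<in> {1..CARD('p)}" and j: "j \<in> {1..l}" and e: "restr ta (\<alpha> j) = restr ta (\<alpha> k)" for j k
    using restr_\<alpha>[OF k j] restr_\<alpha>[OF k, of k] k p e by (auto split: if_splits)
  show ?thesis unfolding satake_closed_def
  proof (intro conjI ballI impI)
    show "I \<subseteq> {i\<in>{1..l}. \<alpha> i \<notin> roots0 so_pq ta h}" using assms(2) white p by fastforce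
    show "j \<in> I" if "i \<in> I" "j \<in> {1..l}" "\<alpha> j \<notin> roots0 so_pq ta h \<and> restr ta (\<alpha> j) = restr ta (\<alpha> i)" for i j
      using arrow[of i j] that assms(2) by auto
  qed (rule assms(1))
qed

section \<open>The inner ideals of the Satake diagram\<close>

definition u :: "nat \<Rightarrow> ('p, 'q) rvec" where "u i = B (s i)"

definition M :: "nat \<Rightarrow> ('p, 'q) rvec set" where "M k = span (u ` {1..k})"

lemma wd_B_restricted:
  assumes "b \<in> idx l" "c \<in> idx l"
  shows "wd (B b) (B c) \<in> restricted_root_space so_pq ta (restr ta (rt b c))"
proof -
  have "lie_br t (wd (B b) (B c)) = restr ta (rt b c) t *\<^sub>R wd (B b) (B c)" if t: "t \<in> ta" for t
  proof -
    have "skw t" using t by (simp add: atorus_def)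
    then show ?thesis unfolding lie_br_wd[OF \<open>skw t\<close>] torus_real(2)[OF t assms(1)] torus_real(2)[OF t assms(2)] restr_rt[OF t]
      by (simp add: scaleR_left_distrib)
  qed
  then show ?thesis by (simp add: restricted_root_space_def so_pq_skw)
qed

lemma restricted_eigen:
  assumes x: "x \<in> restricted_root_space so_pq ta (restr ta (rt b c))" and bc: "b \<in> idx l" "c \<in> idx l"
    and b: "b \<noteq> 0" "\<bar>b\<bar> \<le> int CARD('p)" "\<bar>c\<bar> \<noteq> \<bar>b\<bar>"
  shows "skw x" "lie_br (X b) x = x"
proof -
  show "skw x" using x by (simp add: restricted_root_space_def so_pq_skw)
  have "lie_br (X b) x = restr ta (rt b c) (X b) *\<^sub>R x" using x X_props(1)[OF b(1,2)] by (simp add: restricted_root_space_def)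
  then show "lie_br (X b) x = x" using restr_X[OF b(1,2) bc] wt_pairing_self[OF b(1)] wt_pairing_other[OF b(3)] by simp
qed

text \<open>Members of this space have eigenvalue 1 for both \<open>X (s i)\<close> and
  \<open>X (s j)\<close>, which already cuts out a line.\<close>

lemma restricted_line:
  assumes ij: "i \<in> {1..CARD('p)}" "j \<in> {1..CARD('p)}" "i \<noteq> j"
    and x: "x \<in> restricted_root_space so_pq ta (restr ta (rt (s i) (s j)))"
  obtains k where "x = k *\<^sub>R wd (u i) (u j)"
proof -
  note si = s_small[OF ij(1)] and sj = s_small[OF ij(2)]
  have ne: "\<bar>s j\<bar> \<noteq> \<bar>s i\<bar>" using s_ne[of j i] si sj ij(3) by auto
  have e1: "skw x" "lie_br (X (s i)) x = x" using restricted_eigen[OF x] si sj ne by auto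
  have e2: "lie_br (X (s j)) x = x" using restricted_eigen(2)[of x "s j" "s i"] x si sj ne by (metis rt_commute)
  have o: "fm (B (s j)) (B (s i)) = 0" "fm (B (- s j)) (B (s i)) = 0"
    using B si sj ne by (auto simp: adapted_def dual_index_def)
  note Xi = X_props(4-6)[of "s i"] and Xj = X_props(4-6)[of "s j"]
  show ?thesis
    using lie_br_eigen_2[OF e1(1) _ _ _ e1(2)[unfolded X_def] _ _ _ e2[unfolded X_def] o] Xi Xj si sj that
    unfolding u_def by blast
qed

lemma B_I_single: assumes k: "k \<in> {2..CARD('p)}" shows "B_I so_pq ta h l \<alpha> {k} = W2 (M k)"
proof -
  have kl: "k \<in> {2..l}" using k p by simp
  let ?U = "\<Union>\<mu>\<in>restr ta ` Phi_I so_pq h l \<alpha> {k}. restricted_root_space so_pq ta \<mu>"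
  have idx: "i \<in> {1..CARD('p)} \<and> s i \<in> idx l" if "1 \<le> i" "i \<le> k" for i using s_small[of i] that k by auto
  show ?thesis unfolding B_I_def
  proof
    show "span ?U \<subseteq> W2 (M k)"
    proof (rule span_minimal)
      show "?U \<subseteq> W2 (M k)"
      proof
        fix x assume "x \<in> ?U"
        then obtain i j where ij: "1 \<le> i" "i < j" "j \<le> k" "x \<in> restricted_root_space so_pq ta (restr ta (rt (s i) (s j)))"
          unfolding Phi_single[OF kl] by blast
        obtain c where "x = c *\<^sub>R wd (u i) (u j)" using restricted_line[of i j x] idx[of i] idx[of j] ij by auto
        moreover have "u i \<in> M k" "u j \<in> M k" using ij by (auto simp: M_def intro!: span_base)
        then have "wd (u i) (u j) \<in> W2 (M k)" by (rule wd_in_W2)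
        ultimately show "x \<in> W2 (M k)" unfolding W2_def by (simp add: span_scale)
      qed
    qed (simp add: W2_def)
    have up: "wd (u i) (u j) \<in> span ?U" if "1 \<le> i" "i < j" "j \<le> k" for i j
    proof -
      have "rt (s i) (s j) \<in> Phi_I so_pq h l \<alpha> {k}" unfolding Phi_single[OF kl] using that by blast
      moreover have "wd (u i) (u j) \<in> restricted_root_space so_pq ta (restr ta (rt (s i) (s j)))"
        unfolding u_def using wd_B_restricted idx[of i] idx[of j] that by simp
      ultimately show ?thesis by (intro span_base) blast
    qed
    show "W2 (M k) \<subseteq> span ?U" unfolding M_def W2_span
    proof (rule span_minimal)
      show "{wd x y | x y. x \<in> u ` {1..k} \<and> y \<in> u ` {1..k}} \<subseteq> span ?U"
      proof
        fix w assume "w \<in> {wd x y | x y. x \<in> u ` {1..k} \<and> y \<in> u ` {1..k}}"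
        then obtain i j where ij: "w = wd (u i) (u j)" "i \<in> {1..k}" "j \<in> {1..k}" by blast
        consider "i < j" | "i = j" | "j < i" by linarith
        then show "w \<in> span ?U"
        proof cases
          case 1
          then show ?thesis using up ij by simp
        next
          case 2
          then show ?thesis using ij span_zero by simp
        next
          case 3
          then have "wd (u j) (u i) \<in> span ?U" using up ij by simp
          then show ?thesis using ij(1) span_neg wd_swap by metis
        qed
      qed
    qed simp
  qed
qed

lemma B_I_pair: assumes k: "k \<in> {2..CARD('p)}" shows "B_I so_pq ta h l \<alpha> {1, k} = W1 (u 1) (M k)"
proof -
  have kl: "k \<in> {2..l}" using k p by simp
  let ?U = "\<Union>\<mu>\<in>restr ta ` Phi_I so_pq h l \<alpha> {1, k}. restricted_root_space so_pq ta \<mu>"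
  have idx: "i \<in> {1..CARD('p)} \<and> s i \<in> idx l" if "1 \<le> i" "i \<le> k" for i using s_small[of i] that k by auto
  have k1: "1 \<le> k" using k by simp
  show ?thesis unfolding B_I_def
  proof
    have sub: "subspace (W1 (u 1) (M k))" by (rule subspace_W1) (simp add: M_def)
    show "span ?U \<subseteq> W1 (u 1) (M k)"
    proof (rule span_minimal[OF _ sub])
      show "?U \<subseteq> W1 (u 1) (M k)"
      proof
        fix x assume "x \<in> ?U"
        then obtain j where ij: "2 \<le> j" "j \<le> k" "x \<in> restricted_root_space so_pq ta (restr ta (rt (s 1) (s j)))"
          unfolding Phi_pair[OF kl] by blast
        obtain c where "x = c *\<^sub>R wd (u 1) (u j)" using restricted_line[of 1 j x] idx[of 1] idx[of j] ij k1 by auto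
        moreover have "u j \<in> M k" using ij by (auto simp: M_def intro!: span_base)
        then have "wd (u 1) (u j) \<in> W1 (u 1) (M k)" by (simp add: W1_def)
        ultimately show "x \<in> W1 (u 1) (M k)" using subspace_scale[OF sub] by simp
      qed
    qed
    have "wd (u 1) ` u ` {1..k} \<subseteq> span ?U"
    proof
      fix w assume "w \<in> wd (u 1) ` u ` {1..k}"
      then obtain j where j: "w = wd (u 1) (u j)" "1 \<le> j" "j \<le> k" by auto
      show "w \<in> span ?U"
      proof (cases "j = 1")
        case True
        then show ?thesis using j span_zero by simp
      next
        case False
        then have "rt (s 1) (s j) \<in> Phi_I so_pq h l \<alpha> {1, k}" unfolding Phi_pair[OF kl] using j by force
        moreover have "w \<in> restricted_root_space so_pq ta (restr ta (rt (s 1) (s j)))"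
          unfolding u_def j(1) using wd_B_restricted idx[of 1] idx[of j] j k1 by simp
        ultimately show ?thesis by (intro span_base) blast
      qed
    qed
    then show "W1 (u 1) (M k) \<subseteq> span ?U"
      unfolding W1_def M_def linear_span_image[OF linear_wd, symmetric] by (rule span_minimal) simp
  qed
qed

text \<open>Here \<open>c\<close> also runs over indices whose weights restrict to 0, so a
  restricted root space need not be a line; membership uses only the eigenvalue 1 of
  \<open>X (s 1)\<close>.\<close>

lemma B_I_one: "B_I so_pq ta h l \<alpha> {1} = W1 (u 1) (perp (u 1))"
proof -
  let ?U = "\<Union>\<mu>\<in>restr ta ` Phi_I so_pq h l \<alpha> {1}. restricted_root_space so_pq ta \<mu>"
  have "1 \<in> {1..CARD('p)}" using zero_less_card_finite[where 'a = 'p] by (simp add: Suc_le_eq)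
  then have s1: "s 1 \<noteq> 0" "\<bar>s 1\<bar> \<le> int CARD('p)" "s 1 \<in> idx l" using s_small by auto
  show ?thesis unfolding B_I_def
  proof
    have sub: "subspace (W1 (u 1) (perp (u 1)))" by (rule subspace_W1[OF subspace_perp])
    show "span ?U \<subseteq> W1 (u 1) (perp (u 1))"
    proof (rule span_minimal[OF _ sub])
      show "?U \<subseteq> W1 (u 1) (perp (u 1))"
      proof
        fix x assume "x \<in> ?U"
        then obtain c where c: "c \<in> idx l" "\<bar>c\<bar> \<noteq> \<bar>s 1\<bar>" "x \<in> restricted_root_space so_pq ta (restr ta (rt (s 1) c))"
          unfolding Phi_one by blast
        note e = restricted_eigen[OF c(3) s1(3) c(1) s1(1,2) c(2)]
        show "x \<in> W1 (u 1) (perp (u 1))"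
          unfolding u_def using lie_br_eigen_1(2)[OF e(1) X_props(4-6)[OF s1(1,2)] e(2)[unfolded X_def]] .
      qed
    qed
    show "W1 (u 1) (perp (u 1)) \<subseteq> span ?U"
    proof
      fix x assume "x \<in> W1 (u 1) (perp (u 1))"
      then obtain y where y: "x = wd (u 1) y" "fm (u 1) y = 0" by (auto simp: W1_def perp_def)
      have "x = wd (u 1) (\<Sum>c\<in>idx l. dual_coeff B c y *\<^sub>R B c)" using y(1) adapted_expand[OF B n, of y] by simp
      also have "\<dots> = (\<Sum>c\<in>idx l. dual_coeff B c y *\<^sub>R wd (u 1) (B c))" by (simp add: linear_sum[OF linear_wd])
      also have "\<dots> \<in> span ?U"
      proof (rule span_sum)
        fix c assume c: "c \<in> idx l"
        consider "c = s 1" | "c = - s 1" | "\<bar>c\<bar> \<noteq> \<bar>s 1\<bar>" by linarith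
        then show "dual_coeff B c y *\<^sub>R wd (u 1) (B c) \<in> span ?U"
        proof cases
          case 1
          then show ?thesis by (simp add: u_def span_zero)
        next
          case 2
          \<comment> \<open>Orthogonality of \<open>y\<close> to \<open>u 1\<close> is exactly the
            vanishing of its coefficient at \<open>- s 1\<close>.\<close>
          have "dual_index CARD('p) (- s 1) = s 1" using s1 by (simp add: dual_index_def)
          then have "dual_coeff B c y = 0" using y(2) 2 by (simp add: dual_coeff_def u_def)
          then show ?thesis by (simp add: span_zero)
        next
          case 3
          then have "rt (s 1) c \<in> Phi_I so_pq h l \<alpha> {1}" unfolding Phi_one using c by blast
          then have "wd (u 1) (B c) \<in> ?U" using wd_B_restricted[OF s1(3) c] unfolding u_def by blast
          then show ?thesis by (intro span_scale span_base)
        qed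
      qed
      finally show "x \<in> span ?U" .
    qed
  qed
qed

lemma u_iso: "i \<in> {1..CARD('p)} \<Longrightarrow> j \<in> {1..CARD('p)} \<Longrightarrow> fm (u i) (u j) = 0"
proof -
  assume ij: "i \<in> {1..CARD('p)}" "j \<in> {1..CARD('p)}"
  have "s j \<noteq> - s i"
  proof (cases "i = j")
    case True
    then show ?thesis using s_small[OF ij(1)] by simp
  next
    case False
    then show ?thesis using s_ne[of i j] s_small[OF ij(1)] s_small[OF ij(2)] by auto
  qed
  then show ?thesis using B s_small[OF ij(1)] s_small[OF ij(2)] by (simp add: u_def adapted_def dual_index_def)
qed

lemma M_props:
  assumes k: "k \<le> CARD('p)"
  shows "totally_isotropic (M k)" "dim (M k) = k" "1 \<le> k \<Longrightarrow> u 1 \<in> M k" "j \<le> k \<Longrightarrow> M j \<subseteq> M k"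
proof -
  have ki: "i \<in> {1..CARD('p)}" if "i \<in> {1..k}" for i using that k by simp
  have o: "fm x y = 0" if x: "x \<in> u ` {1..k}" and y: "y \<in> M k" for x y
    using y unfolding M_def
    by (induction rule: span_induct) (use x u_iso ki in \<open>auto simp: subspace_def\<close>)
  have "fm x y = 0" if x: "x \<in> M k" and y: "y \<in> M k" for x y
    using x unfolding M_def
    by (induction rule: span_induct) (use o y in \<open>auto simp: subspace_def\<close>)
  then show "totally_isotropic (M k)" by (simp add: totally_isotropic_def M_def)
  have "dim (span (u ` {1..k})) = card {1..k}"
  proof (rule dual_family_independent(3)[where \<phi> = "\<lambda>i. dual_coeff B (s i)"])
    fix i j assume "i \<in> {1..k}" "j \<in> {1..k}"
    then have "i \<in> {1..l}" "j \<in> {1..l}" "s i \<in> idx l" "s j \<in> idx l" using s_small ki by auto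
    moreover have "s i = s j \<longleftrightarrow> i = j" using s_ne[of i j] calculation(1,2) by fastforce
    ultimately show "dual_coeff B (s i) (u j) = (if i = j then 1 else 0)" unfolding u_def by (simp add: dual_coeff_basis[OF B])
  qed (auto simp: linear_dual_coeff)
  then show "dim (M k) = k" by (simp add: M_def)
  show "u 1 \<in> M k" if "1 \<le> k" using that by (auto simp: M_def intro!: span_base)
  show "M j \<subseteq> M k" if "j \<le> k" unfolding M_def using that by (intro span_mono) auto
qed

lemma u1: "u 1 \<noteq> 0" "fm (u 1) (u 1) = 0"
proof -
  have 1: "1 \<in> {1..CARD('p)}" using zero_less_card_finite[where 'a = 'p] by (simp add: Suc_le_eq)
  show "fm (u 1) (u 1) = 0" using u_iso 1 by blast
  show "u 1 \<noteq> 0"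
  proof
    assume "u 1 = 0"
    then have "M 1 = {0}" by (simp add: M_def)
    then show False using M_props(2)[of 1] 1 by simp
  qed
qed

end

section \<open>Conjugacy classes and chains\<close>

text \<open>The vector \<open>z\<close> would have to lie in the plane of every pair among three
  independent vectors of \<open>M\<close>, and these planes share no line. Dual vectors express this
  by pairings of \<open>z\<close> that vanish.\<close>

lemma W2_not_in_W1:
  fixes M :: "('p::finite, 'q::finite) rvec set"
  assumes M: "subspace M" "3 \<le> dim M" shows "\<not> W2 M \<subseteq> W1 z N"
proof
  assume sub: "W2 M \<subseteq> W1 z N"
  have "M \<noteq> {0}"
  proof
    assume "M = {0}"
    then have "dim M = 0" by (simp only: dim_eq_0)
    then show False using M(2) by linarith
  qed
  then obtain x where "x \<in> M" "x \<noteq> 0" using subspace_0[OF M(1)] by blast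
  then obtain U :: "nat \<Rightarrow> ('p, 'q) rvec" where U: "inj_on U {1..dim M}" "independent (U ` {1..dim M})" "span (U ` {1..dim M}) = M"
    using obtain_indexed_basis[OF M(1)] by metis
  obtain F where F: "\<And>i j. i \<in> {1..dim M} \<Longrightarrow> j \<in> {1..dim M} \<Longrightarrow> fm (U i) (F j) = (if i = j then 1 else 0)"
    using dual_vectors[OF U(1,2)] by blast
  have UM: "U i \<in> M" if "i \<in> {1..dim M}" for i using U(3) that by (metis imageI span_base)
  have key: "fm z (F k) = 0" if k: "i \<in> {1..dim M}" "j \<in> {1..dim M}" "k \<in> {1..dim M}" "i \<noteq> j" "k \<noteq> i" "k \<noteq> j" for i j k
  proof (rule ccontr)
    assume nz: "fm z (F k) \<noteq> 0"
    obtain y where y: "wd (U i) (U j) = wd z y" using sub wd_in_W2[OF UM[OF k(1)] UM[OF k(2)]] by (auto simp: W1_def)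
    have "wd (U i) (U j) *v F k = 0" using F k by (simp add: wd_applyR)
    then have "fm y (F k) *\<^sub>R z = fm z (F k) *\<^sub>R y" unfolding y by (simp add: wd_applyR)
    then have "wd z (fm y (F k) *\<^sub>R z) = wd z (fm z (F k) *\<^sub>R y)" by simp
    then have "wd z y = 0" using nz by simp
    then have "wd (U i) (U j) *v F j = 0" using y by simp
    then have "U i = 0" using F k by (simp add: wd_applyR)
    then show False using F[OF k(1,1)] by simp
  qed
  have i: "1 \<in> {1..dim M}" "2 \<in> {1..dim M}" "3 \<in> {1..dim M}" using M by auto
  have z: "fm z (F 1) = 0" "fm z (F 2) = 0" using key[OF i(2,3,1)] key[OF i(1,3,2)] by auto
  obtain y where y: "wd (U 1) (U 2) = wd z y" using sub wd_in_W2[OF UM[OF i(1)] UM[OF i(2)]] by (auto simp: W1_def)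
  have "wd (U 1) (U 2) *v F 2 = U 1" using F[OF i(1,2)] F[OF i(2,2)] by (simp add: wd_applyR)
  then have "U 1 = fm y (F 2) *\<^sub>R z" unfolding y using z by (simp add: wd_applyR)
  then have "fm (U 1) (F 1) = fm y (F 2) * fm z (F 1)" by (metis fm_scaleR_left)
  then show False using F[OF i(1,1)] z by simp
qed

lemma exists_wd_nonzero:
  fixes x :: "('p::finite, 'q::finite) rvec"
  assumes "subspace M" "2 \<le> dim M" "x \<noteq> 0"
  obtains y where "y \<in> M" "wd x y \<noteq> 0"
proof -
  have "\<not> M \<subseteq> span {x}"
  proof
    assume "M \<subseteq> span {x}"
    then have "dim M \<le> card {x}" by (intro dim_le_card) auto
    then show False using assms by simp
  qed
  then obtain y where y: "y \<in> M" "y \<notin> span {x}" by blast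
  obtain t where t: "fm x t = 1" using exists_dual_vector[OF assms(3)] .
  have "wd x y \<noteq> 0"
  proof
    assume "wd x y = 0"
    then have "y = fm y t *\<^sub>R x" using wd_eq_0_imp t by blast
    moreover have "fm y t *\<^sub>R x \<in> span {x}" by (simp add: span_scale span_base)
    ultimately show False using y by metis
  qed
  then show ?thesis using that y by blast
qed

text \<open>\<open>M\<close> lies in every subspace that contains the images of its exterior square,
  so an inclusion of ideals gives one of the underlying spaces.\<close>

lemma W2_support:
  fixes M :: "('p::finite, 'q::finite) rvec set"
  assumes M: "subspace M" "2 \<le> dim M" and S: "subspace S" "\<And>b v. b \<in> W2 M \<Longrightarrow> b *v v \<in> S"
  shows "M \<subseteq> S"
proof
  fix x assume x: "x \<in> M"
  show "x \<in> S"
  proof (cases "x = 0")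
    case True
    then show ?thesis using S by (simp add: subspace_0)
  next
    case False
    obtain y where y: "y \<in> M" "wd x y \<noteq> 0" using exists_wd_nonzero[OF M False] .
    obtain t where "wd x y *v t = x" using wd_range(1)[OF y(2)] by blast
    then show ?thesis using S(2)[OF wd_in_W2[OF x y(1)], of t] by simp
  qed
qed

lemma W1_support:
  fixes N :: "('p::finite, 'q::finite) rvec set"
  assumes N: "subspace N" "2 \<le> dim N" "z \<noteq> 0" and S: "subspace S" "\<And>b v. b \<in> W1 z N \<Longrightarrow> b *v v \<in> S"
  shows "N \<subseteq> S"
proof
  fix x assume x: "x \<in> N"
  have im: "z \<in> S \<and> y \<in> S" if "y \<in> N" "wd z y \<noteq> 0" for y
  proof -
    have "wd z y \<in> W1 z N" using that by (simp add: W1_def)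
    then show ?thesis using wd_range[OF that(2)] S(2) by metis
  qed
  obtain y where y: "y \<in> N" "wd z y \<noteq> 0" using exists_wd_nonzero[OF N] .
  show "x \<in> S"
  proof (cases "wd z x = 0")
    case False
    then show ?thesis using im[OF x] by blast
  next
    case True
    obtain t where "fm z t = 1" using exists_dual_vector[OF N(3)] .
    then have "x = fm x t *\<^sub>R z" using wd_eq_0_imp[OF True] by blast
    moreover have "fm x t *\<^sub>R z \<in> S" using im[OF y] S(1) by (simp add: subspace_scale)
    ultimately show ?thesis by metis
  qed
qed

lemma ideal_subspace: "X \<in> nonzero_abelian_inner_ideals g \<Longrightarrow> subspace X"
  and ideal_subset: "X \<in> nonzero_abelian_inner_ideals g \<Longrightarrow> X \<subseteq> g"
  by (auto simp: nonzero_abelian_inner_ideals_def inner_ideal_def)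

lemma dim_strict: "subspace X \<Longrightarrow> subspace Y \<Longrightarrow> X \<subset> Y \<Longrightarrow> dim X < dim (Y :: 'a::euclidean_space set)"
  using dim_psubset[of X Y] by (simp add: span_eq_iff[THEN iffD2])

text \<open>The conjugacy classes are labelled by pairs: \<open>(1, False)\<close> stands for \<open>u \<and> u\<^sup>\<bottom>\<close> with \<open>u\<close>
  isotropic, and for a totally isotropic subspace of dimension \<open>k\<close>, \<open>(k, False)\<close> stands for its
  exterior square and \<open>(k, True)\<close> for its product with one of its vectors.\<close>

definition has_label :: "('p::finite, 'q::finite) rmat set \<Rightarrow> nat \<times> bool \<Rightarrow> bool" where
  "has_label X \<kappa> \<longleftrightarrow> (case \<kappa> of (k, b) \<Rightarrow>
     if b then \<exists>z N. totally_isotropic N \<and> z \<in> N \<and> z \<noteq> 0 \<and> dim N = k \<and> X = W1 z N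
     else if k = 1 then \<exists>u. u \<noteq> 0 \<and> fm u u = 0 \<and> X = W1 u (perp u)
     else \<exists>M. totally_isotropic M \<and> dim M = k \<and> X = W2 M)"

text \<open>In dimension 2 the product with a vector is the whole exterior square, so the second
  family starts at 3.\<close>

definition labels :: "nat \<Rightarrow> (nat \<times> bool) set" where
  "labels p = (\<lambda>k. (k, False)) ` {1..p} \<union> (\<lambda>k. (k, True)) ` {3..p}"

text \<open>Chosen with values in 1, ..., p and strictly increasing along inclusions:
  \<open>(2, False)\<close>, \<open>(3, True)\<close>, ..., \<open>(p, True)\<close>,
  \<open>(1, False)\<close> receive 1, 2, ..., p - 1, p, and \<open>(k, False)\<close> with k \<ge>
  3 lies one above \<open>(k, True)\<close>.\<close>

definition label_rank :: "nat \<Rightarrow> nat \<times> bool \<Rightarrow> nat" where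
  "label_rank p \<kappa> = (case \<kappa> of (k, b) \<Rightarrow> if b then k - 1 else if k = 1 then p else if k = 2 then 1 else k)"

lemma label_cases:
  assumes "\<kappa> \<in> labels p"
  obtains "\<kappa> = (1, False)" | k where "\<kappa> = (k, False)" "2 \<le> k" "k \<le> p" | k where "\<kappa> = (k, True)" "3 \<le> k" "k \<le> p"
proof -
  consider k where "\<kappa> = (k, False)" "1 \<le> k" "k \<le> p" | k where "\<kappa> = (k, True)" "3 \<le> k" "k \<le> p"
    using assms by (auto simp: labels_def)
  then show ?thesis
  proof cases
    case 1
    then show ?thesis using that(1,2) by (cases "k = 1") auto
  next
    case 2
    then show ?thesis using that(3) by blast
  qed
qed

lemma has_label_1: "has_label X (1, False) \<longleftrightarrow> (\<exists>u. u \<noteq> 0 \<and> fm u u = 0 \<and> X = W1 u (perp u))"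
  and has_label_F: "2 \<le> k \<Longrightarrow> has_label X (k, False) \<longleftrightarrow> (\<exists>M. totally_isotropic M \<and> dim M = k \<and> X = W2 M)"
  and has_label_T: "has_label X (k, True) \<longleftrightarrow> (\<exists>z N. totally_isotropic N \<and> z \<in> N \<and> z \<noteq> 0 \<and> dim N = k \<and> X = W1 z N)"
  by (simp_all add: has_label_def)

lemma card_labels: "2 \<le> p \<Longrightarrow> card (labels p) = 2 * p - 2"
proof -
  assume p: "2 \<le> p"
  have "card (labels p) = card ((\<lambda>k. (k, False)) ` {1..p}) + card ((\<lambda>k. (k, True)) ` {3..p})"
    unfolding labels_def by (rule card_Un_disjoint) auto
  also have "\<dots> = 2 * p - 2" using p by (simp add: card_image inj_on_def)
  finally show ?thesis .
qed

lemma ideal_has_label: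
  fixes X :: "('p::finite, 'q::finite) rmat set"
  assumes n: "odd (CARD('p) + CARD('q))" and X: "X \<in> nonzero_abelian_inner_ideals so_pq"
  shows "\<exists>\<kappa>\<in>labels CARD('p). has_label X \<kappa>"
proof -
  have pos: "1 \<le> CARD('p)" using zero_less_card_finite[where 'a = 'p] by linarith
  consider u where "u \<noteq> 0" "fm u u = 0" "X = W1 u (perp u)" | M where "totally_isotropic M" "2 \<le> dim M" "X = W2 M"
    | z N where "totally_isotropic N" "z \<in> N" "z \<noteq> 0" "3 \<le> dim N" "X = W1 z N"
    using abelian_inner_ideal_classification[OF n X] by blast
  then show ?thesis
  proof cases
    case 1
    then have "has_label X (1, False)" unfolding has_label_1 by blast
    then show ?thesis using pos by (auto simp: labels_def)
  next
    case 2
    then have "has_label X (dim M, False)" unfolding has_label_F[OF 2(2)] by blast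
    then show ?thesis using dim_totally_isotropic_le[OF 2(1)] 2(2) by (auto simp: labels_def)
  next
    case 3
    then have "has_label X (dim N, True)" unfolding has_label_T by blast
    then show ?thesis using dim_totally_isotropic_le[OF 3(1)] 3(4) by (auto simp: labels_def)
  qed
qed

lemma label_ideal:
  fixes X :: "('p::finite, 'q::finite) rmat set"
  assumes n: "3 \<le> CARD('p) + CARD('q)" and l: "\<kappa> \<in> labels CARD('p)" "has_label X \<kappa>"
  shows "X \<in> nonzero_abelian_inner_ideals so_pq"
  using l(1)
proof (cases rule: label_cases)
  case 1
  then obtain u where u: "u \<noteq> 0" "fm u u = 0" "X = W1 u (perp u)" using l(2) has_label_1 by blast
  show ?thesis unfolding u(3) by (rule W1_perp_mem(1)[OF u(1,2) n])
next
  case (2 k)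
  then obtain M where M: "totally_isotropic M" "dim M = k" "X = W2 M" using l(2) unfolding 2(1) has_label_F[OF 2(2)] by blast
  show ?thesis unfolding M(3) by (rule W2_totally_isotropic_mem[OF M(1)]) (use M 2 in simp)
next
  case (3 k)
  then obtain z N where "totally_isotropic N" "z \<in> N" "z \<noteq> 0" "dim N = k" "X = W1 z N" using l(2) unfolding 3(1) has_label_T by blast
  then show ?thesis using W1_totally_isotropic_mem(1)[of N z] 3(2) by simp
qed

lemma label_dim:
  fixes X :: "('p::finite, 'q::finite) rmat set"
  assumes n: "3 \<le> CARD('p) + CARD('q)"
  shows "has_label X (1, False) \<Longrightarrow> dim X = CARD('p) + CARD('q) - 2"
    and "2 \<le> k \<Longrightarrow> has_label X (k, False) \<Longrightarrow> 2 * dim X = k * (k - 1)"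
    and "3 \<le> k \<Longrightarrow> has_label X (k, True) \<Longrightarrow> dim X = k - 1"
proof -
  show "dim X = CARD('p) + CARD('q) - 2" if "has_label X (1, False)"
    using that W1_perp_mem(2)[OF _ _ n] unfolding has_label_1 by blast
  show "2 * dim X = k * (k - 1)" if k: "2 \<le> k" "has_label X (k, False)"
    using k(2) dim_W2 unfolding has_label_F[OF k(1)] totally_isotropic_def by blast
  show "dim X = k - 1" if k: "3 \<le> k" "has_label X (k, True)"
  proof -
    obtain z N where "totally_isotropic N" "z \<in> N" "z \<noteq> 0" "dim N = k" "X = W1 z N" using k(2) unfolding has_label_T by blast
    then show ?thesis using W1_totally_isotropic_mem(2)[of N z] k(1) by simp
  qed
qed

lemma label_support:
  fixes X :: "('p::finite, 'q::finite) rmat set"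
  assumes "\<kappa> \<in> labels CARD('p)" "\<kappa> \<noteq> (1, False)" "has_label X \<kappa>"
  obtains S where "totally_isotropic S" "dim S = fst \<kappa>" "\<And>b v. b \<in> X \<Longrightarrow> b *v v \<in> S"
  using assms(1)
proof (cases rule: label_cases)
  case 1
  then show ?thesis using assms(2) by simp
next
  case (2 k)
  then obtain M where M: "totally_isotropic M" "dim M = k" "X = W2 M" using assms(3) unfolding 2(1) has_label_F[OF 2(2)] by blast
  have "b *v v \<in> M" if "b \<in> X" for b v using W2_acts(2)[OF M(1)] that M(3) by blast
  then show ?thesis using that[OF M(1)] M(2) 2(1) by simp
next
  case (3 k)
  then obtain z N where N: "totally_isotropic N" "z \<in> N" "z \<noteq> 0" "dim N = k" "X = W1 z N" using assms(3) unfolding 3(1) has_label_T by blast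
  have sN: "subspace N" using N by (simp add: totally_isotropic_def)
  have "b *v v \<in> N" if "b \<in> X" for b v
    using that N(2) unfolding N(5) W1_def by (auto simp: wd_applyR intro!: subspace_diff[OF sN] subspace_scale[OF sN])
  then show ?thesis using that[OF N(1)] N(4) 3(1) by simp
qed

lemma dim_le_support:
  fixes X :: "('p::finite, 'q::finite) rmat set"
  assumes l: "\<kappa> \<in> labels CARD('p)" "\<kappa> \<noteq> (1, False)" "has_label X \<kappa>"
    and S: "subspace S" "\<And>b v. b \<in> X \<Longrightarrow> b *v v \<in> S"
  obtains N where "subspace N" "dim N = fst \<kappa>" "N \<subseteq> S" "snd \<kappa> = False \<longrightarrow> X = W2 N"
  using l(1)
proof (cases rule: label_cases)
  case 1
  then show ?thesis using l(2) by simp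
next
  case (2 k)
  then obtain M where M: "totally_isotropic M" "dim M = k" "X = W2 M" using l(3) unfolding 2(1) has_label_F[OF 2(2)] by blast
  have sM: "subspace M" using M by (simp add: totally_isotropic_def)
  have "M \<subseteq> S" by (rule W2_support[OF sM _ S(1)]) (use M 2 S(2) in auto)
  then show ?thesis using that[OF sM] M 2 by simp
next
  case (3 k)
  then obtain z N where N: "totally_isotropic N" "z \<in> N" "z \<noteq> 0" "dim N = k" "X = W1 z N" using l(3) unfolding 3(1) has_label_T by blast
  have sN: "subspace N" using N by (simp add: totally_isotropic_def)
  have "N \<subseteq> S" by (rule W1_support[OF sN _ N(3) S(1)]) (use N 3 S(2) in auto)
  then show ?thesis using that[OF sN] N 3 by simp
qed

text \<open>The images of \<open>u \<and> perp u\<close> fill \<open>perp u\<close>, whose dimension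
  2 l is too large for a totally isotropic space.\<close>

lemma label_1_not_isotropic:
  fixes X :: "('p::finite, 'q::finite) rmat set"
  assumes n: "CARD('p) + CARD('q) = 2 * l + 1" and p: "CARD('p) \<le> l" and l: "1 \<le> l"
    and X: "has_label X (1, False)" and S: "totally_isotropic S" "\<And>b v. b \<in> X \<Longrightarrow> b *v v \<in> S"
  shows False
proof -
  obtain u where u: "u \<noteq> 0" "fm u u = 0" "X = W1 u (perp u)" using X unfolding has_label_1 by blast
  have sS: "subspace S" using S by (simp add: totally_isotropic_def)
  have d: "dim (perp u) = 2 * l" using dim_perp[OF u(1)] n by simp
  have "perp u \<subseteq> S"
    by (rule W1_support[OF subspace_perp _ u(1) sS]) (use d l u S(2) in auto)
  then have "dim (perp u) \<le> dim S" by (rule dim_subset)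
  then show False using d dim_totally_isotropic_le[OF S(1)] p l by linarith
qed

text \<open>Underlying isotropic spaces are included in each other as the ideals are. For labels of
  the same kind, equal dimensions of these spaces would give ideals of equal dimension. An exterior
  square in dimension at least 3 lies in no ideal whose members share a factor.\<close>

lemma label_rank_less:
  fixes X Y :: "('p::finite, 'q::finite) rmat set"
  assumes n: "CARD('p) + CARD('q) = 2 * l + 1" and p: "CARD('p) \<le> l" and l: "1 \<le> l"
    and X: "\<kappa> \<in> labels CARD('p)" "has_label X \<kappa>" and Y: "\<mu> \<in> labels CARD('p)" "has_label Y \<mu>" and XY: "X \<subset> Y"
  shows "label_rank CARD('p) \<kappa> < label_rank CARD('p) \<mu>"
proof -
  have n3: "3 \<le> CARD('p) + CARD('q)" using n l by simp
  have sX: "subspace X" and sY: "subspace Y" using label_ideal[OF n3] X Y ideal_subspace by blast+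
  have dXY: "dim X < dim Y" using dim_strict[OF sX sY XY] .
  have noW: False if k: "2 < k" "has_label X (k, False)" "Y = W1 z N" for k z N
  proof -
    obtain M where "totally_isotropic M" "dim M = k" "X = W2 M" using k(1,2) has_label_F[of k X] by auto
    then show False using W2_not_in_W1[of M z N] k(1,3) XY by (auto simp: totally_isotropic_def)
  qed
  show ?thesis
  proof (cases "\<mu> = (1, False)")
    case True
    then obtain u where u: "Y = W1 u (perp u)" using Y(2) unfolding True has_label_1 by blast
    from X(1) show ?thesis
    proof (cases rule: label_cases)
      case 1
      then show ?thesis using dXY label_dim(1)[OF n3] X(2) Y(2) True by simp
    next
      case (2 k)
      then show ?thesis using noW[of k] X(2) u True by (cases "k = 2") (auto simp: label_rank_def)
    next
      case (3 k)
      then show ?thesis using True by (auto simp: label_rank_def)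
    qed
  next
    case False
    obtain S where S: "totally_isotropic S" "dim S = fst \<mu>" "\<And>b v. b \<in> Y \<Longrightarrow> b *v v \<in> S"
      using label_support[OF Y(1) False Y(2)] by metis
    have XS: "b *v v \<in> S" if b: "b \<in> X" for b v by (rule S(3)) (use b XY in blast)
    have sS: "subspace S" using S by (simp add: totally_isotropic_def)
    have l1: "\<kappa> \<noteq> (1, False)"
    proof
      assume "\<kappa> = (1, False)"
      then show False using label_1_not_isotropic[OF n p l _ S(1) XS, of X] X(2) by simp
    qed
    obtain N where N: "subspace N" "dim N = fst \<kappa>" "N \<subseteq> S" "snd \<kappa> = False \<longrightarrow> X = W2 N"
      using dim_le_support[OF X(1) l1 X(2) sS XS] .
    have le: "fst \<kappa> \<le> fst \<mu>" using dim_subset[OF N(3)] N(2) S(2) by simp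
    from Y(1) show ?thesis
    proof (cases rule: label_cases)
      case 1
      then show ?thesis using False by simp
    next
      case m: (2 m)
      obtain M where M: "totally_isotropic M" "dim M = m" "Y = W2 M" using Y(2) unfolding m(1) has_label_F[OF m(2)] by blast
      from X(1) show ?thesis
      proof (cases rule: label_cases)
        case 1
        then show ?thesis using l1 by simp
      next
        case (2 k)
        have "k \<noteq> m"
        proof
          assume "k = m"
          then have "2 * dim X = 2 * dim Y" using label_dim(2)[OF n3 2(2)] label_dim(2)[OF n3 m(2)] X(2) Y(2) 2(1) m(1) by simp
          then show False using dXY by simp
        qed
        then show ?thesis using le 2 m by (auto simp: label_rank_def)
      next
        case (3 k)
        then show ?thesis using le m by (auto simp: label_rank_def)
      qed
    next
      case m: (3 m)
      obtain z N' where N': "Y = W1 z N'" using Y(2) unfolding m(1) has_label_T by blast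
      from X(1) show ?thesis
      proof (cases rule: label_cases)
        case 1
        then show ?thesis using l1 by simp
      next
        case (2 k)
        then have "k = 2" using noW[of k z N'] X(2) N' by fastforce
        then show ?thesis using 2 m by (auto simp: label_rank_def)
      next
        case (3 k)
        then have "k - 1 < m - 1" using dXY label_dim(3)[OF n3 3(2)] label_dim(3)[OF n3 m(2)] X(2) Y(2) m(1) by simp
        then show ?thesis using 3 m by (auto simp: label_rank_def)
      qed
    qed
  qed
qed

lemma chain_bound:
  fixes C :: "('p::finite, 'q::finite) rmat set set"
  assumes n: "CARD('p) + CARD('q) = 2 * l + 1" and p: "CARD('p) \<le> l" and l: "1 \<le> l"
    and C: "subset.chain (nonzero_abelian_inner_ideals so_pq) C"
  shows "finite C \<and> card C \<le> CARD('p)"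
proof -
  have odd: "odd (CARD('p) + CARD('q))" using n by simp
  have CI: "C \<subseteq> nonzero_abelian_inner_ideals so_pq" and tot: "\<And>X Y. X \<in> C \<Longrightarrow> Y \<in> C \<Longrightarrow> X \<subseteq> Y \<or> Y \<subseteq> X"
    using C by (auto simp: subset_chain_def)
  define f where "f X = (SOME \<kappa>. \<kappa> \<in> labels CARD('p) \<and> has_label X \<kappa>)" for X :: "('p, 'q) rmat set"
  have f: "f X \<in> labels CARD('p)" "has_label X (f X)" if "X \<in> C" for X
  proof -
    have "\<exists>\<kappa>. \<kappa> \<in> labels CARD('p) \<and> has_label X \<kappa>" using ideal_has_label[OF odd] CI that by blast
    then have "f X \<in> labels CARD('p) \<and> has_label X (f X)" unfolding f_def by (rule someI_ex)
    then show "f X \<in> labels CARD('p)" "has_label X (f X)" by auto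
  qed
  let ?r = "\<lambda>X. label_rank CARD('p) (f X)"
  have less: "?r X < ?r Y" if "X \<in> C" "Y \<in> C" "X \<subset> Y" for X Y
    using label_rank_less[OF n p l f[OF that(1)] f[OF that(2)] that(3)] .
  have inj: "inj_on ?r C"
  proof (rule inj_onI, rule ccontr)
    fix X Y assume XY: "X \<in> C" "Y \<in> C" "?r X = ?r Y" "X \<noteq> Y"
    then have "X \<subset> Y \<or> Y \<subset> X" using tot by blast
    then show False using less[OF XY(1,2)] less[OF XY(2,1)] XY(3) by auto
  qed
  have ran: "?r ` C \<subseteq> {1..CARD('p)}"
  proof
    fix x assume "x \<in> ?r ` C"
    then obtain X where X: "X \<in> C" "x = ?r X" by blast
    have pos: "1 \<le> CARD('p)" using zero_less_card_finite[where 'a = 'p] by linarith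
    from f(1)[OF X(1)] show "x \<in> {1..CARD('p)}"
      by (cases rule: label_cases) (use X(2) pos in \<open>auto simp: label_rank_def\<close>)
  qed
  have "finite C" using inj_on_finite[OF inj ran] by simp
  moreover have "card C \<le> card {1..CARD('p)}" by (rule card_inj_on_le[OF inj ran]) simp
  ultimately show ?thesis by simp
qed

section \<open>Conjugacy and its invariants\<close>

lemma label_conjugate:
  fixes X Y :: "('p::finite, 'q::finite) rmat set"
  assumes n: "CARD('p) + CARD('q) = 2 * l + 1" and p: "CARD('p) \<le> l"
    and l: "\<kappa> \<in> labels CARD('p)" "has_label X \<kappa>" "has_label Y \<kappa>"
  shows "conjugate so_pq X Y"
proof -
  have iso: ?thesis if T: "T ** T' = mat 1" "T' ** T = mat 1" "\<And>u v. fm (T *v u) (T *v v) = fm u v"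
    and XY: "(\<lambda>x. T ** x ** T') ` X = Y" for T T' :: "('p, 'q) rmat"
    using isometry_automorphism(1)[OF T] XY unfolding conjugate_def by blast
  from l(1) show ?thesis
  proof (cases rule: label_cases)
    case 1
    obtain u where u: "u \<noteq> 0" "fm u u = 0" "X = W1 u (perp u)" using l(2) unfolding 1 has_label_1 by blast
    obtain v where v: "v \<noteq> 0" "fm v v = 0" "Y = W1 v (perp v)" using l(3) unfolding 1 has_label_1 by blast
    have t: "totally_isotropic (span {z})" if "fm z z = 0" for z :: "('p, 'q) rvec"
      using that subspace_span[of "{z}"] unfolding totally_isotropic_def span_singleton by auto
    have d: "dim (span {z}) = 1" if "z \<noteq> 0" for z :: "('p, 'q) rvec" using that by (simp add: dim_insert)
    have m: "z \<in> span {z}" for z :: "('p, 'q) rvec" by (simp add: span_base)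
    obtain T T' :: "('p, 'q) rmat" where T: "T ** T' = mat 1" "T' ** T = mat 1" "\<And>u v. fm (T *v u) (T *v v) = fm u v" "T *v u = v"
      using flag_isometry[OF n p t[OF u(2)] m u(1) t[OF v(2)] m v(1)] d[OF u(1)] d[OF v(1)] by metis
    have "(*v) T ` perp u = perp v"
    proof (intro set_eqI iffI)
      fix z assume "z \<in> (*v) T ` perp u"
      then show "z \<in> perp v" using T(3)[of u] T(4) by (auto simp: perp_def)
    next
      fix z assume z: "z \<in> perp v"
      have Tz: "T *v (T' *v z) = z" using T(1) by (simp add: matrix_vector_mul_assoc)
      have "fm u (T' *v z) = fm v z" using T(3)[of u "T' *v z"] T(4) Tz by simp
      then have "T' *v z \<in> perp u" using z by (simp add: perp_def)
      then show "z \<in> (*v) T ` perp u" using Tz by (metis imageI)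
    qed
    then have "(\<lambda>x. T ** x ** T') ` X = Y" unfolding u(3) v(3) isometry_automorphism(3)[OF T(1-3)] T(4) by simp
    then show ?thesis using iso T(1-3) by blast
  next
    case (2 k)
    obtain M where M: "totally_isotropic M" "dim M = k" "X = W2 M" using l(2) unfolding 2(1) has_label_F[OF 2(2)] by blast
    obtain M' where M': "totally_isotropic M'" "dim M' = k" "Y = W2 M'" using l(3) unfolding 2(1) has_label_F[OF 2(2)] by blast
    have ne: "\<exists>z\<in>K. z \<noteq> 0" if "totally_isotropic K" "dim K = k" for K :: "('p, 'q) rvec set"
    proof (rule ccontr)
      assume "\<not> ?thesis"
      then have "dim K = 0" unfolding dim_eq_0 by auto
      then show False using that 2(2) by simp
    qed
    obtain z where z: "z \<in> M" "z \<noteq> 0" using ne[OF M(1,2)] by blast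
    obtain z' where z': "z' \<in> M'" "z' \<noteq> 0" using ne[OF M'(1,2)] by blast
    obtain T T' :: "('p, 'q) rmat" where T: "T ** T' = mat 1" "T' ** T = mat 1" "\<And>u v. fm (T *v u) (T *v v) = fm u v" "(*v) T ` M = M'"
      using flag_isometry[OF n p M(1) z M'(1) z'] M(2) M'(2) by metis
    then have "(\<lambda>x. T ** x ** T') ` X = Y" unfolding M(3) M'(3) isometry_automorphism(4)[OF T(1-3)] T(4) by simp
    then show ?thesis using iso T(1-3) by blast
  next
    case (3 k)
    obtain z N where N: "totally_isotropic N" "z \<in> N" "z \<noteq> 0" "dim N = k" "X = W1 z N" using l(2) unfolding 3(1) has_label_T by blast
    obtain z' N' where N': "totally_isotropic N'" "z' \<in> N'" "z' \<noteq> 0" "dim N' = k" "Y = W1 z' N'" using l(3) unfolding 3(1) has_label_T by blast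
    obtain T T' :: "('p, 'q) rmat" where T: "T ** T' = mat 1" "T' ** T = mat 1" "\<And>u v. fm (T *v u) (T *v v) = fm u v"
      "T *v z = z'" "(*v) T ` N = N'"
      using flag_isometry[OF n p N(1-3) N'(1-3)] N(4) N'(4) by metis
    then have "(\<lambda>x. T ** x ** T') ` X = Y" unfolding N(5) N'(5) isometry_automorphism(3)[OF T(1-3)] T(4,5) by simp
    then show ?thesis using iso T(1-3) by blast
  qed
qed

text \<open>Dimension alone does not separate the classes. Two invariants of the inclusion order do:
  \<open>is_top X\<close> singles out \<open>u \<and> u\<^sup>\<bottom>\<close>, and \<open>below_top X\<close> separates the products with a vector
  from the exterior squares of spaces of dimension at least 3.\<close>

definition is_top :: "('p::finite, 'q::finite) rmat set \<Rightarrow> bool" where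
  "is_top X \<longleftrightarrow> dim X = CARD('p) + CARD('q) - 2 \<and>
     (\<forall>Y\<in>nonzero_abelian_inner_ideals so_pq. Y \<subset> X \<longrightarrow> dim Y < CARD('p))"

definition below_top :: "('p::finite, 'q::finite) rmat set \<Rightarrow> bool" where
  "below_top X \<longleftrightarrow> (\<exists>Y\<in>nonzero_abelian_inner_ideals so_pq. X \<subseteq> Y \<and> is_top Y)"

text \<open>Automorphisms permute the non-zero abelian inner ideals and preserve their dimensions
  and inclusions, and the invariants are defined from these data alone.\<close>

lemma conjugate_invariants:
  fixes X Y :: "('p::finite, 'q::finite) rmat set"
  assumes c: "conjugate so_pq X Y" and X: "X \<in> nonzero_abelian_inner_ideals so_pq"
  shows "dim Y = dim X" "is_top X \<Longrightarrow> is_top Y" "below_top X \<Longrightarrow> below_top Y"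
proof -
  let ?I = "nonzero_abelian_inner_ideals so_pq :: ('p, 'q) rmat set set"
  obtain f where f: "lie_automorphism so_pq f" "f ` X = Y" using c by (auto simp: conjugate_def)
  show "dim Y = dim X" using automorphism_image_ideal(2)[OF f(1) X] f(2) by simp
  have top: "is_top (f ` Z)" if Z: "Z \<in> ?I" and tZ: "is_top Z" for Z
  proof -
    have inj: "inj_on f so_pq" using f(1) by (simp add: lie_automorphism_def bij_betw_def)
    let ?g = "inv_into so_pq f"
    have g: "lie_automorphism so_pq ?g" by (rule lie_automorphism_inv[OF f(1) subspace_so_pq so_pq_lie_br])
    have fZ: "f ` Z \<in> ?I" "dim (f ` Z) = dim Z" using automorphism_image_ideal[OF f(1) Z] by auto
    have "dim W < CARD('p)" if W: "W \<in> ?I" "W \<subset> f ` Z" for W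
    proof -
      have gW: "?g ` W \<in> ?I" "dim (?g ` W) = dim W" using automorphism_image_ideal[OF g W(1)] by auto
      have "?g ` W \<subseteq> ?g ` f ` Z" using W(2) by blast
      also have "\<dots> = Z" using inv_into_image_cancel[OF inj ideal_subset[OF Z]] .
      finally have sub: "?g ` W \<subseteq> Z" .
      have "dim W < dim (f ` Z)" using dim_strict[OF ideal_subspace[OF W(1)] ideal_subspace[OF fZ(1)] W(2)] .
      then have "?g ` W \<noteq> Z" using gW(2) fZ(2) by auto
      then have "?g ` W \<subset> Z" using sub by blast
      then show ?thesis using tZ gW unfolding is_top_def by metis
    qed
    then show ?thesis using tZ fZ(2) by (simp add: is_top_def)
  qed
  show "is_top X \<Longrightarrow> is_top Y" using top[OF X] f(2) by simp
  show "below_top Y" if bX: "below_top X"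
  proof -
    obtain Z where Z: "Z \<in> ?I" "X \<subseteq> Z" "is_top Z" using bX unfolding below_top_def by blast
    have "Y \<subseteq> f ` Z" using Z(2) f(2) by blast
    then show ?thesis using top[OF Z(1,3)] automorphism_image_ideal(1)[OF f(1) Z(1)] by (auto simp: below_top_def)
  qed
qed

text \<open>Below \<open>u \<and> perp u\<close> there are only ideals with a common factor in
  isotropic spaces, of dimension at most p - 1. An exterior square can also have dimension 2 l - 1,
  for instance with k = 6 and l = 8. But then the exterior square of a hyperplane of
  \<open>M\<close>, smaller by k - 1 only, still has dimension 2 l - k \<ge> p.\<close>

lemma is_top_label:
  fixes X :: "('p::finite, 'q::finite) rmat set"
  assumes n: "CARD('p) + CARD('q) = 2 * l + 1" and p: "CARD('p) \<le> l" and l2: "2 \<le> l"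
    and l: "\<kappa> \<in> labels CARD('p)" "has_label X \<kappa>"
  shows "is_top X \<longleftrightarrow> \<kappa> = (1, False)"
proof
  have n3: "3 \<le> CARD('p) + CARD('q)" and odd: "odd (CARD('p) + CARD('q))" and l1: "1 \<le> l" using n l2 by auto
  assume t: "is_top X"
  then have dX: "dim X = 2 * l - 1" using n by (simp add: is_top_def)
  from l(1) show "\<kappa> = (1, False)"
  proof (cases rule: label_cases)
    case (2 k)
    obtain M where M: "totally_isotropic M" "dim M = k" "X = W2 M" using l(2) unfolding 2(1) has_label_F[OF 2(2)] by blast
    have dk: "2 * dim X = k * (k - 1)" using label_dim(2)[OF n3 2(2)] l(2) 2(1) by simp
    have k3: "3 \<le> k"
    proof (rule ccontr)
      assume "\<not> 3 \<le> k"
      then have "k = 2" using 2 by simp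
      then show False using dk dX l2 by simp
    qed
    have "subspace M" using M by (simp add: totally_isotropic_def)
    obtain M' where M': "subspace M'" "M' \<subseteq> span M" "dim M' = k - 1"
      using choose_subspace_of_subspace[of "k - 1" M] M(2) by auto
    have sub: "M' \<subseteq> M" using M'(2) \<open>subspace M\<close> span_eq_iff by metis
    have t': "totally_isotropic M'" using M'(1) sub M(1) by (auto simp: totally_isotropic_def)
    have Y: "W2 M' \<in> nonzero_abelian_inner_ideals so_pq" using W2_totally_isotropic_mem[OF t'] M'(3) k3 by simp
    have dY: "2 * dim (W2 M') = (k - 1) * (k - 2)" using dim_W2[OF M'(1)] M'(3) by (simp add: numeral_2_eq_2)
    have e: "k * (k - 1) = (k - 1) * (k - 2) + 2 * (k - 1)"
      using k3 by (metis add_mult_distrib le_add_diff_inverse2 mult.commute numeral_le_iff order_trans semiring_norm(68) semiring_norm(69) semiring_norm(71) semiring_norm(72))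
    then have dd: "dim (W2 M') + (k - 1) = dim X" using dk dY by linarith
    have "W2 M' \<subseteq> X" unfolding M(3) W2_def using sub by (intro span_mono) blast
    moreover have "W2 M' \<noteq> X" using dd k3 by auto
    ultimately have "W2 M' \<subset> X" by blast
    then have "dim (W2 M') < CARD('p)" using t Y unfolding is_top_def by blast
    then show ?thesis using dd dX 2(3) p k3 by linarith
  next
    case (3 k)
    then have "dim X = k - 1" using label_dim(3)[OF n3 3(2)] l(2) by simp
    then show ?thesis using dX 3 p l2 by linarith
  qed
next
  have n3: "3 \<le> CARD('p) + CARD('q)" and odd: "odd (CARD('p) + CARD('q))" and l1: "1 \<le> l" using n l2 by auto
  assume lam: "\<kappa> = (1, False)"
  have X: "X \<in> nonzero_abelian_inner_ideals so_pq" using label_ideal[OF n3 l] .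
  have "dim Y < CARD('p)" if Y: "Y \<in> nonzero_abelian_inner_ideals so_pq" "Y \<subset> X" for Y
  proof -
    obtain \<mu> where m: "\<mu> \<in> labels CARD('p)" "has_label Y \<mu>" using ideal_has_label[OF odd Y(1)] by blast
    have r: "label_rank CARD('p) \<mu> < CARD('p)" using label_rank_less[OF n p l1 m l Y(2)] lam by (simp add: label_rank_def)
    from m(1) show ?thesis
    proof (cases rule: label_cases)
      case 1
      then show ?thesis using r by (simp add: label_rank_def)
    next
      case (2 k)
      obtain u where u: "X = W1 u (perp u)" using l(2) unfolding lam has_label_1 by blast
      obtain M where M: "totally_isotropic M" "dim M = k" "Y = W2 M" using m(2) unfolding 2(1) has_label_F[OF 2(2)] by blast
      have "k = 2"
      proof (rule ccontr)
        assume "k \<noteq> 2"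
        then show False using W2_not_in_W1[of M u "perp u"] M 2(2) Y(2) u by (auto simp: totally_isotropic_def)
      qed
      then show ?thesis using label_dim(2)[OF n3 2(2)] m(2) 2(1,3) by simp
    next
      case (3 k)
      then show ?thesis using label_dim(3)[OF n3 3(2)] m(2) by simp
    qed
  qed
  then show "is_top X" using label_dim(1)[OF n3] l(2) lam by (simp add: is_top_def)
qed

text \<open>A product \<open>z \<and> N\<close> lies in \<open>z \<and> perp z\<close>; by
  \<open>W2_not_in_W1\<close> an exterior square in dimension at least 3 lies in no such
  ideal.\<close>

lemma below_top_label:
  fixes X :: "('p::finite, 'q::finite) rmat set"
  assumes n: "CARD('p) + CARD('q) = 2 * l + 1" and p: "CARD('p) \<le> l" and l2: "2 \<le> l"
  shows "k \<in> {3..CARD('p)} \<Longrightarrow> has_label X (k, True) \<Longrightarrow> below_top X"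
    and "k \<in> {3..CARD('p)} \<Longrightarrow> has_label X (k, False) \<Longrightarrow> \<not> below_top X"
proof -
  have n3: "3 \<le> CARD('p) + CARD('q)" and odd: "odd (CARD('p) + CARD('q))" using n l2 by auto
  have pos: "1 \<le> CARD('p)" using zero_less_card_finite[where 'a = 'p] by linarith
  have lab1: "(1, False) \<in> labels CARD('p)" using pos by (auto simp: labels_def)
  show "below_top X" if k: "k \<in> {3..CARD('p)}" "has_label X (k, True)"
  proof -
    obtain z N where N: "totally_isotropic N" "z \<in> N" "z \<noteq> 0" "dim N = k" "X = W1 z N" using k(2) unfolding has_label_T by blast
    have zz: "fm z z = 0" "N \<subseteq> perp z" using N(1,2) by (auto simp: totally_isotropic_def perp_def)
    have lb: "has_label (W1 z (perp z)) (1, False)" unfolding has_label_1 using N(3) zz by blast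
    have "X \<subseteq> W1 z (perp z)" unfolding N(5) W1_def using zz(2) by blast
    moreover have "is_top (W1 z (perp z))" using is_top_label[OF n p l2 lab1 lb] by simp
    ultimately show ?thesis using label_ideal[OF n3 lab1 lb] by (auto simp: below_top_def)
  qed
  show "\<not> below_top X" if k: "k \<in> {3..CARD('p)}" "has_label X (k, False)"
  proof
    assume "below_top X"
    then obtain Y where Y: "Y \<in> nonzero_abelian_inner_ideals so_pq" "X \<subseteq> Y" "is_top Y" by (auto simp: below_top_def)
    obtain \<mu> where m: "\<mu> \<in> labels CARD('p)" "has_label Y \<mu>" using ideal_has_label[OF odd Y(1)] by blast
    then have "\<mu> = (1, False)" using is_top_label[OF n p l2 m] Y(3) by simp
    then obtain u where u: "Y = W1 u (perp u)" using m(2) has_label_1 by blast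
    have k2: "2 \<le> k" using k by simp
    obtain M where M: "totally_isotropic M" "dim M = k" "X = W2 M" using k(2) unfolding has_label_F[OF k2] by blast
    then show False using W2_not_in_W1[of M u "perp u"] k(1) Y(2) u by (auto simp: totally_isotropic_def)
  qed
qed

lemma pair_product_inj: "2 \<le> k \<Longrightarrow> 2 \<le> m \<Longrightarrow> k * (k - 1) = m * (m - 1) \<Longrightarrow> k = (m :: nat)"
proof -
  have less: "k * (k - 1) < m * (m - 1)" if "2 \<le> k" "k < m" for k m :: nat
    using that by (intro mult_less_le_imp_less) auto
  assume "2 \<le> k" "2 \<le> m" "k * (k - 1) = m * (m - 1)"
  then show "k = m" using less[of k m] less[of m k] by (metis less_irrefl linorder_neqE_nat)
qed

lemma conjugate_label_unique:
  fixes X Y :: "('p::finite, 'q::finite) rmat set"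
  assumes n: "CARD('p) + CARD('q) = 2 * l + 1" and p: "CARD('p) \<le> l" and l2: "2 \<le> l"
    and X: "\<kappa> \<in> labels CARD('p)" "has_label X \<kappa>" and Y: "\<mu> \<in> labels CARD('p)" "has_label Y \<mu>"
    and c: "conjugate so_pq X Y"
  shows "\<kappa> = \<mu>"
proof -
  have n3: "3 \<le> CARD('p) + CARD('q)" using n l2 by auto
  have XI: "X \<in> nonzero_abelian_inner_ideals so_pq" and YI: "Y \<in> nonzero_abelian_inner_ideals so_pq" using label_ideal[OF n3] X Y by blast+
  note inv = conjugate_invariants[OF c XI] and inv' = conjugate_invariants[OF conjugate_sym[OF c ideal_subset[OF XI]] YI]
  have top: "\<kappa> = (1, False) \<longleftrightarrow> \<mu> = (1, False)"
    using is_top_label[OF n p l2 X] is_top_label[OF n p l2 Y] inv(2) inv'(2) by blast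
  \<comment> \<open>Stated for fresh ideals so that it serves both orders of \<open>X\<close> and
    \<open>Y\<close>. For k = 2 the dimensions 1 and m - 1 differ; otherwise
    \<open>below_top\<close> decides.\<close>
  have mixed: False if a: "\<kappa>' = (k, False)" "2 \<le> k" "k \<le> CARD('p)" "\<mu>' = (m, True)" "3 \<le> m" "m \<le> CARD('p)" "has_label X' \<kappa>'" "has_label Y' \<mu>'"
    "dim Y' = dim X'" "below_top Y' \<Longrightarrow> below_top X'" for X' Y' :: "('p, 'q) rmat set" and \<kappa>' \<mu>' k m
  proof (cases "k = 2")
    case True
    have "2 * dim X' = k * (k - 1)" "dim Y' = m - 1" using label_dim(2)[OF n3 a(2)] label_dim(3)[OF n3 a(5)] a by simp_all
    then show False using True a(5,9) by simp
  next
    case False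
    then have "k \<in> {3..CARD('p)}" "m \<in> {3..CARD('p)}" using a by auto
    then show False using below_top_label[OF n p l2] a by metis
  qed
  from X(1) show ?thesis
  proof (cases rule: label_cases)
    case 1
    then show ?thesis using top by simp
  next
    case k: (2 k)
    from Y(1) show ?thesis
    proof (cases rule: label_cases)
      case 1
      then show ?thesis using top by simp
    next
      case (2 m)
      have "k * (k - 1) = m * (m - 1)"
        using label_dim(2)[OF n3 k(2) X(2)[unfolded k(1)]] label_dim(2)[OF n3 2(2) Y(2)[unfolded 2(1)]] inv(1) by linarith
      then show ?thesis using pair_product_inj k 2 by simp
    next
      case (3 m)
      then show ?thesis using mixed[OF k 3 X(2) Y(2) inv(1) inv'(3)] by blast
    qed
  next
    case k: (3 k)
    from Y(1) show ?thesis
    proof (cases rule: label_cases)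
      case 1
      then show ?thesis using top by simp
    next
      case (2 m)
      then show ?thesis using mixed[OF 2 k Y(2) X(2) inv'(1) inv(3)] by blast
    next
      case (3 m)
      have "k - 1 = m - 1"
        using label_dim(3)[OF n3 k(2)] label_dim(3)[OF n3 3(2)] X(2) Y(2) k(1) 3(1) inv(1) by simp
      then show ?thesis using k 3 by simp
    qed
  qed
qed

text \<open>An extremal element spans a one-dimensional abelian inner ideal, but for p = 1 every
  non-zero abelian inner ideal has dimension 2 l - 1 \<ge> 3.\<close>

lemma no_extremal_rank_one:
  assumes n: "CARD('p::finite) + CARD('q::finite) = 2 * l + 1" and p1: "CARD('p) = 1" and l2: "2 \<le> l"
  shows "\<nexists>e :: ('p, 'q) rmat. extremal so_pq e"
proof
  assume "\<exists>e :: ('p, 'q) rmat. extremal so_pq e"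
  then obtain e :: "('p, 'q) rmat" where e: "e \<in> so_pq" "e \<noteq> 0" "\<And>x. x \<in> so_pq \<Longrightarrow> lie_br e (lie_br e x) \<in> span {e}"
    by (auto simp: extremal_def)
  have n3: "3 \<le> CARD('p) + CARD('q)" and odd: "odd (CARD('p) + CARD('q))" using n l2 by auto
  have "inner_ideal so_pq (span {e})"
    unfolding inner_ideal_def
  proof (intro conjI ballI)
    show "span {e} \<subseteq> so_pq" using e(1) by (intro span_minimal subspace_so_pq) simp
    fix b b' x assume "b \<in> span {e}" "b' \<in> span {e}" and x: "x \<in> (so_pq :: ('p, 'q) rmat set)"
    then obtain c c' where "b = c *\<^sub>R e" "b' = c' *\<^sub>R e" by (auto simp: span_singleton)
    then show "lie_br b (lie_br b' x) \<in> span {e}" using e(3)[OF x] by (simp add: span_scale)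
  qed simp
  moreover have "abelian (span {e})" by (auto simp: abelian_def span_singleton) (simp add: lie_br_def)
  moreover have "span {e} \<noteq> {0}" using e(2) span_base[of e "{e}"] by auto
  ultimately have I: "span {e} \<in> nonzero_abelian_inner_ideals so_pq" by (simp add: nonzero_abelian_inner_ideals_def)
  obtain \<kappa> where l: "\<kappa> \<in> labels CARD('p)" "has_label (span {e}) \<kappa>" using ideal_has_label[OF odd I] by blast
  have "\<kappa> = (1, False)" using l(1) p1 by (auto simp: labels_def)
  then have "dim (span {e}) = CARD('p) + CARD('q) - 2" using label_dim(1)[OF n3] l(2) by blast
  moreover have "dim (span {e}) \<le> card {e}" by (intro dim_le_card) auto
  ultimately show False using n l2 by simp
qed

section \<open>Representatives and the longest chain\<close>

context satake
begin

abbreviation (input) \<B> where "\<B> \<equiv> B_I so_pq ta h l \<alpha>"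

definition rep :: "nat \<times> bool \<Rightarrow> ('p, 'q) rmat set" where
  "rep \<kappa> = (case \<kappa> of (k, b) \<Rightarrow> if b then \<B> {1, k} else \<B> {k})"

lemma pos_p: "1 \<le> CARD('p)"
  using zero_less_card_finite[where 'a = 'p] by linarith

lemma rep_label: "\<kappa> \<in> labels CARD('p) \<Longrightarrow> has_label (rep \<kappa>) \<kappa>"
proof -
  assume "\<kappa> \<in> labels CARD('p)"
  then show ?thesis
  proof (cases rule: label_cases)
    case 1
    then show ?thesis unfolding 1 has_label_1 using B_I_one u1 by (auto simp: rep_def)
  next
    case (2 k)
    then show ?thesis unfolding 2(1) has_label_F[OF 2(2)] using B_I_single[of k] M_props(1,2)[of k] by (auto simp: rep_def)
  next
    case (3 k)
    then show ?thesis unfolding 3(1) has_label_T using B_I_pair[of k] M_props(1-3)[of k] u1(1) by (auto simp: rep_def)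
  qed
qed

lemma odd_dim: "odd (CARD('p) + CARD('q))" and dim_ge_3: "3 \<le> CARD('p) + CARD('q)" and l_ge_1: "1 \<le> l"
  using n l2 by auto

lemma representatives: "representatives_up_to_conjugation so_pq (rep ` labels CARD('p))"
  unfolding representatives_up_to_conjugation_def
proof (intro conjI ballI)
  show "rep ` labels CARD('p) \<subseteq> nonzero_abelian_inner_ideals so_pq"
    using label_ideal[OF dim_ge_3] rep_label by blast
  fix X :: "('p, 'q) rmat set" assume X: "X \<in> nonzero_abelian_inner_ideals so_pq"
  obtain \<kappa> where l: "\<kappa> \<in> labels CARD('p)" "has_label X \<kappa>" using ideal_has_label[OF odd_dim X] by blast
  show "\<exists>!X'. X' \<in> rep ` labels CARD('p) \<and> conjugate so_pq X X'"
  proof (rule ex1I[of _ "rep \<kappa>"])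
    show "rep \<kappa> \<in> rep ` labels CARD('p) \<and> conjugate so_pq X (rep \<kappa>)"
      using label_conjugate[OF n p l rep_label[OF l(1)]] l(1) by blast
    fix X' assume "X' \<in> rep ` labels CARD('p) \<and> conjugate so_pq X X'"
    then obtain \<mu> where m: "\<mu> \<in> labels CARD('p)" "X' = rep \<mu>" "conjugate so_pq X (rep \<mu>)" by blast
    then have "\<kappa> = \<mu>" using conjugate_label_unique[OF n p l2 l m(1) rep_label[OF m(1)]] by blast
    then show "X' = rep \<kappa>" using m(2) by simp
  qed
qed

lemma inj_rep: "inj_on rep (labels CARD('p))"
proof (rule inj_onI)
  fix \<kappa> \<mu> assume a: "\<kappa> \<in> labels CARD('p)" "\<mu> \<in> labels CARD('p)" "rep \<kappa> = rep \<mu>"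
  show "\<kappa> = \<mu>"
    using conjugate_label_unique[OF n p l2 a(1) rep_label[OF a(1)] a(2) rep_label[OF a(2)]] conjugate_refl a(3) by metis
qed

lemma rep_labels: "rep ` labels CARD('p) = {\<B> {k} | k. 1 \<le> k \<and> k \<le> CARD('p)} \<union> {\<B> {1, k} | k. 3 \<le> k \<and> k \<le> CARD('p)}"
  unfolding labels_def image_Un image_image by (auto simp: rep_def)

lemma chain_member:
  assumes k: "k \<in> {2..CARD('p)}"
  shows "W1 (u 1) (M k) \<in> nonzero_abelian_inner_ideals so_pq" "dim (W1 (u 1) (M k)) = k - 1"
    "W1 (u 1) (M k) \<subset> \<B> {1}" "m \<in> {2..CARD('p)} \<Longrightarrow> k < m \<Longrightarrow> W1 (u 1) (M k) \<subset> W1 (u 1) (M m)"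
proof -
  have mem: "W1 (u 1) (M k) \<in> nonzero_abelian_inner_ideals so_pq \<and> dim (W1 (u 1) (M k)) = k - 1" if k: "k \<in> {2..CARD('p)}" for k
  proof -
    have "k \<le> CARD('p)" "1 \<le> k" using k by auto
    note M = M_props(1)[OF this(1)] M_props(2)[OF this(1)] M_props(3)[OF this]
    show ?thesis using W1_totally_isotropic_mem[OF M(1,3) u1(1)] M(2) k by simp
  qed
  show k1: "W1 (u 1) (M k) \<in> nonzero_abelian_inner_ideals so_pq" "dim (W1 (u 1) (M k)) = k - 1" using mem[OF k] by auto
  have "M k \<subseteq> perp (u 1)" using M_props(1,3)[of k] k by (auto simp: totally_isotropic_def perp_def)
  then have sub: "W1 (u 1) (M k) \<subseteq> \<B> {1}" unfolding B_I_one W1_def by blast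
  have "dim (\<B> {1}) = 2 * l - 1" unfolding B_I_one using W1_perp_mem(2)[OF u1 dim_ge_3] n by simp
  then have "dim (W1 (u 1) (M k)) \<noteq> dim (\<B> {1})" using k1(2) k p l2 by auto
  then show "W1 (u 1) (M k) \<subset> \<B> {1}" using sub by auto
  show "W1 (u 1) (M k) \<subset> W1 (u 1) (M m)" if m: "m \<in> {2..CARD('p)}" "k < m"
  proof -
    have "M k \<subseteq> M m" using M_props(4)[of m k] m by simp
    then have "W1 (u 1) (M k) \<subseteq> W1 (u 1) (M m)" unfolding W1_def by blast
    moreover have "dim (W1 (u 1) (M k)) \<noteq> dim (W1 (u 1) (M m))" using mem[OF k] mem[OF m(1)] k m by auto
    ultimately show ?thesis by auto
  qed
qed

text \<open>One inclusion is clear, and both sides have dimension 1.\<close>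

lemma B_I_two: assumes "2 \<le> CARD('p)" shows "\<B> {2} = W1 (u 1) (M 2)"
proof -
  have two: "2 \<in> {2..CARD('p)}" using assms by simp
  have M2: "totally_isotropic (M 2)" "dim (M 2) = 2" "u 1 \<in> M 2" using M_props(1-3)[OF assms] by auto
  have sM: "subspace (M 2)" using M2 by (simp add: totally_isotropic_def)
  have "W1 (u 1) (M 2) \<subseteq> W2 (M 2)" using wd_in_W2 M2(3) by (auto simp: W1_def)
  moreover have "dim (W2 (M 2)) \<le> dim (W1 (u 1) (M 2))" using dim_W2[OF sM] M2(2) chain_member(2)[OF two] by simp
  ultimately have "W1 (u 1) (M 2) = W2 (M 2)"
    using subspace_dim_equal[OF subspace_W1[OF sM], of "W2 (M 2)"] by (simp add: W2_def)
  then show ?thesis using B_I_single[OF two] by simp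
qed

lemma flag_chain:
  assumes p2: "2 \<le> CARD('p)"
  defines "Bs \<equiv> [\<B> {2}] @ map (\<lambda>k. \<B> {1, k}) [3..<CARD('p) + 1] @ [\<B> {1}]"
  shows "sorted_wrt (\<subset>) Bs" "length Bs = CARD('p)" "subset.chain (nonzero_abelian_inner_ideals so_pq) (set Bs)"
proof -
  let ?Z = "\<lambda>k. W1 (u 1) (M k)"
  have "map (\<lambda>k. \<B> {1, k}) [3..<CARD('p) + 1] = map ?Z [3..<CARD('p) + 1]"
    by (rule map_cong[OF refl]) (use B_I_pair in auto)
  moreover have "[2..<CARD('p) + 1] = 2 # [3..<CARD('p) + 1]" using p2 by (simp add: upt_conv_Cons numeral_3_eq_3 numeral_2_eq_2)
  \<comment> \<open>As \<open>\<B> {2}\<close> is the case k = 2 of the same construction, all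
    members but the last are products of \<open>u 1\<close> with the spaces of one flag.\<close>
  ultimately have Bs: "Bs = map ?Z [2..<CARD('p) + 1] @ [\<B> {1}]" unfolding Bs_def using B_I_two[OF p2] by simp
  have mem: "k \<in> {2..CARD('p)}" if "k \<in> set [2..<CARD('p) + 1]" for k using that by auto
  have "sorted_wrt (\<lambda>x y. ?Z x \<subset> ?Z y) [2..<CARD('p) + 1]"
    by (rule sorted_wrt_mono_rel[OF _ sorted_wrt_upt]) (use chain_member(4) mem in blast)
  then show sorted: "sorted_wrt (\<subset>) Bs" unfolding Bs sorted_wrt_append sorted_wrt_map using chain_member(3) mem by auto
  show "length Bs = CARD('p)" unfolding Bs using p2 by simp
  have "(1, False) \<in> labels CARD('p)" using pos_p by (auto simp: labels_def)
  then have "\<B> {1} \<in> nonzero_abelian_inner_ideals so_pq" using label_ideal[OF dim_ge_3 _ rep_label] by (fastforce simp: rep_def)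
  then have "set Bs \<subseteq> nonzero_abelian_inner_ideals so_pq" unfolding Bs using chain_member(1) mem by auto
  moreover have "X \<subseteq> Y \<or> Y \<subseteq> X" if XY: "X \<in> set Bs" "Y \<in> set Bs" for X Y
  proof -
    obtain i j where ij: "i < length Bs" "X = Bs ! i" "j < length Bs" "Y = Bs ! j" using XY by (auto simp: in_set_conv_nth)
    consider "i < j" | "i = j" | "j < i" by linarith
    then show ?thesis using sorted_wrt_nth_less[OF sorted] ij by cases (blast, blast, blast)
  qed
  ultimately show "subset.chain (nonzero_abelian_inner_ideals so_pq) (set Bs)" unfolding subset_chain_def by blast
qed

lemma dim_B_I_one: "dim (\<B> {1}) = 2 * l - 1"
  unfolding B_I_one using W1_perp_mem(2)[OF u1 dim_ge_3] n by simp

end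

theorem proposition4p2:
  fixes l p :: nat
    and g a h :: "(real^('p::finite + 'q::finite)^('p + 'q)) set"
    and \<alpha> :: "nat \<Rightarrow> complex^('p + 'q)^('p + 'q) \<Rightarrow> complex"
    and \<B> :: "nat set \<Rightarrow> (real^('p + 'q)^('p + 'q)) set"
  assumes "l \<ge> 2"
    and "CARD('p) = p"
    and "CARD('p) + CARD('q) = 2 * l + 1"
    and g: "g = so_pq"
    and "maximal_split_abelian g a"
    and "maximal_abelian_subalgebra g h" and "a \<subseteq> h"
    and "satake_basis g a h l \<alpha>"
    and "labelled_B g h l \<alpha>"
    and \<B>: "\<B> = B_I g a h l \<alpha>"
  shows
    "(p = 1 \<longrightarrow>
       satake_closed g a h l \<alpha> {1} \<and>
       representatives_up_to_conjugation g {\<B> {1}} \<and>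
       dim (\<B> {1}) = 2 * l - 1 \<and>
       (\<nexists>e. extremal g e)) \<and>
     (2 \<le> p \<and> p \<le> l \<longrightarrow>
       (\<forall>k\<in>{1..p}. satake_closed g a h l \<alpha> {k}) \<and>
       (\<forall>k\<in>{3..p}. satake_closed g a h l \<alpha> {1, k}) \<and>
       (\<exists>R. representatives_up_to_conjugation g R \<and> card R = 2 * p - 2 \<and>
            (p = 2 \<longrightarrow> R = {\<B> {2}, \<B> {1}} \<and> \<B> {2} \<subset> \<B> {1}) \<and>
            (p \<ge> 3 \<longrightarrow> R = {\<B> {k} | k. 1 \<le> k \<and> k \<le> p} \<union> {\<B> {1, k} | k. 3 \<le> k \<and> k \<le> p})) \<and>
       (\<forall>C. subset.chain (nonzero_abelian_inner_ideals g) C \<longrightarrow> finite C \<and> card C \<le> p) \<and>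
       (let Bs = [\<B> {2}] @ map (\<lambda>k. \<B> {1, k}) [3..<p + 1] @ [\<B> {1}]
        in sorted_wrt (\<subset>) Bs \<and> length Bs = p \<and>
           subset.chain (nonzero_abelian_inner_ideals g) (set Bs)))"
proof (cases "p \<le> l")
  \<comment> \<open>Both implications are vacuous here: p = 1 would give
    \<open>p \<le> l\<close>.\<close>
  case False
  then show ?thesis using assms(1) by simp
next
  case True
  have pl: "CARD('p) \<le> l" using True assms(2) by simp
  have l1: "1 \<le> l" using assms(1) by simp
  obtain B where B: "adapted l B" "a = atorus l B" "h = htorus l B"
    using maximal_tori[OF assms(3) pl l1 assms(5)[unfolded g] assms(6)[unfolded g] assms(7)] .
  interpret S: satake l B \<alpha>
    using B(1) assms(3) pl assms(1) assms(8,9)[unfolded g B(2,3)] by unfold_locales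
  let ?B = "B_I so_pq (atorus l B) (htorus l B) l \<alpha>"
  let ?I = "nonzero_abelian_inner_ideals (so_pq :: ('p, 'q) rmat set)"
  have eqs: "\<B> = ?B" unfolding \<B> g B(2,3) ..
  have closed1: "satake_closed so_pq (atorus l B) (htorus l B) l \<alpha> {k}" if "k \<in> {1..CARD('p)}" for k
    by (rule S.satake_closed_small) (use that in auto)
  have closed2: "satake_closed so_pq (atorus l B) (htorus l B) l \<alpha> {1, k}" if "k \<in> {3..CARD('p)}" for k
    by (rule S.satake_closed_small) (use that in auto)
  have part1: "satake_closed so_pq (atorus l B) (htorus l B) l \<alpha> {1} \<and>
      representatives_up_to_conjugation so_pq {?B {1}} \<and> dim (?B {1}) = 2 * l - 1 \<and>
      (\<nexists>e :: ('p, 'q) rmat. extremal so_pq e)" if p1: "CARD('p) = 1"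
  proof (intro conjI)
    have "labels CARD('p) = {(1, False)}" using p1 by (auto simp: labels_def)
    then show "representatives_up_to_conjugation so_pq {?B {1}}" using S.representatives by (simp add: S.rep_def)
    show "satake_closed so_pq (atorus l B) (htorus l B) l \<alpha> {1}" using closed1[of 1] p1 by simp
    show "dim (?B {1}) = 2 * l - 1" by (rule S.dim_B_I_one)
    show "\<nexists>e :: ('p, 'q) rmat. extremal so_pq e" by (rule no_extremal_rank_one[OF assms(3) p1 assms(1)])
  qed
  have part2: "\<exists>R. representatives_up_to_conjugation so_pq R \<and> card R = 2 * CARD('p) - 2 \<and>
      (CARD('p) = 2 \<longrightarrow> R = {?B {2}, ?B {1}} \<and> ?B {2} \<subset> ?B {1}) \<and>
      (CARD('p) \<ge> 3 \<longrightarrow> R = {?B {k} | k. 1 \<le> k \<and> k \<le> CARD('p)} \<union> {?B {1, k} | k. 3 \<le> k \<and> k \<le> CARD('p)})"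
    if p2: "2 \<le> CARD('p)"
  proof (intro exI conjI impI)
    show "representatives_up_to_conjugation so_pq (S.rep ` labels CARD('p))" by (rule S.representatives)
    show "card (S.rep ` labels CARD('p)) = 2 * CARD('p) - 2" using card_image[OF S.inj_rep] card_labels[OF p2] by simp
    show "S.rep ` labels CARD('p) = {?B {2}, ?B {1}}" if "CARD('p) = 2"
    proof -
      have "{1..CARD('p)} = {1, 2}" "{3..CARD('p)} = {}" using that by auto
      then have "labels CARD('p) = {(1, False), (2, False)}" unfolding labels_def by simp
      then show ?thesis by (auto simp: S.rep_def)
    qed
    show "?B {2} \<subset> ?B {1}" using S.chain_member(3)[of 2] S.B_I_two[OF p2] p2 by simp
    show "S.rep ` labels CARD('p) = {?B {k} | k. 1 \<le> k \<and> k \<le> CARD('p)} \<union> {?B {1, k} | k. 3 \<le> k \<and> k \<le> CARD('p)}"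
      by (rule S.rep_labels)
  qed
  have part3: "\<forall>C. subset.chain ?I C \<longrightarrow> finite C \<and> card C \<le> CARD('p)"
    using chain_bound[OF assms(3) pl l1] by blast
  show ?thesis
    unfolding eqs g B(2,3) assms(2)[symmetric] Let_def
    by (intro conjI impI part2 part3 ballI closed1 closed2 S.flag_chain part1[THEN conjunct1]
        part1[THEN conjunct2, THEN conjunct1] part1[THEN conjunct2, THEN conjunct2, THEN conjunct1]
        part1[THEN conjunct2, THEN conjunct2, THEN conjunct2]) auto
qed

end
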